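(* Let $p$ and the IID matrices $X=X^{(N)}$ satisfy the noise assumptions listed in the context. Define $$F := \int_{-\infty}^{\infty} \frac{(p'(x))^2}{p(x)}\,dx,\qquad G := \int_{-\infty}^{\infty} \frac{(p''(x))^2}{p(x)}\,dx .$$ Let $\omega>0$ be a fixed constant with $2\omega F<1$. Then, under the null hypothesis $\boldsymbol H_0$ (i.e. $Y=X$), the log likelihood ratio $\log\mathcal L(Y;\omega)$, where $$\mathcal L(Y;\omega):=\frac1{2^N}\sum_{\boldsymbol x\in\{\pm1/\sqrt N\}^N}\ \prod_{i,j=1}^N\frac{p(\sqrt N Y_{ij}-\sqrt{\omega N}\,x_ix_j)}{p(\sqrt N Y_{ij})},$$ converges in distribution, as $N\to\infty$, to the Gaussian $\mathcal N(-\rho^*,2\rho^* )$ with mean $-\rho^*$ and variance $2\rho^*$, where $$\rho^*:=-\frac14\left(\log(1-2\omega F)+\frac{\omega^2}{2}(2F^2-G)\right).$$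
   Context: Noise. $X=(X_{ij})$ is an $N\times N$ real random matrix (an IID matrix, with no symmetry constraint) whose entries $X_{ij}$, $1\le i,j\le N$, are independent and identically distributed centered real random variables with $N\,\mathbb E[X_{ij}^2]=1$ and such that for every $D>0$ there is a constant $C_D$ independent of $N$ with $N^{D/2}\,\mathbb E[|X_{ij}|^D]\le C_D$. The normalized entries $\sqrt N X_{ij}$ have density $p$, where $p$ does not depend on $N$ and satisfies: (1) $p$ is smooth, positive everywhere, and symmetric about $0$; (2) $p$ and all its derivatives vanish at infinity; (3) for every positive integer $s$ there are constants $C_s,r_s>0$, independent of $N$, with $|p^{(s)}(x)/p(x)|\le C_s(1+|x|^{r_s})$ for all $x\in\mathbb R$, where $p^{(s)}$ is the $s$-th derivative. Spike and hypotheses. $\boldsymbol x=(x_1,\dots,x_N)$ is a random vector, independent of $X$, with $\sqrt N x_i$ i.i.d. Rademacher ($\pm1$ with probability $1/2$ each). The data matrix is $Y=X+\sqrt\lambda\,\boldsymbol x\boldsymbol x^T$; $\boldsymbol H_0:\lambda=0$ and $\boldsymbol H_1:\lambda=\omega>0$. $\mathcal L(Y;\omega)$ is the likelihood ratio of the law of $Y$ under $\boldsymbol H_1$ with respect to its law under $\boldsymbol H_0$. *)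

theory Defs
  imports "HOL-Probability.Probability"
begin

definition smooth_density :: "(real \<Rightarrow> real) \<Rightarrow> bool" where
  "smooth_density p \<longleftrightarrow>
     (\<forall>k x. (deriv ^^ k) p differentiable (at x)) \<and>
     (\<forall>x. p x > 0) \<and>
     (\<forall>x. p (- x) = p x) \<and>
     (\<forall>k. ((deriv ^^ k) p \<longlongrightarrow> 0) at_infinity) \<and>
     (\<forall>s\<ge>1. \<exists>C>0. \<exists>r>0. \<forall>x. \<bar>(deriv ^^ s) p x / p x\<bar> \<le> C * (1 + \<bar>x\<bar> powr r))"

text \<open>
  The sequence of IID matrices: \<open>X N i j\<close> with \<open>i, j < N\<close> is the \<open>(i, j)\<close> entry (indices start
  at 0) of the \<open>N \<times> N\<close> matrix, a random variable on the probability space \<open>M N\<close>. No relation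
  between the matrices for different \<open>N\<close> is imposed. The entries are identically distributed
  because the normalized entries \<open>sqrt N * X N i j\<close> all have the density \<open>p\<close>. In the moment bound,
  \<open>C\<close> depends only on \<open>D\<close>.
\<close>

definition iid_matrices ::
  "(real \<Rightarrow> real) \<Rightarrow> (nat \<Rightarrow> 'a measure) \<Rightarrow> (nat \<Rightarrow> nat \<Rightarrow> nat \<Rightarrow> 'a \<Rightarrow> real) \<Rightarrow> bool" where
  "iid_matrices p M X \<longleftrightarrow>
     (\<forall>N\<ge>1. prob_space (M N) \<and>
        prob_space.indep_vars (M N) (\<lambda>_. borel) (\<lambda>(i, j). X N i j) ({..<N} \<times> {..<N})) \<and>
     (\<forall>N\<ge>1. \<forall>i<N. \<forall>j<N.
        distributed (M N) lborel (\<lambda>\<xi>. sqrt (real N) * X N i j \<xi>) (\<lambda>x. ennreal (p x)) \<and>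
        integrable (M N) (X N i j) \<and> (\<integral>\<xi>. X N i j \<xi> \<partial>M N) = 0 \<and>
        integrable (M N) (\<lambda>\<xi>. (X N i j \<xi>)\<^sup>2) \<and> real N * (\<integral>\<xi>. (X N i j \<xi>)\<^sup>2 \<partial>M N) = 1) \<and>
     (\<forall>D::real. D > 0 \<longrightarrow> (\<exists>C. \<forall>N\<ge>1. \<forall>i<N. \<forall>j<N.
        integrable (M N) (\<lambda>\<xi>. \<bar>X N i j \<xi>\<bar> powr D) \<and>
        real N powr (D / 2) * (\<integral>\<xi>. \<bar>X N i j \<xi>\<bar> powr D \<partial>M N) \<le> C))"

definition F_const :: "(real \<Rightarrow> real) \<Rightarrow> real" where
  "F_const p = (\<integral>x. (deriv p x)\<^sup>2 / p x \<partial>lborel)"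

definition G_const :: "(real \<Rightarrow> real) \<Rightarrow> real" where
  "G_const p = (\<integral>x. (deriv (deriv p) x)\<^sup>2 / p x \<partial>lborel)"

definition rho_star :: "(real \<Rightarrow> real) \<Rightarrow> real \<Rightarrow> real" where
  "rho_star p \<omega> =
     - (1/4) * (ln (1 - 2 * \<omega> * F_const p) + \<omega>\<^sup>2 / 2 * (2 * (F_const p)\<^sup>2 - G_const p))"

text \<open>
  A spike is a function on the index set \<open>{..<N}\<close> (an element of an extensional function space,
  so that each one is counted exactly once) with values in \<open>{1 / sqrt N, - 1 / sqrt N}\<close>.
\<close>

definition likelihood_ratio ::
  "(real \<Rightarrow> real) \<Rightarrow> real \<Rightarrow> nat \<Rightarrow> (nat \<Rightarrow> nat \<Rightarrow> real) \<Rightarrow> real" where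
  "likelihood_ratio p \<omega> N Y =
     1 / 2 ^ N *
     (\<Sum>x \<in> {..<N} \<rightarrow>\<^sub>E {1 / sqrt (real N), - 1 / sqrt (real N)}.
        \<Prod>i<N. \<Prod>j<N. p (sqrt (real N) * Y i j - sqrt (\<omega> * real N) * x i * x j)
                      / p (sqrt (real N) * Y i j))"

end

theory Submission
  imports Defs
begin

text \<open>
  The likelihood ratio \<open>L\<close> is an average over sign vectors \<open>s\<close> of products over the entries.  Writing
  \<open>p (w - \<epsilon> \<sigma>) / p w = A w + \<sigma> * B w\<close> for \<open>\<sigma> = \<plusminus>1\<close> and \<open>\<epsilon> = sqrt (\<omega> / N)\<close>, with \<open>A\<close> even and \<open>B\<close> odd, the
  entries at \<open>(i, j)\<close> and \<open>(j, i)\<close> together contribute a factor \<open>1 + u + s i * s j * V\<close>, and the pairs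
  \<open>(u, V)\<close> are independent.  Expanding the product and averaging over \<open>s\<close> leaves the subgraphs all of whose
  degrees are even; in the limit \<open>L\<close> is the exponential of
  \<open>S m = \<Sum> u + \<Sum> {\<Prod> V over the edges of c | c a cycle of length at most m}\<close>, minus half its variance.

  Three facts make this precise.
  First, \<open>E L\<^sup>2 = E (\<Prod> (a + \<tau> i * \<tau> j * b))\<close> for the product \<open>\<tau>\<close> of two independent spikes, with \<open>a = E A\<^sup>2\<close> and
  \<open>b = E B\<^sup>2\<close>.  Since \<open>N\<^sup>2 (a - 1)\<close> and \<open>N b\<close> converge to \<open>\<gamma> = \<omega>\<^sup>2 G / 4\<close> and \<open>f = \<omega> F\<close>, this is the partition
  function of the Curie--Weiss model, and it converges to \<open>exp r\<close>, where \<open>r = 2 \<rho>\<^sup>*\<close>, exactly in the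
  high temperature phase \<open>2 f < 1\<close> (\<open>curie_weiss_product_limit\<close>).
  Second, \<open>S m\<close> is asymptotically normal with variance \<open>v m\<close>, centred under the null hypothesis and with mean
  \<open>v m\<close> under the law planted with any fixed spike (\<open>planted_statistic_clt\<close>).  Ordering the edges turns \<open>S m\<close>
  into a sum of martingale differences, whose conditional variances concentrate because two pairs of cycles
  that are correlated share too many vertices to be frequent.  The variances \<open>v m\<close> tend to \<open>r\<close>: the cycles of
  length \<open>k\<close> contribute \<open>(2 f)\<^sup>k / (2 k)\<close>, and the series of these is the logarithm in \<open>\<rho>\<^sup>*\<close>.
  Third, with \<open>g = min (exp (S m - v m / 2)) m\<close> the square in \<open>E (L - g)\<^sup>2 = E L\<^sup>2 - 2 E (L g) + E g\<^sup>2\<close> can be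
  evaluated term by term: \<open>E (L g)\<close> is the mean of \<open>g\<close> under the planted laws.  All three terms tend to
  \<open>exp r\<close> when first \<open>N\<close> and then \<open>m\<close> grows, so \<open>L\<close> is close to \<open>g\<close> in mean square
  (\<open>likelihood_limit\<close>), and \<open>ln L\<close> inherits the normal limit with mean \<open>- r / 2\<close> and variance \<open>r\<close>.

  The argument needs moments that \<open>L\<close> need not have, because \<open>p (w - \<epsilon>)\<close> may exceed \<open>p w\<close> enormously for large
  \<open>w\<close>.  The ratio is therefore replaced by \<open>1\<close> where a bound for the logarithmic
  derivative of \<open>p\<close> exceeds \<open>1 / \<epsilon>\<close>, and then normalised to have mean one.  With probability tending to one no entry is affected, and
  the normalising constants multiply to a factor that tends to one (\<open>LR_test_close\<close>).
\<close>

section \<open>A martingale central limit theorem\<close>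

lemma abs_power_le_fourth: "k \<le> 4 ==> \<bar>y::real\<bar> ^ k \<le> 1 + y ^ 4"
proof (cases "\<bar>y\<bar> \<le> 1")
 case True
 then have "\<bar>y\<bar> ^ k \<le> 1" by (simp add: power_le_one)
 also have "... \<le> 1 + y ^ 4" by simp
 finally show ?thesis .
next
 case False
 assume "k \<le> 4"
 then have "\<bar>y\<bar> ^ k \<le> \<bar>y\<bar> ^ 4" using False by (intro power_increasing) auto
 then show ?thesis by (simp add: power_even_abs)
qed

lemma fourth_power_sum_le: "(x + y :: real) ^ 4 \<le> 8 * (x ^ 4 + y ^ 4)"
proof -
 have "(x + y)\<^sup>2 \<le> 2 * (x\<^sup>2 + y\<^sup>2)" using sum_squares_bound[of x y] by (simp add: power2_sum)
 then have "((x + y)\<^sup>2)\<^sup>2 \<le> (2 * (x\<^sup>2 + y\<^sup>2))\<^sup>2" by (intro power_mono) auto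
 also have "... \<le> 8 * ((x\<^sup>2)\<^sup>2 + (y\<^sup>2)\<^sup>2)"
  using sum_squares_bound[of "x\<^sup>2" "y\<^sup>2"] by (simp add: power2_sum power_mult_distrib algebra_simps)
 finally show ?thesis by simp
qed

lemma norm_integral_le:
 fixes f :: "'a => 'b::{banach,second_countable_topology}"
 assumes "integrable M f" "integrable M g" "\<And>x. x \<in> space M ==> norm (f x) \<le> g x"
 shows "norm (\<integral>x. f x \<partial>M) \<le> (\<integral>x. g x \<partial>M)"
proof -
 have "norm (\<integral>x. f x \<partial>M) \<le> (\<integral>x. norm (f x) \<partial>M)" by (rule integral_norm_bound)
 also have "... \<le> (\<integral>x. g x \<partial>M)" using assms by (intro integral_mono) auto
 finally show ?thesis .
qed

text \<open>
 Conditional expectations enter only through their integrals against functions of the past, which is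
 why the martingale property is stated in this weak form.
\<close>

locale weak_martingale_differences = prob_space M for M :: "'a measure" +
 fixes F :: "nat => 'a measure" and D q :: "nat => 'a => real"
 assumes subalg: "\<And>l. subalgebra M (F l)"
  and filtration: "\<And>k l. k \<le> l ==> subalgebra (F l) (F k)"
  and D_adapted: "\<And>l. D l \<in> borel_measurable (F (Suc l))"
  and q_predictable: "\<And>l. q l \<in> borel_measurable (F l)"
  and q_nonneg: "\<And>l x. 0 \<le> q l x"
  and D4_integrable: "\<And>l. integrable M (\<lambda>x. D l x ^ 4)"
  and q_integrable: "\<And>l. integrable M (q l)"
  and weak_mean: "\<And>l Y K. Y \<in> borel_measurable (F l) ==> (\<And>x. \<bar>Y x\<bar> \<le> (K::real)) ==>
           (\<integral>x. Y x * D l x \<partial>M) = 0"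
  and weak_variance: "\<And>l Y K. Y \<in> borel_measurable (F l) ==> (\<And>x. \<bar>Y x\<bar> \<le> (K::real)) ==>
           (\<integral>x. Y x * (D l x)\<^sup>2 \<partial>M) = (\<integral>x. Y x * q l x \<partial>M)"
begin

definition S :: "nat => 'a => real" where "S n x = (\<Sum>l<n. D l x)"
definition V :: "nat => 'a => real" where "V n x = (\<Sum>l<n. q l x)"

lemma q_measurable[measurable]: "q l \<in> borel_measurable M"
 by (rule measurable_from_subalg[OF subalg q_predictable])

lemma D_measurable[measurable]: "D l \<in> borel_measurable M"
 by (rule measurable_from_subalg[OF subalg D_adapted])

lemma S_measurable[measurable]: "S n \<in> borel_measurable M"
 unfolding S_def[abs_def] by measurable

lemma V_measurable[measurable]: "V n \<in> borel_measurable M"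
 unfolding V_def[abs_def] by measurable

lemma S_adapted: "S n \<in> borel_measurable (F n)"
 unfolding S_def[abs_def]
proof (rule borel_measurable_sum)
 fix l assume "l \<in> {..<n}"
 then show "D l \<in> borel_measurable (F n)"
  using measurable_from_subalg[OF filtration D_adapted, of l n] by (auto simp: Suc_le_eq)
qed

lemma V_predictable: "V (Suc n) \<in> borel_measurable (F n)"
 unfolding V_def[abs_def]
proof (rule borel_measurable_sum)
 fix l assume "l \<in> {..<Suc n}"
 then show "q l \<in> borel_measurable (F n)"
  using measurable_from_subalg[OF filtration q_predictable, of l n] by auto
qed

lemma V_nonneg: "0 \<le> V n x" by (simp add: V_def sum_nonneg q_nonneg)

lemma V_mono: "m \<le> n ==> V m x \<le> V n x"
 unfolding V_def by (rule sum_mono2) (auto simp: q_nonneg)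

lemma q_le_V: "l < n ==> q l x \<le> V n x"
 unfolding V_def by (rule member_le_sum) (auto simp: q_nonneg)

lemma D_power_integrable: "k \<le> 4 ==> integrable M (\<lambda>x. \<bar>D l x\<bar> ^ k)"
 by (rule Bochner_Integration.integrable_bound[where f="\<lambda>x. 1 + D l x ^ 4"])
   (use abs_power_le_fourth[of k] in \<open>auto intro!: D4_integrable AE_I2 simp: add_nonneg_nonneg\<close>)

lemma D_integrable: "integrable M (D l)"
 by (rule integrable_abs_cancel) (use D_power_integrable[of 1 l] in simp_all)

lemma D2_integrable: "integrable M (\<lambda>x. (D l x)\<^sup>2)"
 using D_power_integrable[of 2 l] by simp

lemma expectation_D2: "(\<integral>x. (D l x)\<^sup>2 \<partial>M) = (\<integral>x. q l x \<partial>M)"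
 using weak_variance[of "\<lambda>_. 1" l 1] by simp

lemma complex_integrable_mult:
 fixes Y :: "'a => complex"
 assumes "Y \<in> borel_measurable M" "\<And>x. norm (Y x) \<le> K" "integrable M f"
 shows "integrable M (\<lambda>x. Y x * complex_of_real (f x))"
 by (rule Bochner_Integration.integrable_bound[where f="\<lambda>x. K * f x"])
   (use assms order_trans[OF assms(2) abs_ge_self] in
    \<open>auto intro!: AE_I2 integrable_mult_right mult_mono simp: norm_mult abs_mult\<close>)

lemma complex_weak_mean:
 fixes Y :: "'a => complex"
 assumes Y: "Y \<in> borel_measurable (F l)" and b: "\<And>x. norm (Y x) \<le> K"
 shows "(\<integral>x. Y x * complex_of_real (D l x) \<partial>M) = 0"
proof -
 have [measurable]: "Y \<in> borel_measurable M"
  using Y subalg by (rule measurable_from_subalg[rotated])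
 have i: "integrable M (\<lambda>x. Y x * complex_of_real (D l x))"
  by (rule complex_integrable_mult[OF _ b D_integrable]) simp
 have "(\<integral>x. Re (Y x) * D l x \<partial>M) = 0" "(\<integral>x. Im (Y x) * D l x \<partial>M) = 0"
  using Y b order_trans[OF abs_Re_le_cmod b] order_trans[OF abs_Im_le_cmod b]
  by (auto intro!: weak_mean[where K=K])
 then show ?thesis
  using integral_Re[OF i] integral_Im[OF i] by (simp add: complex_eq_iff)
qed

lemma complex_weak_variance:
 fixes Y :: "'a => complex"
 assumes Y: "Y \<in> borel_measurable (F l)" and b: "\<And>x. norm (Y x) \<le> K"
 shows "(\<integral>x. Y x * complex_of_real ((D l x)\<^sup>2) \<partial>M) = (\<integral>x. Y x * complex_of_real (q l x) \<partial>M)"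
proof -
 have [measurable]: "Y \<in> borel_measurable M"
  using Y subalg by (rule measurable_from_subalg[rotated])
 have i: "integrable M (\<lambda>x. Y x * complex_of_real ((D l x)\<^sup>2))"
  by (rule complex_integrable_mult[OF _ b D2_integrable]) simp
 have j: "integrable M (\<lambda>x. Y x * complex_of_real (q l x))"
  by (rule complex_integrable_mult[OF _ b q_integrable]) simp
 have "(\<integral>x. Re (Y x) * (D l x)\<^sup>2 \<partial>M) = (\<integral>x. Re (Y x) * q l x \<partial>M)"
    "(\<integral>x. Im (Y x) * (D l x)\<^sup>2 \<partial>M) = (\<integral>x. Im (Y x) * q l x \<partial>M)"
  using Y b order_trans[OF abs_Re_le_cmod b] order_trans[OF abs_Im_le_cmod b]
  by (auto intro!: weak_variance[where K=K])
 then show ?thesis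
  using integral_Re[OF i] integral_Im[OF i] integral_Re[OF j] integral_Im[OF j]
  by (simp add: complex_eq_iff del: of_real_power)
qed

lemma variance_square_le:
 assumes b: "\<And>x. q l x \<le> K"
 shows "integrable M (\<lambda>x. (q l x)\<^sup>2)" "(\<integral>x. (q l x)\<^sup>2 \<partial>M) \<le> (\<integral>x. D l x ^ 4 \<partial>M)"
proof -
 have aq: "\<bar>q l x\<bar> \<le> K" "q l x \<le> \<bar>K\<bar>" for x using b[of x] q_nonneg[of l x] by auto
 show i: "integrable M (\<lambda>x. (q l x)\<^sup>2)"
  by (rule Bochner_Integration.integrable_bound[where f="\<lambda>x. K * q l x"])
    (use b q_nonneg aq in \<open>auto intro!: AE_I2 q_integrable mult_mono simp: power2_eq_square abs_mult intro: order_trans\<close>)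
 have j: "integrable M (\<lambda>x. q l x * (D l x)\<^sup>2)"
  by (rule Bochner_Integration.integrable_bound[where f="\<lambda>x. K * (D l x)\<^sup>2"])
    (use b q_nonneg aq in \<open>auto intro!: AE_I2 D2_integrable mult_right_mono simp: abs_mult intro: order_trans\<close>)
 have "(\<integral>x. (q l x)\<^sup>2 \<partial>M) = (\<integral>x. q l x * (D l x)\<^sup>2 \<partial>M)"
  using weak_variance[OF q_predictable aq(1)] by (simp add: power2_eq_square)
 also have "... \<le> (\<integral>x. (q l x)\<^sup>2 / 2 + D l x ^ 4 / 2 \<partial>M)"
 proof (rule integral_mono[OF j])
  show "integrable M (\<lambda>x. (q l x)\<^sup>2 / 2 + D l x ^ 4 / 2)" using i D4_integrable by auto
  show "q l x * (D l x)\<^sup>2 \<le> (q l x)\<^sup>2 / 2 + D l x ^ 4 / 2" for x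
   using sum_squares_bound[of "q l x" "(D l x)\<^sup>2"] by (simp add: power_mult[symmetric] mult.assoc flip: power2_eq_square)
 qed
 also have "... = (\<integral>x. (q l x)\<^sup>2 \<partial>M) / 2 + (\<integral>x. D l x ^ 4 \<partial>M) / 2"
  using i D4_integrable by simp
 finally show "(\<integral>x. (q l x)\<^sup>2 \<partial>M) \<le> (\<integral>x. D l x ^ 4 \<partial>M)" by simp
qed

lemma iexp_second_order: "cmod (iexp x - (1 + \<i> * x - x\<^sup>2 / 2)) \<le> \<bar>x\<bar> ^ 3"
proof -
 have "(\<Sum>k\<le>2. (\<i> * complex_of_real x)^k / fact k) = 1 + \<i> * x - x\<^sup>2 / 2"
  by (simp add: numeral_2_eq_2 power2_eq_square field_simps)
 then have "cmod (iexp x - (1 + \<i> * x - x\<^sup>2 / 2)) \<le> \<bar>x\<bar> ^ 3 / fact 3"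
  using iexp_approx1[of x 2] by (simp add: eval_nat_numeral)
 also have "... \<le> \<bar>x\<bar> ^ 3" by (simp add: fact_numeral)
 finally show ?thesis .
qed

lemma exp_neg_second_order: "0 \<le> y ==> \<bar>exp (- y) - (1 - y)\<bar> \<le> y\<^sup>2" for y :: real
proof -
 assume y: "0 \<le> y"
 have "1 - y \<le> exp (- y)" using exp_ge_add_one_self[of "- y"] by simp
 moreover have "exp (- y) \<le> 1 - y + y\<^sup>2"
 proof -
  have "exp (-y) \<le> inverse (1 + y)"
   using exp_ge_add_one_self[of y] y by (simp add: exp_minus le_imp_inverse_le)
  also have "... \<le> 1 - y + y\<^sup>2"
   using y by (simp add: field_simps power2_eq_square)
  finally show ?thesis .
 qed
 ultimately show ?thesis by auto
qed

text \<open>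
 The compensated exponential \<open>exp (\<i> t S + t\<^sup>2 V / 2)\<close> would have mean one if the differences were
 Gaussian.  Telescoping over \<open>l\<close>, each factor differs from one by third order terms, since the predictable
 \<open>V\<close> cancels the second order.
\<close>

lemma tilted_characteristic_bound:
 assumes VK: "\<And>x. V n x \<le> K"
 shows "norm ((\<integral>x. iexp (t * S n x) * complex_of_real (exp (t\<^sup>2 * V n x / 2)) \<partial>M) - 1)
  \<le> exp (t\<^sup>2 * K / 2) * (\<Sum>l<n. \<bar>t\<bar> ^ 3 * (\<integral>x. \<bar>D l x\<bar> ^ 3 \<partial>M) + t ^ 4 * (\<integral>x. D l x ^ 4 \<partial>M))"
proof -
 define G where "G l x = iexp (t * S l x) * complex_of_real (exp (t\<^sup>2 * V l x / 2))" for l x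
 define R where "R l = exp (t\<^sup>2 * K / 2) * (\<bar>t\<bar> ^ 3 * (\<integral>x. \<bar>D l x\<bar> ^ 3 \<partial>M) + t ^ 4 * (\<integral>x. D l x ^ 4 \<partial>M))" for l
 have [measurable]: "G l \<in> borel_measurable M" for l unfolding G_def[abs_def] by measurable
 have normG: "norm (G l x) \<le> exp (t\<^sup>2 * K / 2)" if "l \<le> n" for l x
  using V_mono[OF that, of x] VK[of x] by (auto simp: G_def norm_mult intro!: mult_left_mono)
 have intG: "integrable M (G l)" if "l \<le> n" for l
  by (rule integrable_const_bound[where B="exp (t\<^sup>2 * K / 2)"]) (use normG[OF that] in auto)
 have step: "norm ((\<integral>x. G (Suc l) x \<partial>M) - (\<integral>x. G l x \<partial>M)) \<le> R l" if l: "l < n" for l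
 proof -
  define Y where "Y x = iexp (t * S l x) * complex_of_real (exp (t\<^sup>2 * V (Suc l) x / 2))" for x
  have Yb: "norm (Y x) \<le> exp (t\<^sup>2 * K / 2)" for x
   using V_mono[of "Suc l" n x] l VK[of x] by (auto simp: Y_def norm_mult intro!: mult_left_mono)
  have YF: "Y \<in> borel_measurable (F l)"
   using S_adapted[of l] V_predictable[of l] unfolding Y_def[abs_def] by measurable
  have [measurable]: "Y \<in> borel_measurable M"
   using YF subalg by (rule measurable_from_subalg[rotated])
  have qK: "q l x \<le> K" for x using q_le_V[OF l, of x] VK[of x] by simp
  define r where "r x = iexp (t * D l x) - (1 + \<i> * (t * D l x) - (t * D l x)\<^sup>2 / 2)" for x
  define r' where "r' x = exp (- (t\<^sup>2 * q l x / 2)) - (1 - t\<^sup>2 * q l x / 2)" for x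
  have [measurable]: "r \<in> borel_measurable M" "r' \<in> borel_measurable M"
   unfolding r_def[abs_def] r'_def[abs_def] by measurable
  have rb: "norm (r x) \<le> \<bar>t\<bar> ^ 3 * \<bar>D l x\<bar> ^ 3" for x
   unfolding r_def using iexp_second_order[of "t * D l x"] by (simp add: abs_mult power_mult_distrib)
  have r'b: "\<bar>r' x\<bar> \<le> t ^ 4 * (q l x)\<^sup>2" for x
  proof -
   have "\<bar>r' x\<bar> \<le> (t\<^sup>2 * q l x / 2)\<^sup>2" unfolding r'_def
    by (rule exp_neg_second_order) (simp add: q_nonneg)
   also have "... \<le> t ^ 4 * (q l x)\<^sup>2"
    by (simp add: power_mult_distrib power_divide flip: power_mult)
   finally show ?thesis .
  qed
  have id: "G (Suc l) x - G l x = Y x * r x - Y x * complex_of_real (r' x)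
    + (\<i> * t) * (Y x * complex_of_real (D l x))
    - (t\<^sup>2 / 2) * (Y x * complex_of_real ((D l x)\<^sup>2)) + (t\<^sup>2 / 2) * (Y x * complex_of_real (q l x))" for x
  proof -
   have "G (Suc l) x = Y x * iexp (t * D l x)" (is "_ = Y x * ?e")
    by (simp add: G_def Y_def S_def exp_add[symmetric] algebra_simps)
   moreover have "G l x = Y x * complex_of_real (exp (- (t\<^sup>2 * q l x / 2)))"
   proof -
    have "exp (t\<^sup>2 * V l x / 2) = exp (t\<^sup>2 * V (Suc l) x / 2) * exp (- (t\<^sup>2 * q l x / 2))"
     by (simp add: V_def exp_add[symmetric] algebra_simps add_divide_distrib)
    then show ?thesis by (simp add: G_def Y_def)
   qed
   moreover have "iexp (t * D l x) = r x + (1 + \<i> * (t * D l x) - (t * D l x)\<^sup>2 / 2)"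
    by (simp add: r_def)
   moreover have "exp (- (t\<^sup>2 * q l x / 2)) = r' x + (1 - t\<^sup>2 * q l x / 2)"
    by (simp add: r'_def)
   ultimately have 1: "G (Suc l) x = Y x * (r x + (1 + \<i> * (t * D l x) - (t * D l x)\<^sup>2 / 2))"
    and 2: "G l x = Y x * complex_of_real (r' x + (1 - t\<^sup>2 * q l x / 2))" by metis+
   show ?thesis unfolding 1 2 by (simp add: algebra_simps power_mult_distrib)
  qed
  have i1: "integrable M (\<lambda>x. Y x * r x)"
   by (rule Bochner_Integration.integrable_bound[where f="\<lambda>x. exp (t\<^sup>2 * K / 2) * (\<bar>t\<bar> ^ 3 * \<bar>D l x\<bar> ^ 3)"])
     (use Yb rb in \<open>auto intro!: AE_I2 D_power_integrable mult_mono simp: norm_mult\<close>)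
  have i2: "integrable M (\<lambda>x. Y x * complex_of_real (r' x))"
   by (rule Bochner_Integration.integrable_bound[where f="\<lambda>x. exp (t\<^sup>2 * K / 2) * (t ^ 4 * (q l x)\<^sup>2)"])
     (use Yb r'b variance_square_le(1)[OF qK] in \<open>auto intro!: AE_I2 mult_mono simp: norm_mult\<close>)
  have i3: "integrable M (\<lambda>x. Y x * complex_of_real (D l x))"
   by (rule complex_integrable_mult[OF _ Yb D_integrable]) simp
  have i4: "integrable M (\<lambda>x. Y x * complex_of_real ((D l x)\<^sup>2))"
   by (rule complex_integrable_mult[OF _ Yb D2_integrable]) simp
  have i5: "integrable M (\<lambda>x. Y x * complex_of_real (q l x))"
   by (rule complex_integrable_mult[OF _ Yb q_integrable]) simp
  have "(\<integral>x. G (Suc l) x \<partial>M) - (\<integral>x. G l x \<partial>M) = (\<integral>x. G (Suc l) x - G l x \<partial>M)"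
   using intG[of l] intG[of "Suc l"] l by simp
  also have "... = (\<integral>x. Y x * r x \<partial>M) - (\<integral>x. Y x * complex_of_real (r' x) \<partial>M)
    + (\<i> * t) * (\<integral>x. Y x * complex_of_real (D l x) \<partial>M)
    - (t\<^sup>2 / 2) * (\<integral>x. Y x * complex_of_real ((D l x)\<^sup>2) \<partial>M)
    + (t\<^sup>2 / 2) * (\<integral>x. Y x * complex_of_real (q l x) \<partial>M)"
   unfolding id using i1 i2 i3 i4 i5 by (simp del: of_real_power)
  also have "... = (\<integral>x. Y x * r x \<partial>M) - (\<integral>x. Y x * complex_of_real (r' x) \<partial>M)"
   by (simp add: complex_weak_mean[OF YF Yb] complex_weak_variance[OF YF Yb] del: of_real_power)
  finally have "norm ((\<integral>x. G (Suc l) x \<partial>M) - (\<integral>x. G l x \<partial>M))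
    \<le> norm (\<integral>x. Y x * r x \<partial>M) + norm (\<integral>x. Y x * complex_of_real (r' x) \<partial>M)"
   by (simp add: norm_triangle_ineq4)
  also have "... \<le> (\<integral>x. exp (t\<^sup>2 * K / 2) * (\<bar>t\<bar> ^ 3 * \<bar>D l x\<bar> ^ 3) \<partial>M) + (\<integral>x. exp (t\<^sup>2 * K / 2) * (t ^ 4 * (q l x)\<^sup>2) \<partial>M)"
   by (intro add_mono norm_integral_le i1 i2)
     (use Yb rb r'b variance_square_le(1)[OF qK] in \<open>auto intro!: D_power_integrable mult_mono simp: norm_mult\<close>)
  also have "... = exp (t\<^sup>2 * K / 2) * (\<bar>t\<bar> ^ 3 * (\<integral>x. \<bar>D l x\<bar> ^ 3 \<partial>M) + t ^ 4 * (\<integral>x. (q l x)\<^sup>2 \<partial>M))"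
   using D_power_integrable[of 3 l] variance_square_le(1)[OF qK] by (simp add: algebra_simps)
  also have "... \<le> R l" unfolding R_def
   using variance_square_le(2)[OF qK] by (intro mult_left_mono add_left_mono) auto
  finally show ?thesis .
 qed
 have "norm ((\<integral>x. G m x \<partial>M) - 1) \<le> (\<Sum>l<m. R l)" if "m \<le> n" for m
  using that
 proof (induction m)
  case 0 then show ?case by (simp add: G_def S_def V_def prob_space)
 next
  case (Suc m)
  have "norm ((\<integral>x. G (Suc m) x \<partial>M) - 1)
    \<le> norm ((\<integral>x. G (Suc m) x \<partial>M) - (\<integral>x. G m x \<partial>M)) + norm ((\<integral>x. G m x \<partial>M) - 1)"
   using norm_triangle_ineq[of "(\<integral>x. G (Suc m) x \<partial>M) - (\<integral>x. G m x \<partial>M)" "(\<integral>x. G m x \<partial>M) - 1"] by simp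
  then show ?case using Suc step[of m] by simp
 qed
 from this[of n] show ?thesis by (simp add: G_def R_def sum_distrib_left)
qed

end

text \<open>
 Stopping the differences as soon as their conditional variances add up to more than \<open>K\<close> keeps the
 martingale structure, because the decision at step \<open>l\<close> is predictable.
\<close>

lemma (in weak_martingale_differences) stopped:
 "weak_martingale_differences M F
   (\<lambda>l x. D l x * indicator {x. V (Suc l) x \<le> K} x) (\<lambda>l x. q l x * indicator {x. V (Suc l) x \<le> K} x)"
proof
 have ind: "(\<lambda>x. indicator {x. V (Suc l) x \<le> K} x :: real) \<in> borel_measurable (F l)" for l
  using V_predictable[of l] by measurable
 have ind': "(\<lambda>x. indicator {x. V (Suc l) x \<le> K} x :: real) \<in> borel_measurable (F (Suc l))" for l
  by (rule measurable_from_subalg[OF filtration ind]) simp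
 have [measurable]: "(\<lambda>x. indicator {x. V (Suc l) x \<le> K} x :: real) \<in> borel_measurable M" for l
  by (rule measurable_from_subalg[OF subalg ind])
 show "subalgebra M (F l)" for l by (rule subalg)
 show "subalgebra (F l) (F k)" if "k \<le> l" for k l by (rule filtration[OF that])
 show "(\<lambda>x. D l x * indicator {x. V (Suc l) x \<le> K} x) \<in> borel_measurable (F (Suc l))" for l
  by (intro borel_measurable_times D_adapted ind')
 show "(\<lambda>x. q l x * indicator {x. V (Suc l) x \<le> K} x) \<in> borel_measurable (F l)" for l
  by (intro borel_measurable_times q_predictable ind)
 show "0 \<le> q l x * indicator {x. V (Suc l) x \<le> K} x" for l x by (simp add: q_nonneg)
 show "integrable M (\<lambda>x. (D l x * indicator {x. V (Suc l) x \<le> K} x) ^ 4)" for l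
  by (rule Bochner_Integration.integrable_bound[OF D4_integrable[of l]]) (auto simp: indicator_def)
 show "integrable M (\<lambda>x. q l x * indicator {x. V (Suc l) x \<le> K} x)" for l
  by (rule Bochner_Integration.integrable_bound[OF q_integrable[of l]]) (auto simp: indicator_def)
 show "(\<integral>x. Y x * (D l x * indicator {x. V (Suc l) x \<le> K} x) \<partial>M) = 0"
  if "Y \<in> borel_measurable (F l)" "\<And>x. \<bar>Y x\<bar> \<le> K'" for Y l K'
 proof -
  have "(\<integral>x. (Y x * indicator {x. V (Suc l) x \<le> K} x) * D l x \<partial>M) = 0"
  proof (rule weak_mean[where K=K'])
   show "(\<lambda>x. Y x * indicator {x. V (Suc l) x \<le> K} x) \<in> borel_measurable (F l)"
    by (intro borel_measurable_times that(1) ind)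
   show "\<bar>Y x * indicator {x. V (Suc l) x \<le> K} x\<bar> \<le> K'" for x
    using that(2)[of x] by (auto simp: indicator_def)
  qed
  then show ?thesis by (simp add: mult_ac)
 qed
 show "(\<integral>x. Y x * (D l x * indicator {x. V (Suc l) x \<le> K} x)\<^sup>2 \<partial>M)
    = (\<integral>x. Y x * (q l x * indicator {x. V (Suc l) x \<le> K} x) \<partial>M)"
  if "Y \<in> borel_measurable (F l)" "\<And>x. \<bar>Y x\<bar> \<le> K'" for Y l K'
 proof -
  have "(\<integral>x. (Y x * indicator {x. V (Suc l) x \<le> K} x) * (D l x)\<^sup>2 \<partial>M)
    = (\<integral>x. (Y x * indicator {x. V (Suc l) x \<le> K} x) * q l x \<partial>M)"
  proof (rule weak_variance[where K=K'])
   show "(\<lambda>x. Y x * indicator {x. V (Suc l) x \<le> K} x) \<in> borel_measurable (F l)"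
    by (intro borel_measurable_times that(1) ind)
   show "\<bar>Y x * indicator {x. V (Suc l) x \<le> K} x\<bar> \<le> K'" for x
    using that(2)[of x] by (auto simp: indicator_def)
  qed
  moreover have "(indicator A x :: real)\<^sup>2 = indicator A x" for A and x :: 'a
   by (simp add: indicator_def)
  ultimately show ?thesis by (simp add: power_mult_distrib mult_ac)
 qed
qed

text \<open>
 The bound \<open>K = v + 1\<close> at which the process is stopped is exceeded with probability at most \<open>e\<close>, by
 Markov's inequality.  The parameter \<open>\<delta>\<close> splits the third moments into second and fourth ones.
\<close>

lemma (in weak_martingale_differences) characteristic_bound:
 assumes v: "0 \<le> v" and \<delta>: "0 < \<delta>" and iV: "integrable M (V n)"
 defines "e \<equiv> (\<integral>x. \<bar>V n x - v\<bar> \<partial>M)" and "d \<equiv> (\<Sum>l<n. \<integral>x. D l x ^ 4 \<partial>M)"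
 shows "norm ((\<integral>x. iexp (t * S n x) \<partial>M) - exp (- (t\<^sup>2 * v / 2)))
  \<le> 2 * e + exp (t\<^sup>2 * (v + 1) / 2) * (t\<^sup>2 * (v + 2) * e + \<bar>t\<bar> ^ 3 * (\<delta> * (v + e) + d / \<delta>) + t ^ 4 * d)"
proof -
 \<comment> \<open>Room of one above the limit, so that stopping is exceptional.\<close>
 define K where "K = v + 1"
 define I where "I l x = (indicator {x. V (Suc l) x \<le> K} x :: real)" for l x
 interpret T: weak_martingale_differences M F "\<lambda>l x. D l x * I l x" "\<lambda>l x. q l x * I l x"
  unfolding I_def by (rule stopped)
 have I01: "0 \<le> I l x" "I l x \<le> 1" for l x by (auto simp: I_def)
 have TVm: "T.V m x \<le> K \<and> (V m x \<le> K \<longrightarrow> T.V m x = V m x)" for m x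
 proof (induction m)
  case 0 then show ?case using v by (simp add: T.V_def V_def K_def)
 next
  case (Suc m)
  show ?case
  proof (cases "V (Suc m) x \<le> K")
   case True
   then have "V m x \<le> K" using V_mono[of m "Suc m" x] by simp
   with Suc have "T.V m x = V m x" by simp
   moreover have "T.V (Suc m) x = T.V m x + q m x * I m x" "V (Suc m) x = V m x + q m x"
    by (simp_all add: T.V_def V_def)
   moreover have "I m x = 1" using True by (simp add: I_def)
   ultimately show ?thesis using True by simp
  next
   case False
   then have "I m x = 0" by (simp add: I_def)
   then have "T.V (Suc m) x = T.V m x" by (simp add: T.V_def)
   with Suc False show ?thesis by simp
  qed
 qed
 have TS: "T.S n x = S n x" if "V n x \<le> K" for x
 proof -
  have "I l x = 1" if "l < n" for l
   using V_mono[of "Suc l" n x] that \<open>V n x \<le> K\<close> by (simp add: I_def)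
  then show ?thesis by (simp add: T.S_def S_def)
 qed
 have iVv: "integrable M (\<lambda>x. \<bar>V n x - v\<bar>)" using iV by auto
 have iTV: "integrable M (T.V n)"
  by (rule integrable_const_bound[where B=K]) (use TVm T.V_nonneg in auto)
 have e0: "0 \<le> e" unfolding e_def by simp
 have i1: "integrable M (\<lambda>x. iexp (t * S n x))" "integrable M (\<lambda>x. iexp (t * T.S n x))"
  by (rule integrable_const_bound[where B=1]; simp)+
 have A: "norm ((\<integral>x. iexp (t * S n x) \<partial>M) - (\<integral>x. iexp (t * T.S n x) \<partial>M)) \<le> 2 * e"
 proof -
  have "norm (\<integral>x. iexp (t * S n x) - iexp (t * T.S n x) \<partial>M) \<le> (\<integral>x. 2 * \<bar>V n x - v\<bar> \<partial>M)"
  proof (rule norm_integral_le)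
   show "integrable M (\<lambda>x. iexp (t * S n x) - iexp (t * T.S n x))" using i1 by auto
   show "integrable M (\<lambda>x. 2 * \<bar>V n x - v\<bar>)" using iVv by auto
   fix x
   show "cmod (iexp (t * S n x) - iexp (t * T.S n x)) \<le> 2 * \<bar>V n x - v\<bar>"
   proof (cases "V n x \<le> K")
    case True then show ?thesis by (simp add: TS)
   next
    case False
    then have "1 \<le> \<bar>V n x - v\<bar>" by (simp add: K_def)
    then show ?thesis
     using norm_triangle_ineq4[of "iexp (t * S n x)" "iexp (t * T.S n x)"] by simp
   qed
  qed
  then show ?thesis using i1 by (simp add: e_def)
 qed
 define c where "c = exp (t\<^sup>2 * K / 2)"
 have B1: "norm ((\<integral>x. iexp (t * T.S n x) * complex_of_real (exp (t\<^sup>2 * v / 2)) \<partial>M)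
   - (\<integral>x. iexp (t * T.S n x) * complex_of_real (exp (t\<^sup>2 * T.V n x / 2)) \<partial>M)) \<le> c * (t\<^sup>2 * (v + 2) * e)"
 proof -
  have j: "integrable M (\<lambda>x. iexp (t * T.S n x) * complex_of_real (exp (t\<^sup>2 * T.V n x / 2)))"
   by (rule integrable_const_bound[where B=c])
     (use TVm in \<open>auto simp: norm_mult c_def intro!: mult_left_mono\<close>)
  have lip: "\<bar>exp a - exp b\<bar> \<le> exp m * \<bar>a - b\<bar>" if "a \<le> m" "b \<le> m" for a b m :: real
  proof -
   have *: "exp a - exp b \<le> exp m * (a - b)" if "b \<le> a" "a \<le> m" for a b
   proof -
    have "exp a - exp b = exp a * (1 - exp (b - a))" by (simp add: exp_diff right_diff_distrib)
    also have "... \<le> exp a * (a - b)" by (rule mult_left_mono) (use exp_ge_add_one_self[of "b - a"] in linarith, simp)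
    also have "... \<le> exp m * (a - b)" using that by (intro mult_right_mono) auto
    finally show ?thesis .
   qed
   show ?thesis using *[of a b] *[of b a] that by (cases "b \<le> a") (auto simp: abs_if)
  qed
  have "norm (\<integral>x. iexp (t * T.S n x) * complex_of_real (exp (t\<^sup>2 * v / 2))
   - iexp (t * T.S n x) * complex_of_real (exp (t\<^sup>2 * T.V n x / 2)) \<partial>M)
   \<le> (\<integral>x. c * (t\<^sup>2 * (v + 2)) * \<bar>V n x - v\<bar> \<partial>M)"
  proof (rule norm_integral_le)
   show "integrable M (\<lambda>x. iexp (t * T.S n x) * complex_of_real (exp (t\<^sup>2 * v / 2))
    - iexp (t * T.S n x) * complex_of_real (exp (t\<^sup>2 * T.V n x / 2)))"
    using i1 j by auto
   show "integrable M (\<lambda>x. c * (t\<^sup>2 * (v + 2)) * \<bar>V n x - v\<bar>)" using iVv by auto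
   fix x
   have TVv: "\<bar>T.V n x - v\<bar> \<le> (v + 2) * \<bar>V n x - v\<bar>"
   proof (cases "V n x \<le> K")
    case True then show ?thesis using TVm[of n x] v by (simp add: mult_le_cancel_right1)
   next
    case False
    then have 1: "1 \<le> \<bar>V n x - v\<bar>" by (simp add: K_def)
    have "\<bar>T.V n x - v\<bar> \<le> v + 2" using TVm[of n x] T.V_nonneg[of n x] v by (auto simp: K_def)
    also have "... \<le> (v + 2) * \<bar>V n x - v\<bar>" using 1 v by (simp add: mult_le_cancel_left1)
    finally show ?thesis .
   qed
   have "cmod (iexp (t * T.S n x) * complex_of_real (exp (t\<^sup>2 * v / 2))
    - iexp (t * T.S n x) * complex_of_real (exp (t\<^sup>2 * T.V n x / 2)))
    = cmod (iexp (t * T.S n x) * complex_of_real (exp (t\<^sup>2 * v / 2) - exp (t\<^sup>2 * T.V n x / 2)))"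
    by (simp only: of_real_diff right_diff_distrib)
   also have "... = \<bar>exp (t\<^sup>2 * v / 2) - exp (t\<^sup>2 * T.V n x / 2)\<bar>"
    by (simp only: norm_mult norm_of_real norm_exp_i_times mult_1)
   also have "... \<le> c * \<bar>t\<^sup>2 * v / 2 - t\<^sup>2 * T.V n x / 2\<bar>"
    unfolding c_def using TVm[of n x] by (intro lip) (auto simp: K_def intro!: mult_left_mono)
   also have "... = c * (t\<^sup>2 / 2 * \<bar>T.V n x - v\<bar>)"
    by (simp add: abs_minus_commute[of "T.V n x"] abs_mult flip: right_diff_distrib diff_divide_distrib)
   also have "... \<le> c * (t\<^sup>2 * ((v + 2) * \<bar>V n x - v\<bar>))"
    by (rule mult_left_mono, rule mult_mono[OF _ TVv]) (auto simp: c_def)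
   finally show "cmod (iexp (t * T.S n x) * complex_of_real (exp (t\<^sup>2 * v / 2))
    - iexp (t * T.S n x) * complex_of_real (exp (t\<^sup>2 * T.V n x / 2))) \<le> c * (t\<^sup>2 * (v + 2)) * \<bar>V n x - v\<bar>"
    by (simp add: mult_ac)
  qed
  then show ?thesis using i1 j by (simp add: e_def mult_ac)
 qed
 have D3: "(\<Sum>l<n. \<integral>x. \<bar>D l x * I l x\<bar> ^ 3 \<partial>M) \<le> \<delta> * (v + e) + d / \<delta>"
 proof -
  have "(\<integral>x. \<bar>D l x * I l x\<bar> ^ 3 \<partial>M) \<le> \<delta> * (\<integral>x. q l x \<partial>M) + (\<integral>x. D l x ^ 4 \<partial>M) / \<delta>" for l
  proof -
   have "(\<integral>x. \<bar>D l x * I l x\<bar> ^ 3 \<partial>M) \<le> (\<integral>x. \<delta> * (D l x)\<^sup>2 + D l x ^ 4 / \<delta> \<partial>M)"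
   proof (rule integral_mono[OF T.D_power_integrable])
    show "integrable M (\<lambda>x. \<delta> * (D l x)\<^sup>2 + D l x ^ 4 / \<delta>)"
     using D2_integrable D4_integrable by auto
    fix x
    let ?y = "\<bar>D l x\<bar>"
    have "\<bar>D l x * I l x\<bar> ^ 3 \<le> ?y ^ 3"
     using I01[of l x] by (intro power_mono) (auto simp: abs_mult mult_left_le)
    also have "... \<le> \<delta> * ?y\<^sup>2 + ?y ^ 4 / \<delta>"
    proof -
     have "0 \<le> (?y - \<delta>)\<^sup>2 + ?y * \<delta>" using \<delta> by simp
     then have "0 \<le> ?y\<^sup>2 * ((?y - \<delta>)\<^sup>2 + ?y * \<delta>)" by (intro mult_nonneg_nonneg) auto
     then have "?y ^ 3 * \<delta> \<le> \<delta>\<^sup>2 * ?y\<^sup>2 + ?y ^ 4"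
      by (simp add: power2_eq_square eval_nat_numeral algebra_simps)
     then show ?thesis using \<delta> by (simp add: field_simps power2_eq_square)
    qed
    finally show "\<bar>D l x * I l x\<bar> ^ 3 \<le> \<delta> * (D l x)\<^sup>2 + D l x ^ 4 / \<delta>" by (simp add: power_even_abs)
   qed simp
   also have "... = \<delta> * (\<integral>x. q l x \<partial>M) + (\<integral>x. D l x ^ 4 \<partial>M) / \<delta>"
    using D2_integrable D4_integrable by (simp add: expectation_D2)
   finally show ?thesis .
  qed
  then have "(\<Sum>l<n. \<integral>x. \<bar>D l x * I l x\<bar> ^ 3 \<partial>M) \<le> (\<Sum>l<n. \<delta> * (\<integral>x. q l x \<partial>M) + (\<integral>x. D l x ^ 4 \<partial>M) / \<delta>)"
   by (rule sum_mono)
  also have "... = \<delta> * (\<integral>x. V n x \<partial>M) + d / \<delta>"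
   by (simp add: d_def V_def sum.distrib sum_distrib_left sum_divide_distrib Bochner_Integration.integral_sum q_integrable)
  also have "(\<integral>x. V n x \<partial>M) \<le> v + e"
  proof -
   have "(\<integral>x. V n x \<partial>M) \<le> (\<integral>x. v + \<bar>V n x - v\<bar> \<partial>M)"
    using iV iVv by (intro integral_mono) auto
   also have "... = v + e" using iVv by (simp add: e_def prob_space)
   finally show ?thesis .
  qed
  finally show ?thesis using \<delta> by simp
 qed
 have D4: "(\<Sum>l<n. \<integral>x. (D l x * I l x) ^ 4 \<partial>M) \<le> d"
  unfolding d_def
  by (intro sum_mono integral_mono T.D4_integrable D4_integrable)
    (auto simp: I_def indicator_def)
 have B2: "norm ((\<integral>x. iexp (t * T.S n x) * complex_of_real (exp (t\<^sup>2 * T.V n x / 2)) \<partial>M) - 1)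
   \<le> c * (\<bar>t\<bar> ^ 3 * (\<delta> * (v + e) + d / \<delta>) + t ^ 4 * d)"
 proof -
  have "norm ((\<integral>x. iexp (t * T.S n x) * complex_of_real (exp (t\<^sup>2 * T.V n x / 2)) \<partial>M) - 1)
   \<le> c * (\<bar>t\<bar> ^ 3 * (\<Sum>l<n. \<integral>x. \<bar>D l x * I l x\<bar> ^ 3 \<partial>M) + t ^ 4 * (\<Sum>l<n. \<integral>x. (D l x * I l x) ^ 4 \<partial>M))"
   using T.tilted_characteristic_bound[of n K t] TVm unfolding c_def
   by (simp add: sum.distrib sum_distrib_left)
  also have "... \<le> c * (\<bar>t\<bar> ^ 3 * (\<delta> * (v + e) + d / \<delta>) + t ^ 4 * d)"
   by (intro mult_left_mono add_mono D3 D4) (auto simp: c_def)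
  finally show ?thesis .
 qed
 have E: "norm ((\<integral>x. iexp (t * T.S n x) \<partial>M) * exp (t\<^sup>2 * v / 2) - 1)
   \<le> c * (t\<^sup>2 * (v + 2) * e) + c * (\<bar>t\<bar> ^ 3 * (\<delta> * (v + e) + d / \<delta>) + t ^ 4 * d)"
  using norm_triangle_mono[OF B1 B2] by simp
 have "norm ((\<integral>x. iexp (t * T.S n x) \<partial>M) - exp (- (t\<^sup>2 * v / 2)))
   = norm (exp (- (t\<^sup>2 * v / 2)) * ((\<integral>x. iexp (t * T.S n x) \<partial>M) * exp (t\<^sup>2 * v / 2) - 1))"
 proof -
  have 1: "complex_of_real (exp (- (t\<^sup>2 * v / 2))) * complex_of_real (exp (t\<^sup>2 * v / 2)) = 1"
   by (simp flip: of_real_mult exp_add)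
  have "b * (z * c - 1) = z * (b * c) - b" for b c z :: complex by (simp add: algebra_simps)
  then show ?thesis by (simp only: 1 mult_1_right)
 qed
 also have "... \<le> norm ((\<integral>x. iexp (t * T.S n x) \<partial>M) * exp (t\<^sup>2 * v / 2) - 1)"
  using v by (simp add: norm_mult mult_left_le_one_le)
 finally have C: "norm ((\<integral>x. iexp (t * T.S n x) \<partial>M) - exp (- (t\<^sup>2 * v / 2)))
   \<le> c * (t\<^sup>2 * (v + 2) * e + \<bar>t\<bar> ^ 3 * (\<delta> * (v + e) + d / \<delta>) + t ^ 4 * d)"
  using E by (simp only: distrib_left add.assoc)
 have "(a - b) + (b - z) = a - z" for a b z :: complex by simp
 from norm_triangle_mono[OF A C, unfolded this] show ?thesis unfolding c_def K_def .
qed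

text \<open>
 The fourth moments play the part of the Lindeberg condition.
\<close>

theorem martingale_clt:
 fixes M :: "nat => 'a measure" and t :: real
 assumes md: "\<And>N. weak_martingale_differences (M N) (F N) (D N) (q N)"
  and v: "0 \<le> v"
  and var: "(\<lambda>N. \<integral>x. \<bar>(\<Sum>l<n N. q N l x) - v\<bar> \<partial>M N) \<longlonglongrightarrow> 0"
  and lindeberg: "(\<lambda>N. \<Sum>l<n N. \<integral>x. D N l x ^ 4 \<partial>M N) \<longlonglongrightarrow> 0"
 shows "(\<lambda>N. \<integral>x. iexp (t * (\<Sum>l<n N. D N l x)) \<partial>M N) \<longlonglongrightarrow> complex_of_real (exp (- (t\<^sup>2 * v / 2)))"
proof -
 interpret W: weak_martingale_differences "M N" "F N" "D N" "q N" for N by (rule md)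
 define e where "e N = (\<integral>x. \<bar>(\<Sum>l<n N. q N l x) - v\<bar> \<partial>M N)" for N
 define d where "d N = (\<Sum>l<n N. \<integral>x. D N l x ^ 4 \<partial>M N)" for N
 define \<delta> where "\<delta> N = sqrt (d N) + 1 / real (Suc N)" for N
 have d0: "0 \<le> d N" for N unfolding d_def by (intro sum_nonneg) simp
 have \<delta>0: "0 < \<delta> N" for N unfolding \<delta>_def using d0[of N] by (intro add_nonneg_pos) auto
 have elim: "e \<longlonglongrightarrow> 0" and dlim: "d \<longlonglongrightarrow> 0"
  using var lindeberg by (simp_all add: e_def[abs_def] d_def[abs_def])
 have \<delta>lim: "\<delta> \<longlonglongrightarrow> 0"
  unfolding \<delta>_def[abs_def]
  using tendsto_add[OF tendsto_real_sqrt[OF dlim] LIMSEQ_inverse_real_of_nat] by (simp add: inverse_eq_divide)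
 have ddlim: "(\<lambda>N. d N / \<delta> N) \<longlonglongrightarrow> 0"
 proof (rule tendsto_sandwich[where f="\<lambda>_. 0" and h="\<lambda>N. sqrt (d N)"])
  have "d N / \<delta> N \<le> sqrt (d N)" for N
  proof -
   have "d N = sqrt (d N) * sqrt (d N)" using d0 by simp
   also have "... \<le> sqrt (d N) * \<delta> N" by (rule mult_left_mono) (auto simp: \<delta>_def d0)
   finally show ?thesis using \<delta>0[of N] by (simp add: field_simps)
  qed
  then show "\<forall>\<^sub>F N in sequentially. d N / \<delta> N \<le> sqrt (d N)" by auto
  show "\<forall>\<^sub>F N in sequentially. 0 \<le> d N / \<delta> N" using d0 \<delta>0 by (auto intro!: always_eventually divide_nonneg_pos)
  show "(\<lambda>N. sqrt (d N)) \<longlonglongrightarrow> 0" using tendsto_real_sqrt[OF dlim] by simp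
 qed simp
 have bound: "norm ((\<integral>x. iexp (t * (\<Sum>l<n N. D N l x)) \<partial>M N) - complex_of_real (exp (- (t\<^sup>2 * v / 2))))
  \<le> 2 * e N + exp (t\<^sup>2 * (v + 1) / 2) * (t\<^sup>2 * (v + 2) * e N + \<bar>t\<bar> ^ 3 * (\<delta> N * (v + e N) + d N / \<delta> N) + t ^ 4 * d N)" for N
 proof -
  have "integrable (M N) (W.V N (n N))"
   unfolding W.V_def[abs_def] by (intro Bochner_Integration.integrable_sum W.q_integrable)
  from W.characteristic_bound[where n="n N" and N=N and t=t, OF v \<delta>0[of N] this]
  show ?thesis unfolding W.S_def W.V_def e_def d_def .
 qed
 have "(\<lambda>N. 2 * e N + exp (t\<^sup>2 * (v + 1) / 2) * (t\<^sup>2 * (v + 2) * e N + \<bar>t\<bar> ^ 3 * (\<delta> N * (v + e N) + d N / \<delta> N) + t ^ 4 * d N)) \<longlonglongrightarrow>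
   2 * 0 + exp (t\<^sup>2 * (v + 1) / 2) * (t\<^sup>2 * (v + 2) * 0 + \<bar>t\<bar> ^ 3 * (0 * (v + 0) + 0) + t ^ 4 * 0)"
  by (intro tendsto_add tendsto_mult tendsto_const elim dlim \<delta>lim ddlim)
 then have lim0: "(\<lambda>N. 2 * e N + exp (t\<^sup>2 * (v + 1) / 2) * (t\<^sup>2 * (v + 2) * e N + \<bar>t\<bar> ^ 3 * (\<delta> N * (v + e N) + d N / \<delta> N) + t ^ 4 * d N)) \<longlonglongrightarrow> 0"
  by simp
 have "(\<lambda>N. (\<integral>x. iexp (t * (\<Sum>l<n N. D N l x)) \<partial>M N) - complex_of_real (exp (- (t\<^sup>2 * v / 2)))) \<longlonglongrightarrow> 0"
  by (rule Lim_null_comparison[OF always_eventually lim0]) (rule allI, rule bound)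
 then show ?thesis by (rule LIM_zero_cancel)
qed

section \<open>Cycles in the complete graph\<close>

text \<open>
 Edges are coded as natural numbers because their order serves as the time of the martingale.
\<close>

definition edge :: "nat => nat => nat" where
 "edge x y = prod_encode (min x y, max x y)"

definition ends :: "nat => nat set" where
 "ends l = {fst (prod_decode l), snd (prod_decode l)}"

lemma ends_edge [simp]: "ends (edge x y) = {x, y}"
 by (auto simp: ends_def edge_def min_def max_def)

lemma edge_commute: "edge x y = edge y x"
 by (simp add: edge_def min.commute max.commute)

lemma edge_eq_iff: "edge x y = edge a b \<longleftrightarrow> {x, y} = {a, b}"
proof
 assume "{x, y} = {a, b}"
 then have "(x = a \<and> y = b) \<or> (x = b \<and> y = a)" by (auto simp: doubleton_eq_iff)
 then show "edge x y = edge a b" by (auto simp: edge_commute)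
qed (metis ends_edge)

definition cyc :: "nat list => nat set" where
 "cyc xs = (\<lambda>i. edge (xs ! i) (xs ! (Suc i mod length xs))) ` {..<length xs}"

definition verts :: "nat set => nat set" where
 "verts c = \<Union> (ends ` c)"

lemma verts_Un: "verts (a \<union> b) = verts a \<union> verts b" by (auto simp: verts_def)

lemma finite_ends [simp]: "finite (ends l)" by (simp add: ends_def)

lemma finite_verts [simp]: "finite c ==> finite (verts c)" by (simp add: verts_def)

lemma ends_nonempty [simp]: "ends l \<noteq> {}" by (simp add: ends_def)

text \<open>
 One list for each cycle: it starts at the largest vertex, and of the two directions the one that
 ends low is taken.
\<close>

definition canonical :: "nat list => bool" where
 "canonical xs \<longleftrightarrow> distinct xs \<and> 3 \<le> length xs \<and> (\<forall>y\<in>set xs. y \<le> xs ! 0) \<and> last xs < xs ! 1"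

definition is_cycle :: "nat set => bool" where
 "is_cycle c \<longleftrightarrow> (\<exists>xs. distinct xs \<and> 3 \<le> length xs \<and> c = cyc xs)"

definition cycles :: "nat => nat => nat set set" where
 "cycles N m = cyc ` {xs. canonical xs \<and> length xs \<le> m \<and> set xs \<subseteq> {..<N}}"

context
 fixes xs :: "nat list" and k :: nat
 assumes d: "distinct xs" and k: "k = length xs" and k3: "3 \<le> k"
begin

lemma xs_eq_iff: "i < k ==> j < k ==> xs ! i = xs ! j \<longleftrightarrow> i = j"
 using d k nth_eq_iff_index_eq by blast

lemma succ_less: "Suc i mod k < k" using k3 by simp

lemma succ_inj: "i < k ==> j < k ==> Suc i mod k = Suc j mod k ==> i = j"
 using k3 by (auto simp: mod_Suc split: if_splits)

lemma succ_succ_neq: "i < k ==> Suc (Suc i mod k) mod k \<noteq> i"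
 using k3 by (auto simp: mod_Suc split: if_splits)

lemma succ_neq: "i < k ==> Suc i mod k \<noteq> i"
 using k3 by (auto simp: mod_Suc split: if_splits)

lemma cyc_edge_inj: "inj_on (\<lambda>i. edge (xs ! i) (xs ! (Suc i mod k))) {..<k}"
proof (rule inj_onI)
 fix i j assume ij: "i \<in> {..<k}" "j \<in> {..<k}" and e: "edge (xs ! i) (xs ! (Suc i mod k)) = edge (xs ! j) (xs ! (Suc j mod k))"
 then have "i = j \<or> (i = Suc j mod k \<and> Suc i mod k = j)"
  using succ_less by (auto simp: edge_eq_iff doubleton_eq_iff xs_eq_iff)
 then show "i = j" using succ_succ_neq[of j] ij by auto
qed

lemma cyc_altdef: "cyc xs = (\<lambda>i. edge (xs ! i) (xs ! (Suc i mod k))) ` {..<k}"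
 by (simp add: cyc_def k)

lemma card_cyc: "card (cyc xs) = k"
 unfolding cyc_altdef using card_image[OF cyc_edge_inj] by simp

lemma verts_cyc: "verts (cyc xs) = set xs"
proof
 show "verts (cyc xs) \<subseteq> set xs"
  using succ_less by (auto simp: verts_def cyc_altdef k)
 show "set xs \<subseteq> verts (cyc xs)"
  by (force simp: verts_def cyc_altdef k in_set_conv_nth)
qed

lemma cyc_neighbours: "i < k ==> edge (xs ! (Suc i mod k)) y \<in> cyc xs \<longleftrightarrow>
  y = xs ! i \<or> y = xs ! (Suc (Suc i mod k) mod k)"
proof
 assume i: "i < k" and "edge (xs ! (Suc i mod k)) y \<in> cyc xs"
 then obtain j where j: "j < k" and "edge (xs ! (Suc i mod k)) y = edge (xs ! j) (xs ! (Suc j mod k))"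
  by (auto simp: cyc_altdef)
 then have "(xs ! (Suc i mod k) = xs ! j \<and> y = xs ! (Suc j mod k)) \<or> (xs ! (Suc i mod k) = xs ! (Suc j mod k) \<and> y = xs ! j)"
  by (auto simp: edge_eq_iff doubleton_eq_iff)
 then show "y = xs ! i \<or> y = xs ! (Suc (Suc i mod k) mod k)"
  using xs_eq_iff[OF succ_less j, of i] xs_eq_iff[OF succ_less succ_less, of i j] succ_inj[OF i j] by auto
next
 assume i: "i < k" and "y = xs ! i \<or> y = xs ! (Suc (Suc i mod k) mod k)"
 then show "edge (xs ! (Suc i mod k)) y \<in> cyc xs"
  using succ_less[of i] by (auto simp: cyc_altdef edge_commute[of _ "xs ! i"])
qed

lemma cyc_card_ends: "l \<in> cyc xs ==> card (ends l) = 2"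
 using succ_less succ_neq[THEN not_sym] by (auto simp: cyc_altdef card_insert_if xs_eq_iff)

lemma cyc_degree: "card {l \<in> cyc xs. x \<in> ends l} \<le> 2"
proof (cases "x \<in> set xs")
 case True
 then obtain j where j: "j < k" "x = xs ! j" by (auto simp: in_set_conv_nth k)
 obtain i where i: "i < k" "j = Suc i mod k"
 proof (cases j)
  case 0 then show ?thesis using that[of "k - 1"] k3 by simp
 next
  case (Suc i) then show ?thesis using that[of i] j by simp
 qed
 have "{l \<in> cyc xs. x \<in> ends l} \<subseteq> {edge x (xs ! i), edge x (xs ! (Suc j mod k))}"
 proof
  fix l assume l: "l \<in> {l \<in> cyc xs. x \<in> ends l}"
  then obtain a b where ab: "l = edge a b" by (auto simp: cyc_altdef)
  then have "x = a \<or> x = b" using l by auto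
  then have "\<exists>y. l = edge x y" using ab edge_commute by blast
  then obtain y where "l = edge x y" ..
  then show "l \<in> {edge x (xs ! i), edge x (xs ! (Suc j mod k))}"
   using l cyc_neighbours[OF i(1), of y] j i by auto
 qed
 then have "card {l \<in> cyc xs. x \<in> ends l} \<le> card {edge x (xs ! i), edge x (xs ! (Suc j mod k))}"
  by (rule card_mono[rotated]) simp
 also have "... \<le> 2" by (simp add: card_insert_le_m1)
 finally show ?thesis .
next
 case False
 then have "{l \<in> cyc xs. x \<in> ends l} = {}" using verts_cyc by (auto simp: verts_def)
 then show ?thesis by (simp only: card.empty)
qed

text \<open>
 A cycle has no proper part that is closed under adjacency, which is how its connectedness is used.
\<close>

lemma cyc_connected:
 assumes X: "X \<subseteq> verts (cyc xs)" "X \<noteq> {}" and closed: "\<And>l. l \<in> cyc xs ==> ends l \<inter> X \<noteq> {} ==> ends l \<subseteq> X"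
 shows "X = verts (cyc xs)"
proof -
 obtain x where x: "x \<in> X" "x \<in> set xs" using X verts_cyc by blast
 then obtain j where j: "j < k" "xs ! j \<in> X" unfolding in_set_conv_nth k by blast
 have "xs ! ((j + n) mod k) \<in> X" for n
 proof (induction n)
  case 0 then show ?case using j by simp
 next
  case (Suc n)
  let ?i = "(j + n) mod k"
  have "edge (xs ! ?i) (xs ! (Suc ?i mod k)) \<in> cyc xs" using k3 by (auto simp: cyc_altdef)
  then have "xs ! (Suc ?i mod k) \<in> X" using closed[of "edge (xs ! ?i) (xs ! (Suc ?i mod k))"] Suc by auto
  then show ?case by (simp add: mod_Suc_eq)
 qed
 moreover have "\<exists>n. i = (j + n) mod k" if "i < k" for i
  by (rule exI[of _ "k - j + i"]) (use that j in simp)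
 ultimately have "set xs \<subseteq> X" by (force simp: in_set_conv_nth k)
 then show ?thesis using X verts_cyc by auto
qed

text \<open>
 Every vertex is met twice, so the signs of a spike cancel along a cycle.  Hence the cycle sums do not
 depend on the spike that is planted.
\<close>

lemma cyc_even:
 fixes s :: "nat => real"
 assumes s: "\<And>x. x \<in> set xs ==> (s x)\<^sup>2 = 1"
 shows "(\<Prod>l\<in>cyc xs. s (fst (prod_decode l)) * s (snd (prod_decode l))) = 1"
proof -
 have "(\<Prod>l\<in>cyc xs. s (fst (prod_decode l)) * s (snd (prod_decode l)))
   = (\<Prod>i<k. s (xs ! i) * s (xs ! (Suc i mod k)))"
  unfolding cyc_altdef prod.reindex[OF cyc_edge_inj]
  by (rule prod.cong) (auto simp: edge_def min_def max_def)
 also have "... = (\<Prod>i<k. s (xs ! i)) * (\<Prod>i<k. s (xs ! (Suc i mod k)))" by (rule prod.distrib)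
 also have "(\<Prod>i<k. s (xs ! (Suc i mod k))) = (\<Prod>i<k. s (xs ! i))"
 proof (rule prod.reindex_bij_betw)
  have "inj_on (\<lambda>i. Suc i mod k) {..<k}" using succ_inj by (auto intro!: inj_onI)
  moreover have "(\<lambda>i. Suc i mod k) ` {..<k} \<subseteq> {..<k}" using succ_less by auto
  ultimately show "bij_betw (\<lambda>i. Suc i mod k) {..<k} {..<k}"
   by (simp add: bij_betw_def endo_inj_surj)
 qed
 also have "(\<Prod>i<k. s (xs ! i)) * (\<Prod>i<k. s (xs ! i)) = (\<Prod>i<k. (s (xs ! i))\<^sup>2)"
  by (simp add: prod.distrib[symmetric] power2_eq_square)
 also have "... = 1" using s by (intro prod.neutral) (auto simp: k)
 finally show ?thesis .
qed

end

lemma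
 assumes "is_cycle c"
 shows cycle_finite: "finite c"
  and cycle_card: "card (verts c) = card c"
  and cycle_card_ge: "3 \<le> card c"
  and cycle_card_ends: "l \<in> c ==> card (ends l) = 2"
  and cycle_degree: "card {l \<in> c. x \<in> ends l} \<le> 2"
  and cycle_connected: "X \<subseteq> verts c ==> X \<noteq> {} ==>
     (\<And>l. l \<in> c ==> ends l \<inter> X \<noteq> {} ==> ends l \<subseteq> X) ==> X = verts c"
  and cycle_even: "(\<And>x. x \<in> verts c ==> (s x)\<^sup>2 = (1::real)) ==>
     (\<Prod>l\<in>c. s (fst (prod_decode l)) * s (snd (prod_decode l))) = 1"
proof -
 obtain xs where xs: "distinct xs" "3 \<le> length xs" "c = cyc xs" using assms by (auto simp: is_cycle_def)
 note [simp] = xs(3)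
 show "finite c" by (simp add: cyc_def)
 show "card (verts c) = card c" using verts_cyc[OF xs(1) refl xs(2)] card_cyc[OF xs(1) refl xs(2)] distinct_card[OF xs(1)] by simp
 show "3 \<le> card c" using card_cyc[OF xs(1) refl xs(2)] xs(2) by simp
 show "l \<in> c ==> card (ends l) = 2" using cyc_card_ends[OF xs(1) refl xs(2)] by simp
 show "card {l \<in> c. x \<in> ends l} \<le> 2" using cyc_degree[OF xs(1) refl xs(2)] by simp
 show "X \<subseteq> verts c ==> X \<noteq> {} ==>
     (\<And>l. l \<in> c ==> ends l \<inter> X \<noteq> {} ==> ends l \<subseteq> X) ==> X = verts c"
  using cyc_connected[OF xs(1) refl xs(2), of X] by simp
 show "(\<And>x. x \<in> verts c ==> (s x)\<^sup>2 = (1::real)) ==>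
     (\<Prod>l\<in>c. s (fst (prod_decode l)) * s (snd (prod_decode l))) = 1"
  using cyc_even[OF xs(1) refl xs(2), of s] verts_cyc[OF xs(1) refl xs(2)] by simp
qed

subsection \<open>Counting cycles\<close>

lemma finite_canonical: "finite {xs. canonical xs \<and> length xs \<le> m \<and> set xs \<subseteq> {..<N}}"
 by (rule finite_subset[OF _ finite_lists_length_le[of "{..<N}" m]]) auto

lemma finite_cycles [simp]: "finite (cycles N m)"
 unfolding cycles_def by (rule finite_imageI[OF finite_canonical])

lemma cycles_cycle: "c \<in> cycles N m ==> is_cycle c"
 by (auto simp: cycles_def is_cycle_def canonical_def)

lemma cycles_card_le: "c \<in> cycles N m ==> card c \<le> m"
 by (auto simp: cycles_def canonical_def card_cyc)

lemma cycles_verts: "c \<in> cycles N m ==> verts c \<subseteq> {..<N}"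
 by (auto simp: cycles_def canonical_def verts_cyc)

text \<open>
 The largest vertex and its two neighbours determine where the list starts and how it proceeds.
\<close>

lemma cyc_inj_canonical: "inj_on cyc {xs. canonical xs \<and> length xs \<le> m \<and> set xs \<subseteq> {..<N}}"
proof (rule inj_onI)
 fix xs ys
 assume "xs \<in> {xs. canonical xs \<and> length xs \<le> m \<and> set xs \<subseteq> {..<N}}"
   and "ys \<in> {xs. canonical xs \<and> length xs \<le> m \<and> set xs \<subseteq> {..<N}}" and eq: "cyc xs = cyc ys"
 then have c: "canonical xs" "canonical ys" by auto
 then have dx: "distinct xs" "3 \<le> length xs" and dy: "distinct ys" "3 \<le> length ys" by (auto simp: canonical_def)
 define k where "k = length xs"
 have ky: "k = length ys" using card_cyc[OF dx(1) refl dx(2)] card_cyc[OF dy(1) refl dy(2)] eq by (simp add: k_def)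
 have k3: "3 \<le> k" using dx by (simp add: k_def)
 have set_eq: "set xs = set ys" using verts_cyc[OF dx(1) refl dx(2)] verts_cyc[OF dy(1) refl dy(2)] eq by simp
 have nb: "(y = xs ! i \<or> y = xs ! (Suc (Suc i mod k) mod k)) \<longleftrightarrow> (y = ys ! i \<or> y = ys ! (Suc (Suc i mod k) mod k))"
  if "i < k" "xs ! (Suc i mod k) = ys ! (Suc i mod k)" for i y
  using cyc_neighbours[OF dx(1) k_def k3 that(1), of y] cyc_neighbours[OF dy(1) ky k3 that(1), of y] eq that by simp
 have mx: "y \<le> xs ! 0" "y \<le> ys ! 0" if "y \<in> set xs" for y
  using that c set_eq by (auto simp: canonical_def)
 have x0: "xs ! 0 = ys ! 0"
  using mx(1)[of "ys ! 0"] mx(2)[of "xs ! 0"] k3 set_eq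
  by (metis antisym k_def ky nth_mem order_less_le_trans zero_less_numeral)
 have x1: "xs ! 1 = ys ! 1"
 proof -
  have "Suc (k - 1) mod k = 0" "Suc 0 mod k = 1" "k - 1 < k" using k3 by auto
  then have "(y = xs ! (k - 1) \<or> y = xs ! 1) \<longleftrightarrow> (y = ys ! (k - 1) \<or> y = ys ! 1)" for y
   using nb[of "k - 1" y] x0 by simp
  moreover have "xs ! (k - 1) < xs ! 1" "ys ! (k - 1) < ys ! 1"
   using c k3 by (auto simp: canonical_def last_conv_nth k_def ky[unfolded k_def, symmetric])
    (metis One_nat_def c(2) canonical_def k_def ky last_conv_nth list.size(3) not_numeral_le_zero)+
  ultimately show ?thesis by (metis order_less_asym)
 qed
 have "n < k \<longrightarrow> xs ! n = ys ! n" for n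
 proof (induction n rule: less_induct)
  case (less n)
  consider "n = 0" | "n = 1" | i where "n = Suc (Suc i)"
   by (metis One_nat_def not0_implies_Suc)
  then show ?case
  proof cases
   case (3 i)
   show ?thesis
   proof
    assume n: "n < k"
    then have "xs ! i = ys ! i" "xs ! Suc i = ys ! Suc i" using less[of i] less[of "Suc i"] 3 by auto
    moreover have "xs ! i \<noteq> xs ! n" "ys ! i \<noteq> ys ! n"
     using n 3 dx dy k_def ky by (auto simp: nth_eq_iff_index_eq)
    ultimately show "xs ! n = ys ! n"
     using nb[of i "xs ! n"] n 3 by simp
   qed
  qed (use x0 x1 in auto)
 qed
 then show "xs = ys" using k_def ky by (intro nth_equalityI) auto
qed

definition distinct_lists :: "nat => nat => nat list set" where
 "distinct_lists n j = {ys. length ys = j \<and> distinct ys \<and> set ys \<subseteq> {..<n}}"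

lemma finite_distinct_lists [simp]: "finite (distinct_lists n j)"
 by (rule finite_subset[OF _ finite_lists_length_eq[of "{..<n}" j]]) (auto simp: distinct_lists_def)

lemma card_distinct_lists: "card (distinct_lists n j) = fact j * (n choose j)"
proof (cases "j \<le> n")
 case True
 have "card (distinct_lists n j) = \<Prod>{n - j + 1 .. n}"
  unfolding distinct_lists_def using card_lists_distinct_length_eq[of "{..<n}" j] True by simp
 also have "... = fact n div fact (n - j)" by (simp add: fact_div_fact True)
 also have "... = fact j * (n choose j)"
  using binomial_fact_lemma[OF True] by (metis fact_nonzero mult.assoc mult.commute nonzero_mult_div_cancel_left)
 finally show ?thesis .
next
 case False
 have "distinct_lists n j = {}"
 proof (safe, simp)
  fix ys assume "ys \<in> distinct_lists n j"
  then have "card (set ys) = j" "set ys \<subseteq> {..<n}"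
   by (auto simp: distinct_lists_def distinct_card)
  with False show False using card_mono[of "{..<n}" "set ys"] by simp
 qed
 then show ?thesis using False by simp
qed

text \<open>Reversal pairs the lists that end low with those that end high.\<close>

lemma card_distinct_lists_ascending_ends:
 assumes j: "2 \<le> j"
 shows "2 * card {ys \<in> distinct_lists n j. last ys < hd ys} = card (distinct_lists n j)"
proof -
 let ?A = "{ys \<in> distinct_lists n j. last ys < hd ys}" and ?B = "{ys \<in> distinct_lists n j. hd ys < last ys}"
 have "card ?A = card ?B"
  by (rule bij_betw_same_card[of rev], rule bij_betw_byWitness[where f'=rev])
    (auto simp: distinct_lists_def hd_rev last_rev)
 moreover have "distinct_lists n j = ?A \<union> ?B"
 proof -
  have "hd ys \<noteq> last ys" if "ys \<in> distinct_lists n j" for ys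
  proof -
   have "ys \<noteq> []" "distinct ys" "length ys \<ge> 2" using that j by (auto simp: distinct_lists_def)
   then show ?thesis by (simp add: hd_conv_nth last_conv_nth nth_eq_iff_index_eq)
  qed
  then show ?thesis by (auto simp: neq_iff)
 qed
 moreover have "card (?A \<union> ?B) = card ?A + card ?B"
  by (rule card_Un_disjoint) auto
 ultimately show ?thesis by (simp only: mult_2)
qed

lemma card_canonical:
 assumes k: "3 \<le> k"
 shows "2 * card {xs. canonical xs \<and> length xs = k \<and> set xs \<subseteq> {..<N}} = fact (k - 1) * (N choose k)"
proof -
 let ?L = "\<lambda>n. {ys \<in> distinct_lists n (k - 1). last ys < hd ys}"
 have "{xs. canonical xs \<and> length xs = k \<and> set xs \<subseteq> {..<N}} = (\<Union>n<N. (\<lambda>ys. n # ys) ` ?L n)"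
 proof (intro equalityI subsetI)
  fix xs assume xs: "xs \<in> {xs. canonical xs \<and> length xs = k \<and> set xs \<subseteq> {..<N}}"
  then obtain n ys where [simp]: "xs = n # ys" by (cases xs) (auto simp: canonical_def)
  have "ys \<noteq> []" using xs k by auto
  then have "ys \<in> ?L n" "n < N" using xs k
   by (auto simp: canonical_def distinct_lists_def hd_conv_nth less_le)
  then show "xs \<in> (\<Union>n<N. (\<lambda>ys. n # ys) ` ?L n)" by auto
 next
  fix xs assume "xs \<in> (\<Union>n<N. (\<lambda>ys. n # ys) ` ?L n)"
  then obtain n ys where n: "n < N" "xs = n # ys" "ys \<in> ?L n" by auto
  then have "ys \<noteq> []" using k by (auto simp: distinct_lists_def)
  then show "xs \<in> {xs. canonical xs \<and> length xs = k \<and> set xs \<subseteq> {..<N}}"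
   using n k by (auto simp: canonical_def distinct_lists_def hd_conv_nth)
 qed
 then have "card {xs. canonical xs \<and> length xs = k \<and> set xs \<subseteq> {..<N}} = (\<Sum>n<N. card ((\<lambda>ys. n # ys) ` ?L n))"
  by (simp only:) (rule card_UN_disjoint, auto)
 also have "... = (\<Sum>n<N. card (?L n))" by (intro sum.cong refl card_image) (auto intro: inj_onI)
 finally have "2 * card {xs. canonical xs \<and> length xs = k \<and> set xs \<subseteq> {..<N}} = (\<Sum>n<N. fact (k - 1) * (n choose (k - 1)))"
  using card_distinct_lists_ascending_ends[of "k - 1"] k by (simp add: sum_distrib_left card_distinct_lists)
 also have "... = fact (k - 1) * (\<Sum>n<N. n choose (k - 1))" by (simp add: sum_distrib_left)
 also have "(\<Sum>n<N. n choose (k - 1)) = N choose k"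
 proof (cases N)
  case (Suc M) then show ?thesis using sum_choose_upper[of "k - 1" M] k by (simp add: lessThan_Suc_atMost)
 qed (use k in simp)
 finally show ?thesis .
qed

lemma sum_cycles:
 fixes g :: "nat => real"
 shows "(\<Sum>c\<in>cycles N m. g (card c)) = (\<Sum>k=3..m. fact (k - 1) * real (N choose k) / 2 * g k)"
proof -
 let ?C = "\<lambda>k. {xs. canonical xs \<and> length xs = k \<and> set xs \<subseteq> {..<N}}"
 have fin: "finite (?C k)" for k
  by (rule finite_subset[OF _ finite_canonical[of k N]]) auto
 have "(\<Sum>c\<in>cycles N m. g (card c)) = (\<Sum>xs\<in>{xs. canonical xs \<and> length xs \<le> m \<and> set xs \<subseteq> {..<N}}. g (card (cyc xs)))"
  unfolding cycles_def by (subst sum.reindex[OF cyc_inj_canonical]) simp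
 also have "{xs. canonical xs \<and> length xs \<le> m \<and> set xs \<subseteq> {..<N}} = (\<Union>k\<in>{3..m}. ?C k)"
  by (auto simp: canonical_def)
 also have "(\<Sum>xs\<in>(\<Union>k\<in>{3..m}. ?C k). g (card (cyc xs))) = (\<Sum>k=3..m. \<Sum>xs\<in>?C k. g (card (cyc xs)))"
  by (rule sum.UNION_disjoint) (use fin in auto)
 also have "... = (\<Sum>k=3..m. fact (k - 1) * real (N choose k) / 2 * g k)"
 proof (rule sum.cong[OF refl])
  fix k assume k: "k \<in> {3..m}"
  have "(\<Sum>xs\<in>?C k. g (card (cyc xs))) = (\<Sum>xs\<in>?C k. g k)"
   by (rule sum.cong) (auto simp: canonical_def card_cyc)
  also have "... = real (card (?C k)) * g k" by simp
  also have "real (card (?C k)) = fact (k - 1) * real (N choose k) / 2"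
  proof -
   have "real (2 * card (?C k)) = real (fact (k - 1) * (N choose k))"
    by (subst card_canonical) (use k in auto)
   then show ?thesis by simp
  qed
  finally show "(\<Sum>xs\<in>?C k. g (card (cyc xs))) = fact (k - 1) * real (N choose k) / 2 * g k" .
 qed
 finally show ?thesis .
qed

lemma choose_over_power_limit: "(\<lambda>N. real (N choose k) / real N ^ k) \<longlonglongrightarrow> 1 / fact k"
proof -
 have "(\<lambda>N. (\<Prod>i<k. 1 - real i / real N) / fact k) \<longlonglongrightarrow> (\<Prod>i<k. 1 - 0) / fact k"
  by (intro tendsto_divide tendsto_prod tendsto_diff tendsto_const lim_const_over_n) auto
 moreover have "\<forall>\<^sub>F N in sequentially. (\<Prod>i<k. 1 - real i / real N) / fact k = real (N choose k) / real N ^ k"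
  using eventually_ge_at_top[of "max 1 k"]
 proof eventually_elim
  case (elim N)
  have "real (N choose k) = (\<Prod>i<k. real (N - i)) / fact k"
   using binomial_altdef_of_nat[of k N, where 'a=real] elim
   by (simp add: prod_dividef atLeast0LessThan fact_prod_rev)
  also have "(\<Prod>i<k. real (N - i)) = (\<Prod>i<k. real N * (1 - real i / real N))"
   by (rule prod.cong) (use elim in \<open>auto simp: field_simps of_nat_diff\<close>)
  finally show ?case using elim by (simp add: prod.distrib)
 qed
 ultimately show ?thesis by (auto elim: Lim_transform_eventually)
qed

text \<open>
 About \<open>N\<^sup>k / (2 k)\<close> cycles have length \<open>k\<close>: the denominator counts the starting points and the directions.
\<close>

lemma sum_cycles_limit:
 assumes \<tau>: "(\<lambda>N. real N * \<tau> N) \<longlonglongrightarrow> \<beta>"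
 shows "(\<lambda>N. \<Sum>c\<in>cycles N m. \<tau> N ^ card c) \<longlonglongrightarrow> (\<Sum>k=3..m. \<beta> ^ k / (2 * real k))"
proof -
 have "(\<lambda>N. \<Sum>k=3..m. fact (k - 1) / 2 * (real (N choose k) / real N ^ k) * (real N * \<tau> N) ^ k)
   \<longlonglongrightarrow> (\<Sum>k=3..m. fact (k - 1) / 2 * (1 / fact k) * \<beta> ^ k)"
  by (intro tendsto_sum tendsto_mult tendsto_const tendsto_power \<tau> choose_over_power_limit)
 also have "(\<Sum>k=3..m. fact (k - 1) / 2 * (1 / fact k) * \<beta> ^ k) = (\<Sum>k=3..m. \<beta> ^ k / (2 * real k))"
  by (rule sum.cong) (auto simp: fact_reduce)
 finally show ?thesis
 proof (rule Lim_transform_eventually)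
  show "\<forall>\<^sub>F N in sequentially. (\<Sum>k=3..m. fact (k - 1) / 2 * (real (N choose k) / real N ^ k) * (real N * \<tau> N) ^ k)
    = (\<Sum>c\<in>cycles N m. \<tau> N ^ card c)"
   using eventually_gt_at_top[of 0]
  proof eventually_elim
   case (elim N)
   then show ?case by (simp add: sum_cycles power_mult_distrib field_simps)
  qed
 qed
qed

subsection \<open>Families of cycles that cover every edge twice\<close>

text \<open>
 There are at most \<open>N\<^sup>k\<close> vertex sets of size \<open>k\<close>, which the weight \<open>(1 / N)\<^sup>k\<close> compensates, and a vertex set of
 bounded size carries a bounded number of configurations.
\<close>

lemma count_by_vertices:
 fixes ver :: "'q => nat set"
 assumes fin: "finite Q" and ver: "\<And>x. x \<in> Q ==> ver x \<subseteq> {..<N} \<and> card (ver x) \<le> r"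
  and fib: "\<And>W. finite W ==> card W \<le> r ==> card {x \<in> Q. ver x = W} \<le> K" and N: "1 \<le> N"
 shows "(\<Sum>x\<in>Q. (1 / real N) ^ card (ver x)) \<le> (real r + 1) * real K"
proof -
 define P where "P v = {W. W \<subseteq> {..<N} \<and> card W = v}" for v
 have finP: "finite (P v)" for v unfolding P_def by (rule finite_subset[of _ "Pow {..<N}"]) auto
 define PP where "PP = (\<Union>v\<le>r. P v)"
 have finPP: "finite PP" unfolding PP_def using finP by auto
 have "(\<Sum>x\<in>Q. (1 / real N) ^ card (ver x)) = (\<Sum>W\<in>PP. \<Sum>x\<in>{x\<in>Q. ver x = W}. (1 / real N) ^ card (ver x))"
  by (rule sum.group[symmetric, OF fin finPP]) (use ver in \<open>auto simp: PP_def P_def\<close>)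
 also have "... \<le> (\<Sum>W\<in>PP. real K * (1 / real N) ^ card W)"
 proof (rule sum_mono)
  fix W assume W: "W \<in> PP"
  then have "card {x\<in>Q. ver x = W} \<le> K"
   by (intro fib) (auto simp: PP_def P_def intro: finite_subset)
  then show "(\<Sum>x\<in>{x\<in>Q. ver x = W}. (1 / real N) ^ card (ver x)) \<le> real K * (1 / real N) ^ card W"
   by (auto intro!: mult_right_mono)
 qed
 also have "... = (\<Sum>v\<le>r. \<Sum>W\<in>P v. real K * (1 / real N) ^ card W)"
  unfolding PP_def by (rule sum.UNION_disjoint) (use finP in \<open>auto simp: P_def\<close>)
 also have "... = (\<Sum>v\<le>r. real (N choose v) * (real K * (1 / real N) ^ v))"
 proof (rule sum.cong[OF refl])
  fix v
  have "card (P v) = N choose v" unfolding P_def using n_subsets[of "{..<N}" v] by simp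
  moreover have "(\<Sum>W\<in>P v. real K * (1 / real N) ^ card W) = (\<Sum>W\<in>P v. real K * (1 / real N) ^ v)"
   by (rule sum.cong) (auto simp: P_def)
  ultimately show "(\<Sum>W\<in>P v. real K * (1 / real N) ^ card W) = real (N choose v) * (real K * (1 / real N) ^ v)" by simp
 qed
 also have "... \<le> (\<Sum>v\<le>r. real K)"
 proof (rule sum_mono)
  fix v
  have "N choose v \<le> N ^ v"
   by (cases "v \<le> N") (auto simp: binomial_le_pow binomial_eq_0)
  then have "real (N choose v) \<le> real N ^ v" by (metis of_nat_le_iff of_nat_power)
  then have "real (N choose v) * (1 / real N) ^ v \<le> real N ^ v * (1 / real N) ^ v"
   by (rule mult_right_mono) simp
  also have "... = 1" using N by (simp add: power_mult_distrib[symmetric])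
  finally have "real (N choose v) * (1 / real N) ^ v \<le> 1" .
  from mult_left_mono[OF this, of "real K"] show "real (N choose v) * (real K * (1 / real N) ^ v) \<le> real K"
   by (simp add: mult_ac)
 qed
 finally show ?thesis by (simp add: algebra_simps)
qed

lemma edges_withinI:
 assumes "ends l \<subseteq> W"
 shows "l \<in> prod_encode ` (W \<times> W)"
proof -
 have "l = prod_encode (fst (prod_decode l), snd (prod_decode l))" by simp
 then show ?thesis using assms unfolding ends_def by blast
qed

lemma card_edge_sets_within:
 assumes "finite W" "card W \<le> r"
 shows "finite {c. verts c \<subseteq> W}" "card {c. verts c \<subseteq> W} \<le> 2 ^ (r * r)"
proof -
 have sub: "{c. verts c \<subseteq> W} \<subseteq> Pow (prod_encode ` (W \<times> W))"
  using edges_withinI by (auto simp: verts_def UN_subset_iff)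
 have fin: "finite (prod_encode ` (W \<times> W))" using assms by simp
 then show "finite {c. verts c \<subseteq> W}" using sub by (meson finite_Pow_iff finite_subset)
 have "card (prod_encode ` (W \<times> W)) \<le> r * r"
  using card_image_le[of "W \<times> W" prod_encode] assms by (simp add: card_cartesian_product mult_le_mono order_trans)
 then have "card (Pow (prod_encode ` (W \<times> W))) \<le> 2 ^ (r * r)" using fin by (simp add: card_Pow)
 then show "card {c. verts c \<subseteq> W} \<le> 2 ^ (r * r)"
  using card_mono[OF _ sub] fin by (meson finite_Pow_iff order_trans)
qed

lemma card_verts_Un_le: "finite a ==> finite b ==> card (verts (a \<union> b)) \<le> card (verts a) + card (verts b)"
 unfolding verts_Un by (rule card_Un_le)

lemma sum_pairs_of_cycles:
 assumes N: "1 \<le> N"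
 shows "(\<Sum>(a, b)\<in>cycles N m \<times> cycles N m. (1 / real N) ^ card (verts (a \<union> b)))
  \<le> (real (2 * m) + 1) * real (2 ^ (2 * m * (2 * m)) * 2 ^ (2 * m * (2 * m)))"
proof -
 have "(\<Sum>x\<in>cycles N m \<times> cycles N m. (1 / real N) ^ card (verts (fst x \<union> snd x)))
  \<le> (real (2 * m) + 1) * real (2 ^ (2 * m * (2 * m)) * 2 ^ (2 * m * (2 * m)))"
 proof (rule count_by_vertices[OF _ _ _ N])
  fix x assume x: "x \<in> cycles N m \<times> cycles N m"
  then have c: "is_cycle (fst x)" "is_cycle (snd x)" "card (fst x) \<le> m" "card (snd x) \<le> m"
   by (auto intro: cycles_cycle cycles_card_le)
  have "verts (fst x) \<subseteq> {..<N}" "verts (snd x) \<subseteq> {..<N}"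
   using cycles_verts[of "fst x" N m] cycles_verts[of "snd x" N m] x by (auto simp: mem_Times_iff)
  then show "verts (fst x \<union> snd x) \<subseteq> {..<N} \<and> card (verts (fst x \<union> snd x)) \<le> 2 * m"
   using card_verts_Un_le[of "fst x" "snd x"] c cycle_card cycle_finite
   by (auto simp: verts_Un)
 next
  fix W :: "nat set" assume W: "finite W" "card W \<le> 2 * m"
  have "{x \<in> cycles N m \<times> cycles N m. verts (fst x \<union> snd x) = W} \<subseteq> {c. verts c \<subseteq> W} \<times> {c. verts c \<subseteq> W}"
   by (auto simp: verts_Un)
  then have "card {x \<in> cycles N m \<times> cycles N m. verts (fst x \<union> snd x) = W} \<le> card ({c. verts c \<subseteq> W} \<times> {c. verts c \<subseteq> W})"
   by (rule card_mono[rotated]) (simp add: card_edge_sets_within(1)[OF W])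
  also have "... \<le> 2 ^ (2 * m * (2 * m)) * 2 ^ (2 * m * (2 * m))"
   unfolding card_cartesian_product by (intro mult_le_mono card_edge_sets_within(2)[OF W])
  finally show "card {x \<in> cycles N m \<times> cycles N m. verts (fst x \<union> snd x) = W} \<le> 2 ^ (2 * m * (2 * m)) * 2 ^ (2 * m * (2 * m))" .
 qed simp
 then show ?thesis by (simp add: case_prod_beta)
qed

lemma sum_quadruples_of_cycles:
 assumes N: "1 \<le> N"
 shows "(\<Sum>((a, a'), (b, b'))\<in>(cycles N m \<times> cycles N m) \<times> (cycles N m \<times> cycles N m).
   (1 / real N) ^ card (verts (a \<union> a' \<union> (b \<union> b'))))
  \<le> (real (4 * m) + 1) * real ((2 ^ (4 * m * (4 * m))) ^ 4)"
proof -
 let ?Q = "(cycles N m \<times> cycles N m) \<times> (cycles N m \<times> cycles N m)"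
 let ?u = "\<lambda>x. fst (fst x) \<union> snd (fst x) \<union> (fst (snd x) \<union> snd (snd x))"
 have "(\<Sum>x\<in>?Q. (1 / real N) ^ card (verts (?u x))) \<le> (real (4 * m) + 1) * real ((2 ^ (4 * m * (4 * m))) ^ 4)"
 proof (rule count_by_vertices[OF _ _ _ N])
  fix x assume x: "x \<in> ?Q"
  obtain a a' b b' where [simp]: "x = ((a, a'), (b, b'))" by (metis prod.collapse)
  have c: "is_cycle a" "is_cycle a'" "is_cycle b" "is_cycle b'" and cm: "card a \<le> m" "card a' \<le> m" "card b \<le> m" "card b' \<le> m"
   using x by (auto intro: cycles_cycle cycles_card_le)
  have "card (verts (?u x)) \<le> card (verts a) + card (verts a') + (card (verts b) + card (verts b'))"
   using card_verts_Un_le[of "a \<union> a'" "b \<union> b'"] card_verts_Un_le[of a a'] card_verts_Un_le[of b b'] c cycle_finite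
   by fastforce
  then show "verts (?u x) \<subseteq> {..<N} \<and> card (verts (?u x)) \<le> 4 * m"
   using x cycles_verts[of _ N m] c cm cycle_card by (auto simp: verts_Un)
 next
  fix W :: "nat set" assume W: "finite W" "card W \<le> 4 * m"
  let ?S = "{c. verts c \<subseteq> W}"
  have "{x \<in> ?Q. verts (?u x) = W} \<subseteq> (?S \<times> ?S) \<times> (?S \<times> ?S)"
   by (auto simp: verts_Un)
  then have "card {x \<in> ?Q. verts (?u x) = W} \<le> card ((?S \<times> ?S) \<times> (?S \<times> ?S))"
   by (rule card_mono[rotated]) (simp add: card_edge_sets_within(1)[OF W])
  also have "... = card ?S ^ 4" by (simp add: card_cartesian_product eval_nat_numeral)
  also have "... \<le> (2 ^ (4 * m * (4 * m))) ^ 4"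
   by (intro power_mono card_edge_sets_within(2)[OF W]) simp
  finally show "card {x \<in> ?Q. verts (?u x) = W} \<le> (2 ^ (4 * m * (4 * m))) ^ 4" .
 qed simp
 then show ?thesis by (simp add: case_prod_beta)
qed

text \<open>
 A proper part of a cycle is a union of paths, and a path has one vertex more than it has edges.
\<close>

lemma proper_part_of_cycle:
 assumes c: "is_cycle c" and A: "A \<subseteq> c" "A \<noteq> {}" "A \<noteq> c"
 shows "card A + 1 \<le> card (verts A)"
proof (rule ccontr)
 assume "\<not> ?thesis"
 then have le: "card (verts A) \<le> card A" by simp
 have fc: "finite c" by (rule cycle_finite[OF c])
 have fA: "finite A" using A fc finite_subset by blast
 define deg where "deg x = card {l \<in> A. x \<in> ends l}" for x
 have deg2: "deg x \<le> 2" for x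
 proof -
  have "deg x \<le> card {l \<in> c. x \<in> ends l}" unfolding deg_def using A fc by (intro card_mono) auto
  then show ?thesis using cycle_degree[OF c, of x] by simp
 qed
 have "(\<Sum>x\<in>verts A. deg x) = (\<Sum>x\<in>verts A. \<Sum>l\<in>A. of_bool (x \<in> ends l))"
  by (rule sum.cong) (simp_all add: deg_def fA Int_def)
 also have "... = (\<Sum>l\<in>A. \<Sum>x\<in>verts A. of_bool (x \<in> ends l))" by (rule sum.swap)
 also have "... = (\<Sum>l\<in>A. 2)"
 proof (rule sum.cong[OF refl])
  fix l assume l: "l \<in> A"
  have "(\<Sum>x\<in>verts A. of_bool (x \<in> ends l)) = card (verts A \<inter> {x. x \<in> ends l})" using fA by simp
  also have "verts A \<inter> {x. x \<in> ends l} = ends l" using l by (auto simp: verts_def)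
  finally show "(\<Sum>x\<in>verts A. of_bool (x \<in> ends l)) = (2::nat)" using cycle_card_ends[OF c] l A by auto
 qed
 finally have sum_deg: "(\<Sum>x\<in>verts A. deg x) = 2 * card A" by simp
 have deg_eq: "deg x = 2" if x: "x \<in> verts A" for x
 proof (rule ccontr)
  assume "deg x \<noteq> 2"
  then have "deg x < 2" using deg2[of x] by simp
  then have "(\<Sum>x\<in>verts A. deg x) < (\<Sum>x\<in>verts A. 2)"
   using x deg2 fA by (intro sum_strict_mono_ex1) auto
  then show False using sum_deg le by simp
 qed
 have star: "{l \<in> A. x \<in> ends l} = {l \<in> c. x \<in> ends l}" if x: "x \<in> verts A" for x
 proof (rule card_subset_eq)
  have "card {l \<in> A. x \<in> ends l} \<le> card {l \<in> c. x \<in> ends l}"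
   using A fc by (intro card_mono) auto
  then show "card {l \<in> A. x \<in> ends l} = card {l \<in> c. x \<in> ends l}"
   using deg_eq[OF x] cycle_degree[OF c, of x] by (simp add: deg_def)
 qed (use A fc in auto)
 have "verts A = verts c"
 proof (rule cycle_connected[OF c])
  show "verts A \<subseteq> verts c" using A by (auto simp: verts_def)
  show "verts A \<noteq> {}" using A by (auto simp: verts_def)
  fix l assume l: "l \<in> c" "ends l \<inter> verts A \<noteq> {}"
  then obtain x where "x \<in> ends l" "x \<in> verts A" by auto
  then have "l \<in> A" using star[of x] l by auto
  then show "ends l \<subseteq> verts A" by (auto simp: verts_def)
 qed
 then have "card c \<le> card A" using le cycle_card[OF c] by simp
 then have "A = c" using A fc by (metis card_seteq)
 then show False using A by simp
qed

text \<open>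
 The four cycles below are the pairs of cycles whose last edges are \<open>e\<close> and \<open>f\<close>; each of the other edges
 has to be used at least twice.  Then each vertex lies on at least two of the cycles.  If none
 lies on three, the cycles through a vertex share both edges there, so that the cycles coincide in pairs.
\<close>

lemma doubly_covered_cycles:
 assumes cyc: "is_cycle a" "is_cycle a'" "is_cycle b" "is_cycle b'"
  and e: "e \<in> a" "e \<in> a'" and f: "f \<in> b" "f \<in> b'"
  and cover: "\<And>l. l \<in> a - {e} ==> l \<in> a' - {e} \<or> l \<in> b - {f} \<or> l \<in> b' - {f}"
   "\<And>l. l \<in> a' - {e} ==> l \<in> a - {e} \<or> l \<in> b - {f} \<or> l \<in> b' - {f}"
   "\<And>l. l \<in> b - {f} ==> l \<in> a - {e} \<or> l \<in> a' - {e} \<or> l \<in> b' - {f}"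
   "\<And>l. l \<in> b' - {f} ==> l \<in> a - {e} \<or> l \<in> a' - {e} \<or> l \<in> b - {f}"
  and nontrivial: "\<not> (a = a' \<and> b = b' \<and> a \<inter> b = {})"
 shows "2 * card (verts (a \<union> a' \<union> (b \<union> b'))) < card a + card a' + (card b + card b')"
proof (rule ccontr)
 assume neg: "\<not> ?thesis"
 define V where "V = verts (a \<union> a' \<union> (b \<union> b'))"
 have fV: "finite V" unfolding V_def using cyc cycle_finite by auto
 have sub: "verts a \<subseteq> V" "verts a' \<subseteq> V" "verts b \<subseteq> V" "verts b' \<subseteq> V"
  by (auto simp: V_def verts_Un)
 define mult :: "nat => nat" where
  "mult x = of_bool (x \<in> verts a) + of_bool (x \<in> verts a') + (of_bool (x \<in> verts b) + of_bool (x \<in> verts b'))" for x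
 have vI: "x \<in> verts c" if "x \<in> ends l" "l \<in> c" for x l c using that by (auto simp: verts_def)
 have vE: "\<exists>l\<in>c. x \<in> ends l" if "x \<in> verts c" for x c using that by (auto simp: verts_def)
 have card_sum: "(\<Sum>x\<in>V. of_bool (x \<in> verts c)) = card c" if "is_cycle c" "verts c \<subseteq> V" for c
  using that fV cycle_card[of c] by (simp add: Int_absorb1 flip: Int_def)
 have total: "(\<Sum>x\<in>V. mult x) = card a + card a' + (card b + card b')"
  unfolding mult_def sum.distrib using card_sum cyc sub by simp
 have mult_ge: "2 \<le> mult x" if x: "x \<in> V" for x
 proof -
  have "x \<in> verts a ==> x \<in> verts a' \<or> x \<in> verts b \<or> x \<in> verts b'"
   using vE[of x a] cover(1) vI[of x] e by blast
  moreover have "x \<in> verts a' ==> x \<in> verts a \<or> x \<in> verts b \<or> x \<in> verts b'"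
   using vE[of x a'] cover(2) vI[of x] e by blast
  moreover have "x \<in> verts b ==> x \<in> verts a \<or> x \<in> verts a' \<or> x \<in> verts b'"
   using vE[of x b] cover(3) vI[of x] f by blast
  moreover have "x \<in> verts b' ==> x \<in> verts a \<or> x \<in> verts a' \<or> x \<in> verts b"
   using vE[of x b'] cover(4) vI[of x] f by blast
  moreover have "x \<in> verts a \<or> x \<in> verts a' \<or> x \<in> verts b \<or> x \<in> verts b'"
   using x by (auto simp: V_def verts_Un)
  ultimately show ?thesis by (auto simp: mult_def)
 qed
 have mult_eq: "mult x = 2" if x: "x \<in> V" for x
 proof (rule ccontr)
  assume "mult x \<noteq> 2"
  then have "2 < mult x" using mult_ge[OF x] by simp
  then have "(\<Sum>x\<in>V. 2) < (\<Sum>x\<in>V. mult x)"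
   using x mult_ge fV by (intro sum_strict_mono_ex1) auto
  then show False using total neg by (simp add: V_def)
 qed
 \<comment> \<open>stated for any two of the cycles that share an edge, so that it serves for both pairs in both orders\<close>
 have same: "c \<subseteq> c'"
  if cc: "is_cycle c" "is_cycle c'" and h: "h \<in> c" "h \<in> c'"
   and excl: "\<And>x. x \<in> verts c ==> x \<in> verts c' ==> x \<notin> verts d \<and> x \<notin> verts d'"
   and cov: "\<And>l. l \<in> c - {h} ==> l \<in> c' \<or> l \<in> d \<or> l \<in> d'" for c c' d d' h
 proof -
  have step: "l \<in> c'" if "l \<in> c" "x \<in> ends l" "x \<in> verts c \<inter> verts c'" for l x
   using cov[of l] excl[of x] that vI[of x l] h by blast
  have "verts c \<inter> verts c' = verts c"
  proof (rule cycle_connected[OF cc(1)])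
   show "verts c \<inter> verts c' \<noteq> {}"
    using h vI[of _ h] ends_nonempty[of h] by blast
   show "ends l \<subseteq> verts c \<inter> verts c'" if "l \<in> c" "ends l \<inter> (verts c \<inter> verts c') \<noteq> {}" for l
    using step[OF that(1)] that vI by blast
  qed simp
  then show ?thesis using step vI ends_nonempty by blast
 qed
 have ex1: "x \<notin> verts b \<and> x \<notin> verts b'" if "x \<in> verts a" "x \<in> verts a'" for x
  using mult_eq[of x] that sub by (auto simp: mult_def)
 have ex2: "x \<notin> verts a \<and> x \<notin> verts a'" if "x \<in> verts b" "x \<in> verts b'" for x
  using mult_eq[of x] that sub by (auto simp: mult_def)
 have "a \<subseteq> a'" by (rule same[where d=b and d'=b', OF cyc(1,2) e ex1]) (use cover(1) in auto)
 moreover have "a' \<subseteq> a" by (rule same[where d=b and d'=b', OF cyc(2,1) e(2,1)]) (use ex1 cover(2) in auto)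
 moreover have "b \<subseteq> b'" by (rule same[where d=a and d'=a', OF cyc(3,4) f ex2]) (use cover(3) in auto)
 moreover have "b' \<subseteq> b" by (rule same[where d=a and d'=a', OF cyc(4,3) f(2,1)]) (use ex2 cover(4) in auto)
 ultimately have eq: "a = a'" "b = b'" by auto
 have "a \<inter> b = {}"
 proof (rule ccontr)
  assume "a \<inter> b \<noteq> {}"
  then obtain l x where "l \<in> a" "l \<in> b" "x \<in> ends l" using ends_nonempty by blast
  then show False using ex1[of x] eq vI[of x l] by auto
 qed
 then show False using eq nontrivial by auto
qed

section \<open>Cycle sums of independent variables\<close>

locale independent_pairs = prob_space P for P :: "'a measure" +
 fixes E :: "nat set" and u h :: "nat => 'a => real" and \<tau> :: real
 assumes finite_E: "finite E"
  and indep: "indep_vars (\<lambda>_. borel) (\<lambda>l x. (u l x, h l x)) E"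
  and u_mean: "\<And>l. l \<in> E ==> expectation (u l) = 0"
  and u_fourth: "\<And>l. l \<in> E ==> integrable P (\<lambda>x. u l x ^ 4)"
  and h_mean: "\<And>l. l \<in> E ==> expectation (h l) = 0"
  and h_fourth: "\<And>l. l \<in> E ==> integrable P (\<lambda>x. h l x ^ 4)"
  and h_fourth_le: "\<And>l. l \<in> E ==> expectation (\<lambda>x. h l x ^ 4) \<le> \<tau> ^ 4"
  and \<tau>_nonneg: "0 \<le> \<tau>"

text \<open>
 The fourth moments are the only ones that the cycle sums require of single edges.
\<close>

lemma (in prob_space) integrable_power_le_fourth:
 fixes f :: "'a => real"
 assumes "f \<in> borel_measurable M" "integrable M (\<lambda>x. f x ^ 4)" "k \<le> 4"
 shows "integrable M (\<lambda>x. f x ^ k)"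
 by (rule Bochner_Integration.integrable_bound[where f="\<lambda>x. 1 + f x ^ 4"])
   (use assms abs_power_le_fourth[of k] in \<open>auto intro!: AE_I2 simp: power_abs add_nonneg_nonneg\<close>)

lemma (in prob_space) abs_moment_le_fourth:
 fixes f :: "'a => real"
 assumes f: "f \<in> borel_measurable M" "integrable M (\<lambda>x. f x ^ 4)" "expectation (\<lambda>x. f x ^ 4) \<le> t ^ 4"
  and t: "0 \<le> t" and k: "k \<in> {2, 3, 4}"
 shows "\<bar>expectation (\<lambda>x. f x ^ k)\<bar> \<le> t ^ k"
proof -
 note i = integrable_power_le_fourth[OF f(1,2)]
 have i2: "integrable M (\<lambda>x. (f x)\<^sup>2)" using i[of 2] by simp
 have two: "expectation (\<lambda>x. (f x)\<^sup>2) \<le> t\<^sup>2"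
 proof -
  have "0 \<le> expectation (\<lambda>x. ((f x)\<^sup>2 - expectation (\<lambda>x. (f x)\<^sup>2))\<^sup>2)" by simp
  also have "... = expectation (\<lambda>x. ((f x)\<^sup>2)\<^sup>2) - (expectation (\<lambda>x. (f x)\<^sup>2))\<^sup>2"
   by (rule variance_eq[OF i2]) (use f in \<open>simp flip: power_mult\<close>)
  finally have "(expectation (\<lambda>x. (f x)\<^sup>2))\<^sup>2 \<le> (t\<^sup>2)\<^sup>2" using f(3) by (simp flip: power_mult)
  then show ?thesis by (rule power2_le_imp_le) simp
 qed
 have three: "\<bar>expectation (\<lambda>x. f x ^ 3)\<bar> \<le> t ^ 3"
 proof (cases "t = 0")
  case True
  have "AE x in M. f x ^ 4 = 0"
   using f True integral_nonneg_eq_0_iff_AE[OF f(2)] by (simp add: antisym)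
  then have "expectation (\<lambda>x. f x ^ 3) = expectation (\<lambda>x. 0)"
   by (intro integral_cong_AE) (use f in \<open>auto\<close>)
  then show ?thesis using True by simp
 next
  case False
  then have tp: "0 < t" using t by simp
  have "\<bar>expectation (\<lambda>x. f x ^ 3)\<bar> \<le> expectation (\<lambda>x. \<bar>f x ^ 3\<bar>)"
   by (rule integral_abs_bound)
  also have "... \<le> expectation (\<lambda>x. (t * (f x)\<^sup>2 + f x ^ 4 / t) / 2)"
  proof (rule integral_mono)
   show "integrable M (\<lambda>x. \<bar>f x ^ 3\<bar>)" using i[of 3] by auto
   show "integrable M (\<lambda>x. (t * (f x)\<^sup>2 + f x ^ 4 / t) / 2)" using i2 f(2) by auto
   fix x
   have "0 \<le> (f x)\<^sup>2 * (\<bar>f x\<bar> - t)\<^sup>2" by simp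
   then have "2 * t * \<bar>f x ^ 3\<bar> \<le> t\<^sup>2 * (f x)\<^sup>2 + f x ^ 4"
    by (simp add: power_abs power2_eq_square eval_nat_numeral algebra_simps abs_mult)
   then show "\<bar>f x ^ 3\<bar> \<le> (t * (f x)\<^sup>2 + f x ^ 4 / t) / 2"
    using tp by (simp add: field_simps power2_eq_square)
  qed
  also have "... = (t * expectation (\<lambda>x. (f x)\<^sup>2) + expectation (\<lambda>x. f x ^ 4) / t) / 2"
   using i2 f(2) by simp
  also have "... \<le> (t * t\<^sup>2 + t ^ 4 / t) / 2"
   using two f(3) tp by (intro divide_right_mono add_mono mult_left_mono) auto
  also have "... = t ^ 3" using tp by (simp add: field_simps eval_nat_numeral)
  finally show ?thesis .
 qed
 show ?thesis using two three f(3) k by auto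
qed

lemma measurable_fst_real_pair: "fst \<in> borel_measurable (borel :: (real \<times> real) measure)"
 unfolding borel_prod[symmetric] by measurable

lemma measurable_snd_real_pair: "snd \<in> borel_measurable (borel :: (real \<times> real) measure)"
 unfolding borel_prod[symmetric] by measurable

context independent_pairs
begin

lemma pair_measurable: "l \<in> E ==> (\<lambda>x. (u l x, h l x)) \<in> borel_measurable P"
 using indep by (auto simp: indep_vars_def)

lemma u_measurable [measurable]: "l \<in> E ==> u l \<in> borel_measurable P"
 using measurable_compose[OF pair_measurable measurable_fst_real_pair] by simp

lemma h_measurable [measurable]: "l \<in> E ==> h l \<in> borel_measurable P"
 using measurable_compose[OF pair_measurable measurable_snd_real_pair] by simp

lemma indep_power: "indep_vars (\<lambda>_. borel) (\<lambda>l x. h l x ^ n l) E"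
proof -
 have "indep_vars (\<lambda>_. borel) (\<lambda>l x. (\<lambda>z. snd z ^ n l) (u l x, h l x)) E"
  by (rule indep_vars_compose2[OF indep]) (simp add: borel_prod[symmetric])
 then show ?thesis by simp
qed

definition moment :: "nat => nat => real" where
 "moment l k = expectation (\<lambda>x. h l x ^ k)"

lemma moment_0 [simp]: "moment l 0 = 1" by (simp add: moment_def prob_space)

lemma moment_1: "l \<in> E ==> moment l (Suc 0) = 0" by (simp add: moment_def h_mean)

lemma moment_le: "l \<in> E ==> k \<le> 4 ==> \<bar>moment l k\<bar> \<le> \<tau> ^ k"
proof -
 assume l: "l \<in> E" and k: "k \<le> 4"
 consider "k = 0" | "k = 1" | "k \<in> {2, 3, 4}" using k by fastforce
 then show ?thesis
 proof cases
  case 3 then show ?thesis unfolding moment_def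
   by (intro abs_moment_le_fourth h_fourth h_fourth_le l \<tau>_nonneg h_measurable)
 qed (use l \<tau>_nonneg in \<open>auto simp: moment_1\<close>)
qed

lemma mixed_moment:
 assumes "\<And>l. l \<in> E ==> n l \<le> 4"
 shows "integrable P (\<lambda>x. \<Prod>l\<in>E. h l x ^ n l)"
  and "expectation (\<lambda>x. \<Prod>l\<in>E. h l x ^ n l) = (\<Prod>l\<in>E. moment l (n l))"
 using indep_vars_integrable[OF finite_E indep_power] indep_vars_lebesgue_integral[OF finite_E indep_power]
  integrable_power_le_fourth[OF h_measurable h_fourth] assms
 by (auto simp: moment_def)

definition edge_prod :: "nat set => 'a => real" where
 "edge_prod c x = (\<Prod>l\<in>c. h l x)"

lemma edge_prod_empty [simp]: "edge_prod {} x = 1" by (simp add: edge_prod_def)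

lemma edge_prod_as_power: "c \<subseteq> E ==> edge_prod c x = (\<Prod>l\<in>E. h l x ^ of_bool (l \<in> c))"
proof -
 assume c: "c \<subseteq> E"
 have "(\<Prod>l\<in>E. h l x ^ of_bool (l \<in> c)) = (\<Prod>l\<in>E. if l \<in> c then h l x else 1)"
  by (rule prod.cong) auto
 also have "... = edge_prod c x" unfolding edge_prod_def
  using c finite_E by (subst prod.inter_restrict[symmetric]) (auto simp: Int_absorb1)
 finally show ?thesis by simp
qed

text \<open>
 The number of the four edge sets that contain \<open>l\<close>, hence the power of \<open>h l\<close> in the product of their edge
 products.
\<close>

definition cover :: "nat set => nat set => nat set => nat set => nat => nat" where
 "cover a b c d l = of_bool (l \<in> a) + of_bool (l \<in> b) + (of_bool (l \<in> c) + of_bool (l \<in> d))"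

lemma edge_prod4_as_power:
 "a \<subseteq> E ==> b \<subseteq> E ==> c \<subseteq> E ==> d \<subseteq> E ==>
  edge_prod a x * edge_prod b x * (edge_prod c x * edge_prod d x) = (\<Prod>l\<in>E. h l x ^ cover a b c d l)"
 by (simp add: edge_prod_as_power cover_def power_add prod.distrib)

lemma cover_le: "cover a b c d l \<le> 4" by (simp add: cover_def)

lemma
 assumes s: "a \<subseteq> E" "b \<subseteq> E" "c \<subseteq> E" "d \<subseteq> E"
 shows edge_prod4_integrable: "integrable P (\<lambda>x. edge_prod a x * edge_prod b x * (edge_prod c x * edge_prod d x))"
  and edge_prod4_expectation: "expectation (\<lambda>x. edge_prod a x * edge_prod b x * (edge_prod c x * edge_prod d x))
   = (\<Prod>l\<in>E. moment l (cover a b c d l))"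
 using mixed_moment[of "cover a b c d"] cover_le by (simp_all add: edge_prod4_as_power[OF s])

lemma edge_prod4_le:
 assumes s: "a \<subseteq> E" "b \<subseteq> E" "c \<subseteq> E" "d \<subseteq> E"
 shows "\<bar>expectation (\<lambda>x. edge_prod a x * edge_prod b x * (edge_prod c x * edge_prod d x))\<bar>
   \<le> \<tau> ^ (card a + card b + (card c + card d))"
proof -
 have "\<bar>\<Prod>l\<in>E. moment l (cover a b c d l)\<bar> \<le> (\<Prod>l\<in>E. \<tau> ^ cover a b c d l)"
  unfolding abs_prod by (intro prod_mono) (auto intro: moment_le cover_le)
 also have "... = \<tau> ^ (\<Sum>l\<in>E. cover a b c d l)" by (rule power_sum[symmetric])
 also have "(\<Sum>l\<in>E. cover a b c d l) = card a + card b + (card c + card d)"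
  using s finite_E by (simp add: cover_def sum.distrib Int_absorb1 flip: Int_def)
 finally show ?thesis by (simp add: edge_prod4_expectation[OF s])
qed

text \<open>
 An edge that is covered once contributes the factor \<open>E (h l) = 0\<close>.
\<close>

lemma edge_prod4_nonzero:
 assumes s: "a \<subseteq> E" "b \<subseteq> E" "c \<subseteq> E" "d \<subseteq> E"
  and nz: "expectation (\<lambda>x. edge_prod a x * edge_prod b x * (edge_prod c x * edge_prod d x)) \<noteq> 0"
 shows "cover a b c d l \<noteq> 1"
proof (cases "l \<in> E")
 case True
 then show ?thesis using nz moment_1[OF True] finite_E
  by (auto simp: edge_prod4_expectation[OF s])
next
 case False then show ?thesis using s by (auto simp: cover_def)
qed

lemma edge_prod2_integrable: "a \<subseteq> E ==> b \<subseteq> E ==> integrable P (\<lambda>x. edge_prod a x * edge_prod b x)"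
 using edge_prod4_integrable[of a b "{}" "{}"] by simp

lemma edge_prod_integrable: "a \<subseteq> E ==> integrable P (edge_prod a)"
 using edge_prod4_integrable[of a "{}" "{}" "{}"] by simp

lemma edge_prod2_le: "a \<subseteq> E ==> b \<subseteq> E ==> \<bar>expectation (\<lambda>x. edge_prod a x * edge_prod b x)\<bar> \<le> \<tau> ^ (card a + card b)"
 using edge_prod4_le[of a b "{}" "{}"] by simp

text \<open>
 Different edge sets differ in some edge, and that edge is covered once.
\<close>

lemma edge_prod2_orthogonal: "a \<subseteq> E ==> b \<subseteq> E ==> a \<noteq> b ==> expectation (\<lambda>x. edge_prod a x * edge_prod b x) = 0"
proof (rule ccontr)
 assume ab: "a \<subseteq> E" "b \<subseteq> E" "a \<noteq> b" and nz: "expectation (\<lambda>x. edge_prod a x * edge_prod b x) \<noteq> 0"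
 then have "cover a b {} {} l \<noteq> 1" for l
  using edge_prod4_nonzero[of a b "{}" "{}"] by simp
 then have "l \<in> a \<longleftrightarrow> l \<in> b" for l by (auto simp: cover_def split: if_splits) (metis One_nat_def add_0 add_0_right of_bool_eq)+
 then show False using ab by auto
qed

lemma edge_prod2_square: "a \<subseteq> E ==> expectation (\<lambda>x. edge_prod a x * edge_prod a x) = (\<Prod>l\<in>a. moment l 2)"
proof -
 assume a: "a \<subseteq> E"
 have "expectation (\<lambda>x. edge_prod a x * edge_prod a x) = (\<Prod>l\<in>E. moment l (cover a a {} {} l))"
  using edge_prod4_expectation[of a a "{}" "{}"] a by simp
 also have "... = (\<Prod>l\<in>E. if l \<in> a then moment l 2 else 1)" by (rule prod.cong) (auto simp: cover_def numeral_2_eq_2)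
 also have "... = (\<Prod>l\<in>a. moment l 2)"
  using a finite_E by (subst prod.inter_restrict[symmetric]) (auto simp: Int_absorb1)
 finally show ?thesis .
qed

lemma edge_prod4_disjoint:
 assumes s: "a \<subseteq> E" "b \<subseteq> E" "c \<subseteq> E" "d \<subseteq> E" and disj: "(a \<union> b) \<inter> (c \<union> d) = {}"
 shows "expectation (\<lambda>x. edge_prod a x * edge_prod b x * (edge_prod c x * edge_prod d x))
   = expectation (\<lambda>x. edge_prod a x * edge_prod b x) * expectation (\<lambda>x. edge_prod c x * edge_prod d x)"
proof -
 have ab: "expectation (\<lambda>x. edge_prod a x * edge_prod b x) = (\<Prod>l\<in>E. moment l (cover a b {} {} l))"
  using edge_prod4_expectation[of a b "{}" "{}"] s by simp
 have cd: "expectation (\<lambda>x. edge_prod c x * edge_prod d x) = (\<Prod>l\<in>E. moment l (cover {} {} c d l))"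
  using edge_prod4_expectation[of "{}" "{}" c d] s by simp
 show ?thesis unfolding ab cd edge_prod4_expectation[OF s] prod.distrib[symmetric]
  by (rule prod.cong) (use disj in \<open>auto simp: cover_def\<close>)
qed

subsection \<open>The natural filtration\<close>

definition past :: "nat => 'a measure" where
 "past n = sigma (space P) (\<Union>k\<in>E \<inter> {..<n}. {(\<lambda>x. (u k x, h k x)) -` A \<inter> space P |A. A \<in> sets borel})"

lemma past_generators: "(\<Union>k\<in>E \<inter> {..<n}. {(\<lambda>x. (u k x, h k x)) -` A \<inter> space P |A. A \<in> sets borel}) \<subseteq> sets P"
 using measurable_sets[OF pair_measurable] by auto

lemma space_past [simp]: "space (past n) = space P"
 unfolding past_def by (rule space_measure_of) (use past_generators sets.space_closed in blast)

lemma sets_past: "sets (past n) = sigma_sets (space P) (\<Union>k\<in>E \<inter> {..<n}. {(\<lambda>x. (u k x, h k x)) -` A \<inter> space P |A. A \<in> sets borel})"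
 unfolding past_def by (rule sets_measure_of) (use past_generators sets.space_closed in blast)

lemma subalgebra_past: "subalgebra P (past n)"
 unfolding subalgebra_def sets_past using sets.sigma_sets_subset[OF past_generators] by simp

lemma past_increasing: "k \<le> n ==> subalgebra (past n) (past k)"
 unfolding subalgebra_def sets_past
 by (auto intro!: sigma_sets_mono' simp del: vimage_eq) (metis IntI lessThan_iff order_less_le_trans)

lemma pair_past: "k \<in> E ==> k < n ==> (\<lambda>x. (u k x, h k x)) \<in> borel_measurable (past n)"
 by (rule measurableI) (auto simp: sets_past intro!: sigma_sets.Basic)

lemma u_past: "k \<in> E ==> k < n ==> u k \<in> borel_measurable (past n)"
 using measurable_compose[OF pair_past measurable_fst_real_pair] by simp

lemma h_past: "k \<in> E ==> k < n ==> h k \<in> borel_measurable (past n)"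
 using measurable_compose[OF pair_past measurable_snd_real_pair] by simp

lemma past_indep:
 assumes l: "l \<in> E" and Y: "Y \<in> borel_measurable (past l)" and g: "g \<in> borel_measurable (borel :: (real \<times> real) measure)"
 shows "indep_var borel Y borel (\<lambda>x. g (u l x, h l x))"
proof -
 let ?G = "\<lambda>k. {(\<lambda>x. (u k x, h k x)) -` A \<inter> space P |A. A \<in> sets borel}"
 have "indep_sets (\<lambda>j. sigma_sets (space P) (\<Union>i\<in>case_bool (E \<inter> {..<l}) {l} j. ?G i)) UNIV"
 proof (rule indep_sets_collect_sigma)
  have G: "indep_sets ?G E" using indep by (simp add: indep_vars_def2)
  show "indep_sets ?G (\<Union>j\<in>UNIV. case_bool (E \<inter> {..<l}) {l} j)"
   by (rule indep_sets_mono_index[OF _ G]) (use l in \<open>auto simp: UNIV_bool\<close>)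
  show "Int_stable (?G i)" for i
  proof (safe intro!: Int_stableI)
   fix A B :: "(real \<times> real) set" assume "A \<in> sets borel" "B \<in> sets borel"
   then show "\<exists>C. (\<lambda>x. (u i x, h i x)) -` A \<inter> space P \<inter> ((\<lambda>x. (u i x, h i x)) -` B \<inter> space P)
     = (\<lambda>x. (u i x, h i x)) -` C \<inter> space P \<and> C \<in> sets borel"
    by (intro exI[of _ "A \<inter> B"]) auto
  qed
  show "disjoint_family_on (case_bool (E \<inter> {..<l}) {l}) UNIV"
   by (auto simp: disjoint_family_on_def split: bool.splits)
 qed
 then have "indep_sets (case_bool (sigma_sets (space P) {Y -` A \<inter> space P |A. A \<in> sets borel})
   (sigma_sets (space P) {(\<lambda>x. g (u l x, h l x)) -` A \<inter> space P |A. A \<in> sets borel})) UNIV"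
 proof (rule indep_sets_mono_sets)
  fix j :: bool
  show "case_bool (sigma_sets (space P) {Y -` A \<inter> space P |A. A \<in> sets borel})
   (sigma_sets (space P) {(\<lambda>x. g (u l x, h l x)) -` A \<inter> space P |A. A \<in> sets borel}) j
   \<subseteq> sigma_sets (space P) (\<Union>i\<in>case_bool (E \<inter> {..<l}) {l} j. ?G i)"
  proof (cases j)
   case True
   have "{Y -` A \<inter> space P |A. A \<in> sets borel} \<subseteq> sets (past l)"
    using measurable_sets[OF Y] by auto
   then show ?thesis using True sets.sigma_sets_subset[of _ "past l"] by (simp add: sets_past)
  next
   case False
   have "(\<lambda>x. g (u l x, h l x)) -` A \<inter> space P = (\<lambda>x. (u l x, h l x)) -` (g -` A \<inter> space borel) \<inter> space P" for A
    by auto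
   then have "{(\<lambda>x. g (u l x, h l x)) -` A \<inter> space P |A. A \<in> sets borel} \<subseteq> ?G l"
    using measurable_sets[OF g] by blast
   then show ?thesis using False by (simp add: sigma_sets_mono')
  qed
 qed
 moreover have "Y \<in> borel_measurable P" using Y subalgebra_past by (rule measurable_from_subalg[rotated])
 moreover have "(\<lambda>x. g (u l x, h l x)) \<in> borel_measurable P"
  using measurable_compose[OF pair_measurable[OF l] g] .
 ultimately show ?thesis unfolding indep_var_eq indep_set_def by simp
qed

text \<open>
 The variables of an edge are independent of the edges before it, so that conditioning on the past
 amounts to freezing it.
\<close>

lemma past_product:
 fixes Y :: "'a => real" and g :: "real \<times> real => real"
 assumes l: "l \<in> E" and Y: "Y \<in> borel_measurable (past l)" and g: "g \<in> borel_measurable (borel :: (real \<times> real) measure)"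
  and i: "integrable P Y" "integrable P (\<lambda>x. g (u l x, h l x))"
 shows "integrable P (\<lambda>x. Y x * g (u l x, h l x))"
  and "expectation (\<lambda>x. Y x * g (u l x, h l x)) = expectation Y * expectation (\<lambda>x. g (u l x, h l x))"
 using indep_var_integrable[OF past_indep[OF l Y g] i] indep_var_lebesgue_integral[OF past_indep[OF l Y g] i] by auto

end

definition steps :: "nat => nat set" where
 "steps N = (\<lambda>(x, y). edge x y) ` ({..<N} \<times> {..<N})"

lemma finite_steps [simp]: "finite (steps N)" by (simp add: steps_def)

lemma card_steps: "card (steps N) \<le> N * N"
 unfolding steps_def using card_image_le[of "{..<N} \<times> {..<N}" "\<lambda>(x, y). edge x y"] by simp

lemma cycles_steps: "c \<in> cycles N m ==> c \<subseteq> steps N"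
proof
 fix l assume "c \<in> cycles N m" and l: "l \<in> c"
 then obtain xs where xs: "c = cyc xs" "canonical xs" "set xs \<subseteq> {..<N}" by (auto simp: cycles_def)
 then obtain i where i: "i < length xs" "l = edge (xs ! i) (xs ! (Suc i mod length xs))"
  using l by (auto simp: cyc_def)
 have "0 < length xs" using xs(2) by (auto simp: canonical_def)
 then have "xs ! i \<in> set xs" "xs ! (Suc i mod length xs) \<in> set xs" using i by auto
 then show "l \<in> steps N" using xs(3) i(2) unfolding steps_def by blast
qed

lemma sum_square_product:
 fixes f :: "'b => real"
 assumes "finite A"
 shows "(\<Sum>a\<in>A. f a)\<^sup>2 = (\<Sum>(a, b)\<in>A \<times> A. f a * f b)"
 by (simp add: power2_eq_square sum_product sum.cartesian_product)

lemma sum_fourth_product: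
 fixes f :: "'b => real"
 assumes "finite A"
 shows "(\<Sum>a\<in>A. f a) ^ 4 = (\<Sum>((a, a'), (b, b'))\<in>(A \<times> A) \<times> (A \<times> A). f a * f a' * (f b * f b'))"
proof -
 have "(\<Sum>a\<in>A. f a) ^ 4 = ((\<Sum>a\<in>A. f a)\<^sup>2)\<^sup>2" by simp
 also have "... = (\<Sum>x\<in>A \<times> A. f (fst x) * f (snd x))\<^sup>2" by (simp add: sum_square_product[OF assms] case_prod_beta)
 also have "... = (\<Sum>((a, a'), (b, b'))\<in>(A \<times> A) \<times> (A \<times> A). f a * f a' * (f b * f b'))"
  by (subst sum_square_product) (simp_all add: assms case_prod_beta)
 finally show ?thesis .
qed

locale cycle_chaos = independent_pairs P "steps N" u h "B / sqrt (real N)"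
 for P :: "'a measure" and N m :: nat and u h :: "nat => 'a => real" and B :: real +
 assumes B_ge_1: "1 \<le> B"
begin

definition C :: "nat set set" where "C = cycles N m"

definition ending :: "nat => nat set set" where "ending l = {c \<in> C. Max c = l}"

text \<open>
 The last edge of a cycle in the order of time is the one at which the cycle is completed; the product over
 the others is known by then.
\<close>

definition butmax :: "nat set => nat set" where "butmax c = c - {Max c}"

definition coeff :: "nat => 'a => real" where
 "coeff l x = (\<Sum>c\<in>ending l. edge_prod (butmax c) x)"

definition chaos_step :: "nat => 'a => real" where
 "chaos_step l x = (if l \<in> steps N then u l x + h l x * coeff l x else 0)"

text \<open>
 The conditional variance of \<open>u l + h l * coeff l\<close> given the past, on which \<open>coeff l\<close> depends.
\<close>

definition cond_var :: "nat => 'a => real" where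
 "cond_var l x = (if l \<in> steps N then expectation (\<lambda>x. (u l x)\<^sup>2)
   + 2 * expectation (\<lambda>x. u l x * h l x) * coeff l x + moment l 2 * (coeff l x)\<^sup>2 else 0)"

lemma C_is_cycle: "c \<in> C ==> is_cycle c" by (auto simp: C_def intro: cycles_cycle)

lemma C_subset: "c \<in> C ==> c \<subseteq> steps N" by (auto simp: C_def dest: cycles_steps)

lemma C_card: "c \<in> C ==> card c \<le> m" by (auto simp: C_def intro: cycles_card_le)

lemma finite_C [simp]: "finite C" by (simp add: C_def)

lemma finite_ending [simp]: "finite (ending l)" by (simp add: ending_def)

lemma ending_C: "c \<in> ending l ==> c \<in> C" by (simp add: ending_def)

lemma Max_in_C: "c \<in> C ==> Max c \<in> c"
 using C_is_cycle cycle_finite cycle_card_ge by (intro Max_in) fastforce+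

lemma butmax_subset: "c \<in> C ==> butmax c \<subseteq> steps N" using C_subset by (auto simp: butmax_def)

lemma card_butmax: "c \<in> C ==> Suc (card (butmax c)) = card c"
 unfolding butmax_def using Max_in_C C_is_cycle cycle_finite by (metis card_Suc_Diff1)

lemma edge_prod_split: "c \<in> C ==> edge_prod c x = h (Max c) x * edge_prod (butmax c) x"
 unfolding edge_prod_def butmax_def by (rule prod.remove) (auto intro: Max_in_C C_is_cycle cycle_finite)

lemma h_coeff: "h l x * coeff l x = (\<Sum>c\<in>ending l. edge_prod c x)"
 unfolding coeff_def sum_distrib_left by (rule sum.cong) (auto simp: ending_def edge_prod_split)

lemma sum_over_ending:
 fixes f :: "nat set => real"
 shows "(\<Sum>l\<in>steps N. \<Sum>c\<in>ending l. f c) = (\<Sum>c\<in>C. f c)"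
proof -
 have "(\<Sum>l\<in>steps N. \<Sum>c\<in>ending l. f c) = (\<Sum>c\<in>(\<Union>l\<in>steps N. ending l). f c)"
  by (rule sum.UNION_disjoint[symmetric]) (auto simp: ending_def)
 also have "(\<Union>l\<in>steps N. ending l) = C"
  using Max_in_C C_subset by (auto simp: ending_def)
 finally show ?thesis .
qed

lemma sum_chaos_step:
 assumes n: "steps N \<subseteq> {..<n}"
 shows "(\<Sum>l<n. chaos_step l x) = (\<Sum>l\<in>steps N. u l x) + (\<Sum>c\<in>C. edge_prod c x)"
proof -
 have "(\<Sum>l<n. chaos_step l x) = (\<Sum>l\<in>steps N. u l x + h l x * coeff l x)"
  using n by (intro sum.mono_neutral_cong_right) (auto simp: chaos_step_def)
 also have "... = (\<Sum>l\<in>steps N. u l x) + (\<Sum>l\<in>steps N. \<Sum>c\<in>ending l. edge_prod c x)"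
  by (simp add: sum.distrib h_coeff)
 finally show ?thesis by (simp add: sum_over_ending)
qed

lemma edge_prod_past: "a \<subseteq> steps N ==> a \<subseteq> {..<l} ==> edge_prod a \<in> borel_measurable (past l)"
 unfolding edge_prod_def[abs_def] by (intro borel_measurable_prod h_past) auto

lemma butmax_less: "c \<in> C ==> butmax c \<subseteq> {..<Max c}"
 unfolding butmax_def using C_is_cycle cycle_finite Max_ge by (auto simp: less_le)

lemma coeff_past: "coeff l \<in> borel_measurable (past l)"
 unfolding coeff_def[abs_def]
 by (intro borel_measurable_sum edge_prod_past) (use butmax_subset butmax_less in \<open>auto simp: ending_def\<close>)

lemma coeff_measurable [measurable]: "coeff l \<in> borel_measurable P"
 using coeff_past subalgebra_past by (rule measurable_from_subalg[rotated])

lemma coeff_integrable: "integrable P (coeff l)"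
 unfolding coeff_def[abs_def]
 by (intro Bochner_Integration.integrable_sum edge_prod_integrable butmax_subset ending_C)

lemma coeff2_integrable: "integrable P (\<lambda>x. (coeff l x)\<^sup>2)"
 unfolding coeff_def[abs_def] sum_square_product[OF finite_ending]
 by (intro Bochner_Integration.integrable_sum)
   (auto intro!: edge_prod2_integrable butmax_subset ending_C)

lemma chaos_fourth_integrable: "integrable P (\<lambda>x. (h l x * coeff l x) ^ 4)"
 unfolding h_coeff sum_fourth_product[OF finite_ending]
 by (intro Bochner_Integration.integrable_sum)
   (auto intro!: edge_prod4_integrable C_subset ending_C)

lemma u_power_integrable: "l \<in> steps N ==> k \<le> 4 ==> integrable P (\<lambda>x. u l x ^ k)"
 by (rule integrable_power_le_fourth[OF u_measurable u_fourth])

lemma h_power_integrable: "l \<in> steps N ==> k \<le> 4 ==> integrable P (\<lambda>x. h l x ^ k)"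
 by (rule integrable_power_le_fourth[OF h_measurable h_fourth])

lemma uh_integrable: "l \<in> steps N ==> integrable P (\<lambda>z. u l z * h l z)"
proof (rule Bochner_Integration.integrable_bound[where f="\<lambda>z. (u l z)\<^sup>2 + (h l z)\<^sup>2"])
 assume l: "l \<in> steps N"
 show "integrable P (\<lambda>z. (u l z)\<^sup>2 + (h l z)\<^sup>2)"
  using u_power_integrable[OF l, of 2] h_power_integrable[OF l, of 2] by auto
 show "(\<lambda>z. u l z * h l z) \<in> borel_measurable P" using l by measurable
 have "\<bar>x * y\<bar> \<le> x\<^sup>2 + y\<^sup>2" for x y :: real
  using sum_squares_bound[of "\<bar>x\<bar>" "\<bar>y\<bar>"] mult_nonneg_nonneg[of "\<bar>x\<bar>" "\<bar>y\<bar>"]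
  unfolding abs_mult power2_abs by linarith
 then show "AE z in P. norm (u l z * h l z) \<le> norm ((u l z)\<^sup>2 + (h l z)\<^sup>2)" by (auto simp: abs_mult)
qed

lemma cond_var_nonneg: "0 \<le> cond_var l y"
proof (cases "l \<in> steps N")
 case True
 note i = u_power_integrable[OF True, of 2] h_power_integrable[OF True, of 2] uh_integrable[OF True]
 let ?m = "coeff l y"
 have "0 \<le> expectation (\<lambda>x. (u l x + ?m * h l x)\<^sup>2)" by simp
 also have "expectation (\<lambda>x. (u l x + ?m * h l x)\<^sup>2)
   = expectation (\<lambda>x. (u l x)\<^sup>2 + 2 * ?m * (u l x * h l x) + ?m\<^sup>2 * (h l x)\<^sup>2)"
  by (rule Bochner_Integration.integral_cong) (auto simp: power2_eq_square algebra_simps)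
 also have "... = expectation (\<lambda>x. (u l x)\<^sup>2) + 2 * ?m * expectation (\<lambda>x. u l x * h l x) + ?m\<^sup>2 * expectation (\<lambda>x. (h l x)\<^sup>2)"
  using i by simp
 also have "... = cond_var l y" using True by (simp add: cond_var_def moment_def)
 finally show ?thesis .
qed (simp add: cond_var_def)

text \<open>
 Every term of the cycle sum is assigned to its last edge.  Given the past, that edge has mean zero
 and enters linearly.
\<close>

theorem chaos_martingale: "weak_martingale_differences P past chaos_step cond_var"
proof
 fix l
 show "subalgebra P (past l)" by (rule subalgebra_past)
 show "subalgebra (past l) (past k)" if "k \<le> l" for k by (rule past_increasing[OF that])
 show "chaos_step l \<in> borel_measurable (past (Suc l))"
 proof (cases "l \<in> steps N")
  case True
  have [measurable]: "u l \<in> borel_measurable (past (Suc l))" "h l \<in> borel_measurable (past (Suc l))"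
   using True by (auto intro: u_past h_past)
  have [measurable]: "coeff l \<in> borel_measurable (past (Suc l))"
   using coeff_past past_increasing[of l "Suc l"] by (auto intro: measurable_from_subalg)
  show ?thesis using True unfolding chaos_step_def[abs_def] by simp
 qed (simp add: chaos_step_def[abs_def])
 show "cond_var l \<in> borel_measurable (past l)"
  using coeff_past[of l] unfolding cond_var_def[abs_def] by (cases "l \<in> steps N") simp_all
 show "0 \<le> cond_var l y" for y by (rule cond_var_nonneg)
 show "integrable P (cond_var l)"
  unfolding cond_var_def[abs_def] using coeff_integrable[of l] coeff2_integrable[of l]
  by (cases "l \<in> steps N") auto
 show "integrable P (\<lambda>y. chaos_step l y ^ 4)"
 proof (cases "l \<in> steps N")
  case True
  show ?thesis
  proof (rule Bochner_Integration.integrable_bound[where f="\<lambda>y. 8 * (u l y ^ 4 + (h l y * coeff l y) ^ 4)"])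
   show "integrable P (\<lambda>y. 8 * (u l y ^ 4 + (h l y * coeff l y) ^ 4))"
    using u_fourth[OF True] chaos_fourth_integrable[of l] by auto
   show "(\<lambda>y. chaos_step l y ^ 4) \<in> borel_measurable P"
    using True unfolding chaos_step_def[abs_def] by measurable
   show "AE y in P. norm (chaos_step l y ^ 4) \<le> norm (8 * (u l y ^ 4 + (h l y * coeff l y) ^ 4))"
    using True fourth_power_sum_le by (auto simp: chaos_step_def intro!: AE_I2 order_trans[OF fourth_power_sum_le])
  qed
 qed (simp add: chaos_step_def)
 fix Y :: "'a => real" and K
 assume Y: "Y \<in> borel_measurable (past l)" and bd: "\<And>x. \<bar>Y x\<bar> \<le> K"
 have [measurable]: "Y \<in> borel_measurable P"
  using Y subalgebra_past by (rule measurable_from_subalg[rotated])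
 have bi: "integrable P (\<lambda>y. Y y * f y)" if "integrable P f" for f
  by (rule Bochner_Integration.integrable_bound[where f="\<lambda>y. K * f y"])
    (use that bd order_trans[OF bd abs_ge_self] in \<open>auto intro!: AE_I2 mult_right_mono simp: abs_mult\<close>)
 have Yi: "integrable P Y" using bi[of "\<lambda>_. 1"] by simp
 have Yc: "(\<lambda>y. Y y * coeff l y) \<in> borel_measurable (past l)" "(\<lambda>y. Y y * (coeff l y)\<^sup>2) \<in> borel_measurable (past l)"
  using Y coeff_past[of l] by measurable
 note Yci = bi[OF coeff_integrable[of l]] bi[OF coeff2_integrable[of l]]
 have g: "(\<lambda>z. fst z ^ j * snd z ^ k) \<in> borel_measurable (borel :: (real \<times> real) measure)" for j k
  using measurable_fst_real_pair measurable_snd_real_pair by measurable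
 show "expectation (\<lambda>y. Y y * chaos_step l y) = 0"
 proof (cases "l \<in> steps N")
  case True
  note a = past_product[OF True Y g[of 1 0] Yi] past_product[OF True Yc(1) g[of 0 1] Yci(1)]
  have "expectation (\<lambda>y. Y y * chaos_step l y) = expectation (\<lambda>y. Y y * u l y + (Y y * coeff l y) * h l y)"
   using True by (simp add: chaos_step_def algebra_simps)
  also have "... = expectation Y * expectation (u l) + expectation (\<lambda>y. Y y * coeff l y) * expectation (h l)"
   using a u_power_integrable[OF True, of 1] h_power_integrable[OF True, of 1] by simp
  finally show ?thesis using u_mean h_mean True by simp
 qed (simp add: chaos_step_def)
 show "expectation (\<lambda>y. Y y * (chaos_step l y)\<^sup>2) = expectation (\<lambda>y. Y y * cond_var l y)"
 proof (cases "l \<in> steps N")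
  case True
  note i = u_power_integrable[OF True, of 2] h_power_integrable[OF True, of 2] uh_integrable[OF True]
  note a = past_product[OF True Y g[of 2 0] Yi] past_product[OF True Yc(1) g[of 1 1] Yci(1)] past_product[OF True Yc(2) g[of 0 2] Yci(2)]
  have "expectation (\<lambda>y. Y y * (chaos_step l y)\<^sup>2)
   = expectation (\<lambda>y. Y y * (u l y)\<^sup>2 + 2 * ((Y y * coeff l y) * (u l y * h l y)) + (Y y * (coeff l y)\<^sup>2) * (h l y)\<^sup>2)"
   using True by (simp add: chaos_step_def power2_eq_square algebra_simps)
  also have "... = expectation Y * expectation (\<lambda>y. (u l y)\<^sup>2)
    + 2 * (expectation (\<lambda>y. Y y * coeff l y) * expectation (\<lambda>y. u l y * h l y))
    + expectation (\<lambda>y. Y y * (coeff l y)\<^sup>2) * expectation (\<lambda>y. (h l y)\<^sup>2)"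
   using a i by simp
  also have "... = expectation Y * expectation (\<lambda>y. (u l y)\<^sup>2)
    + 2 * expectation (\<lambda>y. u l y * h l y) * expectation (\<lambda>y. Y y * coeff l y)
    + moment l 2 * expectation (\<lambda>y. Y y * (coeff l y)\<^sup>2)"
   by (simp add: moment_def)
  also have "... = expectation (\<lambda>y. Y y * expectation (\<lambda>y. (u l y)\<^sup>2)
    + 2 * expectation (\<lambda>y. u l y * h l y) * (Y y * coeff l y) + moment l 2 * (Y y * (coeff l y)\<^sup>2))"
   using Yi Yci by simp
  also have "... = expectation (\<lambda>y. Y y * cond_var l y)"
   using True by (simp add: cond_var_def algebra_simps)
  finally show ?thesis .
 qed (simp add: chaos_step_def cond_var_def)
qed

subsection \<open>Fourth moments and fluctuation of the conditional variance\<close>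

definition small :: real where "small = B ^ (4 * m) / sqrt (real N)"

definition uvert :: "(nat set \<times> nat set) \<times> (nat set \<times> nat set) => nat set" where
 "uvert x = verts (fst (fst x) \<union> snd (fst x) \<union> (fst (snd x) \<union> snd (snd x)))"

definition quads_bound :: real where
 "quads_bound = (real (4 * m) + 1) * real ((2 ^ (4 * m * (4 * m))) ^ 4)"

lemma small_nonneg: "0 \<le> small" using B_ge_1 by (simp add: small_def)

text \<open>
 The exponent \<open>T\<close> counts edges and \<open>v\<close> counts vertices.  One edge more than twice the vertices buys a factor
 \<open>1 / sqrt N\<close> beyond what the sum over the configurations requires.
\<close>

lemma small_power:
 assumes N: "1 \<le> N" and v: "2 * v < T" and T: "T \<le> 4 * m"
 shows "(B / sqrt (real N)) ^ T \<le> small * (1 / real N) ^ v"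
proof -
 have "(B / sqrt (real N)) ^ T = B ^ T * (1 / sqrt (real N)) ^ T" by (simp add: power_divide)
 also have "... \<le> B ^ (4 * m) * (1 / sqrt (real N)) ^ (2 * v + 1)"
  using v T N B_ge_1 by (intro mult_mono power_increasing power_decreasing) auto
 also have "... = small * (1 / real N) ^ v"
  using N by (simp add: small_def power_mult power_divide)
 finally show ?thesis .
qed

lemma sum_quads:
 assumes "1 \<le> N"
 shows "(\<Sum>x\<in>(C \<times> C) \<times> (C \<times> C). (1 / real N) ^ card (uvert x)) \<le> quads_bound"
 using sum_quadruples_of_cycles[OF assms, of m]
 by (simp add: C_def quads_bound_def uvert_def case_prod_beta)

lemma cover_cases:
 assumes n: "\<And>l. cover a b c d l \<noteq> 1"
 shows "l \<in> a ==> l \<in> b \<or> l \<in> c \<or> l \<in> d" "l \<in> b ==> l \<in> a \<or> l \<in> c \<or> l \<in> d"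
  "l \<in> c ==> l \<in> a \<or> l \<in> b \<or> l \<in> d" "l \<in> d ==> l \<in> a \<or> l \<in> b \<or> l \<in> c"
 using n[of l] by (auto simp: cover_def)

lemma card_total_le: "a \<in> C ==> a' \<in> C ==> b \<in> C ==> b' \<in> C ==> card a + card a' + (card b + card b') \<le> 4 * m"
 using C_card[of a] C_card[of a'] C_card[of b] C_card[of b'] by linarith

text \<open>
 Either some edge is covered once and the mean vanishes, or the four cycles cover their edges at least twice and
 have few vertices, by \<open>doubly_covered_cycles\<close>.
\<close>

lemma chaos_fourth_quad:
 assumes N: "1 \<le> N" and c: "a \<in> ending l" "a' \<in> ending l" "b \<in> ending l" "b' \<in> ending l"
 shows "expectation (\<lambda>x. edge_prod a x * edge_prod a' x * (edge_prod b x * edge_prod b' x))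
  \<le> small * (1 / real N) ^ card (uvert ((a, a'), (b, b')))"
proof (cases "expectation (\<lambda>x. edge_prod a x * edge_prod a' x * (edge_prod b x * edge_prod b' x)) = 0")
 case True then show ?thesis using small_nonneg by simp
next
 case False
 have C: "a \<in> C" "a' \<in> C" "b \<in> C" "b' \<in> C" using c by (auto simp: ending_def)
 note sub = C_subset[OF C(1)] C_subset[OF C(2)] C_subset[OF C(3)] C_subset[OF C(4)]
 have l: "l \<in> a" "l \<in> a'" "l \<in> b" "l \<in> b'"
  using c Max_in_C[OF C(1)] Max_in_C[OF C(2)] Max_in_C[OF C(3)] Max_in_C[OF C(4)] by (auto simp: ending_def)
 note cov = cover_cases[OF edge_prod4_nonzero[OF sub False]]
 have "2 * card (verts (a \<union> a' \<union> (b \<union> b'))) < card a + card a' + (card b + card b')"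
  by (rule doubly_covered_cycles[of a a' b b' l l]) (use C C_is_cycle l cov in blast)+
 then have "(B / sqrt (real N)) ^ (card a + card a' + (card b + card b')) \<le> small * (1 / real N) ^ card (uvert ((a, a'), (b, b')))"
  unfolding uvert_def by (intro small_power N card_total_le C) simp
 then show ?thesis using edge_prod4_le[OF sub] by linarith
qed

lemma chaos_fourth_sum:
 assumes N: "1 \<le> N"
 shows "(\<Sum>l\<in>steps N. expectation (\<lambda>y. (h l y * coeff l y) ^ 4)) \<le> small * quads_bound"
proof -
 let ?Q = "\<lambda>l. (ending l \<times> ending l) \<times> (ending l \<times> ending l)"
 let ?e = "\<lambda>x y. edge_prod (fst (fst x)) y * edge_prod (snd (fst x)) y * (edge_prod (fst (snd x)) y * edge_prod (snd (snd x)) y)"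
 have "expectation (\<lambda>y. (h l y * coeff l y) ^ 4) \<le> (\<Sum>x\<in>?Q l. small * (1 / real N) ^ card (uvert x))" for l
 proof -
  have "expectation (\<lambda>y. (h l y * coeff l y) ^ 4) = expectation (\<lambda>y. \<Sum>x\<in>?Q l. ?e x y)"
   unfolding h_coeff sum_fourth_product[OF finite_ending] by (simp add: case_prod_beta)
  also have "... = (\<Sum>x\<in>?Q l. expectation (?e x))"
   by (rule Bochner_Integration.integral_sum) (auto intro!: edge_prod4_integrable C_subset ending_C)
  also have "... \<le> (\<Sum>x\<in>?Q l. small * (1 / real N) ^ card (uvert x))"
  proof (rule sum_mono)
   fix x assume "x \<in> ?Q l"
   then obtain a a' b b' where x: "x = ((a, a'), (b, b'))" "a \<in> ending l" "a' \<in> ending l" "b \<in> ending l" "b' \<in> ending l"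
    by auto
   show "expectation (?e x) \<le> small * (1 / real N) ^ card (uvert x)"
    using chaos_fourth_quad[OF N x(2-)] by (simp add: x(1))
  qed
  finally show ?thesis .
 qed
 then have "(\<Sum>l\<in>steps N. expectation (\<lambda>y. (h l y * coeff l y) ^ 4))
   \<le> (\<Sum>l\<in>steps N. \<Sum>x\<in>?Q l. small * (1 / real N) ^ card (uvert x))"
  by (intro sum_mono) auto
 also have "... = (\<Sum>x\<in>(\<Union>l\<in>steps N. ?Q l). small * (1 / real N) ^ card (uvert x))"
  by (rule sum.UNION_disjoint[symmetric]) (auto simp: ending_def)
 also have "... \<le> (\<Sum>x\<in>(C \<times> C) \<times> (C \<times> C). small * (1 / real N) ^ card (uvert x))"
  by (rule sum_mono2) (use small_nonneg in \<open>auto simp: ending_def\<close>)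
 also have "... \<le> small * quads_bound"
  unfolding sum_distrib_left[symmetric] using small_nonneg sum_quads[OF N] by (rule mult_left_mono[rotated])
 finally show ?thesis .
qed

text \<open>The part of the conditional variance that is quadratic in the cycles.\<close>

definition qvar :: "'a => real" where
 "qvar x = (\<Sum>l\<in>steps N. moment l 2 * (coeff l x)\<^sup>2)"

definition pairs :: "(nat set \<times> nat set) set" where
 "pairs = {(a, a') \<in> C \<times> C. Max a = Max a'}"

definition pair_term :: "nat set \<times> nat set => 'a => real" where
 "pair_term x y = moment (Max (fst x)) 2 * (edge_prod (butmax (fst x)) y * edge_prod (butmax (snd x)) y)"

lemma finite_pairs [simp]: "finite pairs"
 unfolding pairs_def by (rule finite_subset[of _ "C \<times> C"]) auto

lemma pairsD: "x \<in> pairs ==> fst x \<in> C \<and> snd x \<in> C \<and> Max (fst x) = Max (snd x)"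
 by (auto simp: pairs_def)

lemma qvar_pairs: "qvar y = (\<Sum>x\<in>pairs. pair_term x y)"
proof -
 have "qvar y = (\<Sum>l\<in>steps N. \<Sum>x\<in>ending l \<times> ending l. pair_term x y)"
  unfolding qvar_def coeff_def sum_square_product[OF finite_ending] sum_distrib_left
  by (intro sum.cong refl) (auto simp: pair_term_def ending_def)
 also have "... = (\<Sum>x\<in>(\<Union>l\<in>steps N. ending l \<times> ending l). pair_term x y)"
  by (rule sum.UNION_disjoint[symmetric]) (auto simp: ending_def)
 also have "(\<Union>l\<in>steps N. ending l \<times> ending l) = pairs"
  using Max_in_C C_subset by (auto simp: ending_def pairs_def)
 finally show ?thesis .
qed

lemma pair_term_integrable: "x \<in> pairs ==> integrable P (pair_term x)"
 unfolding pair_term_def[abs_def] by (auto intro!: edge_prod2_integrable butmax_subset dest: pairsD)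

lemma expectation_pair_term: "expectation (pair_term x)
  = moment (Max (fst x)) 2 * expectation (\<lambda>y. edge_prod (butmax (fst x)) y * edge_prod (butmax (snd x)) y)"
 by (simp add: pair_term_def[abs_def])

lemma qvar_integrable: "integrable P qvar"
 unfolding qvar_pairs[abs_def] by (intro Bochner_Integration.integrable_sum pair_term_integrable)

lemma expectation_qvar: "expectation qvar = (\<Sum>c\<in>C. \<Prod>l\<in>c. moment l 2)"
proof -
 have "expectation qvar = (\<Sum>x\<in>pairs. expectation (pair_term x))"
  unfolding qvar_pairs[abs_def] by (rule Bochner_Integration.integral_sum[OF pair_term_integrable])
 also have "... = (\<Sum>x\<in>pairs. if fst x = snd x then \<Prod>l\<in>fst x. moment l 2 else 0)"
 proof (rule sum.cong[OF refl])
  fix x assume x: "x \<in> pairs"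
  then have C: "fst x \<in> C" "snd x \<in> C" and mx: "Max (fst x) = Max (snd x)" by (auto dest: pairsD)
  show "expectation (pair_term x) = (if fst x = snd x then \<Prod>l\<in>fst x. moment l 2 else 0)"
  proof (cases "fst x = snd x")
   case True
   have "expectation (pair_term x) = moment (Max (fst x)) 2 * (\<Prod>l\<in>butmax (fst x). moment l 2)"
    using True edge_prod2_square[OF butmax_subset[OF C(1)]] by (simp add: expectation_pair_term)
   also have "... = (\<Prod>l\<in>fst x. moment l 2)"
    unfolding butmax_def using prod.remove[OF cycle_finite[OF C_is_cycle[OF C(1)]] Max_in_C[OF C(1)]] by metis
   finally show ?thesis using True by simp
  next
   case False
   then have "butmax (fst x) \<noteq> butmax (snd x)"
    using Max_in_C[OF C(1)] Max_in_C[OF C(2)] mx unfolding butmax_def by (metis insert_Diff)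
   then show ?thesis using False edge_prod2_orthogonal[OF butmax_subset[OF C(1)] butmax_subset[OF C(2)]]
    by (simp add: expectation_pair_term)
  qed
 qed
 also have "... = (\<Sum>x\<in>(\<lambda>c. (c, c)) ` C. \<Prod>l\<in>fst x. moment l 2)"
  by (rule sum.mono_neutral_cong_right[OF finite_pairs]) (auto simp: pairs_def)
 also have "... = (\<Sum>c\<in>C. \<Prod>l\<in>c. moment l 2)" by (subst sum.reindex) (auto intro: inj_onI)
 finally show ?thesis .
qed

text \<open>
 Two pairs of cycles without common edge are uncorrelated, and so are those for which some edge other than
 the two last ones is used once.  The remaining configurations have few vertices.
\<close>

lemma pair_covariance:
 assumes N: "1 \<le> N" and x: "x \<in> pairs" and y: "y \<in> pairs"
 shows "integrable P (\<lambda>z. pair_term x z * pair_term y z)"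
  and "expectation (\<lambda>z. pair_term x z * pair_term y z) - expectation (pair_term x) * expectation (pair_term y)
   \<le> 2 * small * (1 / real N) ^ card (uvert (x, y))"
proof -
 obtain a a' b b' where [simp]: "x = (a, a')" "y = (b, b')" by (metis prod.collapse)
 have C: "a \<in> C" "a' \<in> C" "b \<in> C" "b' \<in> C" and mx: "Max a = Max a'" "Max b = Max b'"
  using pairsD[OF x] pairsD[OF y] by auto
 note s = butmax_subset[OF C(1)] butmax_subset[OF C(2)] butmax_subset[OF C(3)] butmax_subset[OF C(4)]
 define w where "w = moment (Max a) 2 * moment (Max b) 2"
 define E2 where "E2 a b = expectation (\<lambda>z. edge_prod (butmax a) z * edge_prod (butmax b) z)" for a b
 define E4 where "E4 = expectation (\<lambda>z. edge_prod (butmax a) z * edge_prod (butmax a') z * (edge_prod (butmax b) z * edge_prod (butmax b') z))"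
 define \<tau> where "\<tau> = B / sqrt (real N)"
 have eq: "pair_term x z * pair_term y z
   = w * (edge_prod (butmax a) z * edge_prod (butmax a') z * (edge_prod (butmax b) z * edge_prod (butmax b') z))" for z
  by (simp add: pair_term_def w_def mult_ac)
 show "integrable P (\<lambda>z. pair_term x z * pair_term y z)"
  unfolding eq using edge_prod4_integrable[OF s] by simp
 have cov: "expectation (\<lambda>z. pair_term x z * pair_term y z) - expectation (pair_term x) * expectation (pair_term y)
  = w * (E4 - E2 a a' * E2 b b')"
  unfolding eq expectation_pair_term by (simp add: E4_def E2_def w_def right_diff_distrib)
 show "expectation (\<lambda>z. pair_term x z * pair_term y z) - expectation (pair_term x) * expectation (pair_term y)
   \<le> 2 * small * (1 / real N) ^ card (uvert (x, y))"
 proof (cases "E4 - E2 a a' * E2 b b' = 0")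
  case True then show ?thesis unfolding cov using small_nonneg by simp
 next
  case False
  have nontriv: "\<not> (a = a' \<and> b = b' \<and> a \<inter> b = {})"
  proof
   assume "a = a' \<and> b = b' \<and> a \<inter> b = {}"
   then have "(butmax a \<union> butmax a') \<inter> (butmax b \<union> butmax b') = {}" by (auto simp: butmax_def)
   from edge_prod4_disjoint[OF s this] show False using False by (simp add: E4_def E2_def)
  qed
  have in_max: "Max a \<in> a" "Max a \<in> a'" "Max b \<in> b" "Max b \<in> b'"
   using Max_in_C[OF C(1)] Max_in_C[OF C(2)] Max_in_C[OF C(3)] Max_in_C[OF C(4)] mx by auto
  have bm: "butmax a = a - {Max a}" "butmax a' = a' - {Max a}" "butmax b = b - {Max b}" "butmax b' = b' - {Max b}"
   using mx by (auto simp: butmax_def)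
  have cases: "(a = a' \<and> b = b') \<or> (\<forall>l. cover (butmax a) (butmax a') (butmax b) (butmax b') l \<noteq> 1)"
  proof (cases "E4 = 0")
   case True
   then have "E2 a a' \<noteq> 0" "E2 b b' \<noteq> 0" using False by auto
   then have "butmax a = butmax a'" "butmax b = butmax b'"
    using edge_prod2_orthogonal s unfolding E2_def by blast+
   then have "a = a'" "b = b'" using in_max unfolding bm by (metis insert_Diff)+
   then show ?thesis by simp
  next
   case False
   then show ?thesis using edge_prod4_nonzero[OF s] unfolding E4_def by blast
  qed
  have cv: "l \<in> butmax a ==> l \<in> butmax a' \<or> l \<in> butmax b \<or> l \<in> butmax b'"
   "l \<in> butmax a' ==> l \<in> butmax a \<or> l \<in> butmax b \<or> l \<in> butmax b'"
   "l \<in> butmax b ==> l \<in> butmax a \<or> l \<in> butmax a' \<or> l \<in> butmax b'"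
   "l \<in> butmax b' ==> l \<in> butmax a \<or> l \<in> butmax a' \<or> l \<in> butmax b" for l
   using cases cover_cases[of "butmax a" "butmax a'" "butmax b" "butmax b'" l] by auto
  have lt: "2 * card (verts (a \<union> a' \<union> (b \<union> b'))) < card a + card a' + (card b + card b')"
   by (rule doubly_covered_cycles[OF C_is_cycle[OF C(1)] C_is_cycle[OF C(2)] C_is_cycle[OF C(3)] C_is_cycle[OF C(4)] in_max
      cv[unfolded bm] nontriv])
  have \<tau>0: "0 \<le> \<tau>" using B_ge_1 by (simp add: \<tau>_def)
  have w: "\<bar>w\<bar> \<le> \<tau>\<^sup>2 * \<tau>\<^sup>2"
   unfolding w_def abs_mult \<tau>_def
   by (intro mult_mono moment_le) (use in_max C_subset C in auto)
  have "\<bar>E4 - E2 a a' * E2 b b'\<bar> \<le> \<bar>E4\<bar> + \<bar>E2 a a'\<bar> * \<bar>E2 b b'\<bar>"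
   by (metis abs_mult abs_triangle_ineq4)
  also have "... \<le> \<tau> ^ (card (butmax a) + card (butmax a') + (card (butmax b) + card (butmax b')))
    + \<tau> ^ (card (butmax a) + card (butmax a')) * \<tau> ^ (card (butmax b) + card (butmax b'))"
   unfolding E4_def E2_def \<tau>_def
   by (intro add_mono mult_mono edge_prod4_le edge_prod2_le s) (use B_ge_1 in auto)
  also have "... = 2 * \<tau> ^ (card (butmax a) + card (butmax a') + (card (butmax b) + card (butmax b')))"
   by (simp add: power_add)
  finally have e: "\<bar>E4 - E2 a a' * E2 b b'\<bar> \<le> 2 * \<tau> ^ (card (butmax a) + card (butmax a') + (card (butmax b) + card (butmax b')))" .
  have "w * (E4 - E2 a a' * E2 b b') \<le> \<bar>w\<bar> * \<bar>E4 - E2 a a' * E2 b b'\<bar>"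
   by (metis abs_ge_self abs_mult)
  also have "... \<le> (\<tau>\<^sup>2 * \<tau>\<^sup>2) * (2 * \<tau> ^ (card (butmax a) + card (butmax a') + (card (butmax b) + card (butmax b'))))"
   by (intro mult_mono w e) auto
  also have "... = 2 * \<tau> ^ (4 + (card (butmax a) + card (butmax a') + (card (butmax b) + card (butmax b'))))"
   unfolding power_add by (simp add: power2_eq_square eval_nat_numeral)
  also have "4 + (card (butmax a) + card (butmax a') + (card (butmax b) + card (butmax b')))
    = card a + card a' + (card b + card b')"
   using card_butmax[OF C(1)] card_butmax[OF C(2)] card_butmax[OF C(3)] card_butmax[OF C(4)] by linarith
  also have "\<tau> ^ (card a + card a' + (card b + card b')) \<le> small * (1 / real N) ^ card (uvert (x, y))"
   unfolding \<tau>_def uvert_def using lt by (intro small_power N card_total_le C) simp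
  finally show ?thesis unfolding cov by simp
 qed
qed

lemma qvar_variance:
 assumes N: "1 \<le> N"
 shows "expectation (\<lambda>y. \<bar>qvar y - expectation qvar\<bar>) \<le> sqrt (2 * small * quads_bound)"
proof -
 have "qvar y * qvar y = (\<Sum>z\<in>pairs \<times> pairs. pair_term (fst z) y * pair_term (snd z) y)" for y
  by (simp add: qvar_pairs sum_product sum.cartesian_product case_prod_beta)
 then have sq: "(qvar y)\<^sup>2 = (\<Sum>z\<in>pairs \<times> pairs. pair_term (fst z) y * pair_term (snd z) y)" for y
  by (simp add: power2_eq_square)
 have i2: "integrable P (\<lambda>y. (qvar y)\<^sup>2)"
  unfolding sq by (intro Bochner_Integration.integrable_sum pair_covariance(1)[OF N]) auto
 have "variance qvar = expectation (\<lambda>y. (qvar y)\<^sup>2) - (expectation qvar)\<^sup>2"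
  by (rule variance_eq[OF qvar_integrable i2])
 also have "expectation (\<lambda>y. (qvar y)\<^sup>2) = (\<Sum>z\<in>pairs \<times> pairs. expectation (\<lambda>y. pair_term (fst z) y * pair_term (snd z) y))"
  unfolding sq by (rule Bochner_Integration.integral_sum) (auto intro: pair_covariance(1)[OF N])
 also have "(expectation qvar)\<^sup>2 = (\<Sum>z\<in>pairs \<times> pairs. expectation (pair_term (fst z)) * expectation (pair_term (snd z)))"
 proof -
  have "expectation qvar = (\<Sum>x\<in>pairs. expectation (pair_term x))"
   unfolding qvar_pairs[abs_def] by (rule Bochner_Integration.integral_sum[OF pair_term_integrable])
  then show ?thesis by (simp add: power2_eq_square sum_product sum.cartesian_product case_prod_beta)
 qed
 also have "(\<Sum>z\<in>pairs \<times> pairs. expectation (\<lambda>y. pair_term (fst z) y * pair_term (snd z) y))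
   - (\<Sum>z\<in>pairs \<times> pairs. expectation (pair_term (fst z)) * expectation (pair_term (snd z)))
   \<le> (\<Sum>z\<in>pairs \<times> pairs. 2 * small * (1 / real N) ^ card (uvert z))"
  unfolding sum_subtractf[symmetric]
 proof (rule sum_mono)
  fix z assume "z \<in> pairs \<times> pairs"
  then show "expectation (\<lambda>y. pair_term (fst z) y * pair_term (snd z) y)
    - expectation (pair_term (fst z)) * expectation (pair_term (snd z)) \<le> 2 * small * (1 / real N) ^ card (uvert z)"
   using pair_covariance(2)[OF N, of "fst z" "snd z"] by auto
 qed
 also have "... \<le> (\<Sum>z\<in>(C \<times> C) \<times> (C \<times> C). 2 * small * (1 / real N) ^ card (uvert z))"
  by (rule sum_mono2) (use small_nonneg in \<open>auto simp: pairs_def\<close>)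
 also have "... \<le> 2 * small * quads_bound"
  unfolding sum_distrib_left[symmetric] using small_nonneg sum_quads[OF N] by (intro mult_left_mono) auto
 finally have var: "variance qvar \<le> 2 * small * quads_bound" .
 have iv: "integrable P (\<lambda>y. (qvar y - expectation qvar)\<^sup>2)"
  using i2 qvar_integrable by (simp add: power2_diff)
 have "(expectation (\<lambda>y. \<bar>qvar y - expectation qvar\<bar>))\<^sup>2 \<le> expectation (\<lambda>y. \<bar>qvar y - expectation qvar\<bar>\<^sup>2)"
 proof -
  have "0 \<le> variance (\<lambda>y. \<bar>qvar y - expectation qvar\<bar>)" by simp
  also have "... = expectation (\<lambda>y. \<bar>qvar y - expectation qvar\<bar>\<^sup>2) - (expectation (\<lambda>y. \<bar>qvar y - expectation qvar\<bar>))\<^sup>2"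
   by (rule variance_eq) (use qvar_integrable iv in auto)
  finally show ?thesis by simp
 qed
 then show ?thesis using var by (intro real_le_rsqrt) simp
qed

end

context cycle_chaos
begin

definition pairs_bound :: real where
 "pairs_bound = (real (2 * m) + 1) * real (2 ^ (2 * m * (2 * m)) * 2 ^ (2 * m * (2 * m)))"

lemma sum_pairs:
 assumes "1 \<le> N"
 shows "(\<Sum>(a, b)\<in>C \<times> C. (1 / real N) ^ card (verts (a \<union> b))) \<le> pairs_bound"
 using sum_pairs_of_cycles[OF assms, of m] by (simp add: C_def pairs_bound_def)

lemma sum_single:
 assumes "1 \<le> N"
 shows "(\<Sum>c\<in>C. (1 / real N) ^ card c) \<le> pairs_bound"
proof -
 have "(\<Sum>c\<in>C. (1 / real N) ^ card c) = (\<Sum>x\<in>(\<lambda>c. (c, c)) ` C. (1 / real N) ^ card (verts (fst x \<union> snd x)))"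
  by (subst sum.reindex) (auto intro: inj_onI simp: cycle_card[OF C_is_cycle])
 also have "... \<le> (\<Sum>x\<in>C \<times> C. (1 / real N) ^ card (verts (fst x \<union> snd x)))"
  by (rule sum_mono2) auto
 also have "... \<le> pairs_bound" using sum_pairs[OF assms] by (simp add: case_prod_beta)
 finally show ?thesis .
qed

lemma power_2_rate: "1 \<le> N ==> k \<le> r ==> (B / sqrt (real N)) ^ (2 * k) \<le> B ^ (2 * r) * (1 / real N) ^ k"
proof -
 assume "1 \<le> N" "k \<le> r"
 have "(B / sqrt (real N)) ^ (2 * k) = B ^ (2 * k) * (1 / real N) ^ k"
  by (simp add: power_mult power_divide)
 also have "... \<le> B ^ (2 * r) * (1 / real N) ^ k"
  using B_ge_1 \<open>k \<le> r\<close> by (intro mult_right_mono power_increasing) auto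
 finally show ?thesis .
qed

lemma expectation_coeff2: "expectation (\<lambda>y. (coeff l y)\<^sup>2) \<le> (\<Sum>c\<in>ending l. (B / sqrt (real N)) ^ (2 * (card c - 1)))"
proof -
 have "expectation (\<lambda>y. (coeff l y)\<^sup>2) = expectation (\<lambda>y. \<Sum>x\<in>ending l \<times> ending l. edge_prod (butmax (fst x)) y * edge_prod (butmax (snd x)) y)"
  unfolding coeff_def sum_square_product[OF finite_ending] by (simp add: case_prod_beta)
 also have "... = (\<Sum>x\<in>ending l \<times> ending l. expectation (\<lambda>y. edge_prod (butmax (fst x)) y * edge_prod (butmax (snd x)) y))"
  by (rule Bochner_Integration.integral_sum) (auto intro!: edge_prod2_integrable butmax_subset ending_C)
 also have "... = (\<Sum>x\<in>(\<lambda>c. (c, c)) ` ending l. expectation (\<lambda>y. edge_prod (butmax (fst x)) y * edge_prod (butmax (snd x)) y))"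
 proof (rule sum.mono_neutral_right)
  show "\<forall>x\<in>ending l \<times> ending l - (\<lambda>c. (c, c)) ` ending l. expectation (\<lambda>y. edge_prod (butmax (fst x)) y * edge_prod (butmax (snd x)) y) = 0"
  proof
   fix x assume x: "x \<in> ending l \<times> ending l - (\<lambda>c. (c, c)) ` ending l"
   obtain a b where [simp]: "x = (a, b)" by (cases x)
   have c: "a \<in> C" "b \<in> C" "Max a = Max b" "a \<noteq> b" using x unfolding ending_def by auto
   have "butmax a \<noteq> butmax b"
   proof
    assume "butmax a = butmax b"
    then have "insert (Max a) (a - {Max a}) = insert (Max a) (b - {Max b})" by (simp add: butmax_def)
    then show False using Max_in_C[OF c(1)] Max_in_C[OF c(2)] c(3,4) by (simp add: insert_absorb)
   qed
   then show "expectation (\<lambda>y. edge_prod (butmax (fst x)) y * edge_prod (butmax (snd x)) y) = 0"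
    using edge_prod2_orthogonal[OF butmax_subset[OF c(1)] butmax_subset[OF c(2)]] by simp
  qed
 qed auto
 also have "... = (\<Sum>c\<in>ending l. expectation (\<lambda>y. edge_prod (butmax c) y * edge_prod (butmax c) y))"
  by (subst sum.reindex) (auto intro: inj_onI)
 also have "... \<le> (\<Sum>c\<in>ending l. (B / sqrt (real N)) ^ (2 * (card c - 1)))"
 proof (rule sum_mono)
  fix c assume "c \<in> ending l"
  then have c: "c \<in> C" by (rule ending_C)
  have "expectation (\<lambda>y. edge_prod (butmax c) y * edge_prod (butmax c) y) \<le> (B / sqrt (real N)) ^ (card (butmax c) + card (butmax c))"
   using edge_prod2_le[OF butmax_subset[OF c] butmax_subset[OF c]] by (rule order_trans[OF abs_ge_self])
  also have "card (butmax c) + card (butmax c) = 2 * (card c - 1)" using card_butmax[OF c] by simp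
  finally show "expectation (\<lambda>y. edge_prod (butmax c) y * edge_prod (butmax c) y) \<le> (B / sqrt (real N)) ^ (2 * (card c - 1))" .
 qed
 finally show ?thesis .
qed

lemma sum_coeff2:
 assumes N: "1 \<le> N"
 shows "(\<Sum>l\<in>steps N. expectation (\<lambda>x. (coeff l x)\<^sup>2)) \<le> real N * (B ^ (2 * m) * pairs_bound)"
proof -
 have "(\<Sum>l\<in>steps N. expectation (\<lambda>x. (coeff l x)\<^sup>2)) \<le> (\<Sum>l\<in>steps N. \<Sum>c\<in>ending l. (B / sqrt (real N)) ^ (2 * (card c - 1)))"
  by (rule sum_mono) (rule expectation_coeff2)
 also have "... = (\<Sum>c\<in>C. (B / sqrt (real N)) ^ (2 * (card c - 1)))" by (rule sum_over_ending)
 also have "... \<le> (\<Sum>c\<in>C. real N * (B ^ (2 * m) * (1 / real N) ^ card c))"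
 proof (rule sum_mono)
  fix c assume c: "c \<in> C"
  have 3: "3 \<le> card c" by (rule cycle_card_ge[OF C_is_cycle[OF c]])
  have "(B / sqrt (real N)) ^ (2 * (card c - 1)) \<le> B ^ (2 * m) * (1 / real N) ^ (card c - 1)"
   using C_card[OF c] by (intro power_2_rate N) simp
  also have "(1 / real N) ^ (card c - 1) = real N * (1 / real N) ^ card c"
   using 3 N by (cases "card c") auto
  finally show "(B / sqrt (real N)) ^ (2 * (card c - 1)) \<le> real N * (B ^ (2 * m) * (1 / real N) ^ card c)"
   by (simp add: mult_ac)
 qed
 also have "... = real N * (B ^ (2 * m) * (\<Sum>c\<in>C. (1 / real N) ^ card c))" by (simp add: sum_distrib_left)
 also have "... \<le> real N * (B ^ (2 * m) * pairs_bound)"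
  using B_ge_1 by (intro mult_left_mono sum_single N) auto
 finally show ?thesis .
qed

text \<open>
 The arithmetic--geometric inequality at the scale \<open>sqrt N\<close> reduces first moments to second moments; there are
 \<open>N\<^sup>2\<close> edges, which accounts for the order \<open>N * sqrt N\<close>.
\<close>

lemma sum_abs_coeff:
 assumes N: "1 \<le> N"
 shows "(\<Sum>l\<in>steps N. expectation (\<lambda>x. \<bar>coeff l x\<bar>)) \<le> real N * sqrt (real N) * (1 + B ^ (2 * m) * pairs_bound)"
proof -
 define s where "s = sqrt (real N)"
 have s: "0 < s" "s * s = real N" using N by (auto simp: s_def)
 have "expectation (\<lambda>x. \<bar>coeff l x\<bar>) \<le> 1 / s + s * expectation (\<lambda>x. (coeff l x)\<^sup>2)" for l
 proof -
  have "expectation (\<lambda>x. \<bar>coeff l x\<bar>) \<le> expectation (\<lambda>x. 1 / s + s * (coeff l x)\<^sup>2)"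
  proof (rule integral_mono)
   show "integrable P (\<lambda>x. \<bar>coeff l x\<bar>)" using coeff_integrable by auto
   show "integrable P (\<lambda>x. 1 / s + s * (coeff l x)\<^sup>2)" using coeff2_integrable by auto
   fix x
   have "0 \<le> (s * \<bar>coeff l x\<bar> - 1)\<^sup>2" by simp
   then have "2 * (s * \<bar>coeff l x\<bar>) \<le> 1 + s * (s * (coeff l x)\<^sup>2)"
    by (simp add: power2_diff power_mult_distrib power2_eq_square[of s] mult.assoc)
   moreover have "0 \<le> s * \<bar>coeff l x\<bar>" using s by simp
   ultimately have "s * \<bar>coeff l x\<bar> \<le> 1 + s * (s * (coeff l x)\<^sup>2)" by linarith
   then show "\<bar>coeff l x\<bar> \<le> 1 / s + s * (coeff l x)\<^sup>2" using s by (simp add: field_simps)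
  qed
  also have "... = 1 / s + s * expectation (\<lambda>x. (coeff l x)\<^sup>2)" using coeff2_integrable by (simp add: prob_space)
  finally show ?thesis .
 qed
 then have "(\<Sum>l\<in>steps N. expectation (\<lambda>x. \<bar>coeff l x\<bar>)) \<le> (\<Sum>l\<in>steps N. 1 / s + s * expectation (\<lambda>x. (coeff l x)\<^sup>2))"
  by (rule sum_mono)
 also have "... = real (card (steps N)) / s + s * (\<Sum>l\<in>steps N. expectation (\<lambda>x. (coeff l x)\<^sup>2))"
  by (simp add: sum.distrib sum_distrib_left)
 also have "... \<le> (real N * real N) / s + s * (real N * (B ^ (2 * m) * pairs_bound))"
 proof -
  have "real (card (steps N)) \<le> real N * real N" using card_steps[of N] by (metis of_nat_le_iff of_nat_mult)
  then show ?thesis using s by (intro add_mono divide_right_mono mult_left_mono sum_coeff2 N) auto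
 qed
 also have "... = real N * s * (1 + B ^ (2 * m) * pairs_bound)"
  using s by (simp add: field_simps flip: s(2))
 finally show ?thesis by (simp add: s_def)
qed

text \<open>
 Three contributions: the distance of the mean conditional variance from \<open>v\<close>, the covariances of \<open>u\<close> and
 \<open>h\<close> weighted by \<open>coeff\<close>, and the fluctuation of the part that is quadratic in the cycles.
\<close>

lemma conditional_variance_concentration:
 assumes N: "1 \<le> N" and n: "steps N \<subseteq> {..<n}"
  and cov: "\<And>l. l \<in> steps N ==> \<bar>expectation (\<lambda>x. u l x * h l x)\<bar> \<le> \<kappa>"
 shows "expectation (\<lambda>x. \<bar>(\<Sum>l<n. cond_var l x) - v\<bar>)
  \<le> \<bar>(\<Sum>l\<in>steps N. expectation (\<lambda>x. (u l x)\<^sup>2)) + (\<Sum>c\<in>C. \<Prod>l\<in>c. moment l 2) - v\<bar>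
   + 2 * \<kappa> * (real N * sqrt (real N) * (1 + B ^ (2 * m) * pairs_bound)) + sqrt (2 * small * quads_bound)"
proof -
 define a where "a = (\<Sum>l\<in>steps N. expectation (\<lambda>x. (u l x)\<^sup>2))"
 define k where "k l = expectation (\<lambda>x. u l x * h l x)" for l
 define L where "L x = (\<Sum>l\<in>steps N. \<bar>k l\<bar> * \<bar>coeff l x\<bar>)" for x
 have V: "(\<Sum>l<n. cond_var l x) = a + 2 * (\<Sum>l\<in>steps N. k l * coeff l x) + qvar x" for x
 proof -
  have "(\<Sum>l<n. cond_var l x) = (\<Sum>l\<in>steps N. cond_var l x)"
   using n by (intro sum.mono_neutral_right) (auto simp: cond_var_def)
  also have "... = (\<Sum>l\<in>steps N. expectation (\<lambda>x. (u l x)\<^sup>2) + 2 * (k l * coeff l x) + moment l 2 * (coeff l x)\<^sup>2)"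
   by (rule sum.cong) (auto simp: cond_var_def k_def)
  finally show ?thesis by (simp add: sum.distrib a_def qvar_def sum_distrib_left)
 qed
 have Li: "integrable P L" unfolding L_def[abs_def] using coeff_integrable by auto
 have lin: "\<bar>\<Sum>l\<in>steps N. k l * coeff l x\<bar> \<le> L x" for x
  unfolding L_def abs_mult[symmetric] by (rule sum_abs)
 have EL: "expectation L \<le> \<kappa> * (real N * sqrt (real N) * (1 + B ^ (2 * m) * pairs_bound))"
 proof -
  have "0 \<in> {..<N}" using N by simp
  then have "edge 0 0 \<in> steps N" unfolding steps_def by blast
  then have \<kappa>0: "0 \<le> \<kappa>" using cov[of "edge 0 0"] by linarith
  have "expectation L = (\<Sum>l\<in>steps N. \<bar>k l\<bar> * expectation (\<lambda>x. \<bar>coeff l x\<bar>))"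
   unfolding L_def[abs_def] using coeff_integrable by (subst Bochner_Integration.integral_sum) auto
  also have "... \<le> (\<Sum>l\<in>steps N. \<kappa> * expectation (\<lambda>x. \<bar>coeff l x\<bar>))"
   using cov by (intro sum_mono mult_right_mono) (auto simp: k_def)
  also have "... = \<kappa> * (\<Sum>l\<in>steps N. expectation (\<lambda>x. \<bar>coeff l x\<bar>))" by (simp add: sum_distrib_left)
  also have "... \<le> \<kappa> * (real N * sqrt (real N) * (1 + B ^ (2 * m) * pairs_bound))"
   by (rule mult_left_mono[OF sum_abs_coeff[OF N] \<kappa>0])
  finally show ?thesis .
 qed
 have "expectation (\<lambda>x. \<bar>(\<Sum>l<n. cond_var l x) - v\<bar>)
   \<le> expectation (\<lambda>x. \<bar>a + expectation qvar - v\<bar> + 2 * L x + \<bar>qvar x - expectation qvar\<bar>)"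
 proof (rule integral_mono)
  show "integrable P (\<lambda>x. \<bar>(\<Sum>l<n. cond_var l x) - v\<bar>)"
   unfolding V using qvar_integrable coeff_integrable by auto
  show "integrable P (\<lambda>x. \<bar>a + expectation qvar - v\<bar> + 2 * L x + \<bar>qvar x - expectation qvar\<bar>)"
   using qvar_integrable Li by auto
  fix x
  show "\<bar>(\<Sum>l<n. cond_var l x) - v\<bar> \<le> \<bar>a + expectation qvar - v\<bar> + 2 * L x + \<bar>qvar x - expectation qvar\<bar>"
   unfolding V using lin[of x] by linarith
 qed
 also have "... = \<bar>a + expectation qvar - v\<bar> + 2 * expectation L + expectation (\<lambda>x. \<bar>qvar x - expectation qvar\<bar>)"
  using qvar_integrable Li by (simp add: prob_space)
 also have "... \<le> \<bar>a + expectation qvar - v\<bar> + 2 * (\<kappa> * (real N * sqrt (real N) * (1 + B ^ (2 * m) * pairs_bound)))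
   + sqrt (2 * small * quads_bound)"
  using EL qvar_variance[OF N] by (intro add_mono) auto
 finally show ?thesis by (simp add: a_def expectation_qvar mult.assoc)
qed

lemma fourth_moment_sum:
 assumes N: "1 \<le> N" and n: "steps N \<subseteq> {..<n}"
 shows "(\<Sum>l<n. expectation (\<lambda>x. chaos_step l x ^ 4))
  \<le> 8 * (\<Sum>l\<in>steps N. expectation (\<lambda>x. u l x ^ 4)) + 8 * (small * quads_bound)"
proof -
 interpret W: weak_martingale_differences P past chaos_step cond_var by (rule chaos_martingale)
 have "(\<Sum>l<n. expectation (\<lambda>x. chaos_step l x ^ 4)) = (\<Sum>l\<in>steps N. expectation (\<lambda>x. chaos_step l x ^ 4))"
  using n by (intro sum.mono_neutral_right) (auto simp: chaos_step_def)
 also have "... \<le> (\<Sum>l\<in>steps N. 8 * (expectation (\<lambda>x. u l x ^ 4) + expectation (\<lambda>x. (h l x * coeff l x) ^ 4)))"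
 proof (rule sum_mono)
  fix l assume l: "l \<in> steps N"
  have "expectation (\<lambda>x. chaos_step l x ^ 4) \<le> expectation (\<lambda>x. 8 * (u l x ^ 4 + (h l x * coeff l x) ^ 4))"
  proof (rule integral_mono[OF W.D4_integrable])
   show "integrable P (\<lambda>x. 8 * (u l x ^ 4 + (h l x * coeff l x) ^ 4))"
    using u_fourth[OF l] chaos_fourth_integrable by auto
   show "chaos_step l x ^ 4 \<le> 8 * (u l x ^ 4 + (h l x * coeff l x) ^ 4)" for x
    using l fourth_power_sum_le by (simp add: chaos_step_def)
  qed
  then show "expectation (\<lambda>x. chaos_step l x ^ 4) \<le> 8 * (expectation (\<lambda>x. u l x ^ 4) + expectation (\<lambda>x. (h l x * coeff l x) ^ 4))"
   using u_fourth[OF l] chaos_fourth_integrable by simp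
 qed
 also have "... = 8 * (\<Sum>l\<in>steps N. expectation (\<lambda>x. u l x ^ 4)) + 8 * (\<Sum>l\<in>steps N. expectation (\<lambda>x. (h l x * coeff l x) ^ 4))"
  by (simp add: sum.distrib sum_distrib_left)
 finally show ?thesis using chaos_fourth_sum[OF N] by linarith
qed

subsection \<open>The effect of small means\<close>

text \<open>
 What remains of the cycle products of shifted variables besides the pure cycle sums and the pure means:
 the products in which both occur.
\<close>

definition mixed :: "(nat => real) => 'a => real" where
 "mixed \<mu> x = (\<Sum>c\<in>C. \<Prod>l\<in>c. (h l x + \<mu> l)) - (\<Sum>c\<in>C. edge_prod c x) - (\<Sum>c\<in>C. \<Prod>l\<in>c. \<mu> l)"

definition parts :: "(nat set \<times> nat set) set" where
 "parts = (SIGMA c:C. Pow c - {{}, c})"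

lemma finite_parts [simp]: "finite parts"
 unfolding parts_def by (intro finite_SigmaI) (auto intro: cycle_finite[OF C_is_cycle])

lemma mixed_eq: "mixed \<mu> y = (\<Sum>x\<in>parts. (\<Prod>l\<in>fst x - snd x. \<mu> l) * edge_prod (snd x) y)"
proof -
 have "(\<Prod>l\<in>c. (h l y + \<mu> l)) = edge_prod c y + (\<Prod>l\<in>c. \<mu> l) + (\<Sum>A\<in>Pow c - {{}, c}. (\<Prod>l\<in>c - A. \<mu> l) * edge_prod A y)"
  if c: "c \<in> C" for c
 proof -
  have fc: "finite c" by (rule cycle_finite[OF C_is_cycle[OF c]])
  have ne: "c \<noteq> {}" using Max_in_C[OF c] by auto
  have "(\<Prod>l\<in>c. (h l y + \<mu> l)) = (\<Sum>A\<in>Pow c. edge_prod A y * (\<Prod>l\<in>c - A. \<mu> l))"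
   unfolding edge_prod_def by (rule prod_add[OF fc])
  also have "... = edge_prod {} y * (\<Prod>l\<in>c - {}. \<mu> l) + (edge_prod c y * (\<Prod>l\<in>c - c. \<mu> l)
    + (\<Sum>A\<in>Pow c - {{}} - {c}. edge_prod A y * (\<Prod>l\<in>c - A. \<mu> l)))"
   using fc ne by (subst sum.remove[of _ "{}"], simp, simp, subst sum.remove[of _ c]) auto
  also have "Pow c - {{}} - {c} = Pow c - {{}, c}" by auto
  finally show ?thesis by (simp add: mult_ac)
 qed
 then have "(\<Sum>c\<in>C. \<Prod>l\<in>c. (h l y + \<mu> l)) = (\<Sum>c\<in>C. edge_prod c y) + (\<Sum>c\<in>C. \<Prod>l\<in>c. \<mu> l)
   + (\<Sum>c\<in>C. \<Sum>A\<in>Pow c - {{}, c}. (\<Prod>l\<in>c - A. \<mu> l) * edge_prod A y)"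
  by (simp add: sum.distrib)
 also have "(\<Sum>c\<in>C. \<Sum>A\<in>Pow c - {{}, c}. (\<Prod>l\<in>c - A. \<mu> l) * edge_prod A y) = (\<Sum>x\<in>parts. (\<Prod>l\<in>fst x - snd x. \<mu> l) * edge_prod (snd x) y)"
  unfolding parts_def by (subst sum.Sigma) (auto intro: cycle_finite[OF C_is_cycle] simp: case_prod_beta)
 finally show ?thesis by (simp add: mixed_def)
qed

text \<open>
 A mixed term contains a proper part of a cycle, which has more vertices than edges.  The means on the
 remaining edges are of the order \<open>1 / N\<close>, so the mean square of the sum is of that order too.
\<close>

lemma mixed_small:
 assumes N: "1 \<le> N" and \<mu>: "\<And>l. l \<in> steps N ==> 0 \<le> \<mu> l \<and> \<mu> l \<le> (B / sqrt (real N))\<^sup>2"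
 shows "integrable P (mixed \<mu>)" "expectation (\<lambda>v. \<bar>mixed \<mu> v\<bar>) \<le> sqrt (4 ^ m * B ^ (4 * m) * pairs_bound / real N)"
proof -
 define w where "w x = (\<Prod>l\<in>fst x - snd x. \<mu> l)" for x :: "nat set \<times> nat set"
 define \<tau> where "\<tau> = B / sqrt (real N)"
 have \<tau>0: "0 \<le> \<tau>" using B_ge_1 by (simp add: \<tau>_def)
 have part: "fst x \<in> C \<and> snd x \<subseteq> fst x \<and> snd x \<noteq> {} \<and> snd x \<noteq> fst x \<and> snd x \<subseteq> steps N" if "x \<in> parts" for x
 proof -
  have "fst x \<in> C \<and> snd x \<subseteq> fst x \<and> snd x \<noteq> {} \<and> snd x \<noteq> fst x"
   using that by (auto simp: parts_def)
  then show ?thesis using C_subset[of "fst x"] by blast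
 qed
 have wb: "0 \<le> w x \<and> w x \<le> \<tau> ^ (2 * (card (fst x) - card (snd x)))" if x: "x \<in> parts" for x
 proof -
  have "fst x \<subseteq> steps N" using part[OF x] C_subset by blast
  then have *: "0 \<le> \<mu> l \<and> \<mu> l \<le> \<tau>\<^sup>2" if "l \<in> fst x - snd x" for l using \<mu> that by (auto simp: \<tau>_def)
  have "0 \<le> w x" unfolding w_def using * by (intro prod_nonneg) blast
  moreover have "w x \<le> (\<Prod>l\<in>fst x - snd x. \<tau>\<^sup>2)" unfolding w_def using * by (rule prod_mono)
  moreover have "(\<Prod>l\<in>fst x - snd x. \<tau>\<^sup>2) = \<tau> ^ (2 * (card (fst x) - card (snd x)))"
  proof -
   have "finite (snd x)" using part[OF x] finite_subset finite_steps by blast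
   then show ?thesis using part[OF x] by (simp add: power_mult card_Diff_subset)
  qed
  ultimately show ?thesis by simp
 qed
 have eq: "mixed \<mu> v = (\<Sum>x\<in>parts. w x * edge_prod (snd x) v)" for v by (simp add: mixed_eq w_def)
 have sq: "(mixed \<mu> v)\<^sup>2 = (\<Sum>z\<in>parts \<times> parts. (w (fst z) * w (snd z)) * (edge_prod (snd (fst z)) v * edge_prod (snd (snd z)) v))" for v
  unfolding eq sum_square_product[OF finite_parts] by (simp add: case_prod_beta mult_ac)
 show i: "integrable P (mixed \<mu>)"
  unfolding eq[abs_def] by (intro Bochner_Integration.integrable_sum integrable_mult_right edge_prod_integrable) (use part in blast)
 have e2i: "integrable P (\<lambda>v. edge_prod (snd (fst z)) v * edge_prod (snd (snd z)) v)" if "z \<in> parts \<times> parts" for z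
  using that part by (intro edge_prod2_integrable) (auto simp: mem_Times_iff)
 have i2: "integrable P (\<lambda>v. (mixed \<mu> v)\<^sup>2)"
  unfolding sq by (intro Bochner_Integration.integrable_sum integrable_mult_right e2i)
 have term_le: "w x * w y * expectation (\<lambda>v. edge_prod (snd x) v * edge_prod (snd y) v)
   \<le> B ^ (4 * m) / real N * (1 / real N) ^ card (verts (fst x \<union> fst y))" (is "_ \<le> ?r")
  if x: "x \<in> parts" and y: "y \<in> parts" for x y
 proof (cases "snd x = snd y")
  case False
  then have "expectation (\<lambda>v. edge_prod (snd x) v * edge_prod (snd y) v) = 0"
   using part[OF x] part[OF y] by (intro edge_prod2_orthogonal) auto
  then show ?thesis using B_ge_1 by simp
 next
  case True
  let ?c = "fst x" and ?d = "fst y" and ?A = "snd x"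
  note px = part[OF x] and py = part[OF y]
  have fin: "finite ?c" "finite ?d" using px py cycle_finite[OF C_is_cycle] by auto
  then have cA: "card ?A \<le> card ?c" "card ?A \<le> card ?d" using px py True by (auto intro: card_mono)
  have "w x * w y * expectation (\<lambda>v. edge_prod ?A v * edge_prod (snd y) v)
    \<le> w x * w y * \<tau> ^ (card ?A + card ?A)"
   using wb[OF x] wb[OF y] edge_prod2_le[of ?A "snd y"] px py True
   by (intro mult_left_mono mult_nonneg_nonneg) (auto simp: \<tau>_def)
  also have "... \<le> \<tau> ^ (2 * (card ?c - card ?A)) * \<tau> ^ (2 * (card ?d - card ?A)) * \<tau> ^ (card ?A + card ?A)"
   using wb[OF x] wb[OF y] True \<tau>0 by (intro mult_right_mono mult_mono) auto
  also have "... = \<tau> ^ (2 * (card ?c + card ?d - card ?A))"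
   unfolding power_add[symmetric] using cA by (intro arg_cong[where f="\<lambda>n. \<tau> ^ n"]) auto
  also have "... \<le> B ^ (2 * (2 * m)) * (1 / real N) ^ (card ?c + card ?d - card ?A)"
   unfolding \<tau>_def using C_card[of ?c] C_card[of ?d] px py by (intro power_2_rate N) auto
  also have "... \<le> B ^ (2 * (2 * m)) * (1 / real N) ^ (Suc (card (verts (?c \<union> ?d))))"
  proof (intro mult_left_mono power_decreasing)
   have "card (verts (?c \<union> ?d)) + card (verts ?c \<inter> verts ?d) = card ?c + card ?d"
    using card_Un_Int[of "verts ?c" "verts ?d"] fin cycle_card[OF C_is_cycle] px py by (simp add: verts_Un)
   moreover have "card ?A + 1 \<le> card (verts ?c \<inter> verts ?d)"
   proof -
    have "card ?A + 1 \<le> card (verts ?A)"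
     using px C_is_cycle by (intro proper_part_of_cycle[of ?c]) auto
    also have "... \<le> card (verts ?c \<inter> verts ?d)"
     using px py True fin by (intro card_mono) (auto simp: verts_def)
    finally show ?thesis .
   qed
   ultimately show "Suc (card (verts (?c \<union> ?d))) \<le> card ?c + card ?d - card ?A" by linarith
  qed (use N B_ge_1 in auto)
  finally show ?thesis by simp
 qed
 have "expectation (\<lambda>v. (mixed \<mu> v)\<^sup>2)
   = (\<Sum>z\<in>parts \<times> parts. w (fst z) * w (snd z) * expectation (\<lambda>v. edge_prod (snd (fst z)) v * edge_prod (snd (snd z)) v))"
  unfolding sq by (subst Bochner_Integration.integral_sum) (auto intro!: integrable_mult_right e2i)
 also have "... \<le> (\<Sum>z\<in>parts \<times> parts. B ^ (4 * m) / real N * (1 / real N) ^ card (verts (fst (fst z) \<union> fst (snd z))))"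
 proof (rule sum_mono)
  fix z assume "z \<in> parts \<times> parts"
  then have "fst z \<in> parts" "snd z \<in> parts" by auto
  then show "w (fst z) * w (snd z) * expectation (\<lambda>v. edge_prod (snd (fst z)) v * edge_prod (snd (snd z)) v)
    \<le> B ^ (4 * m) / real N * (1 / real N) ^ card (verts (fst (fst z) \<union> fst (snd z)))"
   by (rule term_le)
 qed
 also have "... = (\<Sum>c\<in>C. \<Sum>A\<in>Pow c - {{}, c}. \<Sum>d\<in>C. \<Sum>A'\<in>Pow d - {{}, d}. B ^ (4 * m) / real N * (1 / real N) ^ card (verts (c \<union> d)))"
 proof -
  let ?g = "\<lambda>c d. B ^ (4 * m) / real N * (1 / real N) ^ card (verts (c \<union> d))"
  have 2: "(\<Sum>x\<in>parts. g (fst x)) = (\<Sum>c\<in>C. \<Sum>A\<in>Pow c - {{}, c}. g c)" for g :: "nat set => real"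
   unfolding parts_def by (subst sum.Sigma) (auto intro: cycle_finite[OF C_is_cycle] simp: case_prod_beta)
  have "(\<Sum>z\<in>parts \<times> parts. ?g (fst (fst z)) (fst (snd z))) = (\<Sum>x\<in>parts. \<Sum>y\<in>parts. ?g (fst x) (fst y))"
   by (simp add: sum.cartesian_product case_prod_beta)
  also have "... = (\<Sum>x\<in>parts. \<Sum>d\<in>C. \<Sum>A'\<in>Pow d - {{}, d}. ?g (fst x) d)"
   by (rule sum.cong[OF refl]) (rule 2)
  also have "... = (\<Sum>c\<in>C. \<Sum>A\<in>Pow c - {{}, c}. \<Sum>d\<in>C. \<Sum>A'\<in>Pow d - {{}, d}. ?g c d)"
   by (rule 2)
  finally show ?thesis .
 qed
 also have "... \<le> (\<Sum>c\<in>C. \<Sum>d\<in>C. 2 ^ m * 2 ^ m * (B ^ (4 * m) / real N * (1 / real N) ^ card (verts (c \<union> d))))"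
 proof (rule sum_mono)
  fix c assume c: "c \<in> C"
  let ?g = "\<lambda>d. B ^ (4 * m) / real N * (1 / real N) ^ card (verts (c \<union> d))"
  have g0: "0 \<le> ?g d" for d using B_ge_1 by simp
  have pw: "real (card (Pow d - {{}, d})) \<le> 2 ^ m" if d: "d \<in> C" for d
  proof -
   have "card (Pow d - {{}, d}) \<le> card (Pow d)" by (rule card_mono) (use cycle_finite[OF C_is_cycle[OF d]] in auto)
   also have "... \<le> 2 ^ m" using C_card[OF d] cycle_finite[OF C_is_cycle[OF d]] by (simp add: card_Pow)
   finally show ?thesis by (metis of_nat_le_iff of_nat_numeral of_nat_power)
  qed
  have "(\<Sum>A\<in>Pow c - {{}, c}. \<Sum>d\<in>C. \<Sum>A'\<in>Pow d - {{}, d}. ?g d)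
    = real (card (Pow c - {{}, c})) * (\<Sum>d\<in>C. real (card (Pow d - {{}, d})) * ?g d)" by simp
  also have "... \<le> 2 ^ m * (\<Sum>d\<in>C. 2 ^ m * ?g d)"
   using g0 pw c B_ge_1 by (intro mult_mono sum_mono mult_right_mono sum_nonneg mult_nonneg_nonneg) auto
  finally show "(\<Sum>A\<in>Pow c - {{}, c}. \<Sum>d\<in>C. \<Sum>A'\<in>Pow d - {{}, d}. ?g d) \<le> (\<Sum>d\<in>C. 2 ^ m * 2 ^ m * ?g d)"
   by (simp add: sum_distrib_left mult.assoc)
 qed
 also have "... = 4 ^ m * B ^ (4 * m) / real N * (\<Sum>(c, d)\<in>C \<times> C. (1 / real N) ^ card (verts (c \<union> d)))"
  by (simp add: sum.cartesian_product case_prod_beta sum_distrib_left mult_ac flip: power_mult_distrib)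
 also have "... \<le> 4 ^ m * B ^ (4 * m) / real N * pairs_bound"
  using B_ge_1 by (intro mult_left_mono sum_pairs N) auto
 finally have s: "expectation (\<lambda>v. (mixed \<mu> v)\<^sup>2) \<le> 4 ^ m * B ^ (4 * m) * pairs_bound / real N" by simp
 have "0 \<le> variance (\<lambda>v. \<bar>mixed \<mu> v\<bar>)" by simp
 also have "... = expectation (\<lambda>v. \<bar>mixed \<mu> v\<bar>\<^sup>2) - (expectation (\<lambda>v. \<bar>mixed \<mu> v\<bar>))\<^sup>2"
  by (rule variance_eq) (use i i2 in auto)
 finally show "expectation (\<lambda>v. \<bar>mixed \<mu> v\<bar>) \<le> sqrt (4 ^ m * B ^ (4 * m) * pairs_bound / real N)"
  using s by (intro real_le_rsqrt) simp
qed

end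

section \<open>The central limit theorem for cycle sums\<close>

lemma iexp_lipschitz: "cmod (iexp x - iexp y) \<le> \<bar>x - y\<bar>"
proof -
 have "iexp x - iexp y = iexp y * (iexp (x - y) - 1)"
  by (simp add: right_diff_distrib exp_add[symmetric])
 then have "cmod (iexp x - iexp y) = cmod (iexp (x - y) - 1)" by (simp only: norm_mult norm_exp_i_times mult_1)
 also have "... \<le> \<bar>x - y\<bar>" using iexp_approx1[of "x - y" 0] by simp
 finally show ?thesis .
qed

lemma (in prob_space) characteristic_perturbation:
 assumes [measurable]: "X \<in> borel_measurable M" "Y \<in> borel_measurable M" and i: "integrable M (\<lambda>x. Y x)"
 shows "cmod (expectation (\<lambda>x. iexp (t * (X x + Y x))) - expectation (\<lambda>x. iexp (t * X x))) \<le> \<bar>t\<bar> * expectation (\<lambda>x. \<bar>Y x\<bar>)"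
proof -
 have j: "integrable M (\<lambda>x. iexp (t * (X x + Y x)))" "integrable M (\<lambda>x. iexp (t * X x))"
  by (rule integrable_const_bound[where B=1]; simp)+
 have "cmod (expectation (\<lambda>x. iexp (t * (X x + Y x)) - iexp (t * X x))) \<le> expectation (\<lambda>x. \<bar>t\<bar> * \<bar>Y x\<bar>)"
 proof (rule norm_integral_le)
  show "integrable M (\<lambda>x. iexp (t * (X x + Y x)) - iexp (t * X x))" using j by (rule Bochner_Integration.integrable_diff)
  show "integrable M (\<lambda>x. \<bar>t\<bar> * \<bar>Y x\<bar>)" using i by auto
  fix x
  have "cmod (iexp (t * (X x + Y x)) - iexp (t * X x)) \<le> \<bar>t * (X x + Y x) - t * X x\<bar>" by (rule iexp_lipschitz)
  also have "... = \<bar>t\<bar> * \<bar>Y x\<bar>" by (simp add: distrib_left abs_mult)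
  finally show "cmod (iexp (t * (X x + Y x)) - iexp (t * X x)) \<le> \<bar>t\<bar> * \<bar>Y x\<bar>" .
 qed
 then show ?thesis using Bochner_Integration.integral_diff[OF j] by simp
qed

text \<open>
 The variables may have means, as they do under the planted law.  Centring them splits the cycle sum into the
 martingale, a deterministic drift and mixed terms that vanish.
\<close>

theorem cycle_sum_clt:
 fixes P :: "nat => 'a measure" and u h :: "nat => nat => 'a => real" and t :: real
 assumes prob: "\<And>N. prob_space (P N)"
  and indep: "\<And>N. prob_space.indep_vars (P N) (\<lambda>_. borel) (\<lambda>l y. (u N l y, h N l y)) (steps N)"
  and u4: "\<And>N l. l \<in> steps N ==> integrable (P N) (\<lambda>y. u N l y ^ 4)"
  and h4: "\<And>N l. l \<in> steps N ==> integrable (P N) (\<lambda>y. h N l y ^ 4)"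
  and B: "1 \<le> B"
  and h4_le: "\<And>N l. l \<in> steps N ==> (\<integral>y. (h N l y - (\<integral>x. h N l x \<partial>P N)) ^ 4 \<partial>P N) \<le> (B / sqrt (real N)) ^ 4"
  and mean_h: "\<And>N l. l \<in> steps N ==> 0 \<le> (\<integral>x. h N l x \<partial>P N) \<and> (\<integral>x. h N l x \<partial>P N) \<le> (B / sqrt (real N))\<^sup>2"
  and var_u: "(\<lambda>N. \<Sum>l\<in>steps N. \<integral>y. (u N l y - (\<integral>x. u N l x \<partial>P N))\<^sup>2 \<partial>P N) \<longlonglongrightarrow> vu"
  and u4_lim: "(\<lambda>N. \<Sum>l\<in>steps N. \<integral>y. (u N l y - (\<integral>x. u N l x \<partial>P N)) ^ 4 \<partial>P N) \<longlonglongrightarrow> 0"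
  and cov: "\<And>N l. l \<in> steps N ==>
    \<bar>\<integral>y. (u N l y - (\<integral>x. u N l x \<partial>P N)) * (h N l y - (\<integral>x. h N l x \<partial>P N)) \<partial>P N\<bar> \<le> \<kappa> N"
  and cov_lim: "(\<lambda>N. \<kappa> N * (real N * sqrt (real N))) \<longlonglongrightarrow> 0"
  and var_h: "\<And>N l. l \<in> steps N ==> card (ends l) = 2 ==>
    \<bar>real N * (\<integral>y. (h N l y - (\<integral>x. h N l x \<partial>P N))\<^sup>2 \<partial>P N) - \<beta>\<bar> \<le> \<delta> N"
  and \<delta>_lim: "\<delta> \<longlonglongrightarrow> 0"
  and drift: "(\<lambda>N. (\<Sum>l\<in>steps N. \<integral>x. u N l x \<partial>P N) + (\<Sum>c\<in>cycles N m. \<Prod>l\<in>c. \<integral>x. h N l x \<partial>P N)) \<longlonglongrightarrow> d"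
  and nonneg: "0 \<le> vu" "0 \<le> \<beta>"
 shows "(\<lambda>N. \<integral>y. iexp (t * ((\<Sum>l\<in>steps N. u N l y) + (\<Sum>c\<in>cycles N m. \<Prod>l\<in>c. h N l y))) \<partial>P N)
   \<longlonglongrightarrow> iexp (t * d) * complex_of_real (exp (- (t\<^sup>2 * (vu + (\<Sum>k=3..m. \<beta> ^ k / (2 * real k))) / 2)))"
proof -
 let ?S = "\<lambda>N y. (\<Sum>l\<in>steps N. u N l y) + (\<Sum>c\<in>cycles N m. \<Prod>l\<in>c. h N l y)"
 define ub hb where "ub N l = (\<integral>x. u N l x \<partial>P N)" and "hb N l = (\<integral>x. h N l x \<partial>P N)" for N l
 define u' h' where "u' N l y = u N l y - ub N l" and "h' N l y = h N l y - hb N l" for N l y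
 define vc where "vc = (\<Sum>k=3..m. \<beta> ^ k / (2 * real k))"
 define v where "v = vu + vc"
 have v0: "0 \<le> v" unfolding v_def vc_def using nonneg by (intro add_nonneg_nonneg sum_nonneg) auto
 interpret prob_space "P N" for N by (rule prob)
 have pm: "(\<lambda>y. (u N l y, h N l y)) \<in> borel_measurable (P N)" if "l \<in> steps N" for N l
  using indep[of N] that by (auto simp: indep_vars_def)
 have um: "u N l \<in> borel_measurable (P N)" "h N l \<in> borel_measurable (P N)" if "l \<in> steps N" for N l
  using measurable_compose[OF pm[OF that] measurable_fst_real_pair] measurable_compose[OF pm[OF that] measurable_snd_real_pair] by simp_all
 have pow_shift: "integrable (P N) (\<lambda>y. (f y - a) ^ 4)"
  if f: "f \<in> borel_measurable (P N)" "integrable (P N) (\<lambda>y. f y ^ 4)" for N f and a :: real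
 proof (rule Bochner_Integration.integrable_bound[where f="\<lambda>y. 8 * (f y ^ 4 + a ^ 4)"])
  show "integrable (P N) (\<lambda>y. 8 * (f y ^ 4 + a ^ 4))" using f by auto
  show "(\<lambda>y. (f y - a) ^ 4) \<in> borel_measurable (P N)" using f by measurable
  have "\<bar>(f y - a) ^ 4\<bar> \<le> 8 * (f y ^ 4 + a ^ 4)" for y
   using fourth_power_sum_le[of "f y" "- a"] by simp
  then show "AE y in P N. norm ((f y - a) ^ 4) \<le> norm (8 * (f y ^ 4 + a ^ 4))"
   by (intro AE_I2) (simp add: order_trans[OF _ abs_ge_self])
 qed
 have chaos: "cycle_chaos (P N) N (u' N) (h' N) B" for N
 proof
  show "finite (steps N)" by simp
  have "indep_vars N (\<lambda>_. borel) (\<lambda>l y. (\<lambda>z. (fst z - ub N l, snd z - hb N l)) (u N l y, h N l y)) (steps N)"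
  proof (rule indep_vars_compose2[OF indep])
   fix l
   show "(\<lambda>z. (fst z - ub N l, snd z - hb N l)) \<in> borel_measurable (borel :: (real \<times> real) measure)"
    unfolding borel_prod[symmetric] by measurable
  qed
  then show "indep_vars N (\<lambda>_. borel) (\<lambda>l y. (u' N l y, h' N l y)) (steps N)"
   by (simp add: u'_def h'_def)
  fix l assume l: "l \<in> steps N"
  have iu: "integrable (P N) (u N l)" using integrable_power_le_fourth[OF um(1)[OF l] u4[OF l], of 1] by simp
  have ih: "integrable (P N) (h N l)" using integrable_power_le_fourth[OF um(2)[OF l] h4[OF l], of 1] by simp
  show "(\<integral>y. u' N l y \<partial>P N) = 0" "(\<integral>y. h' N l y \<partial>P N) = 0"
   using iu ih by (simp_all add: u'_def h'_def ub_def hb_def prob_space)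
  show "integrable (P N) (\<lambda>y. u' N l y ^ 4)" "integrable (P N) (\<lambda>y. h' N l y ^ 4)"
   unfolding u'_def h'_def using um[OF l] u4[OF l] h4[OF l] by (auto intro: pow_shift)
  show "(\<integral>y. h' N l y ^ 4 \<partial>P N) \<le> (B / sqrt (real N)) ^ 4"
   using h4_le[OF l] by (simp add: h'_def hb_def)
 qed (use B in auto)
 interpret K: cycle_chaos "P N" N m "u' N" "h' N" B for N by (rule chaos)
 let ?V = "\<lambda>N. \<Sum>l\<in>steps N. \<integral>y. (u' N l y)\<^sup>2 \<partial>P N"
  and ?W = "\<lambda>N. \<Sum>l\<in>steps N. \<integral>y. u' N l y ^ 4 \<partial>P N"
  and ?M = "\<lambda>N. \<Sum>c\<in>cycles N m. \<Prod>l\<in>c. K.moment N l 2"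
 define n where "n N = Suc (Max (insert 0 (steps N)))" for N
 have n: "steps N \<subseteq> {..<n N}" for N by (auto simp: n_def less_Suc_eq_le)
 have small_lim: "(\<lambda>N. K.small N) \<longlonglongrightarrow> 0"
 proof -
  have "(\<lambda>N. B ^ (4 * m) / sqrt (real N)) \<longlonglongrightarrow> 0"
   by (rule tendsto_divide_0[OF tendsto_const filterlim_at_top_imp_at_infinity[OF filterlim_compose[OF sqrt_at_top filterlim_real_sequentially]]])
  then show ?thesis by (simp add: K.small_def)
 qed
 have mom: "(\<lambda>N. \<Sum>c\<in>cycles N m. \<Prod>l\<in>c. K.moment N l 2) \<longlonglongrightarrow> vc"
 proof (rule tendsto_sandwich)
  have lim: "(\<lambda>N. real N * (max 0 (\<beta> - \<delta> N) / real N)) \<longlonglongrightarrow> \<beta>" "(\<lambda>N. real N * ((\<beta> + \<delta> N) / real N)) \<longlonglongrightarrow> \<beta>"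
  proof -
   have "(\<lambda>N. max 0 (\<beta> - \<delta> N)) \<longlonglongrightarrow> max 0 (\<beta> - 0)" by (intro tendsto_max tendsto_diff tendsto_const \<delta>_lim)
   then have 1: "(\<lambda>N. max 0 (\<beta> - \<delta> N)) \<longlonglongrightarrow> \<beta>" using nonneg by simp
   have "(\<lambda>N. \<beta> + \<delta> N) \<longlonglongrightarrow> \<beta> + 0" by (intro tendsto_add tendsto_const \<delta>_lim)
   then have 2: "(\<lambda>N. \<beta> + \<delta> N) \<longlonglongrightarrow> \<beta>" by simp
   have ev: "\<forall>\<^sub>F N in sequentially. real N \<noteq> 0" using eventually_gt_at_top[of 0] by eventually_elim simp
   show "(\<lambda>N. real N * (max 0 (\<beta> - \<delta> N) / real N)) \<longlonglongrightarrow> \<beta>"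
    by (rule Lim_transform_eventually[OF 1]) (use ev in eventually_elim, simp)
   show "(\<lambda>N. real N * ((\<beta> + \<delta> N) / real N)) \<longlonglongrightarrow> \<beta>"
    by (rule Lim_transform_eventually[OF 2]) (use ev in eventually_elim, simp)
  qed
  show "(\<lambda>N. \<Sum>c\<in>cycles N m. (max 0 (\<beta> - \<delta> N) / real N) ^ card c) \<longlonglongrightarrow> vc"
   unfolding vc_def by (rule sum_cycles_limit[OF lim(1)])
  show "(\<lambda>N. \<Sum>c\<in>cycles N m. ((\<beta> + \<delta> N) / real N) ^ card c) \<longlonglongrightarrow> vc"
   unfolding vc_def by (rule sum_cycles_limit[OF lim(2)])
  have bnd: "0 \<le> K.moment N l 2 \<and> max 0 (\<beta> - \<delta> N) / real N \<le> K.moment N l 2 \<and> K.moment N l 2 \<le> (\<beta> + \<delta> N) / real N"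
   if N: "0 < N" and c: "c \<in> cycles N m" and l: "l \<in> c" for N c l
  proof -
   have "l \<in> steps N" "card (ends l) = 2" using cycles_steps[OF c] l cycle_card_ends[OF cycles_cycle[OF c] l] by auto
   from var_h[OF this] have "\<bar>real N * K.moment N l 2 - \<beta>\<bar> \<le> \<delta> N"
    by (simp add: K.moment_def h'_def hb_def)
   moreover have m0: "0 \<le> K.moment N l 2" by (simp add: K.moment_def)
   moreover have "0 \<le> real N * K.moment N l 2" using m0 by simp
   ultimately show ?thesis using N by (auto simp: field_simps max_def)
  qed
  show "\<forall>\<^sub>F N in sequentially. (\<Sum>c\<in>cycles N m. (max 0 (\<beta> - \<delta> N) / real N) ^ card c) \<le> ?M N"
   using eventually_gt_at_top[of 0]
  proof eventually_elim
   case (elim N)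
   show ?case
   proof (rule sum_mono)
    fix c assume c: "c \<in> cycles N m"
    have "(\<Prod>l\<in>c. max 0 (\<beta> - \<delta> N) / real N) \<le> (\<Prod>l\<in>c. K.moment N l 2)"
     using bnd[OF elim c] by (intro prod_mono) auto
    then show "(max 0 (\<beta> - \<delta> N) / real N) ^ card c \<le> (\<Prod>l\<in>c. K.moment N l 2)" by simp
   qed
  qed
  show "\<forall>\<^sub>F N in sequentially. ?M N \<le> (\<Sum>c\<in>cycles N m. ((\<beta> + \<delta> N) / real N) ^ card c)"
   using eventually_gt_at_top[of 0]
  proof eventually_elim
   case (elim N)
   show ?case
   proof (rule sum_mono)
    fix c assume c: "c \<in> cycles N m"
    have "(\<Prod>l\<in>c. K.moment N l 2) \<le> (\<Prod>l\<in>c. (\<beta> + \<delta> N) / real N)"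
     using bnd[OF elim c] by (intro prod_mono) auto
    then show "(\<Prod>l\<in>c. K.moment N l 2) \<le> ((\<beta> + \<delta> N) / real N) ^ card c" by simp
   qed
  qed
 qed
 define pb where "pb = 1 + B ^ (2 * m) * cycle_chaos.pairs_bound m"
 define qb where "qb = cycle_chaos.quads_bound m"
 have var: "(\<lambda>N. \<integral>x. \<bar>(\<Sum>l<n N. K.cond_var N l x) - v\<bar> \<partial>P N) \<longlonglongrightarrow> 0"
 proof (rule tendsto_sandwich[where f="\<lambda>_. 0" and h="\<lambda>N.
   \<bar>?V N + ?M N - v\<bar>
   + 2 * (\<kappa> N * (real N * sqrt (real N))) * pb + sqrt (2 * K.small N * qb)"])
  show "\<forall>\<^sub>F N in sequentially. (\<integral>x. \<bar>(\<Sum>l<n N. K.cond_var N l x) - v\<bar> \<partial>P N)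
   \<le> \<bar>?V N + ?M N - v\<bar>
   + 2 * (\<kappa> N * (real N * sqrt (real N))) * pb + sqrt (2 * K.small N * qb)"
   using eventually_ge_at_top[of 1]
  proof eventually_elim
   case (elim N)
   have "\<bar>\<integral>y. u' N l y * h' N l y \<partial>P N\<bar> \<le> \<kappa> N" if "l \<in> steps N" for l
    using cov[OF that] by (simp add: u'_def h'_def ub_def hb_def)
   from K.conditional_variance_concentration[OF elim n this, of v] show ?case
    by (simp add: K.C_def pb_def qb_def mult.assoc)
  qed
  have a: "(\<lambda>N. \<Sum>l\<in>steps N. \<integral>y. (u' N l y)\<^sup>2 \<partial>P N) \<longlonglongrightarrow> vu"
   using var_u by (simp add: u'_def ub_def)
  have "(\<lambda>N. \<bar>?V N + ?M N - v\<bar>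
   + 2 * (\<kappa> N * (real N * sqrt (real N))) * pb + sqrt (2 * K.small N * qb)) \<longlonglongrightarrow> \<bar>vu + vc - v\<bar> + 2 * 0 * pb + sqrt (2 * 0 * qb)"
   by (intro tendsto_add tendsto_rabs tendsto_diff tendsto_mult tendsto_real_sqrt tendsto_const a mom cov_lim small_lim)
  then show "(\<lambda>N. \<bar>?V N + ?M N - v\<bar>
   + 2 * (\<kappa> N * (real N * sqrt (real N))) * pb + sqrt (2 * K.small N * qb)) \<longlonglongrightarrow> 0"
   by (simp add: v_def)
 qed auto
 have lind: "(\<lambda>N. \<Sum>l<n N. \<integral>x. K.chaos_step N l x ^ 4 \<partial>P N) \<longlonglongrightarrow> 0"
 proof (rule tendsto_sandwich[where f="\<lambda>_. 0" and h="\<lambda>N. 8 * ?W N + 8 * (K.small N * qb)"])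
  show "\<forall>\<^sub>F N in sequentially. 0 \<le> (\<Sum>l<n N. \<integral>x. K.chaos_step N l x ^ 4 \<partial>P N)"
   by (intro always_eventually allI sum_nonneg) simp
  show "\<forall>\<^sub>F N in sequentially. (\<Sum>l<n N. \<integral>x. K.chaos_step N l x ^ 4 \<partial>P N)
    \<le> 8 * ?W N + 8 * (K.small N * qb)"
   using eventually_ge_at_top[of 1]
  proof eventually_elim
   case (elim N)
   show ?case using K.fourth_moment_sum[OF elim n] by (simp add: qb_def)
  qed
  have a: "(\<lambda>N. \<Sum>l\<in>steps N. \<integral>y. u' N l y ^ 4 \<partial>P N) \<longlonglongrightarrow> 0"
   using u4_lim by (simp add: u'_def ub_def)
  have "(\<lambda>N. 8 * ?W N + 8 * (K.small N * qb)) \<longlonglongrightarrow> 8 * 0 + 8 * (0 * qb)"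
   by (intro tendsto_add tendsto_mult tendsto_const a small_lim)
  then show "(\<lambda>N. 8 * ?W N + 8 * (K.small N * qb)) \<longlonglongrightarrow> 0" by simp
 qed auto
 define X where "X N y = (\<Sum>l\<in>steps N. u' N l y) + (\<Sum>c\<in>cycles N m. K.edge_prod N c y)" for N y
 define dr where "dr N = (\<Sum>l\<in>steps N. ub N l) + (\<Sum>c\<in>cycles N m. \<Prod>l\<in>c. hb N l)" for N
 have clt: "(\<lambda>N. \<integral>y. iexp (t * X N y) \<partial>P N) \<longlonglongrightarrow> complex_of_real (exp (- (t\<^sup>2 * v / 2)))"
  using martingale_clt[OF K.chaos_martingale v0 var lind, of t]
  by (simp add: X_def K.sum_chaos_step[OF n] K.C_def)
 have drl: "dr \<longlonglongrightarrow> d" using drift by (simp add: dr_def[abs_def] ub_def hb_def)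
 have "(\<lambda>N. iexp (t * dr N) * (\<integral>y. iexp (t * X N y) \<partial>P N)) \<longlonglongrightarrow> iexp (t * d) * complex_of_real (exp (- (t\<^sup>2 * v / 2)))"
  by (intro tendsto_mult clt tendsto_exp tendsto_of_real tendsto_const drl)
 moreover have "(\<lambda>N. (\<integral>y. iexp (t * (?S N y)) \<partial>P N)
   - iexp (t * dr N) * (\<integral>y. iexp (t * X N y) \<partial>P N)) \<longlonglongrightarrow> 0"
 proof (rule Lim_null_comparison)
  define c where "c = 4 ^ m * B ^ (4 * m) * cycle_chaos.pairs_bound m"
  have "(\<lambda>N. \<bar>t\<bar> * sqrt (c / real N)) \<longlonglongrightarrow> \<bar>t\<bar> * sqrt 0"
   by (intro tendsto_mult tendsto_real_sqrt tendsto_const lim_const_over_n)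
  then show "(\<lambda>N. \<bar>t\<bar> * sqrt (c / real N)) \<longlonglongrightarrow> 0" by simp
  show "\<forall>\<^sub>F N in sequentially. norm ((\<integral>y. iexp (t * (?S N y)) \<partial>P N)
   - iexp (t * dr N) * (\<integral>y. iexp (t * X N y) \<partial>P N)) \<le> \<bar>t\<bar> * sqrt (c / real N)"
   using eventually_ge_at_top[of 1]
  proof eventually_elim
   case (elim N)
   have "0 \<le> hb N l \<and> hb N l \<le> (B / sqrt (real N))\<^sup>2" if "l \<in> steps N" for l
    using mean_h[OF that] by (simp add: hb_def)
   note mx = K.mixed_small[OF elim this]
   have "h' N l \<in> borel_measurable (P N)" if "c \<in> cycles N m" "l \<in> c" for c l
    by (rule K.h_measurable) (use cycles_steps[OF that(1)] that(2) in blast)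
   then have Xm: "X N \<in> borel_measurable (P N)"
    unfolding X_def[abs_def] K.edge_prod_def
    by (intro borel_measurable_add borel_measurable_sum borel_measurable_prod K.u_measurable)
   have eq: "?S N y = (X N y + dr N) + K.mixed N (hb N) y" for y
    by (simp add: X_def dr_def K.mixed_def K.C_def u'_def h'_def sum_subtractf)
   have "iexp (t * dr N) * (\<integral>y. iexp (t * X N y) \<partial>P N) = (\<integral>y. iexp (t * (X N y + dr N)) \<partial>P N)"
    by (simp add: distrib_left exp_add mult.commute flip: Bochner_Integration.integral_mult_right_zero)
   then have "norm ((\<integral>y. iexp (t * (?S N y)) \<partial>P N)
    - iexp (t * dr N) * (\<integral>y. iexp (t * X N y) \<partial>P N)) \<le> \<bar>t\<bar> * (\<integral>y. \<bar>K.mixed N (hb N) y\<bar> \<partial>P N)"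
    unfolding eq using characteristic_perturbation[of "\<lambda>y. X N y + dr N" N "K.mixed N (hb N)" t] Xm mx(1) by simp
   also have "... \<le> \<bar>t\<bar> * sqrt (c / real N)"
    using mx(2) by (intro mult_left_mono) (simp_all add: c_def)
   finally show ?case .
  qed
 qed
 ultimately have "(\<lambda>N. \<integral>y. iexp (t * (?S N y)) \<partial>P N)
   \<longlonglongrightarrow> iexp (t * d) * complex_of_real (exp (- (t\<^sup>2 * v / 2)))"
  by (rule Lim_transform)
 then show ?thesis by (simp add: v_def vc_def)
qed

section \<open>Gaussian integrals and the Curie--Weiss partition function\<close>

interpretation gauss: prob_space std_normal_distribution
 using real_dist_normal_dist by (simp add: real_distribution_def)

lemma gauss_space [simp]: "space std_normal_distribution = UNIV" by simp

lemma gauss_integral: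
 assumes "f \<in> borel_measurable borel"
 shows "(\<integral>z. f z \<partial>std_normal_distribution) = (\<integral>z. std_normal_density z * f z \<partial>lborel)"
 using assms by (subst integral_density) auto

lemma gauss_integrable:
 fixes f :: "real => real"
 assumes "f \<in> borel_measurable borel"
 shows "integrable std_normal_distribution f \<longleftrightarrow> integrable lborel (\<lambda>z. std_normal_density z * f z)"
 using assms by (subst integrable_density) auto

lemma gauss_exp_linear:
 shows "integrable std_normal_distribution (\<lambda>z. exp (c * z))"
  and "(\<integral>z. exp (c * z) \<partial>std_normal_distribution) = exp (c\<^sup>2 / 2)"
proof -
 have eq: "std_normal_density z * exp (c * z) = exp (c\<^sup>2 / 2) * normal_density c 1 z" for z
  unfolding normal_density_def by (simp add: exp_add[symmetric] power2_eq_square algebra_simps diff_divide_distrib add_divide_distrib)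
 show "integrable std_normal_distribution (\<lambda>z. exp (c * z))"
  by (subst gauss_integrable) (auto simp: eq)
 show "(\<integral>z. exp (c * z) \<partial>std_normal_distribution) = exp (c\<^sup>2 / 2)"
  by (subst gauss_integral) (auto simp: eq)
qed

lemma gauss_exp_quadratic:
 assumes f: "2 * f < 1"
 shows "integrable std_normal_distribution (\<lambda>z. exp (f * z\<^sup>2))"
  and "(\<integral>z. exp (f * z\<^sup>2) \<partial>std_normal_distribution) = 1 / sqrt (1 - 2 * f)"
proof -
 define s where "s = 1 / sqrt (1 - 2 * f)"
 have s2: "s\<^sup>2 = 1 / (1 - 2 * f)" using f by (simp add: s_def power_divide)
 have s0: "0 < s" using f by (simp add: s_def)
 have eq: "std_normal_density z * exp (f * z\<^sup>2) = s * normal_density 0 s z" for z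
 proof -
  have "normal_density 0 s z = 1 / (sqrt (2 * pi) * s) * exp (- z\<^sup>2 * (1 - 2 * f) / 2)"
   unfolding normal_density_def s2 using f by (simp add: s_def real_sqrt_divide)
  then show ?thesis using f unfolding std_normal_density_def
   by (simp add: exp_add[symmetric] s_def algebra_simps diff_divide_distrib)
 qed
 show "integrable std_normal_distribution (\<lambda>z. exp (f * z\<^sup>2))"
  by (subst gauss_integrable) (use integrable_normal_density[OF s0] in \<open>auto simp: eq\<close>)
 show "(\<integral>z. exp (f * z\<^sup>2) \<partial>std_normal_distribution) = 1 / sqrt (1 - 2 * f)"
  by (subst gauss_integral) (use integral_normal_density[OF s0] in \<open>auto simp: eq s_def\<close>)
qed

lemma normal_law:
 assumes "0 < \<sigma>"
 shows "density lborel (\<lambda>x. ennreal (normal_density \<mu> \<sigma> x)) = distr std_normal_distribution borel (\<lambda>z. \<mu> + \<sigma> * z)"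
proof -
 have "distributed std_normal_distribution lborel (\<lambda>z. z) (\<lambda>x. ennreal (std_normal_density x))"
  unfolding distributed_def by (auto simp: distr_id2)
 from gauss.normal_density_affine[OF this, of \<sigma> \<mu>] assms
 have "distributed std_normal_distribution lborel (\<lambda>z. \<mu> + \<sigma> * z) (\<lambda>x. ennreal (normal_density \<mu> \<sigma> x))"
  by simp
 then have "distr std_normal_distribution lborel (\<lambda>z. \<mu> + \<sigma> * z) = density lborel (\<lambda>x. ennreal (normal_density \<mu> \<sigma> x))"
  by (simp add: distributed_def)
 moreover have "distr std_normal_distribution lborel (\<lambda>z. \<mu> + \<sigma> * z) = distr std_normal_distribution borel (\<lambda>z. \<mu> + \<sigma> * z)"
  by (rule distr_cong) auto
 ultimately show ?thesis by simp
qed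

text \<open>
 Convergence of characteristic functions to those of a normal law, degenerate if \<open>v = 0\<close>, in
 the form in which it is applied to test functions.
\<close>

lemma bounded_continuous_limit:
 fixes P :: "nat => 'a measure" and g :: "real => real"
 assumes prob: "\<And>n. prob_space (P n)" and X: "\<And>n. X n \<in> borel_measurable (P n)"
  and ch: "\<And>t. (\<lambda>n. \<integral>y. iexp (t * X n y) \<partial>P n) \<longlonglongrightarrow> iexp (t * d) * complex_of_real (exp (- (t\<^sup>2 * v / 2)))"
  and v: "0 \<le> v" and g: "\<And>x. isCont g x" "\<And>x. \<bar>g x\<bar> \<le> K"
 shows "(\<lambda>n. \<integral>y. g (X n y) \<partial>P n) \<longlonglongrightarrow> (\<integral>z. g (d + sqrt v * z) \<partial>std_normal_distribution)"
proof -
 define Q where "Q n = distr (P n) borel (X n)" for n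
 define Q' where "Q' = distr std_normal_distribution borel (\<lambda>z. d + sqrt v * z)"
 have rQ: "real_distribution (Q n)" for n
  unfolding Q_def using prob_space.prob_space_distr[OF prob X] by (simp add: real_distribution_def real_distribution_axioms_def)
 have rQ': "real_distribution Q'"
  unfolding Q'_def using gauss.prob_space_distr[of "\<lambda>z. d + sqrt v * z" borel]
  by (simp add: real_distribution_def real_distribution_axioms_def)
 have gm: "g \<in> borel_measurable borel"
  using g(1) by (intro borel_measurable_continuous_onI continuous_at_imp_continuous_on) auto
 have "char Q' t = iexp (t * d) * complex_of_real (exp (- (t\<^sup>2 * v / 2)))" for t
 proof -
  have "char Q' t = (\<integral>z. iexp (t * (d + sqrt v * z)) \<partial>std_normal_distribution)"
   unfolding char_def Q'_def by (subst integral_distr) auto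
  also have "... = (\<integral>z. iexp (t * d) * iexp ((t * sqrt v) * z) \<partial>std_normal_distribution)"
   by (simp add: distrib_left exp_add mult.assoc)
  also have "... = iexp (t * d) * char std_normal_distribution (t * sqrt v)"
   unfolding char_def by (rule integral_mult_right_zero)
  also have "... = iexp (t * d) * complex_of_real (exp (- (t\<^sup>2 * v / 2)))"
   using v by (simp add: char_std_normal_distribution power_mult_distrib)
  finally show ?thesis .
 qed
 moreover have "char (Q n) t = (\<integral>y. iexp (t * X n y) \<partial>P n)" for n t
  unfolding char_def Q_def using X by (subst integral_distr) auto
 ultimately have wc: "weak_conv_m Q Q'"
  using ch by (intro levy_continuity rQ rQ') simp
 have "(\<lambda>n. integral\<^sup>L (Q n) g) \<longlonglongrightarrow> integral\<^sup>L Q' g"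
  by (rule weak_conv_imp_integral_bdd_continuous_conv[OF rQ rQ' wc g(1)]) (use g(2) in simp)
 then show ?thesis
  unfolding Q_def Q'_def using X gm by (simp add: integral_distr)
qed

lemma tendsto_mult_ln_one_plus:
 fixes y k :: "nat => real"
 assumes ky: "(\<lambda>n. k n * y n) \<longlonglongrightarrow> c" and y: "y \<longlonglongrightarrow> 0"
 shows "(\<lambda>n. k n * ln (1 + y n)) \<longlonglongrightarrow> c"
proof (rule Lim_transform[OF ky])
 show "(\<lambda>n. k n * ln (1 + y n) - k n * y n) \<longlonglongrightarrow> 0"
 proof (rule Lim_null_comparison)
  have "(\<lambda>n. 2 * (\<bar>k n * y n\<bar> * \<bar>y n\<bar>)) \<longlonglongrightarrow> 2 * (\<bar>c\<bar> * \<bar>0\<bar>)"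
   by (intro tendsto_mult tendsto_const tendsto_rabs ky y)
  then show "(\<lambda>n. 2 * (\<bar>k n * y n\<bar> * \<bar>y n\<bar>)) \<longlonglongrightarrow> 0" by simp
  have "\<forall>\<^sub>F n in sequentially. \<bar>y n\<bar> < 1 / 2"
   using y by (auto simp: tendsto_iff dist_real_def dest: spec[of _ "1/2"])
  then show "\<forall>\<^sub>F n in sequentially. norm (k n * ln (1 + y n) - k n * y n) \<le> 2 * (\<bar>k n * y n\<bar> * \<bar>y n\<bar>)"
  proof eventually_elim
   case (elim n)
   have "norm (k n * ln (1 + y n) - k n * y n) = \<bar>k n\<bar> * \<bar>ln (1 + y n) - y n\<bar>"
    by (simp add: abs_mult flip: right_diff_distrib)
   also have "... \<le> \<bar>k n\<bar> * (2 * (y n)\<^sup>2)"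
    using elim by (intro mult_left_mono abs_ln_one_plus_x_minus_x_bound) auto
   finally show ?case by (simp add: abs_mult power2_eq_square mult_ac)
  qed
 qed
qed

lemma tendsto_power_exp:
 fixes y :: "nat => real" and k :: "nat => nat"
 assumes ky: "(\<lambda>n. real (k n) * y n) \<longlonglongrightarrow> c" and y: "y \<longlonglongrightarrow> 0"
 shows "(\<lambda>n. (1 + y n) ^ k n) \<longlonglongrightarrow> exp c"
proof (rule Lim_transform_eventually)
 show "(\<lambda>n. exp (real (k n) * ln (1 + y n))) \<longlonglongrightarrow> exp c"
  by (intro tendsto_exp tendsto_mult_ln_one_plus ky y)
 have "\<forall>\<^sub>F n in sequentially. \<bar>y n\<bar> < 1"
  using y by (auto simp: tendsto_iff dist_real_def dest: spec[of _ 1])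
 then show "\<forall>\<^sub>F n in sequentially. exp (real (k n) * ln (1 + y n)) = (1 + y n) ^ k n"
  by eventually_elim (simp add: exp_of_nat_mult)
qed

lemma cosh_bounds: "1 + x\<^sup>2 / 2 \<le> cosh x" "cosh x \<le> exp (x\<^sup>2 / 2)" for x :: real
proof -
 have lower: "1 + x\<^sup>2 / 2 \<le> cosh x" if x: "0 \<le> x" for x :: real
 proof -
  have "cosh 0 - (1 + 0\<^sup>2 / 2) \<le> cosh x - (1 + x\<^sup>2 / 2)"
  proof (rule DERIV_nonneg_imp_nondecreasing[OF x])
   fix y :: real assume "0 \<le> y" "y \<le> x"
   then show "\<exists>D. ((\<lambda>y. cosh y - (1 + y\<^sup>2 / 2)) has_real_derivative D) (at y) \<and> 0 \<le> D"
    using real_le_x_sinh[of y]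
    by (intro exI[of _ "sinh y - y"]) (auto intro!: derivative_eq_intros simp: sinh_def exp_minus)
  qed
  then show ?thesis by simp
 qed
 show "1 + x\<^sup>2 / 2 \<le> cosh x" for x :: real using lower[of "\<bar>x\<bar>"] by simp
 have sh: "sinh y \<le> y * cosh y" if y: "0 \<le> y" for y :: real
 proof -
  have "0 * cosh 0 - sinh 0 \<le> y * cosh y - sinh y"
  proof (rule DERIV_nonneg_imp_nondecreasing[OF y])
   fix z :: real assume "0 \<le> z" "z \<le> y"
   then show "\<exists>D. ((\<lambda>y. y * cosh y - sinh y) has_real_derivative D) (at z) \<and> 0 \<le> D"
    by (intro exI[of _ "z * sinh z"]) (auto intro!: derivative_eq_intros)
  qed
  then show ?thesis by simp
 qed
 have upper: "cosh x \<le> exp (x\<^sup>2 / 2)" if x: "0 \<le> x" for x :: real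
 proof -
  have "exp (- (x\<^sup>2 / 2)) * cosh x \<le> exp (- (0\<^sup>2 / 2)) * cosh 0"
  proof (rule DERIV_nonpos_imp_nonincreasing[OF x])
   fix y :: real assume y: "0 \<le> y" "y \<le> x"
   have "((\<lambda>y. exp (- (y\<^sup>2 / 2)) * cosh y) has_real_derivative exp (- (y\<^sup>2 / 2)) * (sinh y - y * cosh y)) (at y)"
    by (auto intro!: derivative_eq_intros simp: algebra_simps)
   moreover have "exp (- (y\<^sup>2 / 2)) * (sinh y - y * cosh y) \<le> 0"
    using sh[OF y(1)] by (intro mult_nonneg_nonpos) auto
   ultimately show "\<exists>D. ((\<lambda>y. exp (- (y\<^sup>2 / 2)) * cosh y) has_real_derivative D) (at y) \<and> D \<le> 0" by blast
  qed
  then have "exp (x\<^sup>2 / 2) * (exp (- (x\<^sup>2 / 2)) * cosh x) \<le> exp (x\<^sup>2 / 2) * 1"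
   by (intro mult_left_mono) auto
  then show ?thesis by (simp add: mult.assoc[symmetric] exp_add[symmetric])
 qed
 show "cosh x \<le> exp (x\<^sup>2 / 2)" for x :: real using upper[of "\<bar>x\<bar>"] by simp
qed

definition signs :: "nat => (nat => real) set" where
 "signs N = {..<N} \<rightarrow>\<^sub>E {1, -1}"

lemma finite_signs [simp]: "finite (signs N)" by (simp add: signs_def finite_PiE)

lemma card_signs: "card (signs N) = 2 ^ N" by (simp add: signs_def card_PiE numeral_2_eq_2)

lemma signs_square: "s \<in> signs N ==> i < N ==> (s i)\<^sup>2 = 1"
proof -
 assume "s \<in> signs N" "i < N"
 then have "s i \<in> {1, -1}" unfolding signs_def by blast
 then show ?thesis by auto
qed

lemma sum_signs_exp: "(\<Sum>\<tau>\<in>signs N. exp (c * (\<Sum>i<N. \<tau> i))) = (2 * cosh c) ^ N"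
proof -
 have "2 * cosh c = exp c + exp (- c)" by (simp add: cosh_def field_simps)
 then have "(2 * cosh c) ^ N = (\<Prod>i<N. \<Sum>y\<in>{1, -1}. exp (c * y))" by simp
 also have "... = (\<Sum>\<tau>\<in>signs N. \<Prod>i<N. exp (c * \<tau> i))"
  unfolding signs_def by (rule prod_sum_PiE) auto
 finally show ?thesis by (simp add: exp_sum sum_distrib_left)
qed

text \<open>
 Gaussian linearisation of the square: \<open>exp (\<theta> T\<^sup>2)\<close> is the mean of \<open>exp (sqrt (2 \<theta>) T z)\<close>, after which the
 spins decouple.
\<close>

lemma curie_weiss_gaussian:
 assumes \<theta>: "0 \<le> \<theta>"
 shows "(\<Sum>\<tau>\<in>signs N. exp (\<theta> * (\<Sum>i<N. \<tau> i)\<^sup>2)) / 2 ^ N = (\<integral>z. cosh (sqrt (2 * \<theta>) * z) ^ N \<partial>std_normal_distribution)"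
proof -
 have "exp (\<theta> * T\<^sup>2) = (\<integral>z. exp (sqrt (2 * \<theta>) * T * z) \<partial>std_normal_distribution)" for T
  using \<theta> by (simp add: gauss_exp_linear(2) power_mult_distrib)
 then have "(\<Sum>\<tau>\<in>signs N. exp (\<theta> * (\<Sum>i<N. \<tau> i)\<^sup>2)) = (\<Sum>\<tau>\<in>signs N. \<integral>z. exp (sqrt (2 * \<theta>) * (\<Sum>i<N. \<tau> i) * z) \<partial>std_normal_distribution)"
  by simp
 also have "... = (\<integral>z. (\<Sum>\<tau>\<in>signs N. exp (sqrt (2 * \<theta>) * (\<Sum>i<N. \<tau> i) * z)) \<partial>std_normal_distribution)"
  by (rule Bochner_Integration.integral_sum[symmetric]) (rule gauss_exp_linear(1))
 also have "... = (\<integral>z. (2 * cosh (sqrt (2 * \<theta>) * z)) ^ N \<partial>std_normal_distribution)"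
 proof (intro Bochner_Integration.integral_cong refl)
  fix z
  show "(\<Sum>\<tau>\<in>signs N. exp (sqrt (2 * \<theta>) * (\<Sum>i<N. \<tau> i) * z)) = (2 * cosh (sqrt (2 * \<theta>) * z)) ^ N"
   unfolding sum_signs_exp[symmetric] by (rule sum.cong) (simp_all add: mult_ac)
 qed
 also have "... = 2 ^ N * (\<integral>z. cosh (sqrt (2 * \<theta>) * z) ^ N \<partial>std_normal_distribution)"
  by (simp add: power_mult_distrib)
 finally show ?thesis by simp
qed

text \<open>
 Since \<open>cosh x\<close> lies between \<open>1 + x\<^sup>2 / 2\<close> and \<open>exp (x\<^sup>2 / 2)\<close>, the integrand tends to \<open>exp (f z\<^sup>2)\<close> and is
 dominated by \<open>exp (f' z\<^sup>2)\<close>, which is integrable for \<open>2 * f' < 1\<close>.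
\<close>

lemma curie_weiss_limit:
 assumes \<theta>: "\<And>N. 0 \<le> \<theta> N" and lim: "(\<lambda>N. real N * \<theta> N) \<longlonglongrightarrow> f" and f: "2 * f < 1"
 shows "(\<lambda>N. (\<Sum>\<tau>\<in>signs N. exp (\<theta> N * (\<Sum>i<N. \<tau> i)\<^sup>2)) / 2 ^ N) \<longlonglongrightarrow> 1 / sqrt (1 - 2 * f)"
proof -
 \<comment> \<open>Strictly between the limit and the critical value.\<close>
 define f' where "f' = (f + 1 / 2) / 2"
 have f': "f < f'" "2 * f' < 1" using f by (auto simp: f'_def)
 have ev: "\<forall>\<^sub>F N in sequentially. real N * \<theta> N \<le> f'"
  using order_tendstoD(2)[OF lim f'(1)] by eventually_elim simp
 define C where "C N z = (if real N * \<theta> N \<le> f' then cosh (sqrt (2 * \<theta> N) * z) ^ N else 0)" for N z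
 have up: "cosh (sqrt (2 * \<theta> N) * z) ^ N \<le> exp (real N * \<theta> N * z\<^sup>2)" for N z
 proof -
  have "cosh (sqrt (2 * \<theta> N) * z) ^ N \<le> exp ((sqrt (2 * \<theta> N) * z)\<^sup>2 / 2) ^ N"
   by (intro power_mono cosh_bounds(2)) (simp add: cosh_real_nonneg)
  also have "... = exp (real N * \<theta> N * z\<^sup>2)"
   using \<theta> by (simp add: exp_of_nat_mult[symmetric] power_mult_distrib)
  finally show ?thesis .
 qed
 have "(\<lambda>N. \<integral>z. C N z \<partial>std_normal_distribution) \<longlonglongrightarrow> (\<integral>z. exp (f * z\<^sup>2) \<partial>std_normal_distribution)"
 proof (rule integral_dominated_convergence[where w="\<lambda>z. exp (f' * z\<^sup>2)"])
  show "integrable std_normal_distribution (\<lambda>z. exp (f' * z\<^sup>2))" by (rule gauss_exp_quadratic(1)[OF f'(2)])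
  have cm: "(\<lambda>z. cosh (c * z :: real)) \<in> borel_measurable borel" for c
   unfolding cosh_def by measurable
  show "C N \<in> borel_measurable std_normal_distribution" for N
   unfolding C_def[abs_def] using cm by auto
  show "AE z in std_normal_distribution. norm (C N z) \<le> exp (f' * z\<^sup>2)" for N
  proof (intro AE_I2)
   fix z
   have "exp (real N * \<theta> N * z\<^sup>2) \<le> exp (f' * z\<^sup>2)" if "real N * \<theta> N \<le> f'"
    using that by (simp add: mult_right_mono)
   then show "norm (C N z) \<le> exp (f' * z\<^sup>2)"
    using order_trans[OF up[of N z]] by (auto simp: C_def cosh_real_nonneg)
  qed
  show "AE z in std_normal_distribution. (\<lambda>N. C N z) \<longlonglongrightarrow> exp (f * z\<^sup>2)"
  proof (intro AE_I2)
   fix z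
   have \<theta>0: "\<theta> \<longlonglongrightarrow> 0"
   proof (rule Lim_transform_eventually)
    show "(\<lambda>N. (real N * \<theta> N) * (1 / real N)) \<longlonglongrightarrow> 0"
     using tendsto_mult[OF lim lim_1_over_n] by simp
    show "\<forall>\<^sub>F N in sequentially. (real N * \<theta> N) * (1 / real N) = \<theta> N"
     using eventually_gt_at_top[of 0] by eventually_elim simp
   qed
   have "(\<lambda>N. cosh (sqrt (2 * \<theta> N) * z) ^ N) \<longlonglongrightarrow> exp (f * z\<^sup>2)"
   proof (rule tendsto_sandwich)
    have 1: "(\<lambda>N. real N * (\<theta> N * z\<^sup>2)) \<longlonglongrightarrow> f * z\<^sup>2"
     using tendsto_mult[OF lim tendsto_const[of "z\<^sup>2"]] by (simp add: mult.assoc)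
    have 2: "(\<lambda>N. \<theta> N * z\<^sup>2) \<longlonglongrightarrow> 0"
     using tendsto_mult[OF \<theta>0 tendsto_const[of "z\<^sup>2"]] by simp
    show "(\<lambda>N. (1 + \<theta> N * z\<^sup>2) ^ N) \<longlonglongrightarrow> exp (f * z\<^sup>2)"
     by (rule tendsto_power_exp[OF 1 2])
    show "(\<lambda>N. exp (real N * \<theta> N * z\<^sup>2)) \<longlonglongrightarrow> exp (f * z\<^sup>2)"
     using 1 by (intro tendsto_exp) (simp add: mult.assoc)
    show "\<forall>\<^sub>F N in sequentially. (1 + \<theta> N * z\<^sup>2) ^ N \<le> cosh (sqrt (2 * \<theta> N) * z) ^ N"
    proof (intro always_eventually allI power_mono)
     fix N
     show "1 + \<theta> N * z\<^sup>2 \<le> cosh (sqrt (2 * \<theta> N) * z)"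
      using cosh_bounds(1)[of "sqrt (2 * \<theta> N) * z"] \<theta>[of N] by (simp add: power_mult_distrib)
     show "0 \<le> 1 + \<theta> N * z\<^sup>2" using \<theta>[of N] by simp
    qed
    show "\<forall>\<^sub>F N in sequentially. cosh (sqrt (2 * \<theta> N) * z) ^ N \<le> exp (real N * \<theta> N * z\<^sup>2)"
     using up by auto
   qed
   then show "(\<lambda>N. C N z) \<longlonglongrightarrow> exp (f * z\<^sup>2)"
    by (rule Lim_transform_eventually) (use ev in eventually_elim, simp add: C_def)
  qed
 qed simp
 moreover have "\<forall>\<^sub>F N in sequentially. (\<integral>z. C N z \<partial>std_normal_distribution) = (\<Sum>\<tau>\<in>signs N. exp (\<theta> N * (\<Sum>i<N. \<tau> i)\<^sup>2)) / 2 ^ N"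
  using ev by eventually_elim (simp add: curie_weiss_gaussian[OF \<theta>] C_def)
 ultimately show ?thesis using gauss_exp_quadratic(2)[OF f] by (auto intro: Lim_transform_eventually)
qed

text \<open>
 Each factor takes two values only, so its logarithm is affine in \<open>\<tau> i * \<tau> j\<close> and the product is an
 exponential of \<open>(\<Sum> \<tau> i)\<^sup>2\<close>.
\<close>

lemma curie_weiss_product_limit:
 fixes a b :: "nat => real"
 assumes a: "(\<lambda>N. (real N)\<^sup>2 * (a N - 1)) \<longlonglongrightarrow> \<gamma>" and b: "(\<lambda>N. real N * b N) \<longlonglongrightarrow> f"
  and b0: "\<And>N. 0 \<le> b N" and f: "2 * f < 1"
 shows "(\<lambda>N. (\<Sum>\<tau>\<in>signs N. \<Prod>i<N. \<Prod>j<N. (a N + \<tau> i * \<tau> j * b N)) / 2 ^ N)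
   \<longlonglongrightarrow> exp (\<gamma> - f\<^sup>2 / 2) / sqrt (1 - 2 * f)"
proof -
 have inv: "(\<lambda>N. 1 / real N) \<longlonglongrightarrow> 0" by (rule lim_1_over_n)
 have b_lim: "b \<longlonglongrightarrow> 0"
 proof (rule Lim_transform_eventually)
  show "(\<lambda>N. (real N * b N) * (1 / real N)) \<longlonglongrightarrow> 0" using tendsto_mult[OF b inv] by simp
  show "\<forall>\<^sub>F N in sequentially. (real N * b N) * (1 / real N) = b N"
   using eventually_gt_at_top[of 0] by eventually_elim simp
 qed
 have a_lim: "a \<longlonglongrightarrow> 1"
 proof (rule LIM_zero_cancel, rule Lim_transform_eventually)
  show "(\<lambda>N. ((real N)\<^sup>2 * (a N - 1)) * (1 / real N) * (1 / real N)) \<longlonglongrightarrow> 0"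
   using tendsto_mult[OF tendsto_mult[OF a inv] inv] by simp
  show "\<forall>\<^sub>F N in sequentially. ((real N)\<^sup>2 * (a N - 1)) * (1 / real N) * (1 / real N) = a N - 1"
   using eventually_gt_at_top[of 0] by eventually_elim (simp add: power2_eq_square)
 qed
 have ab_lim: "(\<lambda>N. a N - b N) \<longlonglongrightarrow> 1" using tendsto_diff[OF a_lim b_lim] by simp
 have pos: "\<forall>\<^sub>F N in sequentially. 0 < a N - b N"
  using order_tendstoD(1)[OF ab_lim, of 0] by simp
 define \<theta> where "\<theta> N = (if 0 < a N - b N then ln (1 + 2 * b N / (a N - b N)) / 2 else 0)" for N
 have \<theta>0: "0 \<le> \<theta> N" for N using b0[of N] by (auto simp: \<theta>_def)
 have \<theta>_lim: "(\<lambda>N. real N * \<theta> N) \<longlonglongrightarrow> f"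
 proof (rule Lim_transform_eventually)
  have "(\<lambda>N. real N * (2 * b N / (a N - b N))) \<longlonglongrightarrow> 2 * f"
   using tendsto_divide[OF tendsto_mult[OF tendsto_const[of 2] b] ab_lim] by (simp add: mult_ac)
  moreover have "(\<lambda>N. 2 * b N / (a N - b N)) \<longlonglongrightarrow> 0"
   using tendsto_divide[OF tendsto_mult[OF tendsto_const[of 2] b_lim] ab_lim] by simp
  ultimately have "(\<lambda>N. real N * ln (1 + 2 * b N / (a N - b N))) \<longlonglongrightarrow> 2 * f"
   by (rule tendsto_mult_ln_one_plus)
  then show "(\<lambda>N. real N * ln (1 + 2 * b N / (a N - b N)) / 2) \<longlonglongrightarrow> f"
   using tendsto_divide[OF _ tendsto_const[of 2]] by fastforce
  show "\<forall>\<^sub>F N in sequentially. real N * ln (1 + 2 * b N / (a N - b N)) / 2 = real N * \<theta> N"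
   using pos by eventually_elim (simp add: \<theta>_def)
 qed
 have norm_lim: "(\<lambda>N. exp ((real N)\<^sup>2 / 2 * ln (1 + ((a N)\<^sup>2 - (b N)\<^sup>2 - 1)))) \<longlonglongrightarrow> exp (\<gamma> - f\<^sup>2 / 2)"
 proof (intro tendsto_exp tendsto_mult_ln_one_plus)
  have "(\<lambda>N. ((real N)\<^sup>2 * (a N - 1)) * (a N + 1) / 2 - (real N * b N)\<^sup>2 / 2) \<longlonglongrightarrow> \<gamma> * (1 + 1) / 2 - f\<^sup>2 / 2"
   by (intro tendsto_diff tendsto_divide tendsto_mult tendsto_add tendsto_power tendsto_const a b a_lim) auto
  then show "(\<lambda>N. (real N)\<^sup>2 / 2 * ((a N)\<^sup>2 - (b N)\<^sup>2 - 1)) \<longlonglongrightarrow> \<gamma> - f\<^sup>2 / 2"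
   by (simp add: power2_eq_square algebra_simps diff_divide_distrib add_divide_distrib)
  have "(\<lambda>N. (a N)\<^sup>2 - (b N)\<^sup>2 - 1) \<longlonglongrightarrow> 1\<^sup>2 - 0\<^sup>2 - 1"
   by (intro tendsto_diff tendsto_power tendsto_const a_lim b_lim)
  then show "(\<lambda>N. (a N)\<^sup>2 - (b N)\<^sup>2 - 1) \<longlonglongrightarrow> 0" by simp
 qed
 have "(\<lambda>N. exp ((real N)\<^sup>2 / 2 * ln (1 + ((a N)\<^sup>2 - (b N)\<^sup>2 - 1))) * ((\<Sum>\<tau>\<in>signs N. exp (\<theta> N * (\<Sum>i<N. \<tau> i)\<^sup>2)) / 2 ^ N))
   \<longlonglongrightarrow> exp (\<gamma> - f\<^sup>2 / 2) * (1 / sqrt (1 - 2 * f))"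
  by (intro tendsto_mult norm_lim curie_weiss_limit \<theta>0 \<theta>_lim f)
 then have "(\<lambda>N. exp ((real N)\<^sup>2 / 2 * ln (1 + ((a N)\<^sup>2 - (b N)\<^sup>2 - 1))) * ((\<Sum>\<tau>\<in>signs N. exp (\<theta> N * (\<Sum>i<N. \<tau> i)\<^sup>2)) / 2 ^ N))
   \<longlonglongrightarrow> exp (\<gamma> - f\<^sup>2 / 2) / sqrt (1 - 2 * f)" by simp
 then show ?thesis
 proof (rule Lim_transform_eventually)
  show "\<forall>\<^sub>F N in sequentially. exp ((real N)\<^sup>2 / 2 * ln (1 + ((a N)\<^sup>2 - (b N)\<^sup>2 - 1))) * ((\<Sum>\<tau>\<in>signs N. exp (\<theta> N * (\<Sum>i<N. \<tau> i)\<^sup>2)) / 2 ^ N)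
    = (\<Sum>\<tau>\<in>signs N. \<Prod>i<N. \<Prod>j<N. (a N + \<tau> i * \<tau> j * b N)) / 2 ^ N"
   using pos
  proof eventually_elim
   case (elim N)
   define r where "r = ln ((a N)\<^sup>2 - (b N)\<^sup>2) / 2"
   have p: "0 < a N - b N" "0 < a N + b N" using elim b0[of N] by auto
   have fac: "(a N)\<^sup>2 - (b N)\<^sup>2 = (a N + b N) * (a N - b N)" by (simp add: power2_eq_square algebra_simps)
   have r: "r = (ln (a N + b N) + ln (a N - b N)) / 2" unfolding r_def fac using p by (simp add: ln_mult)
   have "1 + 2 * b N / (a N - b N) = (a N + b N) / (a N - b N)" using p by (simp add: field_simps)
   then have t: "\<theta> N = (ln (a N + b N) - ln (a N - b N)) / 2" using p by (simp add: \<theta>_def ln_div)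
   have one: "a N + \<sigma> * b N = exp (r + \<theta> N * \<sigma>)" if "\<sigma> = 1 \<or> \<sigma> = -1" for \<sigma>
    using that p by (auto simp: r t field_simps)
   have "(\<Prod>i<N. \<Prod>j<N. (a N + \<tau> i * \<tau> j * b N)) = exp ((real N)\<^sup>2 * r) * exp (\<theta> N * (\<Sum>i<N. \<tau> i)\<^sup>2)" if \<tau>: "\<tau> \<in> signs N" for \<tau>
   proof -
    have "(\<Prod>i<N. \<Prod>j<N. (a N + \<tau> i * \<tau> j * b N)) = (\<Prod>i<N. \<Prod>j<N. exp (r + \<theta> N * (\<tau> i * \<tau> j)))"
    proof (intro prod.cong refl one)
     fix i j assume "i \<in> {..<N}" "j \<in> {..<N}"
     then have "\<tau> i \<in> {1, -1}" "\<tau> j \<in> {1, -1}" using \<tau> unfolding signs_def by blast+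
     then show "\<tau> i * \<tau> j = 1 \<or> \<tau> i * \<tau> j = - 1" by auto
    qed
    also have "... = exp (\<Sum>i<N. \<Sum>j<N. r + \<theta> N * (\<tau> i * \<tau> j))" by (simp add: exp_sum)
    also have "(\<Sum>i<N. \<Sum>j<N. r + \<theta> N * (\<tau> i * \<tau> j)) = (real N)\<^sup>2 * r + \<theta> N * (\<Sum>i<N. \<tau> i)\<^sup>2"
    proof -
     have "(\<Sum>i<N. \<tau> i)\<^sup>2 = (\<Sum>i<N. \<Sum>j<N. \<tau> i * \<tau> j)" by (simp add: power2_eq_square sum_product)
     then show ?thesis by (simp add: sum.distrib power2_eq_square flip: sum_distrib_left)
    qed
    finally show ?thesis by (simp add: exp_add)
   qed
   then have "(\<Sum>\<tau>\<in>signs N. \<Prod>i<N. \<Prod>j<N. (a N + \<tau> i * \<tau> j * b N)) = exp ((real N)\<^sup>2 * r) * (\<Sum>\<tau>\<in>signs N. exp (\<theta> N * (\<Sum>i<N. \<tau> i)\<^sup>2))"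
    by (simp add: sum_distrib_left)
   moreover have "(real N)\<^sup>2 / 2 * ln (1 + ((a N)\<^sup>2 - (b N)\<^sup>2 - 1)) = (real N)\<^sup>2 * r" by (simp add: r_def)
   ultimately show ?case by simp
  qed
 qed
qed

section \<open>The spiked likelihood, one pair of entries at a time\<close>

definition diag :: "nat => bool" where
 "diag l \<longleftrightarrow> fst (prod_decode l) = snd (prod_decode l)"

lemma card_ends: "card (ends l) = 2 \<longleftrightarrow> \<not> diag l"
 by (auto simp: ends_def diag_def card_insert_if)

lemma steps_decode: "l \<in> steps N ==> \<exists>i j. prod_decode l = (i, j) \<and> i \<le> j \<and> j < N"
 by (auto simp: steps_def edge_def)

lemma steps_fibre:
 assumes "l \<in> steps N" "prod_decode l = (i, j)"
 shows "{x \<in> {..<N} \<times> {..<N}. (case x of (x, y) => edge x y) = l} = {(i, j), (j, i)}"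
proof -
 have ij: "i \<le> j" "j < N" using steps_decode[OF assms(1)] assms(2) by auto
 have l: "l = edge i j" using assms(2) ij by (metis edge_def max_def min_def prod_decode_inverse)
 show ?thesis unfolding l using ij by (auto simp: edge_eq_iff doubleton_eq_iff)
qed

lemma prod_by_steps:
 fixes F :: "nat => nat => real"
 shows "(\<Prod>i<N. \<Prod>j<N. F i j) = (\<Prod>l\<in>steps N. case prod_decode l of (i, j) => if i = j then F i i else F i j * F j i)"
proof -
 have "(\<Prod>i<N. \<Prod>j<N. F i j) = (\<Prod>x\<in>{..<N} \<times> {..<N}. F (fst x) (snd x))"
  by (simp add: prod.cartesian_product case_prod_beta)
 also have "... = (\<Prod>l\<in>steps N. \<Prod>x\<in>{x \<in> {..<N} \<times> {..<N}. (case x of (x, y) => edge x y) = l}. F (fst x) (snd x))"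
  by (rule prod.group[symmetric]) (auto simp: steps_def)
 also have "... = (\<Prod>l\<in>steps N. case prod_decode l of (i, j) => if i = j then F i i else F i j * F j i)"
 proof (rule prod.cong[OF refl])
  fix l assume l: "l \<in> steps N"
  obtain i j where ij: "prod_decode l = (i, j)" by (cases "prod_decode l")
  show "(\<Prod>x\<in>{x \<in> {..<N} \<times> {..<N}. (case x of (x, y) => edge x y) = l}. F (fst x) (snd x))
   = (case prod_decode l of (i, j) => if i = j then F i i else F i j * F j i)"
   unfolding steps_fibre[OF l ij] by (simp add: ij)
 qed
 finally show ?thesis .
qed

lemma sum_by_steps:
 fixes F :: "nat => nat => real"
 shows "(\<Sum>i<N. \<Sum>j<N. F i j) = (\<Sum>l\<in>steps N. case prod_decode l of (i, j) => if i = j then F i i else F i j + F j i)"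
proof -
 have "(\<Sum>i<N. \<Sum>j<N. F i j) = (\<Sum>x\<in>{..<N} \<times> {..<N}. F (fst x) (snd x))"
  by (simp add: sum.cartesian_product case_prod_beta)
 also have "... = (\<Sum>l\<in>steps N. \<Sum>x\<in>{x \<in> {..<N} \<times> {..<N}. (case x of (x, y) => edge x y) = l}. F (fst x) (snd x))"
  by (rule sum.group[symmetric]) (auto simp: steps_def)
 also have "... = (\<Sum>l\<in>steps N. case prod_decode l of (i, j) => if i = j then F i i else F i j + F j i)"
 proof (rule sum.cong[OF refl])
  fix l assume l: "l \<in> steps N"
  obtain i j where ij: "prod_decode l = (i, j)" by (cases "prod_decode l")
  show "(\<Sum>x\<in>{x \<in> {..<N} \<times> {..<N}. (case x of (x, y) => edge x y) = l}. F (fst x) (snd x))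
   = (case prod_decode l of (i, j) => if i = j then F i i else F i j + F j i)"
   unfolding steps_fibre[OF l ij] by (simp add: ij)
 qed
 finally show ?thesis .
qed

lemma sum_steps_diag:
 "(\<Sum>l\<in>steps N. if diag l then p else q) = real N * p + ((real N)\<^sup>2 - real N) / 2 * (q::real)"
proof -
 have "(\<Sum>i<N. \<Sum>j<N. if i = j then p else q / 2) = (\<Sum>i<N. p + (real N - 1) * (q / 2))"
 proof (rule sum.cong[OF refl])
  fix i assume i: "i \<in> {..<N}"
  have "(\<Sum>j<N. if i = j then p else q / 2) = p + (\<Sum>j\<in>{..<N} - {i}. q / 2)"
   using i by (subst sum.remove[of _ i]) (auto intro!: sum.cong)
  then show "(\<Sum>j<N. if i = j then p else q / 2) = p + (real N - 1) * (q / 2)"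
   using i by (simp add: of_nat_diff)
 qed
 moreover have "(\<Sum>i<N. \<Sum>j<N. if i = j then p else q / 2) = (\<Sum>l\<in>steps N. if diag l then p else q)"
  unfolding sum_by_steps by (rule sum.cong) (auto simp: diag_def split: prod.split)
 ultimately show ?thesis by (simp add: power2_eq_square algebra_simps)
qed

subsection \<open>Tilting independent variables\<close>

context prob_space
begin

text \<open>
 A product of densities, one for each variable: the variables stay independent and each law is reweighted on
 its own.
\<close>

definition tilt :: "'i set => ('i => 'c => real) => ('i => 'a => 'c) => 'a measure" where
 "tilt I w \<xi> = density M (\<lambda>x. ennreal (\<Prod>i\<in>I. w i (\<xi> i x)))"

context
 fixes I :: "'i set" and w :: "'i => 'c => real" and \<xi> :: "'i => 'a => 'c" and N :: "'c measure"
 assumes fin: "finite I" and ind: "indep_vars (\<lambda>_. N) \<xi> I"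
  and w_meas: "\<And>i. i \<in> I ==> w i \<in> borel_measurable N"
  and w_nonneg: "\<And>i x. i \<in> I ==> 0 \<le> w i (\<xi> i x)"
  and w_int: "\<And>i. i \<in> I ==> integrable M (\<lambda>x. w i (\<xi> i x))"
  and w_one: "\<And>i. i \<in> I ==> expectation (\<lambda>x. w i (\<xi> i x)) = 1"
begin

lemma tilt_xi_measurable: "i \<in> I ==> \<xi> i \<in> measurable M N"
 using ind by (auto simp: indep_vars_def)

lemma tilt_weight_measurable: "(\<lambda>x. \<Prod>i\<in>I. w i (\<xi> i x)) \<in> borel_measurable M"
 by (intro borel_measurable_prod measurable_compose[OF tilt_xi_measurable w_meas])

lemma tilt_weight_nonneg: "0 \<le> (\<Prod>i\<in>I. w i (\<xi> i x))"
 by (intro prod_nonneg w_nonneg)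

lemma tilt_product:
 assumes \<phi>: "\<And>i. i \<in> I ==> \<phi> i \<in> borel_measurable N"
  and i: "\<And>i. i \<in> I ==> integrable M (\<lambda>x. w i (\<xi> i x) * \<phi> i (\<xi> i x) :: real)"
 shows "integrable (tilt I w \<xi>) (\<lambda>x. \<Prod>i\<in>I. \<phi> i (\<xi> i x))"
  and "(\<integral>x. (\<Prod>i\<in>I. \<phi> i (\<xi> i x)) \<partial>tilt I w \<xi>) = (\<Prod>i\<in>I. expectation (\<lambda>x. w i (\<xi> i x) * \<phi> i (\<xi> i x)))"
proof -
 have "indep_vars (\<lambda>_. borel) (\<lambda>i x. (\<lambda>z. w i z * \<phi> i z) (\<xi> i x)) I"
  by (rule indep_vars_compose2[OF ind]) (use w_meas \<phi> in measurable)
 then have ip: "indep_vars (\<lambda>_. borel) (\<lambda>i x. w i (\<xi> i x) * \<phi> i (\<xi> i x)) I" by simp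
 have \<phi>m: "(\<lambda>x. \<Prod>i\<in>I. \<phi> i (\<xi> i x)) \<in> borel_measurable M"
  by (intro borel_measurable_prod measurable_compose[OF tilt_xi_measurable \<phi>])
 show "integrable (tilt I w \<xi>) (\<lambda>x. \<Prod>i\<in>I. \<phi> i (\<xi> i x))"
  unfolding tilt_def using indep_vars_integrable[OF fin ip i] \<phi>m tilt_weight_measurable tilt_weight_nonneg
  by (subst integrable_density) (auto simp: prod.distrib)
 show "(\<integral>x. (\<Prod>i\<in>I. \<phi> i (\<xi> i x)) \<partial>tilt I w \<xi>) = (\<Prod>i\<in>I. expectation (\<lambda>x. w i (\<xi> i x) * \<phi> i (\<xi> i x)))"
  unfolding tilt_def using indep_vars_lebesgue_integral[OF fin ip i] \<phi>m tilt_weight_measurable tilt_weight_nonneg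
  by (subst integral_density) (auto simp: prod.distrib)
qed

lemma tilt_some:
 assumes J: "J \<subseteq> I" and \<phi>: "\<And>i. i \<in> J ==> \<phi> i \<in> borel_measurable N"
  and i: "\<And>i. i \<in> J ==> integrable M (\<lambda>x. w i (\<xi> i x) * \<phi> i (\<xi> i x) :: real)"
 shows "integrable (tilt I w \<xi>) (\<lambda>x. \<Prod>i\<in>J. \<phi> i (\<xi> i x))"
  and "(\<integral>x. (\<Prod>i\<in>J. \<phi> i (\<xi> i x)) \<partial>tilt I w \<xi>) = (\<Prod>i\<in>J. expectation (\<lambda>x. w i (\<xi> i x) * \<phi> i (\<xi> i x)))"
proof -
 define \<psi> where "\<psi> i = (if i \<in> J then \<phi> i else (\<lambda>_. 1))" for i
 have restr: "(\<Prod>i\<in>I. if i \<in> J then f i else 1) = (\<Prod>i\<in>J. f i)" for f :: "'i => real"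
  using J fin by (subst prod.inter_restrict[symmetric]) (auto simp: Int_absorb1)
 have a: "(\<Prod>i\<in>I. \<psi> i (\<xi> i x)) = (\<Prod>i\<in>J. \<phi> i (\<xi> i x))" for x
  unfolding restr[symmetric] by (rule prod.cong) (auto simp: \<psi>_def)
 have b: "(\<Prod>i\<in>I. expectation (\<lambda>x. w i (\<xi> i x) * \<psi> i (\<xi> i x))) = (\<Prod>i\<in>J. expectation (\<lambda>x. w i (\<xi> i x) * \<phi> i (\<xi> i x)))"
  unfolding restr[symmetric] by (rule prod.cong) (auto simp: \<psi>_def w_one)
 have "\<And>i. i \<in> I ==> \<psi> i \<in> borel_measurable N"
  "\<And>i. i \<in> I ==> integrable M (\<lambda>x. w i (\<xi> i x) * \<psi> i (\<xi> i x))"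
  using \<phi> i w_int by (auto simp: \<psi>_def)
 from tilt_product[OF this] show "integrable (tilt I w \<xi>) (\<lambda>x. \<Prod>i\<in>J. \<phi> i (\<xi> i x))"
  "(\<integral>x. (\<Prod>i\<in>J. \<phi> i (\<xi> i x)) \<partial>tilt I w \<xi>) = (\<Prod>i\<in>J. expectation (\<lambda>x. w i (\<xi> i x) * \<phi> i (\<xi> i x)))"
  by (simp_all add: a b)
qed

lemma tilt_single:
 assumes "i \<in> I" "\<phi> \<in> borel_measurable N" "integrable M (\<lambda>x. w i (\<xi> i x) * \<phi> (\<xi> i x) :: real)"
 shows "integrable (tilt I w \<xi>) (\<lambda>x. \<phi> (\<xi> i x))"
  and "(\<integral>x. \<phi> (\<xi> i x) \<partial>tilt I w \<xi>) = expectation (\<lambda>x. w i (\<xi> i x) * \<phi> (\<xi> i x))"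
 using tilt_some[of "{i}" "\<lambda>_. \<phi>"] assms by simp_all

lemma sets_tilt [simp]: "sets (tilt I w \<xi>) = sets M" by (simp add: tilt_def)

lemma space_tilt [simp]: "space (tilt I w \<xi>) = space M" by (simp add: tilt_def)

lemma prob_space_tilt: "prob_space (tilt I w \<xi>)"
proof
 have "indep_vars (\<lambda>_. borel) (\<lambda>i x. w i (\<xi> i x)) I"
  by (rule indep_vars_compose2[OF ind w_meas])
 then have i: "integrable M (\<lambda>x. \<Prod>i\<in>I. w i (\<xi> i x))" "expectation (\<lambda>x. \<Prod>i\<in>I. w i (\<xi> i x)) = 1"
  using indep_vars_integrable[OF fin _ w_int] indep_vars_lebesgue_integral[OF fin _ w_int] w_one by auto
 have "emeasure (tilt I w \<xi>) (space M) = (\<integral>\<^sup>+x. ennreal (\<Prod>i\<in>I. w i (\<xi> i x)) * indicator (space M) x \<partial>M)"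
  unfolding tilt_def using tilt_weight_measurable by (intro emeasure_density) auto
 also have "... = (\<integral>\<^sup>+x. ennreal (\<Prod>i\<in>I. w i (\<xi> i x)) \<partial>M)"
  by (rule nn_integral_cong) simp
 also have "... = 1"
  using nn_integral_eq_integral[OF i(1)] tilt_weight_nonneg i(2) by simp
 finally show "emeasure (tilt I w \<xi>) (space (tilt I w \<xi>)) = 1" by simp
qed

lemma tilt_indep: "prob_space.indep_vars (tilt I w \<xi>) (\<lambda>_. N) \<xi> I"
proof -
 interpret Q: prob_space "tilt I w \<xi>" by (rule prob_space_tilt)
 have rv: "\<xi> i \<in> measurable (tilt I w \<xi>) N" if "i \<in> I" for i
  using tilt_xi_measurable[OF that] by (simp add: measurable_cong_sets[OF sets_tilt refl])
 have "Q.indep_sets (\<lambda>i. {\<xi> i -` A \<inter> space (tilt I w \<xi>) |A. A \<in> sets N}) I"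
 proof (rule Q.indep_setsI)
  fix i assume "i \<in> I"
  then show "{\<xi> i -` A \<inter> space (tilt I w \<xi>) |A. A \<in> sets N} \<subseteq> Q.events"
   using measurable_sets[OF rv] by auto
 next
  fix A J assume J: "J \<noteq> {}" "J \<subseteq> I" "finite J" and A: "\<forall>j\<in>J. A j \<in> {\<xi> j -` A \<inter> space (tilt I w \<xi>) |A. A \<in> sets N}"
  then have "\<forall>j\<in>J. \<exists>B. A j = \<xi> j -` B \<inter> space M \<and> B \<in> sets N" by auto
  then obtain B where B: "\<And>j. j \<in> J ==> A j = \<xi> j -` B j \<inter> space M" "\<And>j. j \<in> J ==> B j \<in> sets N"
   by metis
  define \<phi> where "\<phi> j z = (indicator (B j) z :: real)" for j z
  have \<phi>m: "\<phi> j \<in> borel_measurable N" if "j \<in> J" for j using B(2)[OF that] by (simp add: \<phi>_def[abs_def])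
  have \<phi>i: "integrable M (\<lambda>x. w j (\<xi> j x) * \<phi> j (\<xi> j x))" if j: "j \<in> J" for j
  proof (rule Bochner_Integration.integrable_bound[OF w_int])
   show "j \<in> I" using j J by auto
   show "(\<lambda>x. w j (\<xi> j x) * \<phi> j (\<xi> j x)) \<in> borel_measurable M"
    using measurable_compose[OF tilt_xi_measurable w_meas] measurable_compose[OF tilt_xi_measurable \<phi>m] j J by auto
   show "AE x in M. norm (w j (\<xi> j x) * \<phi> j (\<xi> j x)) \<le> norm (w j (\<xi> j x))"
    by (auto simp: \<phi>_def indicator_def)
  qed
  have one: "Q.prob (A j) = expectation (\<lambda>x. w j (\<xi> j x) * \<phi> j (\<xi> j x))" if j: "j \<in> J" for j
  proof -
   have jI: "j \<in> I" using j J by auto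
   have "A j \<in> sets M" using B j measurable_sets[OF tilt_xi_measurable[OF jI]] by auto
   then have "Q.prob (A j) = (\<integral>x. indicator (A j) x \<partial>tilt I w \<xi>)" by (simp add: sets.sets_into_space Int_absorb2)
   also have "... = (\<integral>x. \<phi> j (\<xi> j x) \<partial>tilt I w \<xi>)"
    by (rule Bochner_Integration.integral_cong) (auto simp: \<phi>_def B(1)[OF j] indicator_def)
   also have "... = expectation (\<lambda>x. w j (\<xi> j x) * \<phi> j (\<xi> j x))" by (rule tilt_single(2)[OF jI \<phi>m[OF j] \<phi>i[OF j]])
   finally show ?thesis .
  qed
  have "(\<Inter>j\<in>J. A j) \<in> sets M"
   using B measurable_sets[OF tilt_xi_measurable] J by (intro sets.finite_INT) auto
  then have "Q.prob (\<Inter>j\<in>J. A j) = (\<integral>x. indicator (\<Inter>j\<in>J. A j) x \<partial>tilt I w \<xi>)"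
   by (simp add: sets.sets_into_space Int_absorb2)
  also have "... = (\<integral>x. (\<Prod>j\<in>J. \<phi> j (\<xi> j x)) \<partial>tilt I w \<xi>)"
  proof (rule Bochner_Integration.integral_cong[OF refl])
   fix x assume w: "x \<in> space (tilt I w \<xi>)"
   have "(\<Prod>j\<in>J. \<phi> j (\<xi> j x)) = (\<Prod>j\<in>J. indicator (A j) x)"
    by (rule prod.cong) (use w B(1) in \<open>auto simp: \<phi>_def indicator_def\<close>)
   also have "... = indicator (\<Inter>j\<in>J. A j) x"
    using J by (auto simp: indicator_def prod_eq_1_iff intro: prod.neutral)
   finally show "indicator (\<Inter>j\<in>J. A j) x = (\<Prod>j\<in>J. \<phi> j (\<xi> j x))" by simp
  qed
  also have "... = (\<Prod>j\<in>J. Q.prob (A j))"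
   using tilt_some(2)[OF J(2) \<phi>m \<phi>i] one by (simp cong: prod.cong)
  finally show "Q.prob (\<Inter>j\<in>J. A j) = (\<Prod>j\<in>J. Q.prob (A j))" .
 qed
 then show ?thesis unfolding Q.indep_vars_def2 using rv by auto
qed

lemma tilt_integral:
 assumes "g \<in> borel_measurable M"
 shows "(\<integral>x. g x \<partial>tilt I w \<xi>) = expectation (\<lambda>x. (\<Prod>i\<in>I. w i (\<xi> i x)) * g x :: real)"
 unfolding tilt_def using assms tilt_weight_measurable tilt_weight_nonneg by (subst integral_density) auto

end

end

section \<open>Null and planted laws of the pair variables\<close>

lemma abs_sum_minus_square: "\<bar>x + y - z\<^sup>2\<bar> \<le> \<bar>x\<bar> + \<bar>y\<bar> + z\<^sup>2" for x y z :: real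
 using zero_le_power2[of z] by linarith

text \<open>
 All that is used of the model for one \<open>N\<close>.  The factor of a pair of entries is \<open>1 + u + \<sigma> V\<close>, with \<open>\<sigma>\<close> the
 product of the signs at its ends; on the diagonal, where \<open>\<sigma> = 1\<close>, there is no \<open>V\<close>.  The envelope \<open>H\<close> carries the
 moments, uniformly in \<open>N\<close>, and the second moments are those of \<open>(A + \<sigma> B)\<close>-products with \<open>a = E A\<^sup>2\<close>
 and \<open>b = E B\<^sup>2\<close>.
\<close>

locale spiked_steps = prob_space P for P :: "'a measure" +
 fixes N :: nat and u V H :: "nat => 'a => real" and K a b :: real
 assumes indep: "indep_vars (\<lambda>_. borel) (\<lambda>l x. (u l x, V l x)) (steps N)"
  and H_measurable: "\<And>l. l \<in> steps N ==> H l \<in> borel_measurable P"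
  and H_integrable: "\<And>l. l \<in> steps N ==> integrable P (\<lambda>x. H l x ^ 6)"
  and H_moment: "\<And>l. l \<in> steps N ==> expectation (\<lambda>x. H l x ^ 6) \<le> K"
  and H_ge_1: "\<And>l x. l \<in> steps N ==> 1 \<le> H l x"
  and u_le: "\<And>l x. l \<in> steps N ==> \<not> diag l ==> \<bar>u l x\<bar> \<le> H l x / real N"
  and u_le_diag: "\<And>l x. l \<in> steps N ==> diag l ==> \<bar>u l x\<bar> \<le> H l x / sqrt (real N)"
  and V_le: "\<And>l x. l \<in> steps N ==> \<bar>V l x\<bar> \<le> H l x / sqrt (real N)"
  and V_diag: "\<And>l x. l \<in> steps N ==> diag l ==> V l x = 0"
  and weight_nonneg: "\<And>l x. l \<in> steps N ==> \<bar>V l x\<bar> \<le> 1 + u l x"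
  and weight_le: "\<And>l x. l \<in> steps N ==> 1 + u l x + \<bar>V l x\<bar> \<le> H l x"
  and u_mean: "\<And>l. l \<in> steps N ==> expectation (u l) = 0"
  and V_mean: "\<And>l. l \<in> steps N ==> expectation (V l) = 0"
  and uV_mean: "\<And>l. l \<in> steps N ==> expectation (\<lambda>x. u l x * V l x) = 0"
  and u_square: "\<And>l. l \<in> steps N ==> expectation (\<lambda>x. (u l x)\<^sup>2) = (if diag l then a + b - 1 else a\<^sup>2 + b\<^sup>2 - 1)"
  and V_square: "\<And>l. l \<in> steps N ==> \<not> diag l ==> expectation (\<lambda>x. (V l x)\<^sup>2) = 2 * a * b"
  and K_ge_1: "1 \<le> K" and b_nonneg: "0 \<le> b" and a_nonneg: "0 \<le> a"
begin

lemma pair_measurable: "l \<in> steps N ==> (\<lambda>x. (u l x, V l x)) \<in> borel_measurable P"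
 using indep by (auto simp: indep_vars_def)

lemma u_measurable: "l \<in> steps N ==> u l \<in> borel_measurable P"
 using measurable_compose[OF pair_measurable measurable_fst_real_pair] by simp

lemma V_measurable: "l \<in> steps N ==> V l \<in> borel_measurable P"
 using measurable_compose[OF pair_measurable measurable_snd_real_pair] by simp

lemmas [measurable] = u_measurable V_measurable H_measurable

definition rate :: "nat => real" where
 "rate l = (if diag l then 1 / sqrt (real N) else 1 / real N)"

definition root :: real where "root = 1 / sqrt (real N)"

lemma rate_nonneg: "0 \<le> rate l" by (simp add: rate_def)

lemma root_nonneg: "0 \<le> root" by (simp add: root_def)

lemma monomial_le:
 assumes l: "l \<in> steps N" and ij: "i + j \<le> 6"
 shows "\<bar>u l x ^ i * V l x ^ j\<bar> \<le> rate l ^ i * root ^ j * H l x ^ 6"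
proof -
 have H1: "1 \<le> H l x" by (rule H_ge_1[OF l])
 have "\<bar>u l x\<bar> \<le> rate l * H l x" "\<bar>V l x\<bar> \<le> root * H l x"
  using u_le[OF l] u_le_diag[OF l] V_le[OF l] by (auto simp: rate_def root_def)
 then have "\<bar>u l x\<bar> ^ i * \<bar>V l x\<bar> ^ j \<le> (rate l * H l x) ^ i * (root * H l x) ^ j"
  using H1 rate_nonneg by (intro mult_mono power_mono) auto
 also have "... = rate l ^ i * root ^ j * H l x ^ (i + j)" by (simp add: power_mult_distrib power_add mult_ac)
 also have "... \<le> rate l ^ i * root ^ j * H l x ^ 6"
  using H1 ij rate_nonneg root_nonneg by (intro mult_left_mono power_increasing) auto
 finally show ?thesis by (simp add: abs_mult power_abs)
qed

lemma monomial_integrable: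
 assumes l: "l \<in> steps N" and ij: "i + j \<le> 6"
 shows "integrable P (\<lambda>x. u l x ^ i * V l x ^ j)"
proof (rule Bochner_Integration.integrable_bound[where f="\<lambda>x. rate l ^ i * root ^ j * H l x ^ 6"])
 show "integrable P (\<lambda>x. rate l ^ i * root ^ j * H l x ^ 6)" using H_integrable[OF l] by simp
 show "(\<lambda>x. u l x ^ i * V l x ^ j) \<in> borel_measurable P" using l by measurable
 show "AE x in P. norm (u l x ^ i * V l x ^ j) \<le> norm (rate l ^ i * root ^ j * H l x ^ 6)"
  by (intro AE_I2) (use monomial_le[OF l ij] in \<open>simp add: order_trans[OF _ abs_ge_self]\<close>)
qed

definition mom :: "nat => nat => nat => real" where
 "mom l i j = expectation (\<lambda>x. u l x ^ i * V l x ^ j)"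

lemma mom_le:
 assumes l: "l \<in> steps N" and ij: "i + j \<le> 6"
 shows "\<bar>mom l i j\<bar> \<le> K * (rate l ^ i * root ^ j)"
proof -
 have "\<bar>mom l i j\<bar> \<le> expectation (\<lambda>x. \<bar>u l x ^ i * V l x ^ j\<bar>)" unfolding mom_def by (rule integral_abs_bound)
 also have "... \<le> expectation (\<lambda>x. rate l ^ i * root ^ j * H l x ^ 6)"
  using monomial_integrable[OF l ij] H_integrable[OF l] by (intro integral_mono monomial_le l ij) auto
 also have "... = rate l ^ i * root ^ j * expectation (\<lambda>x. H l x ^ 6)" by simp
 also have "... \<le> rate l ^ i * root ^ j * K"
  using H_moment[OF l] rate_nonneg root_nonneg by (intro mult_left_mono) auto
 finally show ?thesis by (simp add: mult_ac)
qed

definition sgn_of :: "(nat => real) => nat => real" where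
 "sgn_of s l = s (fst (prod_decode l)) * s (snd (prod_decode l))"

definition lr :: "(nat => real) => nat => 'a => real" where
 "lr s l x = 1 + u l x + sgn_of s l * V l x"

definition likelihood :: "'a => real" where
 "likelihood x = (\<Sum>s\<in>signs N. \<Prod>l\<in>steps N. lr s l x) / 2 ^ N"

lemma sgn_of_square:
 assumes "s \<in> signs N" "l \<in> steps N"
 shows "(sgn_of s l)\<^sup>2 = 1" "\<bar>sgn_of s l\<bar> = 1"
proof -
 have "fst (prod_decode l) < N" "snd (prod_decode l) < N" using steps_decode[OF assms(2)] by auto
 then show "(sgn_of s l)\<^sup>2 = 1"
  unfolding sgn_of_def using signs_square[OF assms(1)] by (simp add: power_mult_distrib)
 then show "\<bar>sgn_of s l\<bar> = 1" by (simp add: abs_square_eq_1)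
qed

definition weight :: "real => (nat => real) => nat => real \<times> real => real" where
 "weight \<epsilon> s l z = 1 + \<epsilon> * (fst z + sgn_of s l * snd z)"

text \<open>
 The two laws to be compared: \<open>\<epsilon> = 0\<close> gives the null hypothesis and \<open>\<epsilon> = 1\<close> the spike with
 signs \<open>s\<close>, so that each estimate below serves for both.
\<close>

definition planted :: "real => (nat => real) => 'a measure" where
 "planted \<epsilon> s = tilt (steps N) (weight \<epsilon> s) (\<lambda>l x. (u l x, V l x))"

lemma weight_bounds:
 assumes s: "s \<in> signs N" and l: "l \<in> steps N" and \<epsilon>: "\<epsilon> \<in> {0, 1}"
 shows "0 \<le> weight \<epsilon> s l (u l x, V l x)" "weight \<epsilon> s l (u l x, V l x) \<le> H l x"
proof -
 have "\<bar>sgn_of s l * V l x\<bar> = \<bar>V l x\<bar>" by (simp add: abs_mult sgn_of_square(2)[OF s l])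
 then show "0 \<le> weight \<epsilon> s l (u l x, V l x)" "weight \<epsilon> s l (u l x, V l x) \<le> H l x"
  using weight_nonneg[OF l, of x] weight_le[OF l, of x] H_ge_1[OF l, of x] \<epsilon> by (auto simp: weight_def)
qed

lemma weight_measurable: "weight \<epsilon> s l \<in> borel_measurable (borel :: (real \<times> real) measure)"
 unfolding weight_def[abs_def] borel_prod[symmetric] by measurable

lemma weight_expand:
 "weight \<epsilon> s l (u l x, V l x) * (u l x ^ i * V l x ^ j)
  = u l x ^ i * V l x ^ j + \<epsilon> * (u l x ^ Suc i * V l x ^ j) + \<epsilon> * sgn_of s l * (u l x ^ i * V l x ^ Suc j)"
 by (simp add: weight_def algebra_simps)

lemma weight_monomial:
 assumes l: "l \<in> steps N" and ij: "i + j \<le> 5"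
 shows "integrable P (\<lambda>x. weight \<epsilon> s l (u l x, V l x) * (u l x ^ i * V l x ^ j))"
  and "expectation (\<lambda>x. weight \<epsilon> s l (u l x, V l x) * (u l x ^ i * V l x ^ j))
   = mom l i j + \<epsilon> * mom l (Suc i) j + \<epsilon> * sgn_of s l * mom l i (Suc j)"
proof -
 note i = monomial_integrable[OF l, of i j] monomial_integrable[OF l, of "Suc i" j] monomial_integrable[OF l, of i "Suc j"]
 show "integrable P (\<lambda>x. weight \<epsilon> s l (u l x, V l x) * (u l x ^ i * V l x ^ j))"
  unfolding weight_expand using i ij by (intro Bochner_Integration.integrable_add integrable_mult_right) auto
 show "expectation (\<lambda>x. weight \<epsilon> s l (u l x, V l x) * (u l x ^ i * V l x ^ j))
   = mom l i j + \<epsilon> * mom l (Suc i) j + \<epsilon> * sgn_of s l * mom l i (Suc j)"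
  unfolding weight_expand using i ij by (simp add: mom_def del: power_Suc)
qed

context
 fixes \<epsilon> :: real and s :: "nat => real"
 assumes \<epsilon>: "\<epsilon> \<in> {0, 1}" and s: "s \<in> signs N"
begin

lemma weight_facts:
 "finite (steps N)"
 "indep_vars (\<lambda>_. borel) (\<lambda>l x. (u l x, V l x)) (steps N)"
 "\<And>l. l \<in> steps N ==> weight \<epsilon> s l \<in> borel_measurable borel"
 "\<And>l x. l \<in> steps N ==> 0 \<le> weight \<epsilon> s l (u l x, V l x)"
 "\<And>l. l \<in> steps N ==> integrable P (\<lambda>x. weight \<epsilon> s l (u l x, V l x))"
 "\<And>l. l \<in> steps N ==> expectation (\<lambda>x. weight \<epsilon> s l (u l x, V l x)) = 1"
proof -
 fix l assume l: "l \<in> steps N"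
 show "integrable P (\<lambda>x. weight \<epsilon> s l (u l x, V l x))"
  using weight_monomial(1)[OF l, of 0 0] by simp
 show "expectation (\<lambda>x. weight \<epsilon> s l (u l x, V l x)) = 1"
  using weight_monomial(2)[OF l, of 0 0] u_mean[OF l] V_mean[OF l] by (simp add: mom_def prob_space)
qed (simp_all add: indep weight_measurable weight_bounds(1)[OF s _ \<epsilon>])

lemma prob_space_planted: "prob_space (planted \<epsilon> s)"
 unfolding planted_def by (rule prob_space_tilt[OF weight_facts])

lemma sets_planted [simp]: "sets (planted \<epsilon> s) = sets P"
 unfolding planted_def by (rule sets_tilt[OF weight_facts])

lemma space_planted [simp]: "space (planted \<epsilon> s) = space P"
 unfolding planted_def by (rule space_tilt[OF weight_facts])

lemma planted_indep: "prob_space.indep_vars (planted \<epsilon> s) (\<lambda>_. borel) (\<lambda>l x. (u l x, sgn_of s l * V l x)) (steps N)"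
proof -
 interpret Q: prob_space "planted \<epsilon> s" by (rule prob_space_planted)
 have "Q.indep_vars (\<lambda>_. borel) (\<lambda>l x. (u l x, V l x)) (steps N)"
  unfolding planted_def by (rule tilt_indep[OF weight_facts])
 then have "Q.indep_vars (\<lambda>_. borel) (\<lambda>l x. (\<lambda>z. (fst z, sgn_of s l * snd z)) (u l x, V l x)) (steps N)"
  by (rule Q.indep_vars_compose2) (unfold borel_prod[symmetric], measurable)
 then show ?thesis by simp
qed

lemma planted_integral:
 assumes g: "g \<in> borel_measurable P"
 shows "(\<integral>x. g x \<partial>planted \<epsilon> s) = expectation (\<lambda>x. (\<Prod>l\<in>steps N. weight \<epsilon> s l (u l x, V l x)) * g x)"
 unfolding planted_def by (rule tilt_integral[OF weight_facts g])

lemma planted_monomial: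
 assumes l: "l \<in> steps N" and ij: "i + j \<le> 5"
 shows "integrable (planted \<epsilon> s) (\<lambda>x. u l x ^ i * V l x ^ j)"
  and "(\<integral>x. u l x ^ i * V l x ^ j \<partial>planted \<epsilon> s) = mom l i j + \<epsilon> * mom l (Suc i) j + \<epsilon> * sgn_of s l * mom l i (Suc j)"
proof -
 have m: "(\<lambda>z. fst z ^ i * snd z ^ j) \<in> borel_measurable (borel :: (real \<times> real) measure)"
  unfolding borel_prod[symmetric] by measurable
 have "integrable P (\<lambda>x. weight \<epsilon> s l (u l x, V l x) * (\<lambda>z. fst z ^ i * snd z ^ j) (u l x, V l x))"
  using weight_monomial(1)[OF l ij] by simp
 note t = tilt_single[OF weight_facts l m this]
 show "integrable (planted \<epsilon> s) (\<lambda>x. u l x ^ i * V l x ^ j)"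
  using t(1) by (simp add: planted_def)
 show "(\<integral>x. u l x ^ i * V l x ^ j \<partial>planted \<epsilon> s) = mom l i j + \<epsilon> * mom l (Suc i) j + \<epsilon> * sgn_of s l * mom l i (Suc j)"
  using t(2) weight_monomial(2)[OF l ij] by (simp add: planted_def)
qed

text \<open>
 The density of the planted law costs one further power of the envelope, and no further factor that depends on \<open>N\<close>.
\<close>

lemma planted_fourth:
 assumes l: "l \<in> steps N" and ij: "i + j = 4"
 shows "(\<integral>x. u l x ^ i * V l x ^ j \<partial>planted \<epsilon> s) \<le> K * (rate l ^ i * root ^ j)"
proof -
 have "(\<integral>x. u l x ^ i * V l x ^ j \<partial>planted \<epsilon> s) = expectation (\<lambda>x. weight \<epsilon> s l (u l x, V l x) * (u l x ^ i * V l x ^ j))"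
  using planted_monomial(2)[OF l] weight_monomial(2)[OF l] ij by simp
 also have "... \<le> expectation (\<lambda>x. rate l ^ i * root ^ j * H l x ^ 6)"
 proof (rule integral_mono)
  show "integrable P (\<lambda>x. weight \<epsilon> s l (u l x, V l x) * (u l x ^ i * V l x ^ j))"
   using weight_monomial(1)[OF l] ij by simp
  show "integrable P (\<lambda>x. rate l ^ i * root ^ j * H l x ^ 6)" using H_integrable[OF l] by simp
  fix x
  have H1: "1 \<le> H l x" by (rule H_ge_1[OF l])
  have "\<bar>u l x\<bar> \<le> rate l * H l x" "\<bar>V l x\<bar> \<le> root * H l x"
   using u_le[OF l] u_le_diag[OF l] V_le[OF l] by (auto simp: rate_def root_def)
  then have "\<bar>u l x\<bar> ^ i * \<bar>V l x\<bar> ^ j \<le> (rate l * H l x) ^ i * (root * H l x) ^ j"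
   using H1 rate_nonneg by (intro mult_mono power_mono) auto
  also have "... = rate l ^ i * root ^ j * H l x ^ 4" by (simp add: power_mult_distrib mult_ac flip: ij power_add)
  finally have b: "\<bar>u l x ^ i * V l x ^ j\<bar> \<le> rate l ^ i * root ^ j * H l x ^ 4" by (simp add: abs_mult power_abs)
  have "weight \<epsilon> s l (u l x, V l x) * (u l x ^ i * V l x ^ j) \<le> weight \<epsilon> s l (u l x, V l x) * \<bar>u l x ^ i * V l x ^ j\<bar>"
   using weight_bounds(1)[OF s l \<epsilon>, of x] by (rule mult_left_mono[OF abs_ge_self])
  also have "... \<le> H l x * (rate l ^ i * root ^ j * H l x ^ 4)"
   by (rule mult_mono[OF weight_bounds(2)[OF s l \<epsilon>] b]) (use H1 in auto)
  also have "... = rate l ^ i * root ^ j * H l x ^ 5" by (simp add: eval_nat_numeral)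
  also have "... \<le> rate l ^ i * root ^ j * H l x ^ 6"
   using H1 rate_nonneg root_nonneg by (intro mult_left_mono power_increasing) auto
  finally show "weight \<epsilon> s l (u l x, V l x) * (u l x ^ i * V l x ^ j) \<le> rate l ^ i * root ^ j * H l x ^ 6" .
 qed
 also have "... = rate l ^ i * root ^ j * expectation (\<lambda>x. H l x ^ 6)" by simp
 also have "... \<le> rate l ^ i * root ^ j * K"
  using H_moment[OF l] rate_nonneg root_nonneg by (intro mult_left_mono) auto
 finally show ?thesis by (simp add: mult_ac)
qed

abbreviation "Q \<equiv> planted \<epsilon> s"

abbreviation "h l x \<equiv> sgn_of s l * V l x"

text \<open>
 Tilting by \<open>1 + \<epsilon> (u + \<sigma> V)\<close> shifts each mean by the corresponding variance.
\<close>

lemma planted_mean: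
 assumes l: "l \<in> steps N"
 shows "(\<integral>x. u l x \<partial>Q) = \<epsilon> * mom l 2 0" "(\<integral>x. h l x \<partial>Q) = \<epsilon> * mom l 0 2"
proof -
 have z: "mom l 1 0 = 0" "mom l 0 1 = 0" "mom l 1 1 = 0"
  using u_mean[OF l] V_mean[OF l] uV_mean[OF l] by (simp_all add: mom_def)
 show "(\<integral>x. u l x \<partial>Q) = \<epsilon> * mom l 2 0"
  using planted_monomial(2)[OF l, of 1 0] z by (simp add: numeral_2_eq_2)
 have "(\<integral>x. V l x \<partial>Q) = \<epsilon> * sgn_of s l * mom l 0 2"
  using planted_monomial(2)[OF l, of 0 1] z by (simp add: numeral_2_eq_2)
 then have "(\<integral>x. h l x \<partial>Q) = \<epsilon> * ((sgn_of s l)\<^sup>2 * mom l 0 2)"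
  by (simp add: power2_eq_square)
 then show "(\<integral>x. h l x \<partial>Q) = \<epsilon> * mom l 0 2" by (simp add: sgn_of_square(1)[OF s l])
qed

lemma planted_integrable:
 assumes l: "l \<in> steps N"
 shows "integrable Q (u l)" "integrable Q (h l)" "integrable Q (\<lambda>x. (u l x)\<^sup>2)" "integrable Q (\<lambda>x. (h l x)\<^sup>2)"
  "integrable Q (\<lambda>x. u l x * h l x)" "integrable Q (\<lambda>x. u l x ^ 4)" "integrable Q (\<lambda>x. h l x ^ 4)"
 using planted_monomial(1)[OF l, of 1 0] planted_monomial(1)[OF l, of 0 1] planted_monomial(1)[OF l, of 2 0]
  planted_monomial(1)[OF l, of 0 2] planted_monomial(1)[OF l, of 1 1] planted_monomial(1)[OF l, of 4 0]
  planted_monomial(1)[OF l, of 0 4]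
 by (simp_all add: power_mult_distrib mult.left_commute[of _ "sgn_of s l"])

lemma centered_fourth:
 fixes f :: "'a => real" and m c d :: real
 assumes i: "integrable Q (\<lambda>y. f y ^ 4)" and f: "f \<in> borel_measurable P"
  and le: "(\<integral>y. f y ^ 4 \<partial>Q) \<le> c" and m: "m ^ 4 \<le> d"
 shows "(\<integral>y. (f y - m) ^ 4 \<partial>Q) \<le> 8 * (c + d)"
proof -
 interpret Q: prob_space Q by (rule prob_space_planted)
 have four: "(x - m) ^ 4 \<le> 8 * (x ^ 4 + m ^ 4)" for x
  using fourth_power_sum_le[of x "- m"] by simp
 have "(\<integral>y. (f y - m) ^ 4 \<partial>Q) \<le> (\<integral>y. 8 * (f y ^ 4 + m ^ 4) \<partial>Q)"
 proof (rule integral_mono')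
  show "integrable Q (\<lambda>y. 8 * (f y ^ 4 + m ^ 4))" using i by auto
 qed (use four in auto)
 also have "... = 8 * ((\<integral>y. f y ^ 4 \<partial>Q) + m ^ 4)" using i by (simp add: Q.prob_space[unfolded space_planted])
 also have "... \<le> 8 * (c + d)" using le m by simp
 finally show ?thesis .
qed

lemma abs_eps_mult_le: "\<bar>x\<bar> \<le> y ==> \<bar>\<epsilon> * x\<bar> \<le> y" for x y :: real
 using \<epsilon> by auto

lemma planted_u_variance:
 assumes l: "l \<in> steps N"
 shows "\<bar>(\<integral>y. (u l y - (\<integral>x. u l x \<partial>Q))\<^sup>2 \<partial>Q) - mom l 2 0\<bar>
  \<le> K * rate l ^ 3 + K * (rate l ^ 2 * root) + K\<^sup>2 * rate l ^ 4"
proof -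
 interpret Q: prob_space Q by (rule prob_space_planted)
 have "(\<integral>y. (u l y - (\<integral>x. u l x \<partial>Q))\<^sup>2 \<partial>Q) = (\<integral>y. (u l y)\<^sup>2 \<partial>Q) - (\<epsilon> * mom l 2 0)\<^sup>2"
  using Q.variance_eq[OF planted_integrable(1)[OF l] planted_integrable(3)[OF l]] planted_mean(1)[OF l] by simp
 moreover have "(\<integral>y. (u l y)\<^sup>2 \<partial>Q) = mom l 2 0 + \<epsilon> * mom l 3 0 + \<epsilon> * sgn_of s l * mom l 2 1"
  using planted_monomial(2)[OF l, of 2 0] by (simp add: eval_nat_numeral)
 ultimately have "(\<integral>y. (u l y - (\<integral>x. u l x \<partial>Q))\<^sup>2 \<partial>Q) - mom l 2 0
   = \<epsilon> * mom l 3 0 + \<epsilon> * (sgn_of s l * mom l 2 1) - (\<epsilon> * mom l 2 0)\<^sup>2" by simp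
 also have "\<bar>...\<bar> \<le> \<bar>\<epsilon> * mom l 3 0\<bar> + \<bar>\<epsilon> * (sgn_of s l * mom l 2 1)\<bar> + (\<epsilon> * mom l 2 0)\<^sup>2"
  by (rule abs_sum_minus_square)
 also have "... \<le> K * rate l ^ 3 + K * (rate l ^ 2 * root) + (K * rate l ^ 2)\<^sup>2"
 proof (intro add_mono abs_eps_mult_le)
  show "\<bar>mom l 3 0\<bar> \<le> K * rate l ^ 3" using mom_le[OF l, of 3 0] by simp
  show "\<bar>sgn_of s l * mom l 2 1\<bar> \<le> K * (rate l ^ 2 * root)"
   using mom_le[OF l, of 2 1] by (simp add: abs_mult sgn_of_square(2)[OF s l])
  have "\<bar>\<epsilon> * mom l 2 0\<bar> \<le> K * rate l ^ 2" using mom_le[OF l, of 2 0] by (intro abs_eps_mult_le) simp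
  from power_mono[OF this, of 2] show "(\<epsilon> * mom l 2 0)\<^sup>2 \<le> (K * rate l ^ 2)\<^sup>2" by simp
 qed
 also have "(K * rate l ^ 2)\<^sup>2 = K\<^sup>2 * rate l ^ 4" by (simp add: power_mult_distrib flip: power_mult)
 finally show ?thesis .
qed

lemma planted_h_variance:
 assumes l: "l \<in> steps N"
 shows "\<bar>(\<integral>y. (h l y - (\<integral>x. h l x \<partial>Q))\<^sup>2 \<partial>Q) - mom l 0 2\<bar>
  \<le> K * (rate l * root ^ 2) + K * root ^ 3 + K\<^sup>2 * root ^ 4"
proof -
 interpret Q: prob_space Q by (rule prob_space_planted)
 have "(\<integral>y. (h l y - (\<integral>x. h l x \<partial>Q))\<^sup>2 \<partial>Q) = (\<integral>y. (h l y)\<^sup>2 \<partial>Q) - (\<epsilon> * mom l 0 2)\<^sup>2"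
  using Q.variance_eq[OF planted_integrable(2)[OF l] planted_integrable(4)[OF l]] planted_mean(2)[OF l] by simp
 moreover have "(\<integral>y. (h l y)\<^sup>2 \<partial>Q) = mom l 0 2 + \<epsilon> * mom l 1 2 + \<epsilon> * sgn_of s l * mom l 0 3"
  using planted_monomial(2)[OF l, of 0 2] sgn_of_square(1)[OF s l]
  by (simp only: power_mult_distrib mult_1) (simp add: eval_nat_numeral)
 ultimately have "(\<integral>y. (h l y - (\<integral>x. h l x \<partial>Q))\<^sup>2 \<partial>Q) - mom l 0 2
   = \<epsilon> * mom l 1 2 + \<epsilon> * (sgn_of s l * mom l 0 3) - (\<epsilon> * mom l 0 2)\<^sup>2" by simp
 also have "\<bar>...\<bar> \<le> \<bar>\<epsilon> * mom l 1 2\<bar> + \<bar>\<epsilon> * (sgn_of s l * mom l 0 3)\<bar> + (\<epsilon> * mom l 0 2)\<^sup>2"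
  by (rule abs_sum_minus_square)
 also have "... \<le> K * (rate l * root ^ 2) + K * root ^ 3 + (K * root ^ 2)\<^sup>2"
 proof (intro add_mono abs_eps_mult_le)
  show "\<bar>mom l 1 2\<bar> \<le> K * (rate l * root ^ 2)" using mom_le[OF l, of 1 2] by simp
  show "\<bar>sgn_of s l * mom l 0 3\<bar> \<le> K * root ^ 3"
   using mom_le[OF l, of 0 3] by (simp add: abs_mult sgn_of_square(2)[OF s l])
  have "\<bar>\<epsilon> * mom l 0 2\<bar> \<le> K * root ^ 2" using mom_le[OF l, of 0 2] by (intro abs_eps_mult_le) simp
  from power_mono[OF this, of 2] show "(\<epsilon> * mom l 0 2)\<^sup>2 \<le> (K * root ^ 2)\<^sup>2" by simp
 qed
 also have "(K * root ^ 2)\<^sup>2 = K\<^sup>2 * root ^ 4" by (simp add: power_mult_distrib flip: power_mult)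
 finally show ?thesis .
qed

lemma planted_covariance:
 assumes l: "l \<in> steps N"
 shows "\<bar>\<integral>y. (u l y - (\<integral>x. u l x \<partial>Q)) * (h l y - (\<integral>x. h l x \<partial>Q)) \<partial>Q\<bar>
  \<le> K * (rate l ^ 2 * root) + K * (rate l * root ^ 2) + K\<^sup>2 * (rate l ^ 2 * root ^ 2)"
proof -
 interpret Q: prob_space Q by (rule prob_space_planted)
 note i = planted_integrable[OF l]
 define m1 m2 where "m1 = (\<integral>x. u l x \<partial>Q)" and "m2 = (\<integral>x. h l x \<partial>Q)"
 have "(\<integral>y. (u l y - m1) * (h l y - m2) \<partial>Q) = (\<integral>y. u l y * h l y - m2 * u l y - m1 * h l y + m1 * m2 \<partial>Q)"
  by (simp add: algebra_simps)
 also have "... = (\<integral>y. u l y * h l y \<partial>Q) - m2 * m1 - m1 * m2 + m1 * m2"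
  using i by (simp add: m1_def m2_def Q.prob_space[unfolded space_planted])
 also have "(\<integral>y. u l y * h l y \<partial>Q) = sgn_of s l * (\<integral>y. u l y * V l y \<partial>Q)"
  by (simp add: mult.left_commute[of _ "sgn_of s l"])
 also have "(\<integral>y. u l y * V l y \<partial>Q) = \<epsilon> * mom l 2 1 + \<epsilon> * sgn_of s l * mom l 1 2"
  using planted_monomial(2)[OF l, of 1 1] uV_mean[OF l] by (simp add: mom_def eval_nat_numeral)
 finally have "(\<integral>y. (u l y - m1) * (h l y - m2) \<partial>Q)
   = \<epsilon> * (sgn_of s l * mom l 2 1) + \<epsilon> * ((sgn_of s l)\<^sup>2 * mom l 1 2) - m1 * m2"
  by (simp add: algebra_simps power2_eq_square)
 also have "\<bar>...\<bar> \<le> \<bar>\<epsilon> * (sgn_of s l * mom l 2 1)\<bar> + \<bar>\<epsilon> * ((sgn_of s l)\<^sup>2 * mom l 1 2)\<bar> + \<bar>m1 * m2\<bar>" by simp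
 also have "... \<le> K * (rate l ^ 2 * root) + K * (rate l * root ^ 2) + (K * rate l ^ 2) * (K * root ^ 2)"
 proof (intro add_mono abs_eps_mult_le)
  show "\<bar>sgn_of s l * mom l 2 1\<bar> \<le> K * (rate l ^ 2 * root)"
   using mom_le[OF l, of 2 1] by (simp add: abs_mult sgn_of_square(2)[OF s l])
  show "\<bar>(sgn_of s l)\<^sup>2 * mom l 1 2\<bar> \<le> K * (rate l * root ^ 2)"
   using mom_le[OF l, of 1 2] by (simp add: sgn_of_square(1)[OF s l])
  have "\<bar>m1\<bar> \<le> K * rate l ^ 2" "\<bar>m2\<bar> \<le> K * root ^ 2"
   unfolding m1_def m2_def planted_mean[OF l]
   using mom_le[OF l, of 2 0] mom_le[OF l, of 0 2] by (auto intro!: abs_eps_mult_le)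
  then show "\<bar>m1 * m2\<bar> \<le> (K * rate l ^ 2) * (K * root ^ 2)"
   unfolding abs_mult using K_ge_1 rate_nonneg by (intro mult_mono) auto
 qed
 finally show ?thesis by (simp add: m1_def m2_def power2_eq_square mult_ac)
qed

end

end

section \<open>The central limit theorem under the planted law\<close>

lemma half_square_le: "((real N)\<^sup>2 - real N) / 2 \<le> (real N)\<^sup>2"
proof -
 have *: "(x - y) / 2 \<le> x" if "0 \<le> x" "0 \<le> y" for x y :: real using that by simp
 show ?thesis by (rule *) simp_all
qed

text \<open>
 The first summands are the total variance of the \<open>u l\<close> off and on the diagonal; \<open>(2 f)\<^sup>k / (2 k)\<close> is the number of
 cycles of length \<open>k\<close> times the variance of each, which is about \<open>(2 f / N)\<^sup>k\<close>.
\<close>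

definition limit_variance :: "real => real => nat => real" where
 "limit_variance \<gamma> f m = \<gamma> + f\<^sup>2 / 2 + f + (\<Sum>k=3..m. (2 * f) ^ k / (2 * real k))"

locale spiked_sequence =
 fixes P :: "nat => 'a measure" and u V H :: "nat => nat => 'a => real" and K \<gamma> f :: real and a b :: "nat => real"
 assumes loc: "\<And>N. spiked_steps (P N) N (u N) (V N) (H N) K (a N) (b N)"
  and a_lim: "(\<lambda>N. (real N)\<^sup>2 * (a N - 1)) \<longlonglongrightarrow> \<gamma>"
  and b_lim: "(\<lambda>N. real N * b N) \<longlonglongrightarrow> f"
  and \<gamma>_nonneg: "0 \<le> \<gamma>" and f_nonneg: "0 \<le> f"
begin

sublocale S: spiked_steps "P N" N "u N" "V N" "H N" K "a N" "b N" for N by (rule loc)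

definition stat :: "nat => nat => 'a => real" where
 "stat m N x = (\<Sum>l\<in>steps N. u N l x) + (\<Sum>c\<in>cycles N m. \<Prod>l\<in>c. V N l x)"

lemma root_lim: "(\<lambda>N. 1 / sqrt (real N)) \<longlonglongrightarrow> 0"
 by (rule tendsto_divide_0[OF tendsto_const filterlim_at_top_imp_at_infinity[OF filterlim_compose[OF sqrt_at_top filterlim_real_sequentially]]])

lemma scaled_zero: "(\<lambda>N. real N * x N) \<longlonglongrightarrow> c ==> x \<longlonglongrightarrow> 0" for x :: "nat => real"
proof (rule Lim_transform_eventually)
 assume "(\<lambda>N. real N * x N) \<longlonglongrightarrow> c"
 from tendsto_mult[OF this lim_1_over_n] show "(\<lambda>N. (real N * x N) * (1 / real N)) \<longlonglongrightarrow> 0" by simp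
 show "\<forall>\<^sub>F N in sequentially. (real N * x N) * (1 / real N) = x N"
  using eventually_gt_at_top[of 0] by eventually_elim simp
qed

lemma a_scaled: "(\<lambda>N. real N * (a N - 1)) \<longlonglongrightarrow> 0"
 using scaled_zero[of "\<lambda>N. real N * (a N - 1)" \<gamma>] a_lim by (simp add: power2_eq_square mult.assoc)

lemma a_one: "a \<longlonglongrightarrow> 1" by (rule LIM_zero_cancel, rule scaled_zero[OF a_scaled])

lemma b_zero: "b \<longlonglongrightarrow> 0" by (rule scaled_zero[OF b_lim])

lemma sum_u_square_limit: "(\<lambda>N. \<Sum>l\<in>steps N. S.mom N l 2 0) \<longlonglongrightarrow> \<gamma> + f\<^sup>2 / 2 + f"
proof -
 have eq: "(\<Sum>l\<in>steps N. S.mom N l 2 0) = real N * (a N - 1) + real N * b N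
   + ((real N)\<^sup>2 * (a N - 1)) * (a N + 1) / 2 - (real N * (a N - 1)) * (a N + 1) / 2 + (real N * b N)\<^sup>2 / 2 - (real N * b N) * b N / 2" for N
 proof -
  have "(\<Sum>l\<in>steps N. S.mom N l 2 0) = (\<Sum>l\<in>steps N. if diag l then a N + b N - 1 else (a N)\<^sup>2 + (b N)\<^sup>2 - 1)"
   by (rule sum.cong) (simp_all add: S.mom_def S.u_square)
  also have "... = real N * (a N + b N - 1) + ((real N)\<^sup>2 - real N) / 2 * ((a N)\<^sup>2 + (b N)\<^sup>2 - 1)"
   by (rule sum_steps_diag)
  finally show ?thesis by (simp add: power2_eq_square field_simps)
 qed
 have "(\<lambda>N. real N * (a N - 1) + real N * b N
   + ((real N)\<^sup>2 * (a N - 1)) * (a N + 1) / 2 - (real N * (a N - 1)) * (a N + 1) / 2 + (real N * b N)\<^sup>2 / 2 - (real N * b N) * b N / 2)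
   \<longlonglongrightarrow> 0 + f + \<gamma> * (1 + 1) / 2 - 0 * (1 + 1) / 2 + f\<^sup>2 / 2 - f * 0 / 2"
  by (intro tendsto_add tendsto_diff tendsto_divide tendsto_mult tendsto_power tendsto_const a_lim b_lim a_scaled a_one b_zero) auto
 then show ?thesis by (simp add: eq add_ac)
qed

lemma K_fourth: "K + K ^ 4 \<le> 2 * K ^ 4" "8 * (2 * K ^ 4) \<le> (2 * (1 + K)) ^ 4" "K \<le> (2 * (1 + K))\<^sup>2"
proof -
 have K: "1 \<le> K" by (rule S.K_ge_1)
 show "K + K ^ 4 \<le> 2 * K ^ 4" using power_increasing[of 1 4 K] K by simp
 have "K ^ 4 \<le> (1 + K) ^ 4" using K by (intro power_mono) auto
 moreover have "(2 * (1 + K)) ^ 4 = 16 * (1 + K) ^ 4" by (simp only: power_mult_distrib) simp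
 ultimately show "8 * (2 * K ^ 4) \<le> (2 * (1 + K)) ^ 4" by linarith
 show "K \<le> (2 * (1 + K))\<^sup>2" using K by (simp add: power2_eq_square algebra_simps)
qed

lemma rate_cases: "S.rate N l = (if diag l then S.root N else (S.root N)\<^sup>2)"
 by (simp add: S.rate_def S.root_def power_divide)

lemma root_powers:
 assumes N: "0 < N"
 shows "real N * S.root N ^ 3 = S.root N" "(real N)\<^sup>2 * S.root N ^ 5 = S.root N" "real N * S.root N ^ 4 = (S.root N)\<^sup>2"
  "(real N)\<^sup>2 * S.root N ^ 8 = S.root N ^ 4" "real N * sqrt (real N) * S.root N ^ 4 = S.root N"
proof -
 define r where "r = sqrt (real N)"
 have r: "0 < r" "real N = r * r" "S.root N = 1 / r" "sqrt (real N) = r" using N by (auto simp: r_def S.root_def)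
 show "real N * S.root N ^ 3 = S.root N" "(real N)\<^sup>2 * S.root N ^ 5 = S.root N" "real N * S.root N ^ 4 = (S.root N)\<^sup>2"
  "(real N)\<^sup>2 * S.root N ^ 8 = S.root N ^ 4" "real N * sqrt (real N) * S.root N ^ 4 = S.root N"
  unfolding r(2-4) using r(1) by (simp_all add: field_simps eval_nat_numeral)
qed

text \<open>
 The shift of the mean equals the variance, because tilting by \<open>1 + u + \<sigma> V\<close> moves the mean of \<open>u\<close> and of \<open>\<sigma> V\<close> by their
 second moments.  With this relation \<open>exp (S - v / 2)\<close> has mean one in the limit, as a likelihood ratio must.
\<close>

theorem planted_statistic_clt:
 assumes \<epsilon>: "\<epsilon> \<in> {0, 1}" and s: "\<And>N. s N \<in> signs N"
 shows "(\<lambda>N. \<integral>v. iexp (t * stat m N v) \<partial>S.planted N \<epsilon> (s N))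
  \<longlonglongrightarrow> iexp (t * (\<epsilon> * limit_variance \<gamma> f m)) * complex_of_real (exp (- (t\<^sup>2 * limit_variance \<gamma> f m / 2)))"
proof -
 define Q where "Q N = S.planted N \<epsilon> (s N)" for N
 define h where "h N l v = S.sgn_of (s N) l * V N l v" for N l v
 \<comment> \<open>\<open>B ^ 4\<close> exceeds \<open>8 * (K + K ^ 4)\<close>, the constant for centred fourth moments, and \<open>B ^ 2\<close> exceeds \<open>K\<close>.\<close>
 let ?U = "\<lambda>N l. \<integral>x. u N l x \<partial>Q N" and ?H = "\<lambda>N l. \<integral>x. h N l x \<partial>Q N"
 let ?U2 = "\<lambda>N l. \<integral>v. (u N l v - ?U N l)\<^sup>2 \<partial>Q N" and ?U4 = "\<lambda>N l. \<integral>v. (u N l v - ?U N l) ^ 4 \<partial>Q N"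
 define B where "B = 2 * (1 + K)"
 define K' where "K' = 2 * K + K\<^sup>2"
 define r where "r N = S.root N" for N
 have r0: "0 \<le> r N" and r1: "0 < N ==> r N \<le> 1" for N by (auto simp: r_def S.root_def)
 have r_lim: "r \<longlonglongrightarrow> 0" using root_lim by (simp add: r_def[abs_def] S.root_def)
 have K1: "1 \<le> K" by (rule S.K_ge_1)
 have Npos: "0 < N" if "l \<in> steps N" for l N using steps_decode[OF that] by auto
 have rp: "r N ^ i \<le> r N ^ j" if "j \<le> i" "0 < N" for N i j
  using that r0 r1 by (intro power_decreasing) auto
 have Br: "B / sqrt (real N) = B * r N" for N by (simp add: r_def S.root_def)
 note pm = S.planted_mean[OF \<epsilon> s] and pi = S.planted_integrable[OF \<epsilon> s]
 have hmean: "(\<integral>v. h N l v \<partial>Q N) = \<epsilon> * S.mom N l 0 2" and umean: "(\<integral>v. u N l v \<partial>Q N) = \<epsilon> * S.mom N l 2 0"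
  if "l \<in> steps N" for N l
  using pm[OF that] by (simp_all add: Q_def h_def)
 have mom02: "0 \<le> S.mom N l 0 2" for N l by (simp add: S.mom_def)
 have mom02_le: "\<epsilon> * S.mom N l 0 2 \<le> K * r N ^ 2" if l: "l \<in> steps N" for N l
  using S.mom_le[OF l, of 0 2] mom02[of N l] \<epsilon> K1 r0[of N] by (auto simp: r_def)
 have "(\<lambda>N. \<integral>v. iexp (t * ((\<Sum>l\<in>steps N. u N l v) + (\<Sum>c\<in>cycles N m. \<Prod>l\<in>c. h N l v))) \<partial>Q N)
   \<longlonglongrightarrow> iexp (t * (\<epsilon> * limit_variance \<gamma> f m))
    * complex_of_real (exp (- (t\<^sup>2 * ((\<gamma> + f\<^sup>2 / 2 + f) + (\<Sum>k=3..m. (2 * f) ^ k / (2 * real k))) / 2)))"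
 proof (rule cycle_sum_clt[where B=B and \<kappa>="\<lambda>N. K' * r N ^ 4" and \<delta>="\<lambda>N. K' * r N + \<bar>real N * (2 * a N * b N) - 2 * f\<bar>"])
  show "prob_space (Q N)" for N unfolding Q_def by (rule S.prob_space_planted[OF \<epsilon> s])
  show "prob_space.indep_vars (Q N) (\<lambda>_. borel) (\<lambda>l v. (u N l v, h N l v)) (steps N)" for N
   unfolding Q_def h_def by (rule S.planted_indep[OF \<epsilon> s])
  show "integrable (Q N) (\<lambda>v. u N l v ^ 4)" "integrable (Q N) (\<lambda>v. h N l v ^ 4)" if "l \<in> steps N" for N l
   using pi(6,7)[OF that] by (simp_all add: Q_def h_def)
  show "1 \<le> B" using K1 by (simp add: B_def)
  show "(\<integral>v. (h N l v - ?H N l) ^ 4 \<partial>Q N) \<le> (B / sqrt (real N)) ^ 4" if l: "l \<in> steps N" for N l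
  proof -
   have "(\<integral>v. (h N l v - ?H N l) ^ 4 \<partial>Q N) \<le> 8 * (K * r N ^ 4 + K ^ 4 * r N ^ 4)"
    unfolding hmean[OF l] unfolding Q_def
   proof (rule S.centered_fourth[OF \<epsilon> s])
    show "integrable (S.planted N \<epsilon> (s N)) (\<lambda>v. h N l v ^ 4)" using pi(7)[OF l] by (simp add: h_def)
    show "h N l \<in> borel_measurable (P N)" unfolding h_def[abs_def] using S.V_measurable[OF l] by measurable
    have "h N l v ^ 4 = u N l v ^ 0 * V N l v ^ 4" for v
     using power_mult[of "S.sgn_of (s N) l" 2 2] S.sgn_of_square(1)[OF s l] by (simp add: h_def power_mult_distrib)
    then show "(\<integral>v. h N l v ^ 4 \<partial>S.planted N \<epsilon> (s N)) \<le> K * r N ^ 4"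
     using S.planted_fourth[OF \<epsilon> s l, of 0 4] by (simp add: r_def)
    have "(\<epsilon> * S.mom N l 0 2) ^ 4 \<le> (K * r N ^ 2) ^ 4"
     using mom02_le[OF l] mom02[of N l] \<epsilon> by (intro power_mono) auto
    also have "... = K ^ 4 * r N ^ 8" by (simp add: power_mult_distrib flip: power_mult)
    also have "... \<le> K ^ 4 * r N ^ 4" using rp[of 4 8 N] Npos[OF l] K1 by (intro mult_left_mono) auto
    finally show "(\<epsilon> * S.mom N l 0 2) ^ 4 \<le> K ^ 4 * r N ^ 4" .
   qed
   also have "... = 8 * (K + K ^ 4) * r N ^ 4" by (simp add: algebra_simps)
   also have "... \<le> B ^ 4 * r N ^ 4"
    using K_fourth r0[of N] unfolding B_def by (intro mult_right_mono) auto
   finally show ?thesis unfolding Br by (simp add: power_mult_distrib)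
  qed
  show "0 \<le> ?H N l \<and> ?H N l \<le> (B / sqrt (real N))\<^sup>2" if l: "l \<in> steps N" for N l
  proof -
   have "K * r N ^ 2 \<le> B\<^sup>2 * r N ^ 2" using K_fourth(3) unfolding B_def by (intro mult_right_mono) auto
   then show ?thesis unfolding Br hmean[OF l] using mom02_le[OF l] mom02[of N l] \<epsilon>
    by (auto simp: power_mult_distrib)
  qed
  show "(\<lambda>N. \<Sum>l\<in>steps N. ?U2 N l) \<longlonglongrightarrow> \<gamma> + f\<^sup>2 / 2 + f"
  proof (rule Lim_transform[OF sum_u_square_limit], rule Lim_null_comparison)
   show "(\<lambda>N. 2 * K' * r N) \<longlonglongrightarrow> 0" using tendsto_mult[OF tendsto_const[of "2 * K'"] r_lim] by simp
   show "\<forall>\<^sub>F N in sequentially. norm ((\<Sum>l\<in>steps N. ?U2 N l) - (\<Sum>l\<in>steps N. S.mom N l 2 0)) \<le> 2 * K' * r N"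
    using eventually_gt_at_top[of 0]
   proof eventually_elim
    case (elim N)
    have "norm ((\<Sum>l\<in>steps N. ?U2 N l) - (\<Sum>l\<in>steps N. S.mom N l 2 0))
      \<le> (\<Sum>l\<in>steps N. \<bar>?U2 N l - S.mom N l 2 0\<bar>)"
     unfolding sum_subtractf[symmetric] real_norm_def by (rule sum_abs)
    also have "... \<le> (\<Sum>l\<in>steps N. if diag l then K' * r N ^ 3 else K' * r N ^ 5)"
    proof (rule sum_mono)
     fix l assume l: "l \<in> steps N"
     define q where "q = S.rate N l"
     have "\<bar>?U2 N l - S.mom N l 2 0\<bar> \<le> K * q ^ 3 + K * (q ^ 2 * r N) + K\<^sup>2 * q ^ 4"
      unfolding Q_def q_def r_def by (rule S.planted_u_variance[OF \<epsilon> s l])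
     also have "... \<le> (if diag l then K' * r N ^ 3 else K' * r N ^ 5)"
     proof (cases "diag l")
      case True
      have "K * r N ^ 3 + K * r N ^ 3 + K\<^sup>2 * r N ^ 4 \<le> K * r N ^ 3 + K * r N ^ 3 + K\<^sup>2 * r N ^ 3"
       using rp[of 3 4 N] elim K1 by (intro add_mono mult_left_mono) auto
      moreover have "q = r N" using True by (simp add: q_def rate_cases r_def)
      ultimately show ?thesis using True by (simp add: K'_def algebra_simps power2_eq_square eval_nat_numeral)
     next
      case False
      have "K * r N ^ 6 + K * r N ^ 5 + K\<^sup>2 * r N ^ 8 \<le> K * r N ^ 5 + K * r N ^ 5 + K\<^sup>2 * r N ^ 5"
       using rp[of 5 6 N] rp[of 5 8 N] elim K1 by (intro add_mono mult_left_mono) auto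
      moreover have "q = r N ^ 2" using False by (simp add: q_def rate_cases r_def)
      moreover have "(r N ^ 2) ^ 3 = r N ^ 6" "(r N ^ 2) ^ 2 * r N = r N ^ 5" "(r N ^ 2) ^ 4 = r N ^ 8"
       by (simp_all add: eval_nat_numeral)
      ultimately show ?thesis using False by (simp add: K'_def algebra_simps)
     qed
     finally show "\<bar>?U2 N l - S.mom N l 2 0\<bar> \<le> (if diag l then K' * r N ^ 3 else K' * r N ^ 5)" .
    qed
    also have "... = real N * (K' * r N ^ 3) + ((real N)\<^sup>2 - real N) / 2 * (K' * r N ^ 5)" by (rule sum_steps_diag)
    also have "... \<le> real N * (K' * r N ^ 3) + (real N)\<^sup>2 * (K' * r N ^ 5)"
     using r0[of N] K1 half_square_le[of N] by (intro add_left_mono mult_right_mono) (auto simp: K'_def)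
    also have "... = K' * (real N * r N ^ 3) + K' * ((real N)\<^sup>2 * r N ^ 5)" by (simp add: mult_ac)
    also have "... = 2 * K' * r N" using root_powers[OF elim] by (simp add: r_def)
    finally show ?case .
   qed
  qed
  show "(\<lambda>N. \<Sum>l\<in>steps N. ?U4 N l) \<longlonglongrightarrow> 0"
  proof (rule Lim_null_comparison)
   show "(\<lambda>N. 32 * K ^ 4 * r N) \<longlonglongrightarrow> 0" using tendsto_mult[OF tendsto_const[of "32 * K ^ 4"] r_lim] by simp
   show "\<forall>\<^sub>F N in sequentially. norm (\<Sum>l\<in>steps N. ?U4 N l) \<le> 32 * K ^ 4 * r N"
    using eventually_gt_at_top[of 0]
   proof eventually_elim
    case (elim N)
    have "norm (\<Sum>l\<in>steps N. ?U4 N l)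
      = (\<Sum>l\<in>steps N. ?U4 N l)"
     by (simp add: sum_nonneg)
    also have "... \<le> (\<Sum>l\<in>steps N. if diag l then 16 * K ^ 4 * r N ^ 4 else 16 * K ^ 4 * r N ^ 8)"
    proof (rule sum_mono)
     fix l assume l: "l \<in> steps N"
     define q where "q = S.rate N l"
     have q: "0 \<le> q" "q \<le> 1" unfolding q_def using elim by (auto simp: S.rate_def)
     have "?U4 N l \<le> 8 * (K * q ^ 4 + K ^ 4 * q ^ 4)"
      unfolding umean[OF l] unfolding Q_def
     proof (rule S.centered_fourth[OF \<epsilon> s])
      show "integrable (S.planted N \<epsilon> (s N)) (\<lambda>v. u N l v ^ 4)" by (rule pi(6)[OF l])
      show "u N l \<in> borel_measurable (P N)" by (rule S.u_measurable[OF l])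
      show "(\<integral>v. u N l v ^ 4 \<partial>S.planted N \<epsilon> (s N)) \<le> K * q ^ 4"
       using S.planted_fourth[OF \<epsilon> s l, of 4 0] by (simp add: q_def)
      have "0 \<le> S.mom N l 2 0" by (simp add: S.mom_def)
      moreover have "S.mom N l 2 0 \<le> K * q ^ 2" using S.mom_le[OF l, of 2 0] by (simp add: q_def)
      ultimately have "(\<epsilon> * S.mom N l 2 0) ^ 4 \<le> (K * q ^ 2) ^ 4"
       using \<epsilon> K1 q by (intro power_mono) auto
      also have "... = K ^ 4 * q ^ 8" by (simp add: power_mult_distrib flip: power_mult)
      also have "... \<le> K ^ 4 * q ^ 4" using q K1 by (intro mult_left_mono power_decreasing) auto
      finally show "(\<epsilon> * S.mom N l 2 0) ^ 4 \<le> K ^ 4 * q ^ 4" .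
     qed
     also have "... = 8 * (K + K ^ 4) * q ^ 4" by (simp add: algebra_simps)
     also have "... \<le> 16 * K ^ 4 * q ^ 4" using K_fourth(1) q by (intro mult_right_mono) auto
     also have "... = (if diag l then 16 * K ^ 4 * r N ^ 4 else 16 * K ^ 4 * r N ^ 8)"
      by (simp add: q_def rate_cases r_def flip: power_mult)
     finally show "?U4 N l \<le> (if diag l then 16 * K ^ 4 * r N ^ 4 else 16 * K ^ 4 * r N ^ 8)" .
    qed
    also have "... = real N * (16 * K ^ 4 * r N ^ 4) + ((real N)\<^sup>2 - real N) / 2 * (16 * K ^ 4 * r N ^ 8)" by (rule sum_steps_diag)
    also have "... \<le> real N * (16 * K ^ 4 * r N ^ 4) + (real N)\<^sup>2 * (16 * K ^ 4 * r N ^ 8)"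
     using r0[of N] K1 half_square_le[of N] by (intro add_left_mono mult_right_mono) auto
    also have "... = 16 * K ^ 4 * (real N * r N ^ 4) + 16 * K ^ 4 * ((real N)\<^sup>2 * r N ^ 8)" by (simp add: mult_ac)
    also have "... = 16 * K ^ 4 * r N ^ 2 + 16 * K ^ 4 * r N ^ 4" using root_powers[OF elim] by (simp add: r_def)
    also have "... \<le> 16 * K ^ 4 * r N + 16 * K ^ 4 * r N"
     using rp[of 1 2 N] rp[of 1 4 N] elim K1 by (intro add_mono mult_left_mono) auto
    finally show ?case by (simp add: mult_ac)
   qed
  qed
  show "\<bar>\<integral>v. (u N l v - ?U N l) * (h N l v - ?H N l) \<partial>Q N\<bar> \<le> K' * r N ^ 4"
   if l: "l \<in> steps N" for N l
  proof (cases "diag l")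
   case True
   then have "h N l = (\<lambda>_. 0)" using S.V_diag[OF l] by (simp add: h_def[abs_def])
   then show ?thesis using r0[of N] K1 by (simp add: K'_def)
  next
   case False
   have N: "0 < N" by (rule Npos[OF l])
   have "S.rate N l = r N ^ 2" using False by (simp add: rate_cases r_def)
   then have "\<bar>\<integral>v. (u N l v - ?U N l) * (h N l v - ?H N l) \<partial>Q N\<bar>
    \<le> K * ((r N ^ 2) ^ 2 * r N) + K * (r N ^ 2 * r N ^ 2) + K\<^sup>2 * ((r N ^ 2) ^ 2 * r N ^ 2)"
    using S.planted_covariance[OF \<epsilon> s l] by (simp add: Q_def h_def r_def)
   also have "... = K * r N ^ 5 + K * r N ^ 4 + K\<^sup>2 * r N ^ 6" by (simp add: eval_nat_numeral)
   also have "... \<le> K * r N ^ 4 + K * r N ^ 4 + K\<^sup>2 * r N ^ 4"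
    using rp[of 4 5 N] rp[of 4 6 N] N K1 by (intro add_mono mult_left_mono) auto
   finally show ?thesis by (simp add: K'_def algebra_simps)
  qed
  show "(\<lambda>N. K' * r N ^ 4 * (real N * sqrt (real N))) \<longlonglongrightarrow> 0"
  proof (rule Lim_transform_eventually)
   show "(\<lambda>N. K' * r N) \<longlonglongrightarrow> 0" using tendsto_mult[OF tendsto_const[of K'] r_lim] by simp
   show "\<forall>\<^sub>F N in sequentially. K' * r N = K' * r N ^ 4 * (real N * sqrt (real N))"
    using eventually_gt_at_top[of 0]
   proof eventually_elim
    case (elim N)
    show ?case using root_powers(5)[OF elim] by (simp add: r_def mult_ac)
   qed
  qed
  show "\<bar>real N * (\<integral>v. (h N l v - ?H N l)\<^sup>2 \<partial>Q N) - 2 * f\<bar> \<le> K' * r N + \<bar>real N * (2 * a N * b N) - 2 * f\<bar>"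
   if l: "l \<in> steps N" and two: "card (ends l) = 2" for N l
  proof -
   have N: "0 < N" by (rule Npos[OF l])
   have nd: "\<not> diag l" using two card_ends by blast
   define W where "W = (\<integral>v. (h N l v - ?H N l)\<^sup>2 \<partial>Q N)"
   have rate: "S.rate N l = r N ^ 2" using nd by (simp add: rate_cases r_def)
   have "\<bar>W - S.mom N l 0 2\<bar> \<le> K * (r N ^ 2 * r N ^ 2) + K * r N ^ 3 + K\<^sup>2 * r N ^ 4"
    using S.planted_h_variance[OF \<epsilon> s l] unfolding rate by (simp add: Q_def h_def r_def W_def)
   also have "... = K * r N ^ 4 + K * r N ^ 3 + K\<^sup>2 * r N ^ 4" by (simp flip: power_add)
   also have "... \<le> K * r N ^ 3 + K * r N ^ 3 + K\<^sup>2 * r N ^ 3"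
    using rp[of 3 4 N] N K1 by (intro add_mono mult_left_mono) auto
   finally have "\<bar>W - S.mom N l 0 2\<bar> \<le> K' * r N ^ 3" by (simp add: K'_def algebra_simps)
   then have "real N * \<bar>W - S.mom N l 0 2\<bar> \<le> real N * (K' * r N ^ 3)" by (rule mult_left_mono) simp
   also have "... = K' * r N" using root_powers(1)[OF N] by (simp add: r_def mult_ac)
   finally have "\<bar>real N * W - real N * S.mom N l 0 2\<bar> \<le> K' * r N" by (simp add: abs_mult flip: right_diff_distrib)
   moreover have "S.mom N l 0 2 = 2 * a N * b N" using S.V_square[OF l nd] by (simp add: S.mom_def)
   ultimately have "\<bar>real N * W - real N * (2 * a N * b N)\<bar> \<le> K' * r N" by (simp only:)
   moreover have "\<bar>x - z\<bar> \<le> k + \<bar>y - z\<bar>" if "\<bar>x - y\<bar> \<le> k" for x y z k :: real using that by linarith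
   ultimately show ?thesis unfolding W_def by blast
  qed
  have "(\<lambda>N. K' * r N + \<bar>2 * a N * (real N * b N) - 2 * f\<bar>) \<longlonglongrightarrow> K' * 0 + \<bar>2 * 1 * f - 2 * f\<bar>"
   by (intro tendsto_add tendsto_mult tendsto_rabs tendsto_diff tendsto_const r_lim a_one b_lim)
  then show "(\<lambda>N. K' * r N + \<bar>real N * (2 * a N * b N) - 2 * f\<bar>) \<longlonglongrightarrow> 0" by (simp add: mult_ac)
  show "(\<lambda>N. (\<Sum>l\<in>steps N. ?U N l) + (\<Sum>c\<in>cycles N m. \<Prod>l\<in>c. ?H N l)) \<longlonglongrightarrow> \<epsilon> * limit_variance \<gamma> f m"
  proof -
   have "(\<lambda>N. real N * (2 * a N * b N)) \<longlonglongrightarrow> 2 * f"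
    using tendsto_mult[OF tendsto_mult[OF tendsto_const[of 2] a_one] b_lim] by (simp add: mult_ac)
   from sum_cycles_limit[OF this, of m]
   have "(\<lambda>N. \<epsilon> * ((\<Sum>l\<in>steps N. S.mom N l 2 0) + (\<Sum>c\<in>cycles N m. (2 * a N * b N) ^ card c))) \<longlonglongrightarrow> \<epsilon> * limit_variance \<gamma> f m"
    unfolding limit_variance_def by (intro tendsto_mult tendsto_add tendsto_const sum_u_square_limit)
   moreover have "(\<Sum>l\<in>steps N. ?U N l) + (\<Sum>c\<in>cycles N m. \<Prod>l\<in>c. ?H N l)
    = \<epsilon> * ((\<Sum>l\<in>steps N. S.mom N l 2 0) + (\<Sum>c\<in>cycles N m. (2 * a N * b N) ^ card c))" for N
   proof -
    have "(\<Prod>l\<in>c. ?H N l) = \<epsilon> * (2 * a N * b N) ^ card c" if c: "c \<in> cycles N m" for c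
    proof -
     have "(\<Prod>l\<in>c. ?H N l) = (\<Prod>l\<in>c. \<epsilon> * (2 * a N * b N))"
     proof (rule prod.cong[OF refl])
      fix l assume l: "l \<in> c"
      have ls: "l \<in> steps N" using cycles_steps[OF c] l by blast
      have "\<not> diag l" using cycle_card_ends[OF cycles_cycle[OF c] l] card_ends by blast
      then show "?H N l = \<epsilon> * (2 * a N * b N)"
       using hmean[OF ls] S.V_square[OF ls] by (simp add: S.mom_def)
     qed
     also have "... = \<epsilon> ^ card c * (2 * a N * b N) ^ card c" by (simp add: power_mult_distrib)
     also have "\<epsilon> ^ card c = \<epsilon>"
      using \<epsilon> cycle_card_ge[OF cycles_cycle[OF c]] by (auto simp: power_0_left)
     finally show ?thesis .
    qed
    then show ?thesis using umean by (simp add: distrib_left sum_distrib_left)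
   qed
   ultimately show ?thesis by simp
  qed
  show "0 \<le> \<gamma> + f\<^sup>2 / 2 + f" "0 \<le> 2 * f" using \<gamma>_nonneg f_nonneg by auto
 qed
 moreover have "(\<Prod>l\<in>c. h N l v) = (\<Prod>l\<in>c. V N l v)" if c: "c \<in> cycles N m" for N c v
 proof -
  have "(\<Prod>l\<in>c. S.sgn_of (s N) l) = 1"
   unfolding S.sgn_of_def using signs_square[OF s] cycles_verts[OF c] by (intro cycle_even[OF cycles_cycle[OF c]]) auto
  then show ?thesis by (simp add: h_def prod.distrib)
 qed
 ultimately show ?thesis by (simp add: stat_def Q_def limit_variance_def)
qed

end

section \<open>The likelihood ratio is a function of the cycle statistic in the limit\<close>

context spiked_steps
begin

lemma lr_measurable: "l \<in> steps N ==> lr s l \<in> borel_measurable P"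
 unfolding lr_def[abs_def] using u_measurable V_measurable by measurable

lemma lr_prod_measurable: "(\<lambda>x. \<Prod>l\<in>steps N. lr s l x) \<in> borel_measurable P"
 by (intro borel_measurable_prod lr_measurable)

lemma likelihood_measurable [measurable]: "likelihood \<in> borel_measurable P"
 unfolding likelihood_def[abs_def]
 by (intro borel_measurable_divide borel_measurable_sum lr_prod_measurable borel_measurable_const)

lemma low_moments:
 assumes l: "l \<in> steps N"
 shows "integrable P (u l)" "integrable P (V l)" "integrable P (\<lambda>x. (u l x)\<^sup>2)" "integrable P (\<lambda>x. (V l x)\<^sup>2)"
  "integrable P (\<lambda>x. u l x * V l x)"
 using monomial_integrable[OF l, of 1 0] monomial_integrable[OF l, of 0 1] monomial_integrable[OF l, of 2 0]
  monomial_integrable[OF l, of 0 2] monomial_integrable[OF l, of 1 1] by simp_all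

text \<open>
 For two spikes the factor depends only on their product \<open>\<tau> i = s i * s' i\<close>.
\<close>

lemma lr_pair:
 assumes l: "l \<in> steps N" and s: "s \<in> signs N" "s' \<in> signs N"
 shows "integrable P (\<lambda>z. lr s l z * lr s' l z)"
  and "expectation (\<lambda>z. lr s l z * lr s' l z) = (case prod_decode l of (i, j) =>
    if i = j then a + (s i * s' i) * (s i * s' i) * b
    else (a + (s i * s' i) * (s j * s' j) * b) * (a + (s j * s' j) * (s i * s' i) * b))"
proof -
 let ?\<sigma> = "sgn_of s l" and ?\<sigma>' = "sgn_of s' l"
 have eq: "lr s l z * lr s' l z = 1 + 2 * u l z + (?\<sigma> + ?\<sigma>') * V l z + (u l z)\<^sup>2 + (?\<sigma> + ?\<sigma>') * (u l z * V l z) + ?\<sigma> * ?\<sigma>' * (V l z)\<^sup>2" for z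
  by (simp add: lr_def power2_eq_square algebra_simps)
 note i = low_moments[OF l]
 show "integrable P (\<lambda>z. lr s l z * lr s' l z)" unfolding eq using i by auto
 have e: "expectation (\<lambda>z. lr s l z * lr s' l z) = 1 + expectation (\<lambda>z. (u l z)\<^sup>2) + ?\<sigma> * ?\<sigma>' * expectation (\<lambda>z. (V l z)\<^sup>2)"
  unfolding eq using i by (simp add: prob_space u_mean[OF l] V_mean[OF l] uV_mean[OF l])
 obtain x y where xy: "prod_decode l = (x, y)" by (cases "prod_decode l")
 have lt: "x < N" "y < N" using steps_decode[OF l] xy by auto
 have sq: "s x * s x = 1" "s' x * s' x = 1" "s y * s y = 1" "s' y * s' y = 1"
  using signs_square[OF s(1)] signs_square[OF s(2)] lt by (simp_all add: power2_eq_square)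
 have \<sigma>: "?\<sigma> = s x * s y" "?\<sigma>' = s' x * s' y" by (simp_all add: sgn_of_def xy)
 show "expectation (\<lambda>z. lr s l z * lr s' l z) = (case prod_decode l of (i, j) =>
    if i = j then a + (s i * s' i) * (s i * s' i) * b
    else (a + (s i * s' i) * (s j * s' j) * b) * (a + (s j * s' j) * (s i * s' i) * b))"
 proof (cases "diag l")
  case True
  then have "x = y" by (simp add: diag_def xy)
  moreover have "(s x * s' x) * (s x * s' x) = 1" using sq by (metis mult.left_commute mult.right_neutral mult.assoc)
  ultimately show ?thesis unfolding e using True by (simp add: u_square[OF l] V_diag[OF l] xy)
 next
  case False
  then have ne: "x \<noteq> y" by (simp add: diag_def xy)
  define \<tau> where "\<tau> = (s x * s' x) * (s y * s' y)"
  have \<tau>: "\<tau> * \<tau> = 1"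
  proof -
   have "\<tau> * \<tau> = (s x * s x) * (s' x * s' x) * (s y * s y) * (s' y * s' y)" by (simp add: \<tau>_def mult_ac)
   then show ?thesis using sq by simp
  qed
  have "?\<sigma> * ?\<sigma>' = \<tau>" by (simp add: \<sigma> \<tau>_def mult_ac)
  then have "expectation (\<lambda>z. lr s l z * lr s' l z) = a\<^sup>2 + b\<^sup>2 + 2 * a * b * \<tau>"
   unfolding e using False by (simp add: u_square[OF l] V_square[OF l])
  also have "... = (a + \<tau> * b) * (a + \<tau> * b)"
  proof -
   have "(a + \<tau> * b) * (a + \<tau> * b) = a\<^sup>2 + (\<tau> * \<tau>) * b\<^sup>2 + 2 * a * b * \<tau>"
    by (simp add: power2_eq_square algebra_simps)
   then show ?thesis by (simp add: \<tau>)
  qed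
  finally show ?thesis using ne by (simp add: xy \<tau>_def mult_ac)
 qed
qed

lemma lr_pair_product:
 assumes s: "s \<in> signs N" "s' \<in> signs N"
 shows "integrable P (\<lambda>x. (\<Prod>l\<in>steps N. lr s l x) * (\<Prod>l\<in>steps N. lr s' l x))"
  and "expectation (\<lambda>x. (\<Prod>l\<in>steps N. lr s l x) * (\<Prod>l\<in>steps N. lr s' l x))
   = (\<Prod>i<N. \<Prod>j<N. (a + (s i * s' i) * (s j * s' j) * b))"
proof -
 have "indep_vars (\<lambda>_. borel) (\<lambda>l x. (\<lambda>z. (1 + fst z + sgn_of s l * snd z) * (1 + fst z + sgn_of s' l * snd z)) (u l x, V l x)) (steps N)"
  by (rule indep_vars_compose2[OF indep]) (unfold borel_prod[symmetric], measurable)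
 then have ind: "indep_vars (\<lambda>_. borel) (\<lambda>l x. lr s l x * lr s' l x) (steps N)"
  by (simp add: lr_def)
 note I = indep_vars_integrable[OF finite_steps ind lr_pair(1)[OF _ s]]
  indep_vars_lebesgue_integral[OF finite_steps ind lr_pair(1)[OF _ s]]
 show "integrable P (\<lambda>x. (\<Prod>l\<in>steps N. lr s l x) * (\<Prod>l\<in>steps N. lr s' l x))"
  using I(1) by (simp add: prod.distrib)
 have "expectation (\<lambda>x. (\<Prod>l\<in>steps N. lr s l x) * (\<Prod>l\<in>steps N. lr s' l x)) = (\<Prod>l\<in>steps N. expectation (\<lambda>x. lr s l x * lr s' l x))"
  using I(2) by (simp add: prod.distrib)
 also have "... = (\<Prod>i<N. \<Prod>j<N. (a + (s i * s' i) * (s j * s' j) * b))"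
  unfolding prod_by_steps by (rule prod.cong[OF refl]) (rule lr_pair(2)[OF _ s])
 finally show "expectation (\<lambda>x. (\<Prod>l\<in>steps N. lr s l x) * (\<Prod>l\<in>steps N. lr s' l x))
   = (\<Prod>i<N. \<Prod>j<N. (a + (s i * s' i) * (s j * s' j) * b))" .
qed

text \<open>
 Multiplication by a fixed sign vector permutes the sign vectors.
\<close>

lemma sum_signs_translate:
 fixes F :: "(nat => real) => real"
 assumes s: "s \<in> signs N" and F: "\<And>x y. (\<And>i. i < N ==> x i = y i) ==> F x = F y"
 shows "(\<Sum>s'\<in>signs N. F (\<lambda>i. s i * s' i)) = (\<Sum>\<tau>\<in>signs N. F \<tau>)"
proof -
 have val: "x i = 1 \<or> x i = -1" if "x \<in> signs N" "i < N" for x i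
 proof -
  have "x i \<in> {1, -1}" using that unfolding signs_def by blast
  then show ?thesis by auto
 qed
 define T where "T x = (\<lambda>i\<in>{..<N}. s i * x i)" for x
 have TT: "T x \<in> signs N" if x: "x \<in> signs N" for x
 proof -
  have "s i * x i \<in> {1, -1}" if "i < N" for i using val[OF s that] val[OF x that] by auto
  then show ?thesis unfolding T_def signs_def by auto
 qed
 have inv: "T (T x) = x" if x: "x \<in> signs N" for x
 proof
  fix i
  show "T (T x) i = x i"
  proof (cases "i < N")
   case True then show ?thesis using val[OF s True] by (auto simp: T_def)
  next
   case False then show ?thesis using x by (auto simp: T_def signs_def PiE_arb[of x])
  qed
 qed
 show ?thesis
  by (rule sum.reindex_bij_witness[where i=T and j=T]) (auto simp: TT inv intro!: F, auto simp: T_def)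
qed

lemma likelihood_second_moment:
 shows "integrable P (\<lambda>x. (likelihood x)\<^sup>2)"
  and "expectation (\<lambda>x. (likelihood x)\<^sup>2) = (\<Sum>\<tau>\<in>signs N. \<Prod>i<N. \<Prod>j<N. (a + \<tau> i * \<tau> j * b)) / 2 ^ N"
proof -
 let ?p = "\<lambda>s x. \<Prod>l\<in>steps N. lr s l x"
 have eq: "(likelihood x)\<^sup>2 = (\<Sum>s\<in>signs N. \<Sum>s'\<in>signs N. ?p s x * ?p s' x) / (2 ^ N * 2 ^ N)" for x
  by (simp add: likelihood_def power_divide power2_eq_square sum_product)
 show "integrable P (\<lambda>x. (likelihood x)\<^sup>2)"
  unfolding eq by (intro integrable_divide Bochner_Integration.integrable_sum lr_pair_product(1))
 have "expectation (\<lambda>x. (likelihood x)\<^sup>2) = (\<Sum>s\<in>signs N. \<Sum>s'\<in>signs N. expectation (\<lambda>x. ?p s x * ?p s' x)) / (2 ^ N * 2 ^ N)"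
  unfolding eq by (simp add: Bochner_Integration.integral_sum lr_pair_product(1) Bochner_Integration.integrable_sum)
 also have "(\<Sum>s\<in>signs N. \<Sum>s'\<in>signs N. expectation (\<lambda>x. ?p s x * ?p s' x))
   = (\<Sum>s\<in>signs N. \<Sum>\<tau>\<in>signs N. \<Prod>i<N. \<Prod>j<N. (a + \<tau> i * \<tau> j * b))"
 proof (rule sum.cong[OF refl])
  fix s assume s: "s \<in> signs N"
  have "(\<Sum>s'\<in>signs N. expectation (\<lambda>x. ?p s x * ?p s' x)) = (\<Sum>s'\<in>signs N. (\<lambda>\<tau>. \<Prod>i<N. \<Prod>j<N. (a + \<tau> i * \<tau> j * b)) (\<lambda>i. s i * s' i))"
   using s by (intro sum.cong refl) (simp add: lr_pair_product(2))
  also have "... = (\<Sum>\<tau>\<in>signs N. \<Prod>i<N. \<Prod>j<N. (a + \<tau> i * \<tau> j * b))"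
   by (rule sum_signs_translate[OF s]) (auto intro!: prod.cong)
  finally show "(\<Sum>s'\<in>signs N. expectation (\<lambda>x. ?p s x * ?p s' x)) = (\<Sum>\<tau>\<in>signs N. \<Prod>i<N. \<Prod>j<N. (a + \<tau> i * \<tau> j * b))" .
 qed
 finally show "expectation (\<lambda>x. (likelihood x)\<^sup>2) = (\<Sum>\<tau>\<in>signs N. \<Prod>i<N. \<Prod>j<N. (a + \<tau> i * \<tau> j * b)) / 2 ^ N"
  by (simp add: card_signs)
qed

lemma lr_prod_integrable:
 assumes s: "s \<in> signs N"
 shows "integrable P (\<lambda>x. \<Prod>l\<in>steps N. lr s l x)"
proof -
 have "integrable P (\<lambda>x. (\<Prod>l\<in>steps N. lr s l x)\<^sup>2)"
  using lr_pair_product(1)[OF s s] by (simp add: power2_eq_square)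
 then show ?thesis by (rule square_integrable_imp_integrable[OF lr_prod_measurable])
qed

lemma likelihood_test:
 assumes g: "g \<in> borel_measurable P" "\<And>x. \<bar>g x\<bar> \<le> c"
 shows "integrable P (\<lambda>x. likelihood x * g x)"
  and "expectation (\<lambda>x. likelihood x * g x) = (\<Sum>s\<in>signs N. \<integral>x. g x \<partial>planted 1 s) / 2 ^ N"
proof -
 let ?p = "\<lambda>s x. \<Prod>l\<in>steps N. lr s l x"
 have eq: "likelihood x * g x = (\<Sum>s\<in>signs N. ?p s x * g x) / 2 ^ N" for x
  by (simp add: likelihood_def sum_distrib_right)
 have i: "integrable P (\<lambda>x. ?p s x * g x)" if s: "s \<in> signs N" for s
 proof (rule Bochner_Integration.integrable_bound[where f="\<lambda>x. c * ?p s x"])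
  show "integrable P (\<lambda>x. c * ?p s x)" using lr_prod_integrable[OF s] by simp
  show "(\<lambda>x. ?p s x * g x) \<in> borel_measurable P" using lr_prod_measurable g(1) by measurable
  have "\<bar>?p s x\<bar> * \<bar>g x\<bar> \<le> \<bar>?p s x\<bar> * \<bar>c\<bar>" for x
   using order_trans[OF g(2) abs_ge_self] by (intro mult_left_mono) auto
  then show "AE x in P. norm (?p s x * g x) \<le> norm (c * ?p s x)"
   by (intro AE_I2) (simp add: abs_mult mult_ac)
 qed
 show "integrable P (\<lambda>x. likelihood x * g x)"
  unfolding eq by (intro integrable_divide Bochner_Integration.integrable_sum i)
 have "expectation (\<lambda>x. likelihood x * g x) = (\<Sum>s\<in>signs N. expectation (\<lambda>x. ?p s x * g x)) / 2 ^ N"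
  unfolding eq using i by (simp add: Bochner_Integration.integral_sum)
 also have "(\<Sum>s\<in>signs N. expectation (\<lambda>x. ?p s x * g x)) = (\<Sum>s\<in>signs N. \<integral>x. g x \<partial>planted 1 s)"
 proof (rule sum.cong[OF refl])
  fix s assume s: "s \<in> signs N"
  show "expectation (\<lambda>x. ?p s x * g x) = (\<integral>x. g x \<partial>planted 1 s)"
   using planted_integral[of 1, OF _ s g(1)] by (simp add: weight_def lr_def add.assoc)
 qed
 finally show "expectation (\<lambda>x. likelihood x * g x) = (\<Sum>s\<in>signs N. \<integral>x. g x \<partial>planted 1 s) / 2 ^ N" .
qed

lemma planted_null:
 fixes g :: "'a => real"
 shows "s \<in> signs N ==> g \<in> borel_measurable P ==> (\<integral>x. g x \<partial>planted 0 s) = expectation g"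
 using planted_integral[of 0 s g] by (simp add: weight_def)

end

text \<open>
 The terms for \<open>k = 1\<close> and \<open>k = 2\<close> that are missing from the logarithmic series are \<open>f\<close> and \<open>f\<^sup>2\<close>.
\<close>

lemma cycle_series_limit:
 assumes f: "0 \<le> f" "2 * f < 1"
 shows "(\<lambda>m. limit_variance \<gamma> f m) \<longlonglongrightarrow> \<gamma> - f\<^sup>2 / 2 - ln (1 - 2 * f) / 2"
proof -
 define x where "x = 2 * f"
 have x: "\<bar>- x\<bar> < 1" using f by (simp add: x_def)
 have s: "(\<lambda>n. x ^ n / real n) sums (- ln (1 - x))"
  using sums_minus[OF ln_series'[OF x]] by simp
 then have "(\<lambda>m. \<Sum>n<m + 1. x ^ n / real n) \<longlonglongrightarrow> - ln (1 - x)"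
  unfolding sums_def by (rule LIMSEQ_ignore_initial_segment)
 then have l: "(\<lambda>m. \<gamma> + f\<^sup>2 / 2 + f + ((\<Sum>n<m + 1. x ^ n / real n) - x - x\<^sup>2 / 2) / 2) \<longlonglongrightarrow> \<gamma> + f\<^sup>2 / 2 + f + (- ln (1 - x) - x - x\<^sup>2 / 2) / 2"
  by (intro tendsto_add tendsto_diff tendsto_divide tendsto_const) auto
 have "\<forall>\<^sub>F m in sequentially. \<gamma> + f\<^sup>2 / 2 + f + ((\<Sum>n<m + 1. x ^ n / real n) - x - x\<^sup>2 / 2) / 2 = limit_variance \<gamma> f m"
  using eventually_ge_at_top[of 2]
 proof eventually_elim
  case (elim m)
  have "{..<m + 1} = {0, 1, 2} \<union> {3..m}" using elim by auto
  then have "(\<Sum>n<m + 1. x ^ n / real n) = (\<Sum>n\<in>{0, 1, 2}. x ^ n / real n) + (\<Sum>n=3..m. x ^ n / real n)"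
   by (simp only:) (rule sum.union_disjoint, auto)
  also have "(\<Sum>n\<in>{0, 1, 2}. x ^ n / real n) = x + x\<^sup>2 / 2" by simp
  finally have "((\<Sum>n<m + 1. x ^ n / real n) - x - x\<^sup>2 / 2) / 2 = (\<Sum>n=3..m. x ^ n / (2 * real n))"
   by (simp add: sum_divide_distrib mult.commute)
  then show ?case by (simp add: limit_variance_def x_def)
 qed
 from Lim_transform_eventually[OF l this] show ?thesis
  by (simp add: x_def power2_eq_square field_simps)
qed

lemma double_limit:
 fixes s :: "nat => real"
 assumes bound: "\<And>m N. \<bar>s N - A\<bar> \<le> x m N + y m" and x: "\<And>m. (\<lambda>N. x m N) \<longlonglongrightarrow> X m"
  and X: "X \<longlonglongrightarrow> 0" and y: "y \<longlonglongrightarrow> 0"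
 shows "s \<longlonglongrightarrow> A"
proof (rule LIMSEQ_I)
 fix e :: real assume e: "0 < e"
 have "\<forall>\<^sub>F m in sequentially. X m < e / 3" "\<forall>\<^sub>F m in sequentially. y m < e / 3"
  using order_tendstoD(2)[OF X, of "e / 3"] order_tendstoD(2)[OF y, of "e / 3"] e by auto
 then have "\<forall>\<^sub>F m in sequentially. X m < e / 3 \<and> y m < e / 3" by (rule eventually_conj)
 then obtain m where m: "X m < e / 3" "y m < e / 3"
  using eventually_happens'[OF sequentially_bot] by blast
 have "\<forall>\<^sub>F N in sequentially. x m N < 2 * e / 3"
  using order_tendstoD(2)[OF x[of m], of "2 * e / 3"] m e by auto
 then obtain N0 where "\<And>N. N \<ge> N0 ==> x m N < 2 * e / 3" by (auto simp: eventually_sequentially)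
 then have "\<bar>s N - A\<bar> < e" if "N \<ge> N0" for N using bound[of N m] m that by fastforce
 then show "\<exists>no. \<forall>n\<ge>no. norm (s n - A) < e" by auto
qed

lemma min_nat_limit:
 fixes x :: "nat => real"
 assumes "x \<longlonglongrightarrow> c"
 shows "(\<lambda>m. min (x m) (real m)) \<longlonglongrightarrow> c"
proof (rule Lim_transform_eventually[OF assms])
 have "\<forall>\<^sub>F m in sequentially. x m < c + 1" using order_tendstoD(2)[OF assms, of "c + 1"] by simp
 moreover have "\<forall>\<^sub>F m in sequentially. c + 1 \<le> real m"
  using filterlim_real_sequentially by (auto simp: filterlim_at_top)
 ultimately show "\<forall>\<^sub>F m in sequentially. x m = min (x m) (real m)" by eventually_elim auto
qed

context spiked_sequence
begin

lemma stat_measurable: "stat m N \<in> borel_measurable (P N)"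
proof -
 have "V N l \<in> borel_measurable (P N)" if "c \<in> cycles N m" "l \<in> c" for c l
  by (rule S.V_measurable) (use cycles_steps[OF that(1)] that(2) in blast)
 then show ?thesis unfolding stat_def[abs_def]
  by (intro borel_measurable_add borel_measurable_sum borel_measurable_prod S.u_measurable)
qed

lemma limit_variance_nonneg: "0 \<le> limit_variance \<gamma> f m"
 unfolding limit_variance_def using \<gamma>_nonneg f_nonneg by (intro add_nonneg_nonneg sum_nonneg) auto

lemma planted_limit:
 fixes g :: "real => real"
 assumes \<epsilon>: "\<epsilon> \<in> {0, 1}" and s: "\<And>N. s N \<in> signs N" and g: "\<And>x. isCont g x" "\<And>x. \<bar>g x\<bar> \<le> c"
 shows "(\<lambda>N. \<integral>y. g (stat m N y) \<partial>S.planted N \<epsilon> (s N))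
  \<longlonglongrightarrow> (\<integral>z. g (\<epsilon> * limit_variance \<gamma> f m + sqrt (limit_variance \<gamma> f m) * z) \<partial>std_normal_distribution)"
proof (rule bounded_continuous_limit[OF _ _ planted_statistic_clt[where m=m, OF \<epsilon> s] limit_variance_nonneg g])
 show "prob_space (S.planted N \<epsilon> (s N))" for N by (rule S.prob_space_planted[OF \<epsilon> s])
 show "stat m N \<in> borel_measurable (S.planted N \<epsilon> (s N))" for N
  using stat_measurable measurable_cong_sets[OF S.sets_planted[OF \<epsilon> s] refl] by blast
qed

lemma null_limit:
 fixes g :: "real => real"
 assumes g: "\<And>x. isCont g x" "\<And>x. \<bar>g x\<bar> \<le> c"
 shows "(\<lambda>N. \<integral>y. g (stat m N y) \<partial>P N) \<longlonglongrightarrow> (\<integral>z. g (sqrt (limit_variance \<gamma> f m) * z) \<partial>std_normal_distribution)"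
proof -
 define s where "s N = (\<lambda>i\<in>{..<N}. 1 :: real)" for N :: nat
 have s: "s N \<in> signs N" for N by (auto simp: s_def signs_def)
 have gm: "g \<in> borel_measurable borel"
  using g(1) by (intro borel_measurable_continuous_onI continuous_at_imp_continuous_on) auto
 have "(\<integral>y. g (stat m N y) \<partial>S.planted N 0 (s N)) = (\<integral>y. g (stat m N y) \<partial>P N)" for N
  by (rule S.planted_null[OF s]) (rule measurable_compose[OF stat_measurable gm])
 then show ?thesis using planted_limit[of 0 s g c m] s g by simp
qed

text \<open>Averaging over the spike costs nothing because the limit holds along each choice of spikes.\<close>

lemma likelihood_weighted_limit:
 fixes g :: "real => real"
 assumes g: "\<And>x. isCont g x" "\<And>x. \<bar>g x\<bar> \<le> c"
 shows "(\<lambda>N. \<integral>y. S.likelihood N y * g (stat m N y) \<partial>P N)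
  \<longlonglongrightarrow> (\<integral>z. g (limit_variance \<gamma> f m + sqrt (limit_variance \<gamma> f m) * z) \<partial>std_normal_distribution)"
proof -
 define I where "I = (\<integral>z. g (limit_variance \<gamma> f m + sqrt (limit_variance \<gamma> f m) * z) \<partial>std_normal_distribution)"
 define D where "D N s = \<bar>(\<integral>y. g (stat m N y) \<partial>S.planted N 1 s) - I\<bar>" for N s
 have gm: "g \<in> borel_measurable borel"
  using g(1) by (intro borel_measurable_continuous_onI continuous_at_imp_continuous_on) auto
 have ne: "signs N \<noteq> {}" for N using card_signs[of N] by auto
 have "\<exists>s. \<forall>N. s N \<in> signs N \<and> (\<forall>s'\<in>signs N. D N s' \<le> D N (s N))"
 proof (rule choice, rule allI)
  fix N
  have "Max (D N ` signs N) \<in> D N ` signs N" using ne by (intro Max_in) auto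
  then obtain s where "s \<in> signs N" "D N s = Max (D N ` signs N)" by auto
  then show "\<exists>s. s \<in> signs N \<and> (\<forall>s'\<in>signs N. D N s' \<le> D N s)" by (intro exI[of _ s]) auto
 qed
 then obtain s where s: "\<And>N. s N \<in> signs N" and worst: "\<And>N s'. s' \<in> signs N ==> D N s' \<le> D N (s N)" by blast
 have "(\<lambda>N. \<integral>y. g (stat m N y) \<partial>S.planted N 1 (s N)) \<longlonglongrightarrow> I"
  using planted_limit[of 1 s g c m] s g by (simp add: I_def)
 then have D0: "(\<lambda>N. D N (s N)) \<longlonglongrightarrow> 0"
  unfolding D_def by (intro tendsto_rabs_zero LIM_zero)
 have "(\<lambda>N. (\<integral>y. S.likelihood N y * g (stat m N y) \<partial>P N) - I) \<longlonglongrightarrow> 0"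
 proof (rule Lim_null_comparison[OF always_eventually D0], rule allI)
  fix N
  have "(\<integral>y. S.likelihood N y * g (stat m N y) \<partial>P N) = (\<Sum>s\<in>signs N. \<integral>y. g (stat m N y) \<partial>S.planted N 1 s) / 2 ^ N"
   by (rule S.likelihood_test(2)[OF measurable_compose[OF stat_measurable gm] g(2)])
  then have "(\<integral>y. S.likelihood N y * g (stat m N y) \<partial>P N) - I = (\<Sum>s\<in>signs N. (\<integral>y. g (stat m N y) \<partial>S.planted N 1 s) - I) / 2 ^ N"
   by (simp add: sum_subtractf card_signs diff_divide_distrib)
  also have "norm ... \<le> (\<Sum>s'\<in>signs N. D N s') / 2 ^ N"
   unfolding D_def real_norm_def abs_divide using sum_abs by (auto intro!: divide_right_mono)
  also have "... \<le> (\<Sum>s'\<in>signs N. D N (s N)) / 2 ^ N"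
   by (intro divide_right_mono sum_mono worst) auto
  also have "... = D N (s N)" by (simp add: card_signs)
  finally show "norm ((\<integral>y. S.likelihood N y * g (stat m N y) \<partial>P N) - I) \<le> D N (s N)" .
 qed
 then show ?thesis unfolding I_def by (rule LIM_zero_cancel)
qed

text \<open>
 The mean square distance between the likelihood ratio and the truncated exponential of the cycle
 statistic tends to \<open>exp r - 2 * I m + J m\<close>, and both \<open>I m\<close> and \<open>J m\<close> tend to \<open>exp r\<close>.  For \<open>J\<close> an upper bound is enough
 because the expression is nonnegative.
\<close>

theorem likelihood_limit:
 fixes \<phi> :: "real => real"
 assumes f2: "2 * f < 1" and \<phi>b: "\<And>x. \<bar>\<phi> x\<bar> \<le> c" and \<phi>l: "\<And>x y. \<bar>\<phi> x - \<phi> y\<bar> \<le> L * \<bar>x - y\<bar>"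
 defines "r \<equiv> \<gamma> - f\<^sup>2 / 2 - ln (1 - 2 * f) / 2"
 shows "(\<lambda>N. \<integral>\<omega>. \<phi> (S.likelihood N \<omega>) \<partial>P N) \<longlonglongrightarrow> (\<integral>z. \<phi> (exp (sqrt r * z - r / 2)) \<partial>std_normal_distribution)"
proof -
 define v where "v m = limit_variance \<gamma> f m" for m
 have v0: "0 \<le> v m" for m by (simp add: v_def limit_variance_nonneg)
 have vr: "v \<longlonglongrightarrow> r" unfolding v_def[abs_def] r_def by (rule cycle_series_limit[OF f_nonneg f2])
 have r0: "0 \<le> r" by (rule LIMSEQ_le_const[OF vr]) (use v0 in auto)
 obtain R where R: "\<And>m. v m \<le> R"
  using convergent_imp_Bseq[of v] vr unfolding convergent_def Bseq_def by (auto simp: v0)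
 have R0: "0 \<le> R" using R[of 0] v0[of 0] by simp
 have L0: "0 \<le> L" using \<phi>l[of 1 0] by (simp add: order_trans[OF abs_ge_zero])
 have \<phi>c: "isCont \<phi> x" for x
  unfolding isCont_def
 proof (rule LIM_zero_cancel, rule Lim_null_comparison)
  show "\<forall>\<^sub>F y in at x. norm (\<phi> y - \<phi> x) \<le> L * \<bar>y - x\<bar>" using \<phi>l by auto
  have "((\<lambda>y. L * \<bar>y - x\<bar>) \<longlongrightarrow> L * \<bar>x - x\<bar>) (at x)" by (intro tendsto_intros)
  then show "((\<lambda>y. L * \<bar>y - x\<bar>) \<longlongrightarrow> 0) (at x)" by simp
 qed
 have \<phi>m: "\<phi> \<in> borel_measurable borel"
  using \<phi>c by (intro borel_measurable_continuous_onI continuous_at_imp_continuous_on) auto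
 define G where "G m x = min (exp (x - v m / 2)) (real m)" for m x
 have Gc: "isCont (G m) x" for m x unfolding G_def[abs_def] by (intro continuous_intros)
 have Gb: "\<bar>G m x\<bar> \<le> real m" for m x unfolding G_def by simp
 have G2b: "(G m x)\<^sup>2 \<le> (real m)\<^sup>2" for m x
  using Gb[of m x] by (simp add: abs_le_square_iff[symmetric])
 have Gm: "G m \<in> borel_measurable borel" for m
  using Gc by (intro borel_measurable_continuous_onI continuous_at_imp_continuous_on) auto
 have GSm: "(\<lambda>\<omega>. G m (stat m N \<omega>)) \<in> borel_measurable (P N)" for m N
  by (rule measurable_compose[OF stat_measurable Gm])
 define q where "q m N = (\<integral>\<omega>. (S.likelihood N \<omega> - G m (stat m N \<omega>))\<^sup>2 \<partial>P N)" for m N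
 define I where "I m = (\<integral>z. G m (v m + sqrt (v m) * z) \<partial>std_normal_distribution)" for m
 define J where "J m = (\<integral>z. (G m (sqrt (v m) * z))\<^sup>2 \<partial>std_normal_distribution)" for m
 have G2i: "integrable (P N) (\<lambda>\<omega>. (G m (stat m N \<omega>))\<^sup>2)" for m N
 proof (rule S.integrable_const_bound[where B="(real m)\<^sup>2"])
  show "AE \<omega> in P N. norm ((G m (stat m N \<omega>))\<^sup>2) \<le> (real m)\<^sup>2"
   using G2b by (intro AE_I2) simp
 qed (use GSm in measurable)
 note LGi = S.likelihood_test(1)[OF GSm Gb]
 have diff_sq: "(S.likelihood N \<omega> - G m (stat m N \<omega>))\<^sup>2
   = (S.likelihood N \<omega>)\<^sup>2 - 2 * (S.likelihood N \<omega> * G m (stat m N \<omega>)) + (G m (stat m N \<omega>))\<^sup>2" for m N \<omega>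
  by (simp add: power2_diff)
 have dsi: "integrable (P N) (\<lambda>\<omega>. (S.likelihood N \<omega> - G m (stat m N \<omega>))\<^sup>2)" for m N
  unfolding diff_sq using S.likelihood_second_moment(1) LGi G2i by (intro Bochner_Integration.integrable_add Bochner_Integration.integrable_diff integrable_mult_right)
 have er: "exp (\<gamma> - f\<^sup>2 / 2) / sqrt (1 - 2 * f) = exp r"
 proof -
  have "exp (ln (1 - 2 * f) / 2) = sqrt (1 - 2 * f)"
   using f2 by (intro real_sqrt_unique[symmetric]) (auto simp flip: exp_of_nat_mult exp_double)
  then show ?thesis unfolding r_def by (simp add: exp_diff)
 qed
 have q_lim: "(\<lambda>N. q m N) \<longlonglongrightarrow> exp r - 2 * I m + J m" for m
 proof -
  have "q m N = (\<Sum>\<tau>\<in>signs N. \<Prod>i<N. \<Prod>j<N. (a N + \<tau> i * \<tau> j * b N)) / 2 ^ N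
    - 2 * (\<integral>\<omega>. S.likelihood N \<omega> * G m (stat m N \<omega>) \<partial>P N) + (\<integral>\<omega>. (G m (stat m N \<omega>))\<^sup>2 \<partial>P N)" for N
   unfolding q_def diff_sq using S.likelihood_second_moment LGi G2i by simp
  moreover have "(\<lambda>N. (\<Sum>\<tau>\<in>signs N. \<Prod>i<N. \<Prod>j<N. (a N + \<tau> i * \<tau> j * b N)) / 2 ^ N) \<longlonglongrightarrow> exp r"
   unfolding er[symmetric] by (rule curie_weiss_product_limit[OF a_lim b_lim S.b_nonneg f2])
  moreover have "(\<lambda>N. \<integral>\<omega>. S.likelihood N \<omega> * G m (stat m N \<omega>) \<partial>P N) \<longlonglongrightarrow> I m"
   unfolding I_def v_def by (rule likelihood_weighted_limit[OF Gc Gb])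
  moreover have "(\<lambda>N. \<integral>\<omega>. (G m (stat m N \<omega>))\<^sup>2 \<partial>P N) \<longlonglongrightarrow> J m"
   unfolding J_def v_def
  proof (rule null_limit)
   show "isCont (\<lambda>x. (G m x)\<^sup>2) x" for x using Gc by (intro continuous_intros)
   show "\<bar>(G m x)\<^sup>2\<bar> \<le> (real m)\<^sup>2" for x using G2b by simp
  qed
  ultimately show ?thesis by (simp add: tendsto_add tendsto_diff tendsto_mult)
 qed
 have I_lim: "I \<longlonglongrightarrow> exp r"
 proof -
  define w where "w z = exp (R / 2) * (exp (sqrt R * z) + exp (- sqrt R * z))" for z
  have "(\<lambda>m. \<integral>z. min (exp (v m / 2 + sqrt (v m) * z)) (real m) \<partial>std_normal_distribution) \<longlonglongrightarrow> (\<integral>z. exp (r / 2 + sqrt r * z) \<partial>std_normal_distribution)"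
  proof (rule integral_dominated_convergence[where w=w])
   show "integrable std_normal_distribution w"
    unfolding w_def[abs_def] using gauss_exp_linear(1)[of "sqrt R"] gauss_exp_linear(1)[of "- sqrt R"] by auto
   show "AE z in std_normal_distribution. (\<lambda>m. min (exp (v m / 2 + sqrt (v m) * z)) (real m)) \<longlonglongrightarrow> exp (r / 2 + sqrt r * z)"
    by (intro AE_I2 min_nat_limit tendsto_exp tendsto_add tendsto_mult tendsto_divide tendsto_real_sqrt vr tendsto_const) simp
   show "AE z in std_normal_distribution. norm (min (exp (v m / 2 + sqrt (v m) * z)) (real m)) \<le> w z" for m
   proof (intro AE_I2)
    fix z
    have "sqrt (v m) * z \<le> sqrt (v m) * \<bar>z\<bar>" using v0 by (intro mult_left_mono) auto
    also have "... \<le> sqrt R * \<bar>z\<bar>" using R v0 by (intro mult_right_mono) auto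
    finally have "exp (v m / 2 + sqrt (v m) * z) \<le> exp (R / 2 + sqrt R * \<bar>z\<bar>)" using R[of m] by simp
    also have "... = exp (R / 2) * exp (sqrt R * \<bar>z\<bar>)" by (rule exp_add)
    also have "... \<le> w z"
    proof -
     have "exp (sqrt R * \<bar>z\<bar>) = exp (sqrt R * z) \<or> exp (sqrt R * \<bar>z\<bar>) = exp (- sqrt R * z)"
      by (cases "0 \<le> z") auto
     then have "exp (sqrt R * \<bar>z\<bar>) \<le> exp (sqrt R * z) + exp (- sqrt R * z)"
      using exp_ge_zero[of "sqrt R * z"] exp_ge_zero[of "- sqrt R * z"] by linarith
     then show ?thesis unfolding w_def by (intro mult_left_mono) auto
    qed
    finally show "norm (min (exp (v m / 2 + sqrt (v m) * z)) (real m)) \<le> w z" by simp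
   qed
  qed auto
  moreover have "I m = (\<integral>z. min (exp (v m / 2 + sqrt (v m) * z)) (real m) \<partial>std_normal_distribution)" for m
   unfolding I_def G_def by (intro Bochner_Integration.integral_cong refl) (simp add: field_simps)
  moreover have "(\<integral>z. exp (r / 2 + sqrt r * z) \<partial>std_normal_distribution) = exp r"
  proof -
   have "(\<integral>z. exp (r / 2 + sqrt r * z) \<partial>std_normal_distribution) = (\<integral>z. exp (r / 2) * exp (sqrt r * z) \<partial>std_normal_distribution)"
    by (simp only: exp_add)
   also have "... = exp (r / 2) * exp (r / 2)" using r0 gauss_exp_linear(2)[of "sqrt r"] by simp
   also have "... = exp r" by (simp flip: exp_add)
   finally show ?thesis .
  qed
  ultimately show ?thesis by (simp add: I_def[abs_def])
 qed
 have J_le: "J m \<le> exp (v m)" for m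
 proof -
  have "J m \<le> (\<integral>z. exp (- v m) * exp (2 * sqrt (v m) * z) \<partial>std_normal_distribution)"
   unfolding J_def
  proof (rule integral_mono')
   show "integrable std_normal_distribution (\<lambda>z. exp (- v m) * exp (2 * sqrt (v m) * z))"
    using gauss_exp_linear(1)[of "2 * sqrt (v m)"] by simp
   fix z
   have "(G m (sqrt (v m) * z))\<^sup>2 \<le> (exp (sqrt (v m) * z - v m / 2))\<^sup>2"
    unfolding G_def by (intro power_mono) auto
   also have "... = exp (- v m) * exp (2 * sqrt (v m) * z)"
    by (simp add: power2_eq_square flip: exp_add)
   finally show "(G m (sqrt (v m) * z))\<^sup>2 \<le> exp (- v m) * exp (2 * sqrt (v m) * z)" .
  qed simp
  also have "... = exp (- v m) * exp ((2 * sqrt (v m))\<^sup>2 / 2)" using gauss_exp_linear(2)[of "2 * sqrt (v m)"] by simp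
  also have "... = exp (v m)" using v0[of m] by (simp add: power_mult_distrib flip: exp_add)
  finally show ?thesis .
 qed
 have err: "(\<lambda>m. exp r - 2 * I m + J m) \<longlonglongrightarrow> 0"
 proof (rule tendsto_sandwich[where f="\<lambda>_. 0" and h="\<lambda>m. exp r - 2 * I m + exp (v m)"])
  have "0 \<le> exp r - 2 * I m + J m" for m
   by (rule LIMSEQ_le_const[OF q_lim]) (auto simp: q_def)
  then show "\<forall>\<^sub>F m in sequentially. 0 \<le> exp r - 2 * I m + J m" by simp
  show "\<forall>\<^sub>F m in sequentially. exp r - 2 * I m + J m \<le> exp r - 2 * I m + exp (v m)" using J_le by simp
  have "(\<lambda>m. exp r - 2 * I m + exp (v m)) \<longlonglongrightarrow> exp r - 2 * exp r + exp r"
   by (intro tendsto_add tendsto_diff tendsto_mult tendsto_const tendsto_exp I_lim vr)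
  then show "(\<lambda>m. exp r - 2 * I m + exp (v m)) \<longlonglongrightarrow> 0" by simp
 qed simp
 define A where "A = (\<integral>z. \<phi> (exp (sqrt r * z - r / 2)) \<partial>std_normal_distribution)"
 define Cm where "Cm m = (\<integral>z. \<phi> (G m (sqrt (v m) * z)) \<partial>std_normal_distribution)" for m
 have C_lim: "Cm \<longlonglongrightarrow> A"
  unfolding Cm_def[abs_def] A_def
 proof (rule integral_dominated_convergence[where w="\<lambda>_. c"])
  show "AE z in std_normal_distribution. (\<lambda>m. \<phi> (G m (sqrt (v m) * z))) \<longlonglongrightarrow> \<phi> (exp (sqrt r * z - r / 2))"
  proof (intro AE_I2 isCont_tendsto_compose[OF \<phi>c])
   fix z
   show "(\<lambda>m. G m (sqrt (v m) * z)) \<longlonglongrightarrow> exp (sqrt r * z - r / 2)"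
    unfolding G_def
    by (intro min_nat_limit tendsto_exp tendsto_diff tendsto_mult tendsto_divide tendsto_real_sqrt vr tendsto_const) simp
  qed
  show "(\<lambda>z. \<phi> (exp (sqrt r * z - r / 2))) \<in> borel_measurable std_normal_distribution"
   using measurable_compose[OF _ \<phi>m] by measurable
  show "(\<lambda>z. \<phi> (G m (sqrt (v m) * z))) \<in> borel_measurable std_normal_distribution" for m
   using measurable_compose[OF measurable_compose[OF _ Gm] \<phi>m] by measurable
 qed (use \<phi>b in auto)
 have c_lim: "(\<lambda>N. \<integral>\<omega>. \<phi> (G m (stat m N \<omega>)) \<partial>P N) \<longlonglongrightarrow> Cm m" for m
  unfolding Cm_def v_def
  by (rule null_limit[where g="\<lambda>x. \<phi> (G m x)"]) (use isCont_o2[OF Gc \<phi>c] \<phi>b in auto)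
 have approx: "\<bar>(\<integral>\<omega>. \<phi> (S.likelihood N \<omega>) \<partial>P N) - (\<integral>\<omega>. \<phi> (G m (stat m N \<omega>)) \<partial>P N)\<bar> \<le> L * sqrt (q m N)" for m N
 proof -
  let ?d = "\<lambda>\<omega>. S.likelihood N \<omega> - G m (stat m N \<omega>)"
  have dm: "?d \<in> borel_measurable (P N)" using GSm by measurable
  have di: "integrable (P N) ?d" using S.square_integrable_imp_integrable[OF dm dsi] .
  have i: "integrable (P N) (\<lambda>\<omega>. \<phi> (S.likelihood N \<omega>))" "integrable (P N) (\<lambda>\<omega>. \<phi> (G m (stat m N \<omega>)))"
   using measurable_compose[OF S.likelihood_measurable \<phi>m] measurable_compose[OF GSm \<phi>m] \<phi>b
   by (auto intro!: S.integrable_const_bound[where B=c])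
  have "\<bar>(\<integral>\<omega>. \<phi> (S.likelihood N \<omega>) \<partial>P N) - (\<integral>\<omega>. \<phi> (G m (stat m N \<omega>)) \<partial>P N)\<bar>
    = norm (\<integral>\<omega>. \<phi> (S.likelihood N \<omega>) - \<phi> (G m (stat m N \<omega>)) \<partial>P N)" using i by simp
  also have "... \<le> (\<integral>\<omega>. L * \<bar>?d \<omega>\<bar> \<partial>P N)"
   by (rule norm_integral_le) (use i di \<phi>l in auto)
  also have "... = L * (\<integral>\<omega>. \<bar>?d \<omega>\<bar> \<partial>P N)" by simp
  also have "... \<le> L * sqrt (q m N)"
  proof (rule mult_left_mono[OF real_le_rsqrt L0])
   have "0 \<le> (\<integral>\<omega>. (\<bar>?d \<omega>\<bar> - (\<integral>\<omega>. \<bar>?d \<omega>\<bar> \<partial>P N))\<^sup>2 \<partial>P N)" by simp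
   also have "... = (\<integral>\<omega>. \<bar>?d \<omega>\<bar>\<^sup>2 \<partial>P N) - (\<integral>\<omega>. \<bar>?d \<omega>\<bar> \<partial>P N)\<^sup>2"
    by (rule S.variance_eq) (use di dsi in auto)
   finally show "(\<integral>\<omega>. \<bar>?d \<omega>\<bar> \<partial>P N)\<^sup>2 \<le> q m N" by (simp add: q_def)
  qed
  finally show ?thesis .
 qed
 show ?thesis unfolding A_def[symmetric]
 proof (rule double_limit)
  show "\<bar>(\<integral>\<omega>. \<phi> (S.likelihood N \<omega>) \<partial>P N) - A\<bar>
   \<le> (L * sqrt (q m N) + \<bar>(\<integral>\<omega>. \<phi> (G m (stat m N \<omega>)) \<partial>P N) - Cm m\<bar>) + \<bar>Cm m - A\<bar>" for m N
   using approx[of N m] by linarith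
  show "(\<lambda>N. L * sqrt (q m N) + \<bar>(\<integral>\<omega>. \<phi> (G m (stat m N \<omega>)) \<partial>P N) - Cm m\<bar>) \<longlonglongrightarrow> L * sqrt (exp r - 2 * I m + J m) + \<bar>Cm m - Cm m\<bar>" for m
   by (intro tendsto_add tendsto_mult tendsto_rabs tendsto_diff tendsto_real_sqrt tendsto_const q_lim c_lim)
  have "(\<lambda>m. L * sqrt (exp r - 2 * I m + J m) + \<bar>Cm m - Cm m\<bar>) \<longlonglongrightarrow> L * sqrt 0 + 0"
   using err by (intro tendsto_add tendsto_mult tendsto_real_sqrt tendsto_const) auto
  then show "(\<lambda>m. L * sqrt (exp r - 2 * I m + J m) + \<bar>Cm m - Cm m\<bar>) \<longlonglongrightarrow> 0" by simp
  show "(\<lambda>m. \<bar>Cm m - A\<bar>) \<longlonglongrightarrow> 0" using C_lim by (intro tendsto_rabs_zero LIM_zero)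
 qed
qed

end

section \<open>The likelihood ratio of a single entry\<close>

text \<open>
 The envelope \<open>g\<close> is a multiple of a power of \<open>2 + \<bar>x\<bar>\<close>.  It bounds the two logarithmic derivatives
 not only at \<open>x\<close> but on the unit interval around it, so that shifts by less than one are harmless.
\<close>

locale tame_density =
 fixes p p1 p2 g :: "real => real" and \<kappa> \<omega> :: real
 assumes deriv1: "\<And>x. (p has_real_derivative p1 x) (at x)"
  and deriv2: "\<And>x. (p1 has_real_derivative p2 x) (at x)"
  and p2_cont: "\<And>x. isCont p2 x"
  and p_pos: "\<And>x. 0 < p x" and p_even: "\<And>x. p (- x) = p x"
  and p_prob: "prob_space (density lborel (\<lambda>x. ennreal (p x)))"
  and env1: "\<And>x y. \<bar>y - x\<bar> \<le> 1 ==> \<bar>p1 y\<bar> \<le> g x * p y"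
  and env2: "\<And>x y. \<bar>y - x\<bar> \<le> 1 ==> \<bar>p2 y\<bar> \<le> g x * p y"
  and g_ge_1: "\<And>x. 1 \<le> g x" and g_even: "\<And>x. g (- x) = g x"
  and g_meas: "g \<in> borel_measurable borel"
  and g_shift: "\<And>x y. \<bar>y - x\<bar> \<le> 1 ==> g y \<le> \<kappa> * g x"
  and g_moment: "\<And>k. integrable (density lborel (\<lambda>x. ennreal (p x))) (\<lambda>x. g x ^ k)"
  and \<omega>_pos: "0 < \<omega>"
begin

definition law :: "real measure" where "law = density lborel (\<lambda>x. ennreal (p x))"

sublocale law: prob_space law unfolding law_def by (rule p_prob)

lemma sets_law [simp, measurable_cong]: "sets law = sets borel" by (simp add: law_def)

lemma space_law [simp]: "space law = UNIV" by (simp add: law_def)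

lemma p_cont: "isCont p x" and p1_cont: "isCont p1 x"
 using deriv1 deriv2 by (auto intro: DERIV_isCont)

lemma p_meas [measurable]: "p \<in> borel_measurable borel"
 using p_cont by (intro borel_measurable_continuous_onI continuous_at_imp_continuous_on) auto

lemmas [measurable] = g_meas

lemma law_integral:
 assumes [measurable]: "f \<in> borel_measurable borel"
 shows "(\<integral>x. f x \<partial>law) = (\<integral>x. p x * f x \<partial>lborel :: real)"
  and "integrable law f \<longleftrightarrow> integrable lborel (\<lambda>x. p x * f x)"
proof -
 have "AE x in lborel. 0 \<le> p x" using p_pos by (auto intro: less_imp_le)
 then show "(\<integral>x. f x \<partial>law) = (\<integral>x. p x * f x \<partial>lborel)" "integrable law f \<longleftrightarrow> integrable lborel (\<lambda>x. p x * f x)"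
  unfolding law_def by (simp_all add: integral_density integrable_density)
qed

lemma law_odd:
 assumes [measurable]: "f \<in> borel_measurable borel" and odd: "\<And>x. f (- x) = - f x"
 shows "(\<integral>x. f x \<partial>law) = (0::real)"
proof -
 have "(\<integral>x. p x * f x \<partial>lborel) = (\<integral>x. p (- x) * f (- x) \<partial>lborel)"
  using lborel_integral_real_affine[of "- 1" "\<lambda>x. p x * f x" 0] by simp
 also have "... = - (\<integral>x. p x * f x \<partial>lborel)" by (simp add: p_even odd)
 finally show ?thesis by (simp add: law_integral)
qed

definition eps :: "nat => real" where "eps N = sqrt (\<omega> / real N)"

text \<open>
 The set on which the ratio is kept.  It is cut out by the envelope itself rather than by a radius, so that Markov's inequality
 bounds the complement and the logarithm of \<open>p\<close> varies by at most one over a shift by \<open>eps N\<close>.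
\<close>

definition core :: "nat => real set" where "core N = {x. eps N * g x \<le> 1}"

lemma core_measurable [measurable]: "core N \<in> sets borel" unfolding core_def by measurable

lemma eps_nonneg: "0 \<le> eps N" using \<omega>_pos by (simp add: eps_def)

lemma eps_square: "(eps N)\<^sup>2 = \<omega> / real N" using \<omega>_pos by (simp add: eps_def)

lemma eps_eq: "eps N = sqrt \<omega> / sqrt (real N)" by (simp add: eps_def real_sqrt_divide)

lemma eps_lim: "eps \<longlonglongrightarrow> 0"
proof -
 have "(\<lambda>N. sqrt (\<omega> / real N)) \<longlonglongrightarrow> sqrt 0" by (intro tendsto_real_sqrt lim_const_over_n)
 then show ?thesis by (simp add: eps_def[abs_def])
qed

lemma core_eps_le_1: "x \<in> core N ==> eps N \<le> 1"
 using mult_left_mono[OF g_ge_1[of x] eps_nonneg[of N]] by (simp add: core_def)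

lemma core_even: "- x \<in> core N \<longleftrightarrow> x \<in> core N" by (simp add: core_def g_even)

lemma eventually_core: "\<forall>\<^sub>F N in sequentially. x \<in> core N"
proof -
 have "(\<lambda>N. eps N * g x) \<longlonglongrightarrow> 0 * g x" by (intro tendsto_mult eps_lim tendsto_const)
 then have "\<forall>\<^sub>F N in sequentially. eps N * g x < 1" by (intro order_tendstoD) auto
 then show ?thesis by eventually_elim (simp add: core_def)
qed

lemma density_ratio_bounds:
 assumes x: "x \<in> core N" and h: "\<bar>h\<bar> \<le> eps N"
 shows "exp (- 1) * p x \<le> p (x + h)" "p (x + h) \<le> exp 1 * p x"
proof -
 have h1: "\<bar>h\<bar> \<le> 1" using core_eps_le_1[OF x] h by simp
 have "norm (ln (p (x + h)) - ln (p x)) \<le> g x * norm (x + h - x)"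
 proof (rule field_differentiable_bound[of "{x - 1..x + 1}" _ "\<lambda>y. p1 y / p y"])
  fix y assume "y \<in> {x - 1..x + 1}"
  then have "\<bar>p1 y\<bar> \<le> g x * p y" by (intro env1) auto
  then show "norm (p1 y / p y) \<le> g x" using p_pos[of y] by (simp add: divide_le_eq)
  show "((\<lambda>y. ln (p y)) has_real_derivative p1 y / p y) (at y within {x - 1..x + 1})"
   using p_pos[of y] deriv1[of y, THEN DERIV_subset[where t="{x - 1..x + 1}"]]
   by (auto intro!: derivative_eq_intros)
 qed (use h1 in auto)
 also have "... \<le> g x * eps N" using h g_ge_1[of x] by (intro mult_left_mono) auto
 also have "... \<le> 1" using x by (simp add: core_def mult.commute)
 finally have *: "\<bar>ln (p (x + h)) - ln (p x)\<bar> \<le> 1" by simp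
 have "exp (- 1) * p x = exp (- 1 + ln (p x))" using p_pos[of x] by (simp only: exp_add exp_ln)
 also have "... \<le> exp (ln (p (x + h)))" using * by (subst exp_le_cancel_iff) linarith
 finally show "exp (- 1) * p x \<le> p (x + h)" using p_pos by simp
 have "exp (ln (p (x + h))) \<le> exp (1 + ln (p x))" using * by (subst exp_le_cancel_iff) linarith
 also have "... = exp 1 * p x" using p_pos[of x] by (simp only: exp_add exp_ln)
 finally show "p (x + h) \<le> exp 1 * p x" using p_pos by simp
qed

lemma first_difference:
 assumes "0 \<le> h" shows "\<exists>y. \<bar>y - x\<bar> \<le> h \<and> p (x + h) - p (x - h) = 2 * h * p1 y"
proof (cases "h = 0")
 case False
 then have "x - h < x + h" using assms by simp
 from MVT2[OF this deriv1] obtain y where "x - h < y" "y < x + h" "p (x + h) - p (x - h) = (x + h - (x - h)) * p1 y"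
  by blast
 then show ?thesis by (intro exI[of _ y]) auto
qed auto

text \<open>
 The mean value theorem for the quotient of the second difference and \<open>h\<^sup>2\<close>, then for \<open>p1\<close>.  An exact expression
 serves both the uniform bound and the pointwise limit.
\<close>

lemma second_difference:
 assumes "0 \<le> h" shows "\<exists>y. \<bar>y - x\<bar> \<le> h \<and> p (x + h) + p (x - h) - 2 * p x = h\<^sup>2 * p2 y"
proof (cases "h = 0")
 case False
 then have h: "0 < h" using assms by simp
 have df: "((\<lambda>t. p (x + t) + p (x - t)) has_real_derivative p1 (x + t) - p1 (x - t)) (at t)" for t
  by (auto intro!: derivative_eq_intros DERIV_chain2[OF deriv1])
 have dg: "((\<lambda>t. t\<^sup>2) has_real_derivative 2 * t) (at t)" for t :: real
  by (auto intro!: derivative_eq_intros)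
 obtain c where c: "0 < c" "c < h"
  "(p (x + h) + p (x - h) - (p (x + 0) + p (x - 0))) * (2 * c) = (h\<^sup>2 - 0\<^sup>2) * (p1 (x + c) - p1 (x - c))"
  using GMVT'[OF h DERIV_isCont[OF df] DERIV_isCont[OF dg] dg df] by blast
 have "x - c < x + c" using c by simp
 from MVT2[OF this deriv2] obtain y where y: "x - c < y" "y < x + c" "p1 (x + c) - p1 (x - c) = (x + c - (x - c)) * p2 y"
  by blast
 have "(p (x + h) + p (x - h) - 2 * p x) * (2 * c) = (h\<^sup>2 * p2 y) * (2 * c)"
  using c(3) unfolding y(3) by (simp add: algebra_simps)
 then have "p (x + h) + p (x - h) - 2 * p x = h\<^sup>2 * p2 y" using c(1) by simp
 then show ?thesis using y c by (intro exI[of _ y]) auto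
qed auto

definition even0 :: "nat => real => real" where
 "even0 N x = (if x \<in> core N then (p (x - eps N) + p (x + eps N)) / (2 * p x) else 1)"

definition odd0 :: "nat => real => real" where
 "odd0 N x = (if x \<in> core N then (p (x - eps N) - p (x + eps N)) / (2 * p x) else 0)"

definition mass :: "nat => real" where "mass N = (\<integral>x. even0 N x \<partial>law)"

lemma even0_measurable [measurable]: "even0 N \<in> borel_measurable borel"
 unfolding even0_def[abs_def] by measurable

lemma odd0_measurable [measurable]: "odd0 N \<in> borel_measurable borel"
 unfolding odd0_def[abs_def] by measurable

lemma even0_even: "even0 N (- x) = even0 N x"
 using p_even[of "x - eps N"] p_even[of "x + eps N"] by (simp add: even0_def core_even p_even add.commute)

lemma odd0_odd: "odd0 N (- x) = - odd0 N x"
 using p_even[of "x - eps N"] p_even[of "x + eps N"]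
 by (simp add: odd0_def core_even p_even add.commute minus_divide_left)

lemma even0_bounds: "exp (- 1) \<le> even0 N x" "even0 N x \<le> exp 1"
proof -
 have e: "exp (- 1) \<le> (1::real)" "1 \<le> exp (1::real)" by auto
 have "exp (- 1) \<le> (p (x - eps N) + p (x + eps N)) / (2 * p x) \<and> (p (x - eps N) + p (x + eps N)) / (2 * p x) \<le> exp 1"
  if x: "x \<in> core N"
  using density_ratio_bounds[OF x, of "eps N"] density_ratio_bounds[OF x, of "- eps N"] eps_nonneg[of N] p_pos[of x]
  by (simp add: pos_le_divide_eq pos_divide_le_eq)
 then show "exp (- 1) \<le> even0 N x" "even0 N x \<le> exp 1" using e by (auto simp: even0_def)
qed

lemma odd0_le_even0: "\<bar>odd0 N x\<bar> \<le> even0 N x"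
proof (cases "x \<in> core N")
 case True
 have "\<bar>p (x - eps N) - p (x + eps N)\<bar> \<le> p (x - eps N) + p (x + eps N)"
  using p_pos[of "x - eps N"] p_pos[of "x + eps N"] by linarith
 then show ?thesis using True p_pos[of x] by (simp add: even0_def odd0_def divide_right_mono)
qed (simp add: even0_def odd0_def)

lemma even0_near_1: "\<bar>even0 N x - 1\<bar> \<le> exp 1 * (eps N)\<^sup>2 * g x"
proof (cases "x \<in> core N")
 case True
 note s1 = core_eps_le_1[OF True]
 obtain y where y: "\<bar>y - x\<bar> \<le> eps N" "p (x + eps N) + p (x - eps N) - 2 * p x = (eps N)\<^sup>2 * p2 y"
  using second_difference[OF eps_nonneg] by blast
 have "\<bar>p2 y\<bar> \<le> g x * p y" by (rule env2) (use y s1 in auto)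
 also have "... \<le> g x * (exp 1 * p x)"
  using density_ratio_bounds(2)[OF True y(1)] g_ge_1[of x] by (intro mult_left_mono) auto
 finally have b: "\<bar>p2 y\<bar> \<le> g x * (exp 1 * p x)" .
 have "even0 N x - 1 = (eps N)\<^sup>2 * p2 y / (2 * p x)"
  using True p_pos[of x] y(2) by (simp add: even0_def field_simps)
 then have "\<bar>even0 N x - 1\<bar> = (eps N)\<^sup>2 * \<bar>p2 y\<bar> / (2 * p x)" using p_pos[of x] by (simp add: abs_mult)
 also have "... \<le> (eps N)\<^sup>2 * (g x * (exp 1 * p x)) / (2 * p x)"
  using b p_pos[of x] by (intro divide_right_mono mult_left_mono) auto
 also have "... = exp 1 * (eps N)\<^sup>2 * g x / 2" using p_pos[of x] by simp
 also have "... \<le> exp 1 * (eps N)\<^sup>2 * g x" using g_ge_1[of x] by simp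
 finally show ?thesis .
qed (use g_ge_1[of x] in \<open>simp add: even0_def\<close>)

lemma odd0_small: "\<bar>odd0 N x\<bar> \<le> exp 1 * eps N * g x"
proof (cases "x \<in> core N")
 case True
 note s1 = core_eps_le_1[OF True]
 obtain y where y: "\<bar>y - x\<bar> \<le> eps N" "p (x + eps N) - p (x - eps N) = 2 * eps N * p1 y"
  using first_difference[OF eps_nonneg] by blast
 have "\<bar>p1 y\<bar> \<le> g x * p y" by (rule env1) (use y s1 in auto)
 also have "... \<le> g x * (exp 1 * p x)"
  using density_ratio_bounds(2)[OF True y(1)] g_ge_1[of x] by (intro mult_left_mono) auto
 finally have b: "\<bar>p1 y\<bar> \<le> g x * (exp 1 * p x)" .
 have "p (x - eps N) - p (x + eps N) = - (2 * eps N * p1 y)" using y(2) by simp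
 then have "odd0 N x = - (eps N * p1 y / p x)"
  using True p_pos[of x] by (simp add: odd0_def)
 then have "\<bar>odd0 N x\<bar> = eps N * \<bar>p1 y\<bar> / p x" using p_pos[of x] eps_nonneg[of N] by (simp add: abs_mult)
 also have "... \<le> eps N * (g x * (exp 1 * p x)) / p x"
  using b p_pos[of x] eps_nonneg[of N] by (intro divide_right_mono mult_left_mono) auto
 also have "... = exp 1 * eps N * g x" using p_pos[of x] by simp
 finally show ?thesis .
qed (use g_ge_1[of x] eps_nonneg[of N] in \<open>simp add: odd0_def\<close>)

lemma even0_integrable: "integrable law (even0 N)"
proof (rule law.integrable_const_bound[where B="exp 1"])
 have "norm (even0 N x) \<le> exp 1" for x
  using less_le_trans[OF exp_gt_zero even0_bounds(1)[of N x]] even0_bounds(2)[of N x] by simp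
 then show "AE x in law. norm (even0 N x) \<le> exp 1" by simp
qed simp

lemma mass_ge: "exp (- 1) \<le> mass N"
proof -
 have "exp (- 1) = (\<integral>x. exp (- 1) \<partial>law)" using law.prob_space by simp
 also have "... \<le> mass N" unfolding mass_def
  by (intro integral_mono even0_integrable even0_bounds) auto
 finally show ?thesis .
qed

lemma mass_pos: "0 < mass N"
 using mass_ge[of N] exp_gt_zero[of "- 1::real"] by linarith

lemma shifted_core:
 "integrable lborel (\<lambda>x. indicator (core N) x * p (x + h) :: real)"
 "(\<integral>x. indicator (core N) x * p (x + h) \<partial>lborel) = law.prob {y. y - h \<in> core N}"
proof -
 let ?f = "\<lambda>x. p x * indicator {y. y - h \<in> core N} x :: real"
 have [measurable]: "{y. y - h \<in> core N} \<in> sets borel"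
 proof -
  have "(\<lambda>y. y - h) -` core N \<inter> space borel \<in> sets borel" by (rule measurable_sets[OF _ core_measurable]) simp
  then show ?thesis by (simp add: vimage_def)
 qed
 have eq: "?f (h + 1 * x) = indicator (core N) x * p (x + h)" for x
  by (simp add: indicator_def add.commute)
 have i: "integrable lborel ?f"
  by (subst law_integral(2)[symmetric]) (simp_all add: law.emeasure_eq_measure)
 show "integrable lborel (\<lambda>x. indicator (core N) x * p (x + h) :: real)"
  using lborel_integrable_real_affine[OF i, of 1 h] unfolding eq by simp
 have "law.prob {y. y - h \<in> core N} = (\<integral>x. indicator {y. y - h \<in> core N} x \<partial>law)" by simp
 also have "... = (\<integral>x. ?f x \<partial>lborel)" by (rule law_integral) simp
 also have "... = (\<integral>x. indicator (core N) x * p (x + h) \<partial>lborel)"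
  using lborel_integral_real_affine[of 1 ?f h] unfolding eq by simp
 finally show "(\<integral>x. indicator (core N) x * p (x + h) \<partial>lborel) = law.prob {y. y - h \<in> core N}" by simp
qed

lemma \<kappa>_ge_1: "1 \<le> \<kappa>" using g_shift[of 0 0] g_ge_1[of 0] by simp

text \<open>
 Markov's inequality with the sixth power of the envelope.  Any power above the fourth makes the sum over \<open>N\<^sup>2\<close> entries
 vanish.
\<close>

definition tail :: "nat => real" where
 "tail N = \<omega> ^ 3 * \<kappa> ^ 6 * (\<integral>x. g x ^ 6 \<partial>law) / real N ^ 3"

lemma tail_bound:
 assumes [measurable]: "S \<in> sets borel" and S: "\<And>x. x \<notin> S ==> 1 \<le> eps N * \<kappa> * g x"
 shows "1 - law.prob S \<le> tail N"
proof -
 have "1 - law.prob S = law.prob (- S)" using law.prob_compl[of S] by (simp add: Compl_eq_Diff_UNIV)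
 also have "... = (\<integral>x. indicator (- S) x \<partial>law)" by simp
 also have "... \<le> (\<integral>x. (eps N * \<kappa>) ^ 6 * g x ^ 6 \<partial>law)"
 proof (rule integral_mono)
  show "integrable law (indicator (- S) :: real => real)" by (simp add: law.emeasure_eq_measure)
  show "integrable law (\<lambda>x. (eps N * \<kappa>) ^ 6 * g x ^ 6)" using g_moment[of 6] by (simp add: law_def)
  fix x
  show "indicator (- S) x \<le> (eps N * \<kappa>) ^ 6 * g x ^ 6"
   using S[of x] one_le_power[of "eps N * \<kappa> * g x" 6] by (auto simp: indicator_def power_mult_distrib)
 qed
 also have "... = tail N"
 proof -
  have "eps N ^ 6 = ((eps N)\<^sup>2) ^ 3" by (simp flip: power_mult)
  then show ?thesis by (simp add: tail_def eps_square power_mult_distrib power_divide)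
 qed
 finally show ?thesis .
qed

lemma tail_nonneg: "0 \<le> tail N"
 using \<omega>_pos \<kappa>_ge_1 g_ge_1 by (auto simp: tail_def intro!: divide_nonneg_nonneg mult_nonneg_nonneg integral_nonneg zero_le_power order_trans[OF zero_le_one])

lemma core_prob: "1 - law.prob (core N) \<le> tail N"
proof (rule tail_bound)
 fix x assume "x \<notin> core N"
 then have "1 \<le> eps N * g x" by (simp add: core_def)
 also have "... \<le> eps N * g x * \<kappa>" using mult_left_mono[of 1 \<kappa> "eps N * g x"] \<kappa>_ge_1 eps_nonneg[of N] g_ge_1[of x] by simp
 finally show "1 \<le> eps N * \<kappa> * g x" by (simp add: mult.assoc mult.commute[of "g x"])
qed simp

text \<open>
 Shifting the variable turns the integrals of \<open>p (x - eps N)\<close> and \<open>p (x + eps N)\<close> over the core into probabilities of shifted cores.  The constant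
 therefore differs from one only by tail probabilities, although each ratio differs from one
 by the order of \<open>eps N\<close>.
\<close>

lemma mass_eq: "mass N = (law.prob {y. y - eps N \<in> core N} + law.prob {y. y - (- eps N) \<in> core N}) / 2 + 1 - law.prob (core N)"
proof -
 let ?c = "\<lambda>x. indicator (core N) x * p (x + eps N)" and ?d = "\<lambda>x. indicator (core N) x * p (x + - eps N)"
 let ?e = "\<lambda>x. p x * indicator (core N) x"
 have i: "integrable lborel ?c" "integrable lborel ?d" "integrable lborel p" "integrable lborel ?e"
 proof -
  show "integrable lborel ?c" "integrable lborel ?d" by (rule shifted_core(1))+
  show "integrable lborel p" using law_integral(2)[of "\<lambda>_. 1"] by simp
  show "integrable lborel ?e" using shifted_core(1)[of N 0] by (simp add: mult.commute)
 qed
 have "mass N = (\<integral>x. p x * even0 N x \<partial>lborel)" unfolding mass_def by (rule law_integral) simp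
 also have "... = (\<integral>x. (?c x + ?d x) / 2 + p x - ?e x \<partial>lborel)"
  using p_pos by (intro Bochner_Integration.integral_cong refl) (simp add: even0_def indicator_def less_imp_neq[symmetric])
 also have "... = ((\<integral>x. ?c x \<partial>lborel) + (\<integral>x. ?d x \<partial>lborel)) / 2 + (\<integral>x. p x \<partial>lborel) - (\<integral>x. ?e x \<partial>lborel)"
  using i by simp
 also have "(\<integral>x. p x \<partial>lborel) = 1" using law_integral(1)[of "\<lambda>_. 1"] law.prob_space by simp
 also have "(\<integral>x. ?e x \<partial>lborel) = law.prob (core N)" using shifted_core(2)[of N 0] by (simp add: mult.commute)
 finally show ?thesis unfolding shifted_core(2) by simp
qed

lemma mass_near_1: "\<bar>mass N - 1\<bar> \<le> tail N"
proof (cases "eps N \<le> 1")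
 case True
 have sh: "1 - law.prob {y. y - h \<in> core N} \<le> tail N" if h: "\<bar>h\<bar> \<le> 1" for h
 proof (rule tail_bound)
  have "(\<lambda>y. y - h) -` core N \<inter> space borel \<in> sets borel" by (rule measurable_sets[OF _ core_measurable]) simp
  then show "{y. y - h \<in> core N} \<in> sets borel" by (simp add: vimage_def)
  fix x assume "x \<notin> {y. y - h \<in> core N}"
  then have "1 \<le> eps N * g (x - h)" by (simp add: core_def)
  also have "... \<le> eps N * (\<kappa> * g x)" using h eps_nonneg by (intro mult_left_mono g_shift) auto
  finally show "1 \<le> eps N * \<kappa> * g x" by (simp add: mult.assoc)
 qed
 have "1 - law.prob {y. y - eps N \<in> core N} \<le> tail N" "1 - law.prob {y. y - (- eps N) \<in> core N} \<le> tail N"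
  using sh[of "eps N"] sh[of "- eps N"] True eps_nonneg[of N] by simp_all
 moreover have "law.prob {y. y - eps N \<in> core N} \<le> 1" "law.prob {y. y - (- eps N) \<in> core N} \<le> 1" "law.prob (core N) \<le> 1"
  by auto
 moreover have "\<bar>(u + v) / 2 + 1 - w - 1\<bar> \<le> t"
  if "1 - u \<le> t" "1 - v \<le> t" "1 - w \<le> t" "u \<le> 1" "v \<le> 1" "w \<le> 1" for u v w t :: real
  using that by (simp add: abs_le_iff field_simps)
 ultimately show ?thesis using core_prob[of N] unfolding mass_eq by blast
next
 case False
 then have "core N = {}" using core_eps_le_1 by auto
 then show ?thesis using tail_nonneg[of N] by (simp add: mass_eq)
qed

lemma tail_lim: "(\<lambda>N. (real N)\<^sup>2 * tail N) \<longlonglongrightarrow> 0"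
proof -
 have "(real N)\<^sup>2 * tail N = \<omega> ^ 3 * \<kappa> ^ 6 * (\<integral>x. g x ^ 6 \<partial>law) / real N" for N
  by (simp add: tail_def power2_eq_square power3_eq_cube)
 then show ?thesis using lim_const_over_n by simp
qed

lemma mass_lim: "(\<lambda>N. (real N)\<^sup>2 * (mass N - 1)) \<longlonglongrightarrow> 0"
proof (rule tendsto_0_le[where K=1, OF tail_lim])
 have "norm ((real N)\<^sup>2 * (mass N - 1)) \<le> norm ((real N)\<^sup>2 * tail N) * 1" for N
  using mass_near_1[of N] tail_nonneg[of N] by (simp add: abs_mult mult_left_mono)
 then show "\<forall>\<^sub>F N in sequentially. norm ((real N)\<^sup>2 * (mass N - 1)) \<le> norm ((real N)\<^sup>2 * tail N) * 1"
  by simp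
qed

lemma mass_lim_1: "(\<lambda>N. real N * (mass N - 1)) \<longlonglongrightarrow> 0" "mass \<longlonglongrightarrow> 1"
proof -
 have "(\<lambda>N. (real N)\<^sup>2 * (mass N - 1) * inverse (real N)) \<longlonglongrightarrow> 0"
  using tendsto_mult[OF mass_lim lim_inverse_n] by simp
 then show *: "(\<lambda>N. real N * (mass N - 1)) \<longlonglongrightarrow> 0"
  by (rule Lim_transform_eventually) (auto intro!: eventually_sequentiallyI[of 1] simp: power2_eq_square field_simps)
 have "(\<lambda>N. real N * (mass N - 1) * inverse (real N)) \<longlonglongrightarrow> 0"
  using tendsto_mult[OF * lim_inverse_n] by simp
 then have "(\<lambda>N. mass N - 1) \<longlonglongrightarrow> 0"
  by (rule Lim_transform_eventually)
    (auto intro!: eventually_sequentiallyI[of 1] simp: field_simps)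
 then show "mass \<longlonglongrightarrow> 1" by (simp add: LIM_zero_iff)
qed

text \<open>
 There are \<open>N\<^sup>2\<close> entries, and \<open>mass N\<close> differs from one by less than the order of \<open>1 / N\<^sup>2\<close>.
\<close>

lemma mass_power_lim: "(\<lambda>N. mass N ^ (N * N)) \<longlonglongrightarrow> 1"
proof (rule tendsto_sandwich)
 have m: "1 + real (N * N) * (mass N - 1) \<le> mass N ^ (N * N)" for N
  using Bernoulli_inequality[of "mass N - 1" "N * N"] mass_pos[of N] by simp
 have n: "mass N ^ (N * N) \<le> exp ((real N)\<^sup>2 * (mass N - 1))" for N
 proof -
  have "mass N ^ (N * N) \<le> exp (mass N - 1) ^ (N * N)"
   using mass_pos[of N] exp_ge_add_one_self[of "mass N - 1"] by (intro power_mono) auto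
  also have "... = exp ((real N)\<^sup>2 * (mass N - 1))" by (simp add: power2_eq_square flip: exp_of_nat_mult)
  finally show ?thesis .
 qed
 show "\<forall>\<^sub>F N in sequentially. 1 + (real N)\<^sup>2 * (mass N - 1) \<le> mass N ^ (N * N)"
  using m by (simp add: power2_eq_square)
 show "\<forall>\<^sub>F N in sequentially. mass N ^ (N * N) \<le> exp ((real N)\<^sup>2 * (mass N - 1))" using n by simp
 have "(\<lambda>N. 1 + (real N)\<^sup>2 * (mass N - 1)) \<longlonglongrightarrow> 1 + 0" by (intro tendsto_add tendsto_const mass_lim)
 then show "(\<lambda>N. 1 + (real N)\<^sup>2 * (mass N - 1)) \<longlonglongrightarrow> 1" by simp
 have "(\<lambda>N. exp ((real N)\<^sup>2 * (mass N - 1))) \<longlonglongrightarrow> exp 0" by (intro tendsto_exp mass_lim)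
 then show "(\<lambda>N. exp ((real N)\<^sup>2 * (mass N - 1))) \<longlonglongrightarrow> 1" by simp
qed

definition A :: "nat => real => real" where "A N x = even0 N x / mass N"

definition B :: "nat => real => real" where "B N x = odd0 N x / mass N"

lemma A_measurable [measurable]: "A N \<in> borel_measurable borel" unfolding A_def[abs_def] by measurable

lemma B_measurable [measurable]: "B N \<in> borel_measurable borel" unfolding B_def[abs_def] by measurable

text \<open>
 A multiple of \<open>g\<close>, large enough for the bounds on \<open>A\<close> and \<open>B\<close> to hold for all \<open>N\<close> at once.
\<close>

definition G :: "real => real" where
 "G x = (1 + exp 1 * (exp 1 * \<omega> + \<omega> ^ 3 * \<kappa> ^ 6 * (\<integral>x. g x ^ 6 \<partial>law)) + exp 1 * exp 1 * sqrt \<omega>) * g x"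

lemma G_measurable [measurable]: "G \<in> borel_measurable borel" unfolding G_def[abs_def] by measurable

lemma m6_nonneg: "0 \<le> (\<integral>x. g x ^ 6 \<partial>law)" using g_ge_1 by (intro Bochner_Integration.integral_nonneg zero_le_power order_trans[OF zero_le_one])

lemma G_ge_1: "1 \<le> G x"
proof -
 have "0 \<le> exp 1 * (exp 1 * \<omega> + \<omega> ^ 3 * \<kappa> ^ 6 * (\<integral>x. g x ^ 6 \<partial>law))" "0 \<le> exp 1 * exp 1 * sqrt \<omega>"
  using \<omega>_pos \<kappa>_ge_1 m6_nonneg by auto
 then have "1 * 1 \<le> G x" unfolding G_def using g_ge_1[of x] by (intro mult_mono) auto
 then show ?thesis by simp
qed

lemma G_moment: "integrable law (\<lambda>x. G x ^ k)"
 using g_moment[of k] unfolding G_def power_mult_distrib law_def by simp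

lemma inverse_mass: "inverse (mass N) \<le> exp 1"
 using le_imp_inverse_le[OF mass_ge[of N]] by (simp add: exp_minus)

lemma A_near_1: "\<bar>A N x - 1\<bar> \<le> G x / real N"
proof -
 let ?t = "\<omega> ^ 3 * \<kappa> ^ 6 * (\<integral>x. g x ^ 6 \<partial>law)"
 have t: "0 \<le> ?t" using \<omega>_pos \<kappa>_ge_1 m6_nonneg by simp
 have tail: "tail N \<le> ?t / real N * g x"
 proof (cases "N = 0")
  case False
  then have "real N \<le> real N ^ 3" using self_le_power[of "real N" 3] by simp
  then have "tail N \<le> ?t / real N" unfolding tail_def using False t by (intro divide_left_mono) auto
  also have "... = ?t / real N * 1" by simp
  also have "... \<le> ?t / real N * g x" using t g_ge_1 by (intro mult_left_mono) auto
  finally show ?thesis .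
 qed (simp add: tail_def)
 have "A N x - 1 = (even0 N x - 1 - (mass N - 1)) * inverse (mass N)"
  using mass_pos[of N] by (simp add: A_def field_simps)
 then have "\<bar>A N x - 1\<bar> = \<bar>even0 N x - 1 - (mass N - 1)\<bar> * inverse (mass N)"
  using mass_pos[of N] by (simp add: abs_mult)
 also have "... \<le> (exp 1 * (eps N)\<^sup>2 * g x + ?t / real N * g x) * exp 1"
  using even0_near_1[of N x] mass_near_1[of N] tail inverse_mass[of N] mass_pos[of N]
  by (intro mult_mono) auto
 also have "... = exp 1 * (exp 1 * \<omega> + ?t) * g x / real N"
  by (simp add: eps_square add_divide_distrib algebra_simps)
 also have "... \<le> G x / real N"
  unfolding G_def using g_ge_1[of x] \<omega>_pos by (intro divide_right_mono mult_right_mono) auto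
 finally show ?thesis .
qed

lemma B_small: "\<bar>B N x\<bar> \<le> G x / sqrt (real N)"
proof -
 let ?t = "\<omega> ^ 3 * \<kappa> ^ 6 * (\<integral>x. g x ^ 6 \<partial>law)"
 have t: "0 \<le> exp 1 * (exp 1 * \<omega> + ?t)" using \<omega>_pos \<kappa>_ge_1 m6_nonneg by simp
 have "\<bar>B N x\<bar> = \<bar>odd0 N x\<bar> * inverse (mass N)" using mass_pos[of N] by (simp add: B_def divide_inverse abs_mult)
 also have "... \<le> (exp 1 * eps N * g x) * exp 1"
  using odd0_small[of N x] inverse_mass[of N] mass_pos[of N] eps_nonneg[of N] g_ge_1[of x] by (intro mult_mono) auto
 also have "... = exp 1 * exp 1 * sqrt \<omega> * g x / sqrt (real N)" by (simp add: eps_eq)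
 also have "... \<le> G x / sqrt (real N)"
  unfolding G_def using g_ge_1[of x] t by (intro divide_right_mono mult_right_mono) auto
 finally show ?thesis .
qed

lemma B_le_A: "\<bar>B N x\<bar> \<le> A N x"
 using odd0_le_even0[of N x] mass_pos[of N] by (simp add: A_def B_def divide_right_mono)

lemma A_bounded: "\<bar>A N x\<bar> \<le> exp 1 * exp 1" and B_bounded: "\<bar>B N x\<bar> \<le> exp 1 * exp 1"
proof -
 have "A N x \<le> exp 1 * exp 1"
  using even0_bounds(2)[of N x] inverse_mass[of N] mass_pos[of N] unfolding A_def divide_inverse
  by (intro mult_mono) auto
 then show "\<bar>A N x\<bar> \<le> exp 1 * exp 1" "\<bar>B N x\<bar> \<le> exp 1 * exp 1" using B_le_A[of N x] by auto
qed

lemma AB_integrable: "integrable law (\<lambda>x. A N x ^ i * B N x ^ j)"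
proof (rule law.integrable_const_bound[where B="(exp 1 * exp 1) ^ i * (exp 1 * exp 1) ^ j"])
 show "AE x in law. norm (A N x ^ i * B N x ^ j) \<le> (exp 1 * exp 1) ^ i * (exp 1 * exp 1) ^ j"
  using A_bounded B_bounded by (auto simp: abs_mult power_abs intro!: mult_mono power_mono)
qed measurable

lemma A_mean: "(\<integral>x. A N x \<partial>law) = 1"
 using mass_pos[of N] by (simp add: A_def mass_def[symmetric])

lemma B_mean: "(\<integral>x. B N x \<partial>law) = 0"
 by (rule law_odd) (simp_all add: B_def odd0_odd)

lemma AB_mean: "(\<integral>x. A N x * B N x \<partial>law) = 0"
 by (rule law_odd) (simp_all add: A_def B_def odd0_odd even0_even)

definition a :: "nat => real" where "a N = (\<integral>x. (A N x)\<^sup>2 \<partial>law)"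

definition b :: "nat => real" where "b N = (\<integral>x. (B N x)\<^sup>2 \<partial>law)"

lemma curvature_lim: "(\<lambda>N. real N * (A N x - 1)) \<longlonglongrightarrow> \<omega> * p2 x / (2 * p x)"
proof -
 have "\<exists>y. \<bar>y - x\<bar> \<le> eps N \<and> p (x + eps N) + p (x - eps N) - 2 * p x = (eps N)\<^sup>2 * p2 y" for N
  by (rule second_difference[OF eps_nonneg])
 then obtain y where y: "\<And>N. \<bar>y N - x\<bar> \<le> eps N"
  "\<And>N. p (x + eps N) + p (x - eps N) - 2 * p x = (eps N)\<^sup>2 * p2 (y N)" by metis
 have "(\<lambda>N. y N - x) \<longlonglongrightarrow> 0" by (rule tendsto_0_le[OF eps_lim, where K=1]) (use y(1) eps_nonneg in auto)
 then have "y \<longlonglongrightarrow> x" by (simp add: LIM_zero_iff)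
 then have "(\<lambda>N. p2 (y N)) \<longlonglongrightarrow> p2 x" by (rule isCont_tendsto_compose[OF p2_cont])
 then have "(\<lambda>N. (\<omega> * p2 (y N) / (2 * p x) - real N * (mass N - 1)) / mass N) \<longlonglongrightarrow> (\<omega> * p2 x / (2 * p x) - 0) / 1"
  using p_pos[of x] by (intro tendsto_divide tendsto_diff tendsto_mult tendsto_const mass_lim_1) auto
 moreover have "\<forall>\<^sub>F N in sequentially. (\<omega> * p2 (y N) / (2 * p x) - real N * (mass N - 1)) / mass N = real N * (A N x - 1)"
  using eventually_core[of x] eventually_gt_at_top[of 0]
 proof eventually_elim
  case (elim N)
  have "even0 N x - 1 = (eps N)\<^sup>2 * p2 (y N) / (2 * p x)"
   using elim(1) p_pos[of x] y(2)[of N] by (simp add: even0_def field_simps)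
  then have e: "real N * (even0 N x - 1) = \<omega> * p2 (y N) / (2 * p x)" using elim(2) by (simp add: eps_square)
  have "real N * (A N x - 1) = (real N * (even0 N x - 1) - real N * (mass N - 1)) / mass N"
   using mass_pos[of N] by (simp add: A_def field_simps)
  then show ?case by (simp add: e)
 qed
 ultimately show ?thesis using Lim_transform_eventually by force
qed

lemma slope_lim: "(\<lambda>N. sqrt (real N) * B N x) \<longlonglongrightarrow> - (sqrt \<omega> * p1 x / p x)"
proof -
 have "\<exists>y. \<bar>y - x\<bar> \<le> eps N \<and> p (x + eps N) - p (x - eps N) = 2 * eps N * p1 y" for N
  by (rule first_difference[OF eps_nonneg])
 then obtain y where y: "\<And>N. \<bar>y N - x\<bar> \<le> eps N"
  "\<And>N. p (x + eps N) - p (x - eps N) = 2 * eps N * p1 (y N)" by metis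
 have "(\<lambda>N. y N - x) \<longlonglongrightarrow> 0" by (rule tendsto_0_le[OF eps_lim, where K=1]) (use y(1) eps_nonneg in auto)
 then have "y \<longlonglongrightarrow> x" by (simp add: LIM_zero_iff)
 then have "(\<lambda>N. p1 (y N)) \<longlonglongrightarrow> p1 x" by (rule isCont_tendsto_compose[OF p1_cont])
 then have "(\<lambda>N. - (sqrt \<omega> * p1 (y N) / p x) / mass N) \<longlonglongrightarrow> - (sqrt \<omega> * p1 x / p x) / 1"
  using p_pos[of x] by (intro tendsto_divide tendsto_minus tendsto_mult tendsto_const mass_lim_1) auto
 moreover have "\<forall>\<^sub>F N in sequentially. - (sqrt \<omega> * p1 (y N) / p x) / mass N = sqrt (real N) * B N x"
  using eventually_core[of x] eventually_gt_at_top[of 0]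
 proof eventually_elim
  case (elim N)
  have "p (x - eps N) - p (x + eps N) = - (2 * eps N * p1 (y N))" using y(2)[of N] by simp
  then have "odd0 N x = - (eps N * p1 (y N) / p x)"
   using elim(1) p_pos[of x] by (simp add: odd0_def)
  then have "sqrt (real N) * odd0 N x = - (sqrt \<omega> * p1 (y N) / p x)" using elim(2) by (simp add: eps_eq)
  then show ?case by (simp add: B_def)
 qed
 ultimately show ?thesis using Lim_transform_eventually by force
qed

lemma p1_meas [measurable]: "p1 \<in> borel_measurable borel"
 using p1_cont by (intro borel_measurable_continuous_onI continuous_at_imp_continuous_on) auto

lemma p2_meas [measurable]: "p2 \<in> borel_measurable borel"
 using p2_cont by (intro borel_measurable_continuous_onI continuous_at_imp_continuous_on) auto

text \<open>
 \<open>a N - 1\<close> is the variance of \<open>A N\<close>, and \<open>N (A N - 1)\<close> tends to \<open>\<omega> p'' / (2 p)\<close>.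
\<close>

lemma a_lim: "(\<lambda>N. (real N)\<^sup>2 * (a N - 1)) \<longlonglongrightarrow> \<omega>\<^sup>2 / 4 * (\<integral>x. (p2 x)\<^sup>2 / p x \<partial>lborel)"
proof -
 have "(\<lambda>N. \<integral>x. (real N * (A N x - 1))\<^sup>2 \<partial>law) \<longlonglongrightarrow> (\<integral>x. (\<omega> * p2 x / (2 * p x))\<^sup>2 \<partial>law)"
 proof (rule integral_dominated_convergence[where w="\<lambda>x. (G x)\<^sup>2"])
  show "AE x in law. (\<lambda>N. (real N * (A N x - 1))\<^sup>2) \<longlonglongrightarrow> (\<omega> * p2 x / (2 * p x))\<^sup>2"
   by (intro AE_I2 tendsto_power curvature_lim)
  have "norm ((real N * (A N x - 1))\<^sup>2) \<le> (G x)\<^sup>2" for N x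
  proof -
   have "\<bar>real N * (A N x - 1)\<bar> \<le> \<bar>G x\<bar>"
    using A_near_1[of N x] G_ge_1[of x] by (cases "N = 0") (auto simp: abs_mult pos_le_divide_eq mult.commute simp del: right_diff_distrib)
   then show ?thesis by (simp add: abs_le_square_iff)
  qed
  then show "AE x in law. norm ((real N * (A N x - 1))\<^sup>2) \<le> (G x)\<^sup>2" for N by simp
 qed (use G_moment[of 2] in \<open>auto simp: measurable_cong_sets[OF sets_law refl]\<close>)
 moreover have "(\<integral>x. (real N * (A N x - 1))\<^sup>2 \<partial>law) = (real N)\<^sup>2 * (a N - 1)" for N
 proof -
  have "(\<integral>x. (real N * (A N x - 1))\<^sup>2 \<partial>law) = (\<integral>x. (real N)\<^sup>2 * ((A N x)\<^sup>2 - 2 * A N x + 1) \<partial>law)"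
   by (intro Bochner_Integration.integral_cong refl) (simp add: power2_eq_square algebra_simps)
  also have "... = (real N)\<^sup>2 * (a N - 2 * 1 + 1)"
   using AB_integrable[of N 2 0] AB_integrable[of N 1 0] A_mean[of N] law.prob_space by (simp add: a_def)
  finally show ?thesis by simp
 qed
 moreover have "(\<integral>x. (\<omega> * p2 x / (2 * p x))\<^sup>2 \<partial>law) = \<omega>\<^sup>2 / 4 * (\<integral>x. (p2 x)\<^sup>2 / p x \<partial>lborel)"
 proof -
  have "p x * (\<omega> * p2 x / (2 * p x))\<^sup>2 = \<omega>\<^sup>2 / 4 * ((p2 x)\<^sup>2 / p x)" for x
   using p_pos[of x] by (simp add: power_mult_distrib power_divide power2_eq_square[of "p x"])
  then have "(\<integral>x. (\<omega> * p2 x / (2 * p x))\<^sup>2 \<partial>law) = (\<integral>x. \<omega>\<^sup>2 / 4 * ((p2 x)\<^sup>2 / p x) \<partial>lborel)"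
   by (subst law_integral) (simp_all only:, measurable)
  then show ?thesis by (simp only: integral_mult_right_zero)
 qed
 ultimately show ?thesis by simp
qed

text \<open>
 \<open>sqrt N * B N\<close> tends to \<open>- sqrt \<omega> * p' / p\<close>.
\<close>

lemma b_lim: "(\<lambda>N. real N * b N) \<longlonglongrightarrow> \<omega> * (\<integral>x. (p1 x)\<^sup>2 / p x \<partial>lborel)"
proof -
 have "(\<lambda>N. \<integral>x. (sqrt (real N) * B N x)\<^sup>2 \<partial>law) \<longlonglongrightarrow> (\<integral>x. (- (sqrt \<omega> * p1 x / p x))\<^sup>2 \<partial>law)"
 proof (rule integral_dominated_convergence[where w="\<lambda>x. (G x)\<^sup>2"])
  show "AE x in law. (\<lambda>N. (sqrt (real N) * B N x)\<^sup>2) \<longlonglongrightarrow> (- (sqrt \<omega> * p1 x / p x))\<^sup>2"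
   by (intro AE_I2 tendsto_power slope_lim)
  have "norm ((sqrt (real N) * B N x)\<^sup>2) \<le> (G x)\<^sup>2" for N x
  proof -
   have "\<bar>sqrt (real N) * B N x\<bar> \<le> \<bar>G x\<bar>"
    using B_small[of N x] G_ge_1[of x] by (cases "N = 0") (auto simp: abs_mult field_simps)
   then show ?thesis by (simp add: abs_le_square_iff del: real_sqrt_mult)
  qed
  then show "AE x in law. norm ((sqrt (real N) * B N x)\<^sup>2) \<le> (G x)\<^sup>2" for N by simp
 qed (use G_moment[of 2] in \<open>auto simp: measurable_cong_sets[OF sets_law refl]\<close>)
 moreover have "(\<integral>x. (sqrt (real N) * B N x)\<^sup>2 \<partial>law) = real N * b N" for N
  by (simp add: power_mult_distrib b_def)
 moreover have "(\<integral>x. (- (sqrt \<omega> * p1 x / p x))\<^sup>2 \<partial>law) = \<omega> * (\<integral>x. (p1 x)\<^sup>2 / p x \<partial>lborel)"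
 proof -
  have "p x * (- (sqrt \<omega> * p1 x / p x))\<^sup>2 = \<omega> * ((p1 x)\<^sup>2 / p x)" for x
   using p_pos[of x] \<omega>_pos by (simp add: power_mult_distrib power_divide power2_eq_square[of "p x"])
  then have "(\<integral>x. (- (sqrt \<omega> * p1 x / p x))\<^sup>2 \<partial>law) = (\<integral>x. \<omega> * ((p1 x)\<^sup>2 / p x) \<partial>lborel)"
   by (subst law_integral) (simp_all only:, measurable)
  then show ?thesis by (simp only: integral_mult_right_zero)
 qed
 ultimately show ?thesis by simp
qed

lemma entry_ratio:
 assumes "x \<in> core N" "\<sigma> = 1 \<or> \<sigma> = - 1"
 shows "p (x - eps N * \<sigma>) / p x = mass N * (A N x + \<sigma> * B N x)"
proof -
 have "mass N * (A N x + \<sigma> * B N x) = even0 N x + \<sigma> * odd0 N x"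
  using mass_pos[of N] by (simp add: A_def B_def field_simps)
 also have "... = p (x - eps N * \<sigma>) / p x"
  using assms p_pos[of x] by (auto simp: even0_def odd0_def field_simps)
 finally show ?thesis by simp
qed

end

section \<open>From a matrix of entries to pairs of entries\<close>

locale spiked_matrix = tame_density p p1 p2 g \<kappa> \<omega> + prob_space P
 for p p1 p2 g :: "real => real" and \<kappa> \<omega> :: real and P :: "'a measure" +
 fixes N :: nat and w :: "nat \<times> nat => 'a => real"
 assumes w_indep: "indep_vars (\<lambda>_. borel) w ({..<N} \<times> {..<N})"
  and w_law: "\<And>c. c \<in> {..<N} \<times> {..<N} ==> distr P borel (w c) = law"
begin

abbreviation cells :: "(nat \<times> nat) set" where "cells \<equiv> {..<N} \<times> {..<N}"

lemma w_measurable: "c \<in> cells ==> w c \<in> borel_measurable P"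
 using w_indep unfolding indep_vars_def by blast

lemma entry_integral:
 assumes c: "c \<in> cells" and f: "f \<in> borel_measurable borel"
 shows "expectation (\<lambda>y. f (w c y)) = (\<integral>x. f x \<partial>law :: real)"
  and "integrable P (\<lambda>y. f (w c y)) \<longleftrightarrow> integrable law f"
 using integral_distr[OF w_measurable[OF c] f] integrable_distr_eq[OF w_measurable[OF c] f]
 unfolding w_law[OF c] by auto

lemma two_entries_integral:
 fixes f h :: "real => real"
 assumes c: "c \<in> cells" "c' \<in> cells" "c \<noteq> c'"
  and f: "f \<in> borel_measurable borel" "integrable law f" and h: "h \<in> borel_measurable borel" "integrable law h"
 shows "integrable P (\<lambda>y. f (w c y) * h (w c' y))"
  and "expectation (\<lambda>y. f (w c y) * h (w c' y)) = (\<integral>x. f x \<partial>law) * (\<integral>x. h x \<partial>law)"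
proof -
 define F where "F d = (if d = c then f else h)" for d
 have "indep_vars (\<lambda>_. borel) (\<lambda>d y. F d (w d y)) {c, c'}"
  by (rule indep_vars_compose2[OF indep_vars_subset[OF w_indep]]) (use c f h in \<open>auto simp: F_def\<close>)
 moreover have "integrable P (\<lambda>y. F d (w d y))" if "d \<in> {c, c'}" for d
  using that c f h by (auto simp: F_def entry_integral)
 ultimately have "integrable P (\<lambda>y. \<Prod>d\<in>{c, c'}. F d (w d y))"
  "expectation (\<lambda>y. \<Prod>d\<in>{c, c'}. F d (w d y)) = (\<Prod>d\<in>{c, c'}. expectation (\<lambda>y. F d (w d y)))"
  by (auto intro: indep_vars_integrable indep_vars_lebesgue_integral)
 then show "integrable P (\<lambda>y. f (w c y) * h (w c' y))"
  "expectation (\<lambda>y. f (w c y) * h (w c' y)) = (\<integral>x. f x \<partial>law) * (\<integral>x. h x \<partial>law)"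
  using c f h by (auto simp: F_def entry_integral)
qed

definition u :: "nat => 'a => real" where
 "u l x = (case prod_decode l of (i, j) =>
   if i = j then A N (w (i, i) x) + B N (w (i, i) x) - 1
   else A N (w (i, j) x) * A N (w (j, i) x) + B N (w (i, j) x) * B N (w (j, i) x) - 1)"

definition V :: "nat => 'a => real" where
 "V l x = (case prod_decode l of (i, j) =>
   if i = j then 0 else A N (w (i, j) x) * B N (w (j, i) x) + A N (w (j, i) x) * B N (w (i, j) x))"

definition H :: "nat => 'a => real" where
 "H l x = (case prod_decode l of (i, j) => 9 * (G (w (i, j) x) * (if i = j then 1 else G (w (j, i) x))))"

definition K :: real where "K = 9 ^ 6 * ((\<integral>x. G x ^ 6 \<partial>law) * (\<integral>x. G x ^ 6 \<partial>law))"

text \<open>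
 Different steps use disjoint sets of entries.
\<close>

lemma pair_indep: "indep_vars (\<lambda>_. borel) (\<lambda>l v. (u l v, V l v)) (steps N)"
proof -
 define C where "C l = (case prod_decode l of (i, j) => {(i, j), (j, i)})" for l :: nat
 define Y :: "nat => (nat \<times> nat => real) => real \<times> real" where "Y l z = (case prod_decode l of (i, j) =>
  if i = j then (A N (z (i, i)) + B N (z (i, i)) - 1, 0)
  else (A N (z (i, j)) * A N (z (j, i)) + B N (z (i, j)) * B N (z (j, i)) - 1,
     A N (z (i, j)) * B N (z (j, i)) + A N (z (j, i)) * B N (z (i, j))))" for l z
 have C: "C l = {x \<in> cells. (case x of (x, y) => edge x y) = l}" if "l \<in> steps N" for l
  using steps_fibre[OF that] by (cases "prod_decode l") (simp add: C_def)
 have "indep_vars (\<lambda>l. PiM (C l) (\<lambda>_. borel)) (\<lambda>l v. restrict (\<lambda>c. w c v) (C l)) (steps N)"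
  by (rule indep_vars_restrict[OF w_indep]) (auto simp: C disjoint_family_on_def)
 then have "indep_vars (\<lambda>_. borel) (\<lambda>l v. Y l (restrict (\<lambda>c. w c v) (C l))) (steps N)"
 proof (rule indep_vars_compose2)
  fix l assume "l \<in> steps N"
  obtain i j where ij: "prod_decode l = (i, j)" by (cases "prod_decode l")
  have [measurable]: "(\<lambda>z. z (i, j)) \<in> borel_measurable (PiM (C l) (\<lambda>_. borel))"
   "(\<lambda>z. z (j, i)) \<in> borel_measurable (PiM (C l) (\<lambda>_. borel))"
   by (auto simp: C_def ij intro!: measurable_component_singleton)
  show "Y l \<in> borel_measurable (PiM (C l) (\<lambda>_. borel))"
  proof (cases "i = j")
   case True
   have [measurable]: "(\<lambda>z. z (i, i)) \<in> borel_measurable (PiM (C l) (\<lambda>_. borel))"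
    by (auto simp: C_def ij True intro!: measurable_component_singleton)
   have "Y l = (\<lambda>z. (A N (z (i, i)) + B N (z (i, i)) - 1, 0))" by (simp add: fun_eq_iff Y_def ij True)
   then show ?thesis by simp
  qed (unfold Y_def[abs_def] ij, simp, measurable)
 qed
 moreover have "(\<lambda>l v. Y l (restrict (\<lambda>c. w c v) (C l))) = (\<lambda>l v. (u l v, V l v))"
  by (intro ext) (auto simp: Y_def C_def u_def V_def split: prod.split)
 ultimately show ?thesis by simp
qed

lemma decode_cells:
 assumes "l \<in> steps N"
 obtains i j where "prod_decode l = (i, j)" "(i, j) \<in> cells" "(j, i) \<in> cells" "diag l \<longleftrightarrow> i = j"
proof -
 obtain i j where ij: "prod_decode l = (i, j)" "i \<le> j" "j < N" using steps_decode[OF assms] by auto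
 show ?thesis by (rule that[of i j]) (use ij in \<open>auto simp: diag_def\<close>)
qed

lemma steps_pos: "l \<in> steps N ==> 1 \<le> real N"
 using steps_decode[of l N] by auto

lemma A_le: assumes "1 \<le> real N" shows "\<bar>A N x\<bar> \<le> 2 * G x"
proof -
 have "G x / real N \<le> G x / 1" using assms G_ge_1[of x] by (intro divide_left_mono) auto
 then show ?thesis using A_near_1[of N x] G_ge_1[of x] by linarith
qed

lemma B_le: assumes "1 \<le> real N" shows "\<bar>B N x\<bar> \<le> G x"
proof -
 have "G x / sqrt (real N) \<le> G x / 1" using assms G_ge_1[of x] by (intro divide_left_mono) auto
 then show ?thesis using B_small[of N x] by simp
qed

lemma pair_u_le:
 assumes "1 \<le> real N"
 shows "\<bar>A N x * A N y + B N x * B N y - 1\<bar> \<le> 9 * (G x * G y) / real N"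
proof -
 define z where "z = G x * G y / real N"
 have "\<bar>(A N x - 1) * A N y\<bar> \<le> G x / real N * (2 * G y)"
  unfolding abs_mult using A_near_1 A_le[OF assms] G_ge_1[of x] by (intro mult_mono) auto
 also have "... = 2 * z" by (simp add: z_def)
 finally have 1: "\<bar>(A N x - 1) * A N y\<bar> \<le> 2 * z" .
 have "\<bar>A N y - 1\<bar> \<le> 1 * G y / real N" using A_near_1[of N y] by simp
 also have "... \<le> z"
  unfolding z_def using G_ge_1[of x] G_ge_1[of y] assms by (intro divide_right_mono mult_right_mono) auto
 finally have 2: "\<bar>A N y - 1\<bar> \<le> z" .
 have "\<bar>B N x * B N y\<bar> \<le> G x / sqrt (real N) * (G y / sqrt (real N))"
  unfolding abs_mult using B_small G_ge_1[of x] by (intro mult_mono) auto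
 also have "... = z" by (simp add: z_def)
 finally have 3: "\<bar>B N x * B N y\<bar> \<le> z" .
 have "A N x * A N y + B N x * B N y - 1 = (A N x - 1) * A N y + (A N y - 1) + B N x * B N y"
  by (simp add: algebra_simps)
 then have "\<bar>A N x * A N y + B N x * B N y - 1\<bar> \<le> 4 * z" using 1 2 3 by linarith
 also have "... \<le> 9 * z" using 3 by linarith
 finally show ?thesis by (simp add: z_def)
qed

lemma pair_V_le_root:
 assumes "1 \<le> real N"
 shows "\<bar>A N x * B N y + A N y * B N x\<bar> \<le> 4 * (G x * G y) / sqrt (real N)"
proof -
 have "\<bar>A N x * B N y\<bar> \<le> 2 * G x * (G y / sqrt (real N))" for x y
  unfolding abs_mult using B_small A_le[OF assms] G_ge_1[of x] by (intro mult_mono) auto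
 from this[of x y] this[of y x] show ?thesis by (simp add: mult_ac)
qed

text \<open>
 The factor is the product of two likelihood ratios, which are nonnegative for either sign.
\<close>

lemma pair_V_le_weight: "\<bar>A N x * B N y + A N y * B N x\<bar> \<le> A N x * A N y + B N x * B N y"
proof -
 have "0 \<le> (A N x - B N x) * (A N y - B N y)" "0 \<le> (A N x + B N x) * (A N y + B N y)"
  using B_le_A[of N x] B_le_A[of N y] by (intro mult_nonneg_nonneg; simp add: abs_le_iff)+
 then show ?thesis by (simp add: abs_le_iff algebra_simps)
qed

lemma pair_weight_le:
 assumes "1 \<le> real N"
 shows "A N x * A N y + B N x * B N y + \<bar>A N x * B N y + A N y * B N x\<bar> \<le> 9 * (G x * G y)"
proof -
 have "\<bar>A N x * A N y\<bar> \<le> 2 * G x * (2 * G y)"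
  unfolding abs_mult using A_le[OF assms] G_ge_1[of x] by (intro mult_mono) auto
 moreover have "\<bar>B N x * B N y\<bar> \<le> G x * G y"
  unfolding abs_mult using B_le[OF assms] G_ge_1[of x] by (intro mult_mono) auto
 moreover have "\<bar>A N x * B N y\<bar> \<le> 2 * G x * G y" "\<bar>A N y * B N x\<bar> \<le> 2 * G y * G x"
  unfolding abs_mult using A_le[OF assms] B_le[OF assms] G_ge_1[of x] G_ge_1[of y] by (intro mult_mono; auto)+
 moreover have "2 * G y * G x = 2 * (G x * G y)" "2 * G x * G y = 2 * (G x * G y)" "2 * G x * (2 * G y) = 4 * (G x * G y)" by simp_all
 ultimately show ?thesis by linarith
qed

definition monom_AB :: "nat => nat => real => real" where "monom_AB i j x = A N x ^ i * B N x ^ j"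

lemma monom_AB_law: "monom_AB i j \<in> borel_measurable borel" "integrable law (monom_AB i j)"
 by (simp_all add: monom_AB_def[abs_def] AB_integrable)

lemma monom_AB_means:
 "(\<integral>x. monom_AB 1 0 x \<partial>law) = 1" "(\<integral>x. monom_AB 0 1 x \<partial>law) = 0" "(\<integral>x. monom_AB 1 1 x \<partial>law) = 0"
 "(\<integral>x. monom_AB 2 0 x \<partial>law) = a N" "(\<integral>x. monom_AB 0 2 x \<partial>law) = b N"
 using A_mean[of N] B_mean[of N] AB_mean[of N] by (simp_all add: monom_AB_def a_def b_def)

lemma off_diag_moments:
 assumes l: "l \<in> steps N" "\<not> diag l"
 shows "expectation (u l) = 0" "expectation (V l) = 0" "expectation (\<lambda>y. u l y * V l y) = 0"
  "expectation (\<lambda>y. (u l y)\<^sup>2) = (a N)\<^sup>2 + (b N)\<^sup>2 - 1" "expectation (\<lambda>y. (V l y)\<^sup>2) = 2 * a N * b N"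
proof -
 obtain i j where ij: "prod_decode l = (i, j)" "(i, j) \<in> cells" "(j, i) \<in> cells" "diag l \<longleftrightarrow> i = j"
  by (rule decode_cells[OF l(1)])
 have ne: "(i, j) \<noteq> (j, i)" "i \<noteq> j" using ij(4) l(2) by auto
 let ?m = "\<lambda>r s r' s' y. monom_AB r s (w (i, j) y) * monom_AB r' s' (w (j, i) y)"
 have i: "integrable P (?m r s r' s')" for r s r' s'
  by (rule two_entries_integral(1)[OF ij(2,3) ne(1) monom_AB_law monom_AB_law])
 have e: "expectation (?m r s r' s') = (\<integral>x. monom_AB r s x \<partial>law) * (\<integral>x. monom_AB r' s' x \<partial>law)" for r s r' s'
  by (rule two_entries_integral(2)[OF ij(2,3) ne(1) monom_AB_law monom_AB_law])
 have u: "u l y = ?m 1 0 1 0 y + ?m 0 1 0 1 y - 1" for y using ne by (simp add: u_def ij monom_AB_def)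
 have V: "V l y = ?m 1 0 0 1 y + ?m 0 1 1 0 y" for y using ne by (simp add: V_def ij monom_AB_def)
 have uV: "u l y * V l y = ?m 2 0 1 1 y + ?m 1 1 2 0 y + ?m 1 1 0 2 y + ?m 0 2 1 1 y - ?m 1 0 0 1 y - ?m 0 1 1 0 y" for y
  unfolding u V by (simp add: monom_AB_def power2_eq_square algebra_simps)
 have u2: "(u l y)\<^sup>2 = ?m 2 0 2 0 y + ?m 0 2 0 2 y + 1 + 2 * ?m 1 1 1 1 y - 2 * ?m 1 0 1 0 y - 2 * ?m 0 1 0 1 y" for y
  unfolding u by (simp add: monom_AB_def power2_eq_square algebra_simps)
 have V2: "(V l y)\<^sup>2 = ?m 2 0 0 2 y + ?m 0 2 2 0 y + 2 * ?m 1 1 1 1 y" for y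
  unfolding V by (simp add: monom_AB_def power2_eq_square algebra_simps)
 have one: "expectation (\<lambda>_. 1 :: real) = 1" using prob_space by simp
 show "expectation (u l) = 0" unfolding u[abs_def] using one by (simp add: i e monom_AB_means del: One_nat_def)
 show "expectation (V l) = 0" unfolding V[abs_def] by (simp add: i e monom_AB_means del: One_nat_def)
 show "expectation (\<lambda>y. u l y * V l y) = 0" unfolding uV by (simp add: i e monom_AB_means del: One_nat_def)
 show "expectation (\<lambda>y. (u l y)\<^sup>2) = (a N)\<^sup>2 + (b N)\<^sup>2 - 1" unfolding u2
  using one by (simp add: i e monom_AB_means power2_eq_square del: One_nat_def)
 show "expectation (\<lambda>y. (V l y)\<^sup>2) = 2 * a N * b N" unfolding V2 by (simp add: i e monom_AB_means del: One_nat_def)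
qed

lemma diag_moments:
 assumes l: "l \<in> steps N" "diag l"
 shows "expectation (u l) = 0" "expectation (\<lambda>y. (u l y)\<^sup>2) = a N + b N - 1"
proof -
 obtain i j where ij: "prod_decode l = (i, j)" "(i, j) \<in> cells" "(j, i) \<in> cells" "diag l \<longleftrightarrow> i = j"
  by (rule decode_cells[OF l(1)])
 have j: "j = i" using ij(4) l(2) by simp
 let ?m = "\<lambda>r s y. monom_AB r s (w (i, i) y)"
 have c: "(i, i) \<in> cells" using ij(2) j by simp
 have i: "integrable P (?m r s)" for r s using entry_integral(2)[OF c monom_AB_law(1)] monom_AB_law(2) by simp
 have e: "expectation (?m r s) = (\<integral>x. monom_AB r s x \<partial>law)" for r s by (rule entry_integral(1)[OF c monom_AB_law(1)])
 have u: "u l y = ?m 1 0 y + ?m 0 1 y - 1" for y by (simp add: u_def ij(1) j monom_AB_def)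
 have u2: "(u l y)\<^sup>2 = ?m 2 0 y + ?m 0 2 y + 1 + 2 * ?m 1 1 y - 2 * ?m 1 0 y - 2 * ?m 0 1 y" for y
  unfolding u by (simp add: monom_AB_def power2_eq_square algebra_simps)
 have one: "expectation (\<lambda>_. 1 :: real) = 1" using prob_space by simp
 show "expectation (u l) = 0" unfolding u[abs_def] using one by (simp add: i e monom_AB_means del: One_nat_def)
 show "expectation (\<lambda>y. (u l y)\<^sup>2) = a N + b N - 1" unfolding u2
  using one by (simp add: i e monom_AB_means del: One_nat_def)
qed

lemma G6: "1 \<le> (\<integral>x. G x ^ 6 \<partial>law)"
proof -
 have "(\<integral>x. 1 \<partial>law) \<le> (\<integral>x. G x ^ 6 \<partial>law)"
  by (rule integral_mono) (use G_moment G_ge_1 in \<open>auto intro: one_le_power\<close>)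
 then show ?thesis using law.prob_space by simp
qed

lemma H_moments:
 assumes l: "l \<in> steps N"
 shows "integrable P (\<lambda>y. H l y ^ 6)" "expectation (\<lambda>y. H l y ^ 6) \<le> K"
proof -
 obtain i j where ij: "prod_decode l = (i, j)" "(i, j) \<in> cells" "(j, i) \<in> cells" "diag l \<longleftrightarrow> i = j"
  by (rule decode_cells[OF l])
 have Gm: "(\<lambda>x. G x ^ 6) \<in> borel_measurable borel" by measurable
 have "integrable P (\<lambda>y. H l y ^ 6) \<and> expectation (\<lambda>y. H l y ^ 6) \<le> K"
 proof (cases "i = j")
  case True
  have c: "(i, i) \<in> cells" using ij(2) True by simp
  have h: "H l y ^ 6 = 9 ^ 6 * G (w (i, i) y) ^ 6" for y
   by (simp add: H_def ij(1) True power_mult_distrib)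
  have i: "integrable P (\<lambda>y. G (w (i, i) y) ^ 6)" using entry_integral(2)[OF c Gm] G_moment[of 6] by simp
  have "expectation (\<lambda>y. G (w (i, i) y) ^ 6) = (\<integral>x. G x ^ 6 \<partial>law) * 1"
   using entry_integral(1)[OF c Gm] by simp
  also have "... \<le> (\<integral>x. G x ^ 6 \<partial>law) * (\<integral>x. G x ^ 6 \<partial>law)" using G6 by (intro mult_left_mono) auto
  finally show ?thesis using i unfolding h K_def by simp
 next
  case False
  then have ne: "(i, j) \<noteq> (j, i)" by simp
  have h: "H l y ^ 6 = 9 ^ 6 * (G (w (i, j) y) ^ 6 * G (w (j, i) y) ^ 6)" for y
   using False by (simp add: H_def ij(1) power_mult_distrib)
  show ?thesis unfolding h K_def
   using two_entries_integral[OF ij(2,3) ne Gm G_moment Gm G_moment] by simp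
 qed
 then show "integrable P (\<lambda>y. H l y ^ 6)" "expectation (\<lambda>y. H l y ^ 6) \<le> K" by auto
qed

sublocale S: spiked_steps P N u V H K "a N" "b N"
proof
 show "indep_vars (\<lambda>_. borel) (\<lambda>l z. (u l z, V l z)) (steps N)" by (rule pair_indep)
 have GG: "1 \<le> G x * G y" for x y using mult_mono[of 1 "G x" 1 "G y"] G_ge_1[of x] G_ge_1[of y] by simp
 show "1 \<le> K"
 proof -
  have "1 * 1 \<le> (\<integral>x. G x ^ 6 \<partial>law) * (\<integral>x. G x ^ 6 \<partial>law)" using G6 by (intro mult_mono) auto
  then show ?thesis unfolding K_def by simp
 qed
 show "0 \<le> b N" "0 \<le> a N" by (simp_all add: a_def b_def)
 fix l assume l: "l \<in> steps N"
 note N1 = steps_pos[OF l]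
 obtain i j where ij: "prod_decode l = (i, j)" "(i, j) \<in> cells" "(j, i) \<in> cells" "diag l \<longleftrightarrow> i = j"
  by (rule decode_cells[OF l])
 note [measurable] = w_measurable[OF ij(2)] w_measurable[OF ij(3)]
 show "H l \<in> borel_measurable P" unfolding H_def[abs_def] ij(1) by simp
 show "integrable P (\<lambda>z. H l z ^ 6)" "expectation (\<lambda>z. H l z ^ 6) \<le> K" by (rule H_moments[OF l])+
 show "expectation (u l) = 0" using off_diag_moments(1) diag_moments(1) l by blast
 show "expectation (\<lambda>z. (u l z)\<^sup>2) = (if diag l then a N + b N - 1 else (a N)\<^sup>2 + (b N)\<^sup>2 - 1)"
  using off_diag_moments(4) diag_moments(2) l by simp
 have Vd: "diag l ==> V l = (\<lambda>_. 0)" using ij by (auto simp: V_def)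
 show "expectation (V l) = 0" "expectation (\<lambda>z. u l z * V l z) = 0"
  using off_diag_moments(2,3)[OF l] Vd by (cases "diag l"; simp)+
 show "expectation (\<lambda>z. (V l z)\<^sup>2) = 2 * a N * b N" if "\<not> diag l"
  using off_diag_moments(5)[OF l that] .
 fix z
 show "V l z = 0" if "diag l" using Vd that by simp
 show "1 \<le> H l z" using GG[of "w (i, j) z" "w (j, i) z"] G_ge_1[of "w (i, j) z"] by (auto simp: H_def ij(1))
 show "\<bar>u l z\<bar> \<le> H l z / real N" if "\<not> diag l"
  using pair_u_le[OF N1] that ij(4) by (simp add: u_def H_def ij(1))
 show "\<bar>u l z\<bar> \<le> H l z / sqrt (real N)" if d: "diag l"
 proof -
  let ?x = "w (i, i) z"
  have "G ?x / real N \<le> G ?x / sqrt (real N)"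
   using N1 G_ge_1[of ?x] by (intro divide_left_mono) (auto simp: real_le_lsqrt power2_eq_square)
  moreover have "G ?x / sqrt (real N) + G ?x / sqrt (real N) \<le> 9 * G ?x / sqrt (real N)"
   unfolding add_divide_distrib[symmetric] using G_ge_1[of ?x] by (intro divide_right_mono) auto
  ultimately have "\<bar>A N ?x + B N ?x - 1\<bar> \<le> 9 * G ?x / sqrt (real N)"
   using A_near_1[of N ?x] B_small[of N ?x] by linarith
  then show ?thesis using d ij by (simp add: u_def H_def)
 qed
 show "\<bar>V l z\<bar> \<le> H l z / sqrt (real N)"
 proof (cases "diag l")
  case False
  have "4 * (G (w (i, j) z) * G (w (j, i) z)) / sqrt (real N) \<le> 9 * (G (w (i, j) z) * G (w (j, i) z)) / sqrt (real N)"
   using GG[of "w (i, j) z" "w (j, i) z"] by (intro divide_right_mono) auto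
  then show ?thesis using pair_V_le_root[OF N1, of "w (i, j) z" "w (j, i) z"] False ij(4) by (simp add: V_def H_def ij(1))
 next
  case True
  then show ?thesis using G_ge_1[of "w (i, i) z"] ij by (simp add: V_def H_def)
 qed
 show "\<bar>V l z\<bar> \<le> 1 + u l z"
  using pair_V_le_weight[of "w (i, j) z" "w (j, i) z"] B_le_A[of N "w (i, i) z"] by (auto simp: V_def u_def ij(1))
 show "1 + u l z + \<bar>V l z\<bar> \<le> H l z"
  using pair_weight_le[OF N1, of "w (i, j) z" "w (j, i) z"] A_le[OF N1, of "w (i, i) z"] B_le[OF N1, of "w (i, i) z"] G_ge_1[of "w (i, i) z"]
  by (auto simp: V_def u_def H_def ij(1) abs_le_iff)
qed

text \<open>
 On the event that all entries lie in the core, truncation has changed nothing but the normalisation.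
\<close>

lemma likelihood_ratio_eq:
 assumes N: "0 < N" and core: "\<And>c. c \<in> cells ==> w c v \<in> core N"
  and Y: "\<And>i j. (i, j) \<in> cells ==> sqrt (real N) * Y i j = w (i, j) v"
 shows "likelihood_ratio p \<omega> N Y = mass N ^ (N * N) * S.likelihood v"
proof -
 let ?r = "sqrt (real N)"
 let ?F = "\<lambda>x. \<Prod>i<N. \<Prod>j<N. p (?r * Y i j - sqrt (\<omega> * real N) * x i * x j) / p (?r * Y i j)"
 let ?scale = "\<lambda>s. restrict (\<lambda>i. s i / ?r) {..<N}"
 have r: "0 < ?r" using N by simp
 have bij: "bij_betw ?scale (signs N) ({..<N} \<rightarrow>\<^sub>E {1 / ?r, - 1 / ?r})"
 proof (rule bij_betw_byWitness[where f'="\<lambda>x. restrict (\<lambda>i. x i * ?r) {..<N}"])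
  show "\<forall>s\<in>signs N. restrict (\<lambda>i. ?scale s i * ?r) {..<N} = s"
   using r by (auto simp: signs_def fun_eq_iff PiE_iff extensional_def)
  show "\<forall>x\<in>{..<N} \<rightarrow>\<^sub>E {1 / ?r, - 1 / ?r}. ?scale (restrict (\<lambda>i. x i * ?r) {..<N}) = x"
   using r by (auto simp: fun_eq_iff PiE_iff extensional_def)
  show "?scale ` signs N \<subseteq> {..<N} \<rightarrow>\<^sub>E {1 / ?r, - 1 / ?r}"
  proof (rule image_subsetI, unfold restrict_PiE_iff, rule ballI)
   fix s i assume "s \<in> signs N" "i \<in> {..<N}"
   then have "s i = 1 \<or> s i = - 1" unfolding signs_def by (auto dest: PiE_mem)
   then show "s i / ?r \<in> {1 / ?r, - 1 / ?r}" by (rule disjE) simp_all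
  qed
  show "(\<lambda>x. restrict (\<lambda>i. x i * ?r) {..<N}) ` ({..<N} \<rightarrow>\<^sub>E {1 / ?r, - 1 / ?r}) \<subseteq> signs N"
  proof (rule image_subsetI, unfold signs_def restrict_PiE_iff, rule ballI)
   fix x i assume "x \<in> {..<N} \<rightarrow>\<^sub>E {1 / ?r, - 1 / ?r}" "i \<in> {..<N}"
   then have "x i = 1 / ?r \<or> x i = - 1 / ?r" by (auto dest: PiE_mem)
   then show "x i * ?r \<in> {1, - 1}" using r by (elim disjE) simp_all
  qed
 qed
 have F: "?F (?scale s) = mass N ^ (N * N) * (\<Prod>l\<in>steps N. S.lr s l v)" if s: "s \<in> signs N" for s
 proof -
  have si: "s i = 1 \<or> s i = - 1" if "i < N" for i using s that by (auto simp: signs_def PiE_iff)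
  have cancel: "z * r * (x / r) * (y / r) = z / r * (x * y)" if "r \<noteq> 0" for z r x y :: real
   using that by simp
  have sc: "sqrt (\<omega> * real N) * (s i / ?r) * (s j / ?r) = eps N * (s i * s j)" for i j
   unfolding real_sqrt_mult eps_eq by (rule cancel) (use r in simp)
  have "?F (?scale s) = (\<Prod>i<N. \<Prod>j<N. mass N * (A N (w (i, j) v) + s i * s j * B N (w (i, j) v)))"
  proof (intro prod.cong refl)
   fix i j assume ij: "i \<in> {..<N}" "j \<in> {..<N}"
   have "s i * s j = 1 \<or> s i * s j = - 1" using si[of i] si[of j] ij by auto
   then have "p (w (i, j) v - eps N * (s i * s j)) / p (w (i, j) v) = mass N * (A N (w (i, j) v) + s i * s j * B N (w (i, j) v))"
    using ij by (intro entry_ratio core) auto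
   then show "p (?r * Y i j - sqrt (\<omega> * real N) * ?scale s i * ?scale s j) / p (?r * Y i j)
    = mass N * (A N (w (i, j) v) + s i * s j * B N (w (i, j) v))"
    using ij Y[of i j] sc[of i j] by simp
  qed
  also have "... = mass N ^ (N * N) * (\<Prod>i<N. \<Prod>j<N. A N (w (i, j) v) + s i * s j * B N (w (i, j) v))"
   by (simp add: prod.distrib power_mult)
  also have "(\<Prod>i<N. \<Prod>j<N. A N (w (i, j) v) + s i * s j * B N (w (i, j) v)) = (\<Prod>l\<in>steps N. S.lr s l v)"
   unfolding prod_by_steps
  proof (rule prod.cong[OF refl])
   fix l assume "l \<in> steps N"
   then obtain i j where ij: "prod_decode l = (i, j)" "i \<le> j" "j < N" using steps_decode by blast
   have s: "s i * s j = 1 \<or> s i * s j = - 1" "s i * s i = 1" using si[of i] si[of j] ij by auto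
   have expand: "(x + \<sigma> * y) * (x' + \<sigma> * y') = 1 + (x * x' + y * y' - 1) + \<sigma> * (x * y' + x' * y)"
    if "\<sigma> = 1 \<or> \<sigma> = - 1" for \<sigma> x y x' y' :: real
    using that by (auto simp: algebra_simps)
   show "(case prod_decode l of (i, j) => if i = j then A N (w (i, i) v) + s i * s i * B N (w (i, i) v)
     else (A N (w (i, j) v) + s i * s j * B N (w (i, j) v)) * (A N (w (j, i) v) + s j * s i * B N (w (j, i) v)))
    = S.lr s l v"
   proof (cases "j = i")
    case True
    then show ?thesis using s(2) by (simp add: S.lr_def u_def V_def ij(1))
   next
    case False
    then show ?thesis using expand[OF s(1)] by (simp add: S.lr_def S.sgn_of_def u_def V_def ij(1) mult.commute[of "s j" "s i"])
   qed
  qed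
  finally show ?thesis .
 qed
 have "likelihood_ratio p \<omega> N Y = 1 / 2 ^ N * (\<Sum>s\<in>signs N. ?F (?scale s))"
  unfolding likelihood_ratio_def by (subst sum.reindex_bij_betw[OF bij, symmetric]) simp
 also have "(\<Sum>s\<in>signs N. ?F (?scale s)) = (\<Sum>s\<in>signs N. mass N ^ (N * N) * (\<Prod>l\<in>steps N. S.lr s l v))"
  by (rule sum.cong[OF refl F])
 also have "1 / 2 ^ N * ... = mass N ^ (N * N) * S.likelihood v"
  by (simp add: S.likelihood_def flip: sum_distrib_left)
 finally show ?thesis .
qed

lemma outside_core: "prob {x \<in> space P. \<exists>c\<in>cells. w c x \<notin> core N} \<le> (real N)\<^sup>2 * tail N"
proof -
 have m: "{x \<in> space P. w c x \<notin> core N} \<in> events" if c: "c \<in> cells" for c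
  using w_measurable[OF c] by measurable
 have one: "prob {x \<in> space P. w c x \<notin> core N} \<le> tail N" if c: "c \<in> cells" for c
 proof -
  have "prob {x \<in> space P. w c x \<notin> core N} = prob (w c -` (- core N) \<inter> space P)"
   by (rule arg_cong[where f=prob]) auto
  also have "... = measure (distr P borel (w c)) (- core N)"
   using w_measurable[OF c] by (subst measure_distr) auto
  also have "... = 1 - law.prob (core N)"
   unfolding w_law[OF c] using law.prob_compl[of "core N"] by (simp add: Compl_eq_Diff_UNIV)
  finally show ?thesis using core_prob[of N] by simp
 qed
 have "{x \<in> space P. \<exists>c\<in>cells. w c x \<notin> core N} = (\<Union>c\<in>cells. {x \<in> space P. w c x \<notin> core N})" by auto
 then have "prob {x \<in> space P. \<exists>c\<in>cells. w c x \<notin> core N} \<le> (\<Sum>c\<in>cells. prob {x \<in> space P. w c x \<notin> core N})"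
  using m by (auto intro!: finite_measure_subadditive_finite)
 also have "... \<le> (\<Sum>c\<in>cells. tail N)" by (intro sum_mono one)
 also have "... = (real N)\<^sup>2 * tail N" by (simp add: power2_eq_square)
 finally show ?thesis .
qed

end

section \<open>The limit of the log likelihood ratio\<close>

lemma (in spiked_steps) likelihood_nonneg: "0 \<le> likelihood \<omega>"
proof -
 have "0 \<le> lr s l \<omega>" if "s \<in> signs N" "l \<in> steps N" for s l
 proof -
  have "\<bar>sgn_of s l * V l \<omega>\<bar> \<le> 1 + u l \<omega>"
   using sgn_of_square(2)[OF that] weight_nonneg[OF that(2), of \<omega>] by (simp add: abs_mult)
  then show ?thesis by (simp add: lr_def abs_le_iff)
 qed
 then show ?thesis unfolding likelihood_def by (intro divide_nonneg_nonneg sum_nonneg prod_nonneg) auto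
qed

lemma (in spiked_steps) likelihood_mean: "integrable P likelihood" "expectation likelihood = 1"
proof -
 have "(\<integral>\<omega>. 1 \<partial>planted 1 s) = (1::real)" if "s \<in> signs N" for s
  using prob_space.prob_space[OF prob_space_planted[of 1 s]] that by simp
 then show "integrable P likelihood" "expectation likelihood = 1"
  using likelihood_test[of "\<lambda>_. 1" 1] by (simp_all add: card_signs)
qed

lemma (in spiked_matrix) outside_core_event: "{x \<in> space P. \<exists>c\<in>cells. w c x \<notin> core N} \<in> events"
proof -
 have "{x \<in> space P. w c x \<notin> core N} \<in> events" if c: "c \<in> cells" for c
  using w_measurable[OF c] by measurable
 then have "(\<Union>c\<in>cells. {x \<in> space P. w c x \<notin> core N}) \<in> events" by (intro sets.finite_UN) auto
 also have "(\<Union>c\<in>cells. {x \<in> space P. w c x \<notin> core N}) = {x \<in> space P. \<exists>c\<in>cells. w c x \<notin> core N}" by auto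
 finally show ?thesis .
qed

locale spiked_matrices = tame_density p p1 p2 g \<kappa> \<omega>
 for p p1 p2 g :: "real => real" and \<kappa> \<omega> :: real +
 fixes P :: "nat => 'a measure" and w :: "nat => nat \<times> nat => 'a => real"
 assumes matrix: "\<And>N. spiked_matrix p p1 p2 g \<kappa> \<omega> (P N) N (w N)"
begin

sublocale E: spiked_matrix p p1 p2 g \<kappa> \<omega> "P N" N "w N" for N by (rule matrix)

definition fisher :: real where "fisher = (\<integral>x. (p1 x)\<^sup>2 / p x \<partial>lborel)"

definition curvature :: real where "curvature = (\<integral>x. (p2 x)\<^sup>2 / p x \<partial>lborel)"

lemma fisher_nonneg: "0 \<le> fisher" and curvature_nonneg: "0 \<le> curvature"
 unfolding fisher_def curvature_def
 by (simp_all add: Bochner_Integration.integral_nonneg less_imp_le[OF p_pos])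

sublocale Q: spiked_sequence P E.u E.V E.H E.K "\<omega>\<^sup>2 / 4 * curvature" "\<omega> * fisher" a b
proof (rule spiked_sequence.intro)
 show "spiked_steps (P N) N (E.u N) (E.V N) (E.H N) E.K (a N) (b N)" for N by (rule E.S.spiked_steps_axioms)
 show "(\<lambda>N. (real N)\<^sup>2 * (a N - 1)) \<longlonglongrightarrow> \<omega>\<^sup>2 / 4 * curvature" unfolding curvature_def by (rule a_lim)
 show "(\<lambda>N. real N * b N) \<longlonglongrightarrow> \<omega> * fisher" unfolding fisher_def by (rule b_lim)
 show "0 \<le> \<omega>\<^sup>2 / 4 * curvature" "0 \<le> \<omega> * fisher" using fisher_nonneg curvature_nonneg \<omega>_pos by simp_all
qed

definition LR :: "nat => 'a => real" where
 "LR N x = likelihood_ratio p \<omega> N (\<lambda>i j. w N (i, j) x / sqrt (real N))"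

lemma LR_measurable [measurable]: "LR N \<in> borel_measurable (P N)"
proof -
 have [measurable]: "w N (i, j) \<in> borel_measurable (P N)" if "i \<in> {..<N}" "j \<in> {..<N}" for i j
  using that by (intro E.w_measurable) auto
 show ?thesis unfolding LR_def[abs_def] likelihood_ratio_def by measurable
qed

lemma LR_pos: "0 < LR N x"
proof -
 have "{..<N} \<rightarrow>\<^sub>E {1 / sqrt (real N), - 1 / sqrt (real N)} \<noteq> {}" by (simp add: PiE_eq_empty_iff)
 then show ?thesis unfolding LR_def likelihood_ratio_def
  by (intro mult_pos_pos sum_pos prod_pos divide_pos_pos p_pos finite_PiE) auto
qed

text \<open>
 A test function sees the truncation with probability at most \<open>N\<^sup>2 tail N\<close>, and the normalisation through the
 Lipschitz constant.
\<close>

lemma LR_test_close: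
 assumes \<phi>: "\<And>x. 0 \<le> \<phi> x" "\<And>x. \<phi> x \<le> 1" "\<And>x y. \<bar>\<phi> x - \<phi> y\<bar> \<le> c * \<bar>x - y\<bar>" and N: "0 < N"
  and \<phi>m: "\<phi> \<in> borel_measurable borel" and c: "0 \<le> c"
 shows "\<bar>(\<integral>z. \<phi> (LR N z) \<partial>P N) - (\<integral>z. \<phi> (E.S.likelihood N z) \<partial>P N)\<bar>
  \<le> (real N)\<^sup>2 * tail N + c * \<bar>mass N ^ (N * N) - 1\<bar>"
proof -
 let ?bad = "{z \<in> space (P N). \<exists>c\<in>{..<N} \<times> {..<N}. w N c z \<notin> core N}"
 let ?L = "E.S.likelihood N" and ?m = "c * \<bar>mass N ^ (N * N) - 1\<bar>"
 have Lm: "?L \<in> borel_measurable (P N)" by (rule E.S.likelihood_measurable)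
 have bad [measurable]: "?bad \<in> sets (P N)" by (rule E.outside_core_event)
 have i: "integrable (P N) (\<lambda>z. \<phi> (LR N z))" "integrable (P N) (\<lambda>z. \<phi> (?L z))"
  using measurable_compose[OF LR_measurable \<phi>m] measurable_compose[OF Lm \<phi>m] \<phi>
  by (auto intro!: E.integrable_const_bound[where B=1])
 have ib: "integrable (P N) (\<lambda>z. indicator ?bad z + ?m * ?L z)"
  by (intro Bochner_Integration.integrable_add integrable_mult_right E.S.likelihood_mean(1) integrable_real_indicator bad)
    (simp add: E.emeasure_eq_measure)
 have pw: "norm (\<phi> (LR N z) - \<phi> (?L z)) \<le> indicator ?bad z + ?m * ?L z" if z: "z \<in> space (P N)" for z
 proof (cases "z \<in> ?bad")
  case True
  have "\<bar>\<phi> (LR N z) - \<phi> (?L z)\<bar> \<le> 1" using \<phi>(1,2)[of "LR N z"] \<phi>(1,2)[of "?L z"] by (simp add: abs_le_iff)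
  then show ?thesis using True E.S.likelihood_nonneg[of N z] c by (simp add: add_increasing2)
 next
  case False
  then have "LR N z = mass N ^ (N * N) * ?L z"
   unfolding LR_def using z N by (intro E.likelihood_ratio_eq) auto
  then have "LR N z - ?L z = (mass N ^ (N * N) - 1) * ?L z" by (simp add: algebra_simps)
  then have "\<bar>LR N z - ?L z\<bar> = \<bar>mass N ^ (N * N) - 1\<bar> * ?L z"
   using E.S.likelihood_nonneg[of N z] by (simp add: abs_mult)
  then show ?thesis using \<phi>(3)[of "LR N z" "?L z"] False by (simp add: mult.assoc)
 qed
 have "\<bar>(\<integral>z. \<phi> (LR N z) \<partial>P N) - (\<integral>z. \<phi> (?L z) \<partial>P N)\<bar> = norm (\<integral>z. \<phi> (LR N z) - \<phi> (?L z) \<partial>P N)"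
  using i by simp
 also have "... \<le> (\<integral>z. indicator ?bad z + ?m * ?L z \<partial>P N)"
  by (rule norm_integral_le[OF Bochner_Integration.integrable_diff[OF i] ib pw])
 also have "... = E.prob N ?bad + ?m"
 proof -
  have "?bad \<inter> space (P N) = ?bad" by auto
  moreover have "integrable (P N) (indicator ?bad :: 'a => real)"
   by (rule integrable_real_indicator[OF bad]) (simp add: E.emeasure_eq_measure)
  ultimately show ?thesis using E.S.likelihood_mean[of N]
   by (subst Bochner_Integration.integral_add) (simp_all only: Bochner_Integration.integral_indicator integrable_mult_right integral_mult_right_zero mult_1_right)
 qed
 also have "... \<le> (real N)\<^sup>2 * tail N + ?m" using E.outside_core by simp
 finally show ?thesis .
qed

lemma LR_limit:
 assumes \<phi>: "\<And>x. 0 \<le> \<phi> x" "\<And>x. \<phi> x \<le> 1" "\<And>x y. \<bar>\<phi> x - \<phi> y\<bar> \<le> c * \<bar>x - y\<bar>"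
  and \<phi>m: "\<phi> \<in> borel_measurable borel" and c: "0 \<le> c" and f: "2 * \<omega> * fisher < 1"
 defines "r \<equiv> \<omega>\<^sup>2 / 4 * curvature - (\<omega> * fisher)\<^sup>2 / 2 - ln (1 - 2 * (\<omega> * fisher)) / 2"
 shows "(\<lambda>N. \<integral>v. \<phi> (LR N v) \<partial>P N) \<longlonglongrightarrow> (\<integral>z. \<phi> (exp (sqrt r * z - r / 2)) \<partial>std_normal_distribution)"
proof -
 have "(\<lambda>N. \<integral>v. \<phi> (E.S.likelihood N v) \<partial>P N) \<longlonglongrightarrow> (\<integral>z. \<phi> (exp (sqrt r * z - r / 2)) \<partial>std_normal_distribution)"
  unfolding r_def
 proof (rule Q.likelihood_limit)
  show "\<bar>\<phi> x\<bar> \<le> 1" for x using \<phi>(1,2)[of x] by simp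
 qed (use f \<phi>(3) in \<open>auto simp: mult.assoc\<close>)
 moreover have "(\<lambda>N. (\<integral>v. \<phi> (LR N v) \<partial>P N) - (\<integral>v. \<phi> (E.S.likelihood N v) \<partial>P N)) \<longlonglongrightarrow> 0"
 proof (rule Lim_null_comparison)
  show "\<forall>\<^sub>F N in sequentially. norm ((\<integral>v. \<phi> (LR N v) \<partial>P N) - (\<integral>v. \<phi> (E.S.likelihood N v) \<partial>P N))
    \<le> (real N)\<^sup>2 * tail N + c * \<bar>mass N ^ (N * N) - 1\<bar>"
   using eventually_gt_at_top[of 0] by eventually_elim (simp add: LR_test_close[OF \<phi> _ \<phi>m c])
  have "(\<lambda>N. (real N)\<^sup>2 * tail N + c * \<bar>mass N ^ (N * N) - 1\<bar>) \<longlonglongrightarrow> 0 + c * \<bar>1 - 1\<bar>"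
   by (intro tendsto_add tail_lim tendsto_mult tendsto_const tendsto_rabs tendsto_diff mass_power_lim)
  then show "(\<lambda>N. (real N)\<^sup>2 * tail N + c * \<bar>mass N ^ (N * N) - 1\<bar>) \<longlonglongrightarrow> 0" by simp
 qed
 ultimately show ?thesis using tendsto_add by fastforce
qed

text \<open>
 Otherwise \<open>p' = 0\<close> almost everywhere and \<open>p\<close> would be a positive constant, which does not vanish at infinity.
\<close>

lemma fisher_pos:
 assumes p0: "(p \<longlongrightarrow> 0) at_infinity"
 shows "0 < fisher"
proof (rule ccontr)
 assume "\<not> 0 < fisher"
 then have F0: "(\<integral>x. (p1 x)\<^sup>2 / p x \<partial>lborel) = 0" using fisher_nonneg by (simp add: fisher_def)
 have eq: "p x * (p1 x / p x)\<^sup>2 = (p1 x)\<^sup>2 / p x" for x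
  using p_pos[of x] by (simp add: power2_eq_square)
 have "integrable law (\<lambda>x. (p1 x / p x)\<^sup>2)"
 proof (rule Bochner_Integration.integrable_bound[where f="\<lambda>x. g x ^ 2"])
  show "integrable law (\<lambda>x. g x ^ 2)" using g_moment[of 2] by (simp add: law_def)
  have "\<bar>p1 x / p x\<bar> \<le> \<bar>g x\<bar>" for x
   using env1[of x x] p_pos[of x] g_ge_1[of x] by (simp add: divide_le_eq)
  then show "AE x in law. norm ((p1 x / p x)\<^sup>2) \<le> norm ((g x)\<^sup>2)"
   unfolding real_norm_def abs_power2 abs_le_square_iff by simp
 qed measurable
 then have "integrable lborel (\<lambda>x. (p1 x)\<^sup>2 / p x)" by (subst (asm) law_integral(2)) (simp_all add: eq)
 moreover have "AE x in lborel. 0 \<le> (p1 x)\<^sup>2 / p x" by (simp add: less_imp_le[OF p_pos])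
 ultimately have "AE x in lborel. (p1 x)\<^sup>2 / p x = 0"
  using F0 integral_nonneg_eq_0_iff_AE by blast
 then have ae: "AE x in lborel. p1 x = 0" by eventually_elim (use p_pos in \<open>simp add: less_imp_neq[symmetric]\<close>)
 have const: "p y = p 0" if "0 \<le> y" for y
 proof -
  have "(\<integral>x. p1 x * indicator {0..y} x \<partial>lborel) = p y - p 0"
   using that deriv1 p1_cont by (intro integral_FTC_Icc_real) auto
  moreover have "(\<integral>x. p1 x * indicator {0..y} x \<partial>lborel) = integral\<^sup>L lborel (\<lambda>x::real. 0)"
   by (rule integral_cong_AE) (use ae in auto)
  ultimately show ?thesis by simp
 qed
 have "(p \<longlongrightarrow> 0) at_top" using p0 at_top_le_at_infinity tendsto_mono by blast
 moreover have "(p \<longlongrightarrow> p 0) at_top"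
  by (rule tendsto_eventually, rule eventually_mono[OF eventually_ge_at_top[of 0]], rule const)
 ultimately have "p 0 = 0" by (intro tendsto_unique[of at_top p]) auto
 then show False using p_pos[of 0] by simp
qed

end

subsection \<open>Test functions of the logarithm\<close>

lemma cts_step_lipschitz:
 assumes "a < b" shows "\<bar>cts_step a b x - cts_step a b y\<bar> \<le> \<bar>x - y\<bar> / (b - a)"
proof -
 have clamp: "cts_step a b x = min 1 (max 0 ((b - x) / (b - a)))" for x
  using assms by (auto simp: cts_step_def min_def max_def field_simps)
 have "\<bar>min 1 (max 0 s) - min 1 (max 0 t)\<bar> \<le> \<bar>s - t\<bar>" for s t :: real
  by (auto simp: min_def max_def abs_if)
 then have "\<bar>cts_step a b x - cts_step a b y\<bar> \<le> \<bar>(b - x) / (b - a) - (b - y) / (b - a)\<bar>" unfolding clamp .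
 also have "... = \<bar>(y - x) / (b - a)\<bar>" by (simp flip: diff_divide_distrib)
 also have "... = \<bar>x - y\<bar> / (b - a)" using assms by (simp add: abs_minus_commute)
 finally show ?thesis .
qed

text \<open>
 A function of \<open>ln L\<close> that is constant below \<open>a\<close> is a Lipschitz function of \<open>L\<close>, although \<open>ln\<close> is not Lipschitz
 near zero.
\<close>

lemma ln_max_lipschitz: "\<bar>ln (max x (exp a)) - ln (max y (exp a))\<bar> \<le> exp (- a) * \<bar>x - y\<bar>" for x y a :: real
proof -
 have *: "ln v - ln u \<le> exp (- a) * (v - u)" if "exp a \<le> u" "u \<le> v" for u v :: real
 proof -
  have u: "0 < u" using that(1) exp_gt_zero[of a] by linarith
  then have "ln v - ln u \<le> (v - u) / u" using that by (intro ln_diff_le) auto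
  also have "... \<le> (v - u) / exp a" using that u by (intro divide_left_mono) auto
  also have "... = exp (- a) * (v - u)" by (simp add: exp_minus divide_inverse)
  finally show ?thesis .
 qed
 have mono: "ln u \<le> ln v" if "exp a \<le> u" "u \<le> v" for u v :: real
  using that exp_gt_zero[of a] by (subst ln_le_cancel_iff) linarith+
 have sym: "\<bar>ln u - ln v\<bar> \<le> exp (- a) * \<bar>u - v\<bar>" if "exp a \<le> u" "u \<le> v" for u v :: real
 proof -
  have "\<bar>ln u - ln v\<bar> = ln v - ln u" "\<bar>u - v\<bar> = v - u" using mono[OF that] that by simp_all
  then show ?thesis using *[OF that] by simp
 qed
 let ?x = "max x (exp a)" and ?y = "max y (exp a)"
 have "\<bar>ln ?x - ln ?y\<bar> \<le> exp (- a) * \<bar>?x - ?y\<bar>"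
  using sym[of ?x ?y] sym[of ?y ?x] abs_minus_commute[of "ln ?x" "ln ?y"] abs_minus_commute[of ?x ?y]
  by (metis max.cobounded2 linear)
 also have "... \<le> exp (- a) * \<bar>x - y\<bar>" by (intro mult_left_mono) (auto simp: max_def)
 finally show ?thesis .
qed

lemma cts_step_ln_max: "0 < x ==> a < b ==> cts_step a b (ln (max x (exp a))) = cts_step a b (ln x)"
proof (cases "x \<le> exp a")
 case True
 assume "0 < x"
 then have "ln x \<le> a" using True ln_le_cancel_iff[of x "exp a"] by simp
 then show ?thesis using True by (simp add: cts_step_def max_def)
qed (simp add: max_def)

context spiked_matrices
begin

theorem log_LR_weak_conv:
 assumes f: "2 * \<omega> * fisher < 1"
 defines "r \<equiv> \<omega>\<^sup>2 / 4 * curvature - (\<omega> * fisher)\<^sup>2 / 2 - ln (1 - 2 * (\<omega> * fisher)) / 2"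
 assumes r: "0 < r"
 shows "weak_conv_m (\<lambda>N. distr (P N) borel (\<lambda>v. ln (LR N v)))
  (density lborel (\<lambda>x. ennreal (normal_density (- (r / 2)) (sqrt r) x)))"
proof (rule integral_cts_step_conv_imp_weak_conv)
 show "real_distribution (distr (P N) borel (\<lambda>v. ln (LR N v)))" for N
  by (rule prob_space.real_distribution_distr[OF E.prob_space_axioms]) measurable
 have sr: "0 < sqrt r" using r by simp
 show "real_distribution (density lborel (\<lambda>x. ennreal (normal_density (- (r / 2)) (sqrt r) x)))"
  using prob_space_normal_density[OF sr] by (simp add: real_distribution_def real_distribution_axioms_def)
 fix a' b' :: real assume ab: "a' < b'"
 \<comment> \<open>\<open>cts_step\<close> is constant below \<open>a'\<close>, so the maximum leaves the test function of \<open>ln L\<close> unchanged.\<close>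
 define \<phi> where "\<phi> x = cts_step a' b' (ln (max x (exp a')))" for x
 have cm [measurable]: "cts_step a' b' \<in> borel_measurable borel"
  unfolding cts_step_def[abs_def] by measurable
 have \<phi>m: "\<phi> \<in> borel_measurable borel" unfolding \<phi>_def[abs_def] by measurable
 have lip: "\<bar>\<phi> x - \<phi> y\<bar> \<le> exp (- a') / (b' - a') * \<bar>x - y\<bar>" for x y
 proof -
  have "\<bar>\<phi> x - \<phi> y\<bar> \<le> \<bar>ln (max x (exp a')) - ln (max y (exp a'))\<bar> / (b' - a')"
   unfolding \<phi>_def by (rule cts_step_lipschitz[OF ab])
  also have "... \<le> exp (- a') * \<bar>x - y\<bar> / (b' - a')"
   using ab by (intro divide_right_mono ln_max_lipschitz) auto
  finally show ?thesis by simp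
 qed
 have "(\<lambda>N. \<integral>v. \<phi> (LR N v) \<partial>P N) \<longlonglongrightarrow> (\<integral>z. \<phi> (exp (sqrt r * z - r / 2)) \<partial>std_normal_distribution)"
  unfolding r_def by (rule LR_limit[OF _ _ lip \<phi>m _ f]) (use ab in \<open>auto simp: \<phi>_def cts_step_def\<close>)
 moreover have "(\<integral>v. \<phi> (LR N v) \<partial>P N) = (\<integral>x. cts_step a' b' x \<partial>distr (P N) borel (\<lambda>v. ln (LR N v)))" for N
  by (subst integral_distr) (simp_all add: \<phi>_def cts_step_ln_max[OF LR_pos ab])
 moreover have "(\<integral>z. \<phi> (exp (sqrt r * z - r / 2)) \<partial>std_normal_distribution)
   = (\<integral>x. cts_step a' b' x \<partial>density lborel (\<lambda>x. ennreal (normal_density (- (r / 2)) (sqrt r) x)))"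
  unfolding normal_law[OF sr]
  by (subst integral_distr) (simp_all add: \<phi>_def cts_step_ln_max[OF _ ab] add.commute)
 ultimately show "(\<lambda>N. \<integral>x. cts_step a' b' x \<partial>distr (P N) borel (\<lambda>v. ln (LR N v)))
  \<longlonglongrightarrow> (\<integral>x. cts_step a' b' x \<partial>density lborel (\<lambda>x. ennreal (normal_density (- (r / 2)) (sqrt r) x)))"
  by simp
qed

end

text \<open>
 The logarithm contributes at least \<open>f\<close>, and \<open>f\<^sup>2 / 2 < f\<close>.
\<close>

lemma limit_variance_pos:
 fixes f \<gamma> :: real
 assumes "0 < f" "2 * f < 1" "0 \<le> \<gamma>" shows "0 < \<gamma> - f\<^sup>2 / 2 - ln (1 - 2 * f) / 2"
proof -
 have "ln (1 - 2 * f) \<le> - (2 * f)" using ln_le_minus_one[of "1 - 2 * f"] assms by simp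
 moreover have "f\<^sup>2 < f * 1" unfolding power2_eq_square using assms by (intro mult_strict_left_mono) auto
 ultimately show ?thesis using assms by linarith
qed

lemma polynomial_envelope:
 fixes p q :: "real => real"
 assumes p: "\<And>x. 0 < p x" and q: "\<And>x. \<bar>q x / p x\<bar> \<le> C * (1 + \<bar>x\<bar> powr r)"
  and C: "0 < C" "2 * C \<le> D" and k: "0 < r" "r \<le> real k" and xy: "\<bar>y - x\<bar> \<le> 1"
 shows "\<bar>q y\<bar> \<le> D * (2 + \<bar>x\<bar>) ^ k * p y"
proof -
 have "\<bar>y\<bar> powr r \<le> (2 + \<bar>x\<bar>) powr r" using xy k by (intro powr_mono2) auto
 also have "... \<le> (2 + \<bar>x\<bar>) powr real k" using k by (intro powr_mono) auto
 also have "... = (2 + \<bar>x\<bar>) ^ k" by (rule powr_realpow) simp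
 finally have 1: "\<bar>y\<bar> powr r \<le> (2 + \<bar>x\<bar>) ^ k" .
 have 2: "1 \<le> (2 + \<bar>x\<bar>) ^ k" by (rule one_le_power) simp
 have "\<bar>q y\<bar> / p y \<le> C * (1 + \<bar>y\<bar> powr r)" using q[of y] p[of y] by simp
 also have "... \<le> C * (2 * (2 + \<bar>x\<bar>) ^ k)"
  by (rule mult_left_mono) (use 1 2 C in linarith)+
 also have "... = 2 * C * (2 + \<bar>x\<bar>) ^ k" by simp
 also have "... \<le> D * (2 + \<bar>x\<bar>) ^ k" using C 2 by (intro mult_right_mono) auto
 finally show ?thesis using p[of y] by (simp add: divide_le_eq)
qed

lemma power_le_powr: "(2 + \<bar>x\<bar>) ^ n \<le> 4 ^ n + 2 ^ n * \<bar>x\<bar> powr (real n + 1)" for x :: real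
proof (cases "\<bar>x\<bar> \<le> 2")
 case True
 then have "(2 + \<bar>x\<bar>) ^ n \<le> 4 ^ n" by (intro power_mono) auto
 then show ?thesis by (simp add: add_increasing2)
next
 case False
 then have "(2 + \<bar>x\<bar>) ^ n \<le> (2 * \<bar>x\<bar>) ^ n" by (intro power_mono) auto
 also have "... = 2 ^ n * \<bar>x\<bar> powr real n" using False by (simp add: power_mult_distrib powr_realpow)
 also have "... \<le> 2 ^ n * \<bar>x\<bar> powr (real n + 1)" using False by (intro mult_left_mono powr_mono) auto
 finally show ?thesis by (simp add: add_increasing)
qed

lemma smooth_density_tame:
 assumes p: "smooth_density p" and prob: "prob_space (density lborel (\<lambda>x. ennreal (p x)))"
  and mom: "\<And>D. 0 < D ==> integrable (density lborel (\<lambda>x. ennreal (p x))) (\<lambda>x. \<bar>x\<bar> powr D)" and \<omega>: "0 < \<omega>"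
 shows "\<exists>g \<kappa>. tame_density p (deriv p) (deriv (deriv p)) g \<kappa> \<omega>"
proof -
 have diff: "(deriv ^^ k) p differentiable (at x)" for k x using p unfolding smooth_density_def by blast
 have pos: "0 < p x" and even: "p (- x) = p x" for x using p unfolding smooth_density_def by auto
 have ex: "\<exists>C>0. \<exists>r>0. \<forall>x. \<bar>(deriv ^^ s) p x / p x\<bar> \<le> C * (1 + \<bar>x\<bar> powr r)" if "1 \<le> s" for s
  using p that unfolding smooth_density_def by blast
 from ex[of 1] obtain C1 r1 where c1: "0 < C1" "0 < r1" "\<And>x. \<bar>deriv p x / p x\<bar> \<le> C1 * (1 + \<bar>x\<bar> powr r1)" by auto
 from ex[of 2] obtain C2 r2 where c2: "0 < C2" "0 < r2" "\<And>x. \<bar>deriv (deriv p) x / p x\<bar> \<le> C2 * (1 + \<bar>x\<bar> powr r2)"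
  by (auto simp: numeral_2_eq_2)
 obtain k :: nat where k: "max r1 r2 \<le> real k" using real_arch_simple by blast
 define D where "D = 1 + 2 * C1 + 2 * C2"
 define g where "g x = D * (2 + \<bar>x\<bar>) ^ k" for x :: real
 have D: "1 \<le> D" "2 * C1 \<le> D" "2 * C2 \<le> D" using c1(1) c2(1) by (auto simp: D_def)
 have d: "((deriv ^^ j) p has_real_derivative (deriv ^^ Suc j) p x) (at x)" for j x
  using diff[of j x] by (simp add: DERIV_deriv_iff_real_differentiable)
 have "tame_density p (deriv p) (deriv (deriv p)) g (2 ^ k) \<omega>"
 proof (rule tame_density.intro)
  show "(p has_real_derivative deriv p x) (at x)" for x using d[of 0 x] by simp
  show "(deriv p has_real_derivative deriv (deriv p) x) (at x)" for x using d[of 1 x] by simp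
  show "isCont (deriv (deriv p)) x" for x using d[of 2 x] DERIV_isCont by (force simp: numeral_2_eq_2)
  show "0 < p x" "p (- x) = p x" "g (- x) = g x" for x using pos even by (simp_all add: g_def)
  show "prob_space (density lborel (\<lambda>x. ennreal (p x)))" by (rule prob)
  show "0 < \<omega>" by (rule \<omega>)
  show "\<bar>deriv p y\<bar> \<le> g x * p y" if "\<bar>y - x\<bar> \<le> 1" for x y
   unfolding g_def by (rule polynomial_envelope[OF pos c1(3) c1(1) D(2) c1(2) _ that]) (use k in simp)
  show "\<bar>deriv (deriv p) y\<bar> \<le> g x * p y" if "\<bar>y - x\<bar> \<le> 1" for x y
   unfolding g_def by (rule polynomial_envelope[OF pos c2(3) c2(1) D(3) c2(2) _ that]) (use k in simp)
  show "1 \<le> g x" for x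
  proof -
   have "1 * 1 \<le> g x" unfolding g_def using D by (intro mult_mono one_le_power) auto
   then show ?thesis by simp
  qed
  show gm: "g \<in> borel_measurable borel" unfolding g_def[abs_def] by measurable
  show "g y \<le> 2 ^ k * g x" if "\<bar>y - x\<bar> \<le> 1" for x y
  proof -
   have "(2 + \<bar>y\<bar>) ^ k \<le> (2 * (2 + \<bar>x\<bar>)) ^ k" using that by (intro power_mono) auto
   also have "... = 2 ^ k * (2 + \<bar>x\<bar>) ^ k" by (rule power_mult_distrib)
   finally have "D * (2 + \<bar>y\<bar>) ^ k \<le> D * (2 ^ k * (2 + \<bar>x\<bar>) ^ k)" using D by (intro mult_left_mono) auto
   then show ?thesis by (simp only: g_def mult.left_commute)
  qed
  show "integrable (density lborel (\<lambda>x. ennreal (p x))) (\<lambda>x. g x ^ m)" for m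
  proof (rule Bochner_Integration.integrable_bound)
   interpret prob_space "density lborel (\<lambda>x. ennreal (p x))" by (rule prob)
   show "integrable (density lborel (\<lambda>x. ennreal (p x))) (\<lambda>x. D ^ m * (4 ^ (k * m) + 2 ^ (k * m) * \<bar>x\<bar> powr (real (k * m) + 1)))"
    by (intro integrable_mult_right Bochner_Integration.integrable_add integrable_const mom) (simp_all add: add_nonneg_pos)
   show "(\<lambda>x. g x ^ m) \<in> borel_measurable (density lborel (\<lambda>x. ennreal (p x)))" using gm by simp
   have "\<bar>g x ^ m\<bar> \<le> \<bar>D ^ m * (4 ^ (k * m) + 2 ^ (k * m) * \<bar>x\<bar> powr (real (k * m) + 1))\<bar>" for x
   proof -
    have "g x ^ m = D ^ m * (2 + \<bar>x\<bar>) ^ (k * m)" by (simp add: g_def power_mult_distrib power_mult)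
    also have "... \<le> D ^ m * (4 ^ (k * m) + 2 ^ (k * m) * \<bar>x\<bar> powr (real (k * m) + 1))"
     using D by (intro mult_left_mono power_le_powr) auto
    finally have "g x ^ m \<le> D ^ m * (4 ^ (k * m) + 2 ^ (k * m) * \<bar>x\<bar> powr (real (k * m) + 1))" .
    moreover have "0 \<le> g x ^ m" using D by (simp add: g_def)
    ultimately show ?thesis by simp
   qed
   then show "AE x in density lborel (\<lambda>x. ennreal (p x)). norm (g x ^ m)
     \<le> norm (D ^ m * (4 ^ (k * m) + 2 ^ (k * m) * \<bar>x\<bar> powr (real (k * m) + 1)))" by simp
  qed
 qed
 then show ?thesis by blast
qed

lemma weak_conv_m_eventually_cong:
 assumes "weak_conv_m A C" "\<forall>\<^sub>F n in sequentially. A n = B n"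
 shows "weak_conv_m B C"
 unfolding weak_conv_m_def weak_conv_def
proof (intro allI impI)
 fix x assume "isCont (cdf C) x"
 then have "(\<lambda>n. cdf (A n) x) \<longlonglongrightarrow> cdf C x" using assms(1) by (simp add: weak_conv_m_def weak_conv_def)
 moreover have "\<forall>\<^sub>F n in sequentially. cdf (A n) x = cdf (B n) x"
  using assms(2) by eventually_elim simp
 ultimately show "(\<lambda>n. cdf (B n) x) \<longlonglongrightarrow> cdf C x" by (rule Lim_transform_eventually)
qed

theorem theorem2p8:
  fixes p :: "real \<Rightarrow> real"
    and M :: "nat \<Rightarrow> 'a measure"
    and X :: "nat \<Rightarrow> nat \<Rightarrow> nat \<Rightarrow> 'a \<Rightarrow> real"
    and \<omega> :: real
  assumes "smooth_density p"
    and "iid_matrices p M X"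
    and "\<omega> > 0"
    and "2 * \<omega> * F_const p < 1"
  shows "weak_conv_m
           (\<lambda>N. distr (M N) borel (\<lambda>\<xi>. ln (likelihood_ratio p \<omega> N (\<lambda>i j. X N i j \<xi>))))
           (density lborel
              (\<lambda>x. ennreal (normal_density (- rho_star p \<omega>) (sqrt (2 * rho_star p \<omega>)) x)))"
proof -
 let ?D = "density lborel (\<lambda>x. ennreal (p x))"
 note iid = assms(2)[unfolded iid_matrices_def]
 note cells = conjunct1[OF iid, rule_format] and entries = conjunct1[OF conjunct2[OF iid], rule_format]
  and moments = conjunct2[OF conjunct2[OF iid], rule_format]
 have prob: "prob_space (M N)" if "1 \<le> N" for N by (rule conjunct1[OF cells[OF that]])
 have indep: "prob_space.indep_vars (M N) (\<lambda>_. borel) (\<lambda>(i, j). X N i j) ({..<N} \<times> {..<N})" if "1 \<le> N" for N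
  by (rule conjunct2[OF cells[OF that]])
 have dist: "distributed (M N) lborel (\<lambda>\<xi>. sqrt (real N) * X N i j \<xi>) (\<lambda>x. ennreal (p x))" if "1 \<le> N" "i < N" "j < N" for N i j
  by (rule conjunct1[OF entries[OF that]])
 have distr: "distr (M N) borel (\<lambda>\<xi>. sqrt (real N) * X N i j \<xi>) = ?D" if "1 \<le> N" "i < N" "j < N" for N i j
  unfolding distributed_distr_eq_density[OF dist[OF that], symmetric] by (rule distr_cong) simp_all
 have X1: "(\<lambda>\<xi>. X 1 0 0 \<xi>) \<in> borel_measurable (M 1)" "distr (M 1) borel (\<lambda>\<xi>. X 1 0 0 \<xi>) = ?D"
  using distr[of 1 0 0] distributed_measurable[OF dist[of 1 0 0]] by simp_all
 have pD: "prob_space ?D"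
  using prob_space.prob_space_distr[OF prob[of 1] X1(1)] X1(2) by simp
 have mom: "integrable ?D (\<lambda>x. \<bar>x\<bar> powr D)" if D: "0 < D" for D
 proof -
  obtain C :: real where C: "\<And>N i j. 1 \<le> N ==> i < N ==> j < N ==> integrable (M N) (\<lambda>\<xi>. \<bar>X N i j \<xi>\<bar> powr D)"
   using moments[OF D] by blast
  have "integrable (M 1) (\<lambda>\<xi>. \<bar>X 1 0 0 \<xi>\<bar> powr D)" by (rule C) simp_all
  then show ?thesis unfolding X1(2)[symmetric] using X1(1) by (subst integrable_distr_eq) auto
 qed
 obtain g \<kappa> where tame: "tame_density p (deriv p) (deriv (deriv p)) g \<kappa> \<omega>"
  using smooth_density_tame[OF assms(1) pD mom assms(3)] by blast
 interpret tame_density p "deriv p" "deriv (deriv p)" g \<kappa> \<omega> by (rule tame)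
 \<comment> \<open>Nothing is assumed about \<open>M 0\<close>; without entries any probability space will do there.\<close>
 define P where "P N = M (max 1 N)" for N
 define w where "w N c \<xi> = sqrt (real N) * X N (fst c) (snd c) \<xi>" for N c \<xi>
 have "spiked_matrices p (deriv p) (deriv (deriv p)) g \<kappa> \<omega> P w"
 proof (intro spiked_matrices.intro spiked_matrices_axioms.intro tame)
  fix N
  have pN: "prob_space (P N)" unfolding P_def by (rule prob) simp
  show "spiked_matrix p (deriv p) (deriv (deriv p)) g \<kappa> \<omega> (P N) N (w N)"
  proof (intro spiked_matrix.intro spiked_matrix_axioms.intro tame pN)
   interpret prob_space "P N" by (rule pN)
   show "indep_vars (\<lambda>_. borel) (w N) ({..<N} \<times> {..<N})"
   proof (cases "N = 0")
    case True
    then show ?thesis unfolding indep_vars_def indep_sets_def by simp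
   next
    case False
    then have "indep_vars (\<lambda>_. borel) (\<lambda>c. case c of (i, j) => X N i j) ({..<N} \<times> {..<N})"
     using indep[of N] by (simp add: P_def max_def)
    then have "indep_vars (\<lambda>_. borel) (\<lambda>c \<xi>. sqrt (real N) * (case c of (i, j) => X N i j) \<xi>) ({..<N} \<times> {..<N})"
     by (rule indep_vars_compose2) simp
    then show ?thesis by (simp add: w_def[abs_def] case_prod_beta)
   qed
   show "distr (P N) borel (w N c) = tame_density.law p" if c: "c \<in> {..<N} \<times> {..<N}" for c
    using c distr[of N "fst c" "snd c"] by (auto simp: P_def w_def[abs_def] max_def law_def)
  qed
 qed
 then interpret S: spiked_matrices p "deriv p" "deriv (deriv p)" g \<kappa> \<omega> P w .
 have FG: "S.fisher = F_const p" "S.curvature = G_const p"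
  by (simp_all add: S.fisher_def S.curvature_def F_const_def G_const_def)
 define r where "r = \<omega>\<^sup>2 / 4 * S.curvature - (\<omega> * S.fisher)\<^sup>2 / 2 - ln (1 - 2 * (\<omega> * S.fisher)) / 2"
 have p0: "(p \<longlongrightarrow> 0) at_infinity" using assms(1) unfolding smooth_density_def by (metis funpow_0)
 have f: "2 * \<omega> * S.fisher < 1" using assms(4) by (simp add: FG)
 have r: "0 < r" unfolding r_def
  using S.fisher_pos[OF p0] S.curvature_nonneg assms(3) f by (intro limit_variance_pos) (auto simp: mult.assoc)
 have rho: "rho_star p \<omega> = r / 2"
  unfolding r_def FG rho_star_def by (simp add: algebra_simps power_mult_distrib)
 have "weak_conv_m (\<lambda>N. distr (P N) borel (\<lambda>\<xi>. ln (S.LR N \<xi>)))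
  (density lborel (\<lambda>x. ennreal (normal_density (- (r / 2)) (sqrt r) x)))"
  using S.log_LR_weak_conv[OF f] r unfolding r_def by blast
 moreover have "\<forall>\<^sub>F N in sequentially. distr (P N) borel (\<lambda>\<xi>. ln (S.LR N \<xi>))
   = distr (M N) borel (\<lambda>\<xi>. ln (likelihood_ratio p \<omega> N (\<lambda>i j. X N i j \<xi>)))"
  using eventually_gt_at_top[of 0]
 proof eventually_elim
  case (elim N)
  have "P N = M N" using elim by (simp add: P_def max_def)
  moreover have "(\<lambda>i j. w N (i, j) \<xi> / sqrt (real N)) = (\<lambda>i j. X N i j \<xi>)" for \<xi>
   using elim by (simp add: w_def)
  ultimately show ?case by (simp add: S.LR_def)
 qed
 ultimately show ?thesis
  unfolding rho using weak_conv_m_eventually_cong by simp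
qed

end
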